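(* Let $\lambda:L\to Q$ be a line bundle and $\pi:J^1L\to Q$ its first jet bundle. Then there is a canonical contact structure $(J^1L,H_L)$, $H_L\subset T(J^1L)$, such that the contact line bundle is isomorphic to the pull-back of the line bundle on the base manifold: $$T(J^1L)/H_L\cong\pi^*L.$$ Denote this line bundle by $L_{J^1L}$. Furthermore, the non-degenerate Jacobi structure $(L_{J^1L},\{\cdot,\cdot\}_L)$ induced in this line bundle is fibre-wise linear and it is completely determined by the algebraic structure of derivations acting on sections: $$\{l_a,l_b\}_L=l_{[a,b]},\qquad \{l_a,\pi^*s\}_L=\pi^*(a[s]),\qquad \{\pi^*s,\pi^*r\}_L=0$$ for all $s,r\in\Gamma(L)$ and all $a,b\in\Gamma(DL)$, where $l:\Gamma(DL)\to\Gamma(L_{J^1L})$ is the inclusion of derivations as fibre-wise linear sections of $L_{J^1L}$.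
   Context: A line bundle is a real vector bundle of rank 1 over a smooth manifold. The der bundle $DL\to Q$ has fibre $D_xL$ the space of $\mathbb{R}$-linear maps $a_x:\Gamma(L)\to L_x$ for which there is $\delta(a_x)\in T_xQ$ with $a_x(f s)=f(x)a_x(s)+\delta(a_x)[f]\,s(x)$ for all $f\in C^\infty(Q)$, $s\in\Gamma(L)$. Sections $a\in\Gamma(DL)$ are derivations of $\Gamma(L)$, acting by $a[s](x)=a(x)(s)$, with Lie bracket the commutator. The jet bundle is $J^1L=(DL)^*\otimes L$, with $j^1_xs(a_x)=a_x(s)$. The line bundle $\pi^*L\to J^1L$ has the fibre-wise constant sections $\pi^*s$, $s\in\Gamma(L)$, and the fibre-wise linear sections $l_a$, $a\in\Gamma(DL)$, given by $l_a(\alpha_q)=\alpha_q(a(q))\in L_q$. A Jacobi structure on a line bundle $L'\to M$ is a Lie bracket on $\Gamma(L')$ that is a differential operator of order $\le 1$ in each argument. Then $\{s,f\cdot r\}=f\cdot\{s,r\}+X_s[f]\cdot r$ for an $\mathbb{R}$-linear map $X:\Gamma(L')\to\Gamma(TM)$ (the symbol), and $X_{f\cdot s}=f\cdot X_s+\Lambda^\sharp(df\otimes s)$ for a bundle map $\Lambda^\sharp:T^*M\otimes L'\to TM$ (the squiggle). The Jacobi structure is non-degenerate if the induced bundle map $J^1L'\to DL'$, $j^1s\mapsto\{s,\cdot\}$, is an isomorphism. A contact structure on a manifold $M$ is a hyperplane distribution $H\subset TM$ such that, with contact line bundle $L_H=TM/H$ and projection $\theta:TM\to L_H$, the curvature form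 $\omega_H:\wedge^2H\to L_H$, $(X,Y)\mapsto\theta([X,Y])$, is non-degenerate. A contact structure is equivalent to a non-degenerate Jacobi structure on $L_H$: the contact structure induces the bracket $\{s,r\}=\theta([X_s,X_r])$, where the $\mathbb{R}$-linear map $X:\Gamma(L_H)\to\Gamma(TM)$ satisfies $\theta(X_s)=s$ and is the symbol of the bracket, with squiggle $\Lambda^\sharp(df\otimes s)=\omega^\sharp(df|_H\otimes s)$, $\omega^\sharp$ being the inverse of the musical map of $\omega_H$; conversely, $H=\Lambda^\sharp(T^*M\otimes L_H)$. A Jacobi structure on $\pi^*L\to J^1L$ is fibre-wise linear if the bracket of two fibre-wise linear sections is fibre-wise linear, the bracket of a fibre-wise linear and a fibre-wise constant section is fibre-wise constant, and the bracket of two fibre-wise constant sections is zero. *)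

theory Defs
  imports "HOL-Analysis.Analysis" "HOL-Algebra.AbelCoset" "HOL-Algebra.Module"
begin

subsection \<open>Real vector spaces with explicit carrier\<close>

text \<open>A real vector space is a module over the field of real numbers; the ring
  multiplication and unit that the record type of modules also carries are not used.\<close>

definition real_space :: "(real, real) module" where
  "real_space = \<lparr>carrier = UNIV, mult = (*), one = 1, zero = 0, add = (+), smult = (*)\<rparr>"

abbreviation vec_space :: "(real, 'v) module \<Rightarrow> bool" where
  "vec_space V \<equiv> module real_space V"

abbreviation vec_subspace :: "'v set \<Rightarrow> (real, 'v) module \<Rightarrow> bool" where
  "vec_subspace W V \<equiv> submodule W real_space V"

definition one_dimensional :: "(real, 'v) module \<Rightarrow> bool" where
  "one_dimensional V \<longleftrightarrow>
     (\<exists>b\<in>carrier V. b \<noteq> \<zero>\<^bsub>V\<^esub> \<and> (\<forall>w\<in>carrier V. \<exists>c. w = c \<odot>\<^bsub>V\<^esub> b))"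

definition coord :: "(real, 'v) module \<Rightarrow> 'v \<Rightarrow> 'v \<Rightarrow> real" where
  "coord V b w = (THE c. w = c \<odot>\<^bsub>V\<^esub> b)"

definition lin_span :: "(real, 'v) module \<Rightarrow> 'v set \<Rightarrow> 'v set" where
  "lin_span V S = \<Inter>{W. vec_subspace W V \<and> S \<subseteq> W}"

definition lin_map :: "(real, 'v) module \<Rightarrow> (real, 'w) module \<Rightarrow> ('v \<Rightarrow> 'w) \<Rightarrow> bool" where
  "lin_map V W F \<longleftrightarrow> F \<in> carrier V \<rightarrow> carrier W \<and>
     (\<forall>u\<in>carrier V. \<forall>v\<in>carrier V. F (u \<oplus>\<^bsub>V\<^esub> v) = F u \<oplus>\<^bsub>W\<^esub> F v) \<and>
     (\<forall>c. \<forall>v\<in>carrier V. F (c \<odot>\<^bsub>V\<^esub> v) = c \<odot>\<^bsub>W\<^esub> F v)"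

definition lin_maps :: "(real, 'v) module \<Rightarrow> (real, 'w) module \<Rightarrow> ('v \<Rightarrow> 'w) set" where
  "lin_maps V W = {F \<in> extensional (carrier V). lin_map V W F}"

text \<open>A space \<open>C\<close> of (extensional) sections of a family \<open>V\<close> of vector spaces over \<open>I\<close>,
  with pointwise operations.\<close>

definition fun_space :: "'i set \<Rightarrow> ('i \<Rightarrow> (real, 'v) module) \<Rightarrow> ('i \<Rightarrow> 'v) set
    \<Rightarrow> (real, 'i \<Rightarrow> 'v) module" where
  "fun_space I V C = \<lparr>carrier = C, mult = undefined, one = undefined,
     zero = (\<lambda>i\<in>I. \<zero>\<^bsub>V i\<^esub>),
     add = (\<lambda>s r. \<lambda>i\<in>I. s i \<oplus>\<^bsub>V i\<^esub> r i),
     smult = (\<lambda>c s. \<lambda>i\<in>I. c \<odot>\<^bsub>V i\<^esub> s i)\<rparr>"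

text \<open>The quotient \<open>V/W\<close>: its elements are the cosets \<open>W +> v\<close>.\<close>

definition quotient_space :: "(real, 'v) module \<Rightarrow> 'v set \<Rightarrow> (real, 'v set) module" where
  "quotient_space V W = \<lparr>carrier = a_rcosets\<^bsub>V\<^esub> W, mult = undefined, one = undefined,
     zero = W, add = set_add V,
     smult = (\<lambda>c C. \<Union>v\<in>C. W +>\<^bsub>V\<^esub> (c \<odot>\<^bsub>V\<^esub> v))\<rparr>"

text \<open>The product \<open>f \<cdot> s\<close> of a function and a section.\<close>

definition fmult :: "'i set \<Rightarrow> ('i \<Rightarrow> (real, 'v) module) \<Rightarrow> ('i \<Rightarrow> real) \<Rightarrow> ('i \<Rightarrow> 'v) \<Rightarrow> 'i \<Rightarrow> 'v" where
  "fmult I V f s = (\<lambda>i\<in>I. f i \<odot>\<^bsub>V i\<^esub> s i)"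


subsection \<open>Smooth maps and smooth manifolds\<close>

primrec ck_on :: "nat \<Rightarrow> 'a::real_normed_vector set \<Rightarrow> ('a \<Rightarrow> 'b::real_normed_vector) \<Rightarrow> bool" where
  "ck_on 0 S f \<longleftrightarrow> continuous_on S f"
| "ck_on (Suc k) S f \<longleftrightarrow> (\<forall>x\<in>S. f differentiable (at x)) \<and>
     (\<forall>v. ck_on k S (\<lambda>x. frechet_derivative f (at x) v))"

text \<open>Only used for open \<open>S\<close> in a finite-dimensional space, where it says that \<open>f\<close> is of class
  \<open>C\<^sup>\<infinity>\<close>.\<close>

definition smooth_on :: "'a::real_normed_vector set \<Rightarrow> ('a \<Rightarrow> 'b::real_normed_vector) \<Rightarrow> bool" where
  "smooth_on S f \<longleftrightarrow> (\<forall>k. ck_on k S f)"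

text \<open>An atlas is a set of pairs of a chart domain and a chart map into the model space \<open>'e\<close>.
  The model space is an arbitrary finite-dimensional normed space rather than a
  \<open>euclidean_space\<close>, because the latter excludes dimension 0.\<close>

type_synonym ('m, 'e) atlas = "('m set \<times> ('m \<Rightarrow> 'e)) set"

definition points :: "('m, 'e) atlas \<Rightarrow> 'm set" where
  "points A = (\<Union>(U, \<phi>)\<in>A. U)"

definition mfd_open :: "('m, 'e::real_normed_vector) atlas \<Rightarrow> 'm set \<Rightarrow> bool" where
  "mfd_open A W \<longleftrightarrow> W \<subseteq> points A \<and> (\<forall>(U, \<phi>)\<in>A. open (\<phi> ` (U \<inter> W)))"

definition smooth_manifold :: "('m, 'e::real_normed_vector) atlas \<Rightarrow> bool" where
  "smooth_manifold A \<longleftrightarrow>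
     (\<exists>B :: 'e set. finite B \<and> span B = UNIV) \<and>
     (\<forall>(U, \<phi>)\<in>A. inj_on \<phi> U) \<and>
     (\<forall>(U, \<phi>)\<in>A. \<forall>(V, \<psi>)\<in>A. open (\<phi> ` (U \<inter> V)) \<and>
        smooth_on (\<phi> ` (U \<inter> V)) (\<psi> \<circ> inv_into U \<phi>)) \<and>
     Hausdorff_space (topology (mfd_open A)) \<and> second_countable (topology (mfd_open A))"

definition smooth_fun :: "('m, 'e::real_normed_vector) atlas \<Rightarrow> 'm set \<Rightarrow> ('m \<Rightarrow> real) \<Rightarrow> bool" where
  "smooth_fun A W f \<longleftrightarrow> (\<forall>(U, \<phi>)\<in>A. smooth_on (\<phi> ` (U \<inter> W)) (f \<circ> inv_into U \<phi>))"

definition Cinf :: "('m, 'e::real_normed_vector) atlas \<Rightarrow> (real, 'm \<Rightarrow> real) module" where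
  "Cinf A = fun_space (points A) (\<lambda>_. real_space)
     {f \<in> extensional (points A). smooth_fun A (points A) f}"

text \<open>Tangent vectors at \<open>x\<close> are the derivations of \<open>C\<^sup>\<infinity>\<close> at \<open>x\<close>.\<close>

definition tangent :: "('m, 'e::real_normed_vector) atlas \<Rightarrow> 'm \<Rightarrow> (real, ('m \<Rightarrow> real) \<Rightarrow> real) module" where
  "tangent A x = fun_space (carrier (Cinf A)) (\<lambda>_. real_space)
     {v \<in> lin_maps (Cinf A) real_space.
        \<forall>f\<in>carrier (Cinf A). \<forall>g\<in>carrier (Cinf A).
          v (\<lambda>y\<in>points A. f y * g y) = f x * v g + g x * v f}"

text \<open>For a family \<open>a\<close> of functionals on functions or sections, \<open>act I a s\<close> is the function or
  section \<open>x \<mapsto> a(x)(s)\<close>.\<close>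

definition act :: "'i set \<Rightarrow> ('i \<Rightarrow> 's \<Rightarrow> 'v) \<Rightarrow> 's \<Rightarrow> 'i \<Rightarrow> 'v" where
  "act I a s = (\<lambda>x\<in>I. a x s)"

definition vfields :: "('m, 'e::real_normed_vector) atlas \<Rightarrow> (real, 'm \<Rightarrow> ('m \<Rightarrow> real) \<Rightarrow> real) module" where
  "vfields A = fun_space (points A) (tangent A)
     {X \<in> (\<Pi>\<^sub>E x\<in>points A. carrier (tangent A x)).
        \<forall>f\<in>carrier (Cinf A). act (points A) X f \<in> carrier (Cinf A)}"

definition vf_bracket :: "('m, 'e::real_normed_vector) atlas \<Rightarrow> ('m \<Rightarrow> ('m \<Rightarrow> real) \<Rightarrow> real)
    \<Rightarrow> ('m \<Rightarrow> ('m \<Rightarrow> real) \<Rightarrow> real) \<Rightarrow> 'm \<Rightarrow> ('m \<Rightarrow> real) \<Rightarrow> real" where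
  "vf_bracket A X Y = (\<lambda>x\<in>points A. \<lambda>f\<in>carrier (Cinf A).
     X x (act (points A) Y f) - Y x (act (points A) X f))"

text \<open>The tangent map of \<open>\<sigma> : M \<rightarrow> M'\<close>; \<open>A\<close> is the atlas of \<open>M\<close> and \<open>A'\<close> that of \<open>M'\<close>.\<close>

definition tangent_map :: "('m, 'e::real_normed_vector) atlas \<Rightarrow> ('n, 'f::real_normed_vector) atlas
    \<Rightarrow> ('m \<Rightarrow> 'n) \<Rightarrow> (('m \<Rightarrow> real) \<Rightarrow> real) \<Rightarrow> ('n \<Rightarrow> real) \<Rightarrow> real" where
  "tangent_map A A' \<sigma> v = (\<lambda>f\<in>carrier (Cinf A'). v (\<lambda>x\<in>points A. f (\<sigma> x)))"


subsection \<open>Line bundles\<close>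

text \<open>A line bundle consists of the atlas of its base, its fibres, and a set of local frames
  \<open>(U, e)\<close>, that is, of local trivialisations \<open>U \<times> \<real> \<rightarrow> L|\<^sub>U\<close>, \<open>(x, c) \<mapsto> c e(x)\<close>,
  with smooth transition functions.\<close>

record ('m, 'e, 'v) line_bundle =
  base :: "('m, 'e) atlas"
  fibre :: "'m \<Rightarrow> (real, 'v) module"
  frames :: "('m set \<times> ('m \<Rightarrow> 'v)) set"

abbreviation pts :: "('m, 'e, 'v) line_bundle \<Rightarrow> 'm set" where
  "pts L \<equiv> points (base L)"

definition is_line_bundle :: "('m, 'e::real_normed_vector, 'v) line_bundle \<Rightarrow> bool" where
  "is_line_bundle L \<longleftrightarrow> smooth_manifold (base L) \<and>
     (\<forall>x\<in>pts L. vec_space (fibre L x) \<and> one_dimensional (fibre L x)) \<and>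
     (\<forall>(U, e)\<in>frames L. mfd_open (base L) U \<and>
        (\<forall>x\<in>U. e x \<in> carrier (fibre L x) \<and> e x \<noteq> \<zero>\<^bsub>fibre L x\<^esub>)) \<and>
     (\<forall>x\<in>pts L. \<exists>(U, e)\<in>frames L. x \<in> U) \<and>
     (\<forall>(U, e)\<in>frames L. \<forall>(U', e')\<in>frames L.
        smooth_fun (base L) (U \<inter> U') (\<lambda>x. coord (fibre L x) (e x) (e' x)))"

definition sections :: "('m, 'e::real_normed_vector, 'v) line_bundle \<Rightarrow> (real, 'm \<Rightarrow> 'v) module" where
  "sections L = fun_space (pts L) (fibre L)
     {s \<in> (\<Pi>\<^sub>E x\<in>pts L. carrier (fibre L x)).
        \<forall>(U, e)\<in>frames L. smooth_fun (base L) U (\<lambda>x. coord (fibre L x) (e x) (s x))}"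

abbreviation \<Gamma> :: "('m, 'e::real_normed_vector, 'v) line_bundle \<Rightarrow> ('m \<Rightarrow> 'v) set" where
  "\<Gamma> L \<equiv> carrier (sections L)"

definition lb_isomorphism :: "('m, 'e::real_normed_vector, 'v) line_bundle \<Rightarrow> ('m, 'e, 'w) line_bundle
    \<Rightarrow> ('m \<Rightarrow> 'v \<Rightarrow> 'w) \<Rightarrow> bool" where
  "lb_isomorphism L L' \<Theta> \<longleftrightarrow> is_line_bundle L \<and> is_line_bundle L' \<and> base L = base L' \<and>
     (\<forall>x\<in>pts L. lin_map (fibre L x) (fibre L' x) (\<Theta> x) \<and>
        bij_betw (\<Theta> x) (carrier (fibre L x)) (carrier (fibre L' x))) \<and>
     (\<forall>(U, e)\<in>frames L. \<forall>(U', e')\<in>frames L'.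
        smooth_fun (base L) (U \<inter> U') (\<lambda>x. coord (fibre L' x) (e' x) (\<Theta> x (e x))))"

text \<open>The map on sections induced by a bundle map over the identity of \<open>M\<close>.\<close>

definition on_sections :: "'m set \<Rightarrow> ('m \<Rightarrow> 'v \<Rightarrow> 'w) \<Rightarrow> ('m \<Rightarrow> 'v) \<Rightarrow> 'm \<Rightarrow> 'w" where
  "on_sections M \<Theta> s = (\<lambda>x\<in>M. \<Theta> x (s x))"

definition pullback :: "('n, 'f) atlas \<Rightarrow> ('n \<Rightarrow> 'm) \<Rightarrow> ('m, 'e, 'v) line_bundle
    \<Rightarrow> ('n, 'f, 'v) line_bundle" where
  "pullback A p L = \<lparr>base = A, fibre = (\<lambda>y. fibre L (p y)),
     frames = {({y \<in> points A. p y \<in> U}, (\<lambda>y. e (p y))) |U e. (U, e) \<in> frames L}\<rparr>"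


subsection \<open>The der bundle and the first jet bundle\<close>

definition der_space :: "('m, 'e::real_normed_vector, 'v) line_bundle \<Rightarrow> 'm
    \<Rightarrow> (real, ('m \<Rightarrow> 'v) \<Rightarrow> 'v) module" where
  "der_space L x = fun_space (\<Gamma> L) (\<lambda>_. fibre L x)
     {a \<in> lin_maps (sections L) (fibre L x).
        \<exists>\<delta>\<in>carrier (tangent (base L) x). \<forall>f\<in>carrier (Cinf (base L)). \<forall>s\<in>\<Gamma> L.
          a (fmult (pts L) (fibre L) f s) = f x \<odot>\<^bsub>fibre L x\<^esub> a s \<oplus>\<^bsub>fibre L x\<^esub> \<delta> f \<odot>\<^bsub>fibre L x\<^esub> s x}"

text \<open>\<open>\<Gamma>(DL)\<close>. Smoothness of a section \<open>a\<close> means that \<open>a[s]\<close> is smooth for all smooth \<open>s\<close>.\<close>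

definition derivations :: "('m, 'e::real_normed_vector, 'v) line_bundle \<Rightarrow> ('m \<Rightarrow> ('m \<Rightarrow> 'v) \<Rightarrow> 'v) set" where
  "derivations L = {a \<in> (\<Pi>\<^sub>E x\<in>pts L. carrier (der_space L x)). \<forall>s\<in>\<Gamma> L. act (pts L) a s \<in> \<Gamma> L}"

definition der_bracket :: "('m, 'e::real_normed_vector, 'v) line_bundle \<Rightarrow> ('m \<Rightarrow> ('m \<Rightarrow> 'v) \<Rightarrow> 'v)
    \<Rightarrow> ('m \<Rightarrow> ('m \<Rightarrow> 'v) \<Rightarrow> 'v) \<Rightarrow> 'm \<Rightarrow> ('m \<Rightarrow> 'v) \<Rightarrow> 'v" where
  "der_bracket L a b = (\<lambda>x\<in>pts L. \<lambda>s\<in>\<Gamma> L.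
     a x (act (pts L) b s) \<ominus>\<^bsub>fibre L x\<^esub> b x (act (pts L) a s))"

text \<open>The fibre \<open>(D\<^sub>xL)\<^sup>* \<otimes> L\<^sub>x\<close>, realised as the space of linear maps \<open>D\<^sub>xL \<rightarrow> L\<^sub>x\<close>.\<close>

definition jet_space :: "('m, 'e::real_normed_vector, 'v) line_bundle \<Rightarrow> 'm
    \<Rightarrow> (real, (('m \<Rightarrow> 'v) \<Rightarrow> 'v) \<Rightarrow> 'v) module" where
  "jet_space L x = fun_space (carrier (der_space L x)) (\<lambda>_. fibre L x)
     (lin_maps (der_space L x) (fibre L x))"

definition jet :: "('m, 'e::real_normed_vector, 'v) line_bundle \<Rightarrow> ('m \<Rightarrow> 'v) \<Rightarrow> 'm
    \<Rightarrow> (('m \<Rightarrow> 'v) \<Rightarrow> 'v) \<Rightarrow> 'v" where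
  "jet L s x = (\<lambda>a\<in>carrier (der_space L x). a s)"

type_synonym ('m, 'v) jet_point = "'m \<times> ((('m \<Rightarrow> 'v) \<Rightarrow> 'v) \<Rightarrow> 'v)"

text \<open>A chart \<open>(U, \<phi>)\<close> of the base and a frame \<open>(V, e)\<close> give at each \<open>x \<in> U \<inter> V\<close> the elements
  \<open>s \<mapsto> s(x)\<close> and \<open>f e \<mapsto> \<partial>\<^sub>v f(x) e(x)\<close> of \<open>D\<^sub>xL\<close> (\<open>v\<close> in the model space). The values of
  \<open>\<alpha> \<in> J\<^sup>1\<^sub>xL\<close> on these are its fibre coordinates: for \<open>\<alpha> = j\<^sup>1\<^sub>x(f e)\<close> they are the value and the
  differential of \<open>f\<close> at \<open>x\<close> in the chart.\<close>

definition ev_der :: "('m, 'e::real_normed_vector, 'v) line_bundle \<Rightarrow> 'm \<Rightarrow> ('m \<Rightarrow> 'v) \<Rightarrow> 'v" where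
  "ev_der L x = (\<lambda>s\<in>\<Gamma> L. s x)"

definition partial_der :: "('m, 'e::real_normed_vector, 'v) line_bundle \<Rightarrow> 'm set \<Rightarrow> ('m \<Rightarrow> 'e)
    \<Rightarrow> ('m \<Rightarrow> 'v) \<Rightarrow> 'm \<Rightarrow> 'e \<Rightarrow> ('m \<Rightarrow> 'v) \<Rightarrow> 'v" where
  "partial_der L U \<phi> e x v = (\<lambda>s\<in>\<Gamma> L.
     frechet_derivative ((\<lambda>y. coord (fibre L y) (e y) (s y)) \<circ> inv_into U \<phi>) (at (\<phi> x)) v
       \<odot>\<^bsub>fibre L x\<^esub> e x)"

definition jet_chart :: "('m, 'e::real_normed_vector, 'v) line_bundle \<Rightarrow> 'm set \<Rightarrow> ('m \<Rightarrow> 'e)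
    \<Rightarrow> ('m \<Rightarrow> 'v) \<Rightarrow> ('m, 'v) jet_point \<Rightarrow> 'e \<times> real \<times> ('e \<Rightarrow>\<^sub>L real)" where
  "jet_chart L U \<phi> e = (\<lambda>(x, \<alpha>). (\<phi> x, coord (fibre L x) (e x) (\<alpha> (ev_der L x)),
     Blinfun (\<lambda>v. coord (fibre L x) (e x) (\<alpha> (partial_der L U \<phi> e x v)))))"

definition J1 :: "('m, 'e::real_normed_vector, 'v) line_bundle
    \<Rightarrow> (('m, 'v) jet_point, 'e \<times> real \<times> ('e \<Rightarrow>\<^sub>L real)) atlas" where
  "J1 L = {((SIGMA x:U \<inter> V. carrier (jet_space L x)), jet_chart L U \<phi> e) |U \<phi> V e.
     (U, \<phi>) \<in> base L \<and> (V, e) \<in> frames L}"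

text \<open>The line bundle \<open>\<pi>\<^sup>*L \<rightarrow> J\<^sup>1L\<close> with its fibre-wise constant and fibre-wise linear
  sections.\<close>

definition pi_star :: "('m, 'e::real_normed_vector, 'v) line_bundle
    \<Rightarrow> (('m, 'v) jet_point, 'e \<times> real \<times> ('e \<Rightarrow>\<^sub>L real), 'v) line_bundle" where
  "pi_star L = pullback (J1 L) fst L"

definition const_section :: "('m, 'e::real_normed_vector, 'v) line_bundle \<Rightarrow> ('m \<Rightarrow> 'v)
    \<Rightarrow> ('m, 'v) jet_point \<Rightarrow> 'v" where
  "const_section L s = (\<lambda>p\<in>points (J1 L). s (fst p))"

definition lin_section :: "('m, 'e::real_normed_vector, 'v) line_bundle \<Rightarrow> ('m \<Rightarrow> ('m \<Rightarrow> 'v) \<Rightarrow> 'v)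
    \<Rightarrow> ('m, 'v) jet_point \<Rightarrow> 'v" where
  "lin_section L a = (\<lambda>p\<in>points (J1 L). snd p (a (fst p)))"


subsection \<open>Jacobi structures\<close>

text \<open>\<open>D\<close> is a differential operator of order at most 1 on \<open>\<Gamma>(L)\<close>: it is linear and
  \<open>[[D, f], g] = 0\<close> for all smooth functions \<open>f\<close>, \<open>g\<close>.\<close>

definition diff_op1 :: "('m, 'e::real_normed_vector, 'v) line_bundle \<Rightarrow> (('m \<Rightarrow> 'v) \<Rightarrow> 'm \<Rightarrow> 'v) \<Rightarrow> bool" where
  "diff_op1 L D \<longleftrightarrow> lin_map (sections L) (sections L) D \<and>
     (\<forall>f\<in>carrier (Cinf (base L)). \<forall>g\<in>carrier (Cinf (base L)). \<forall>s\<in>\<Gamma> L.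
        let m = fmult (pts L) (fibre L) in
        D (m f (m g s)) \<oplus>\<^bsub>sections L\<^esub> m g (m f (D s)) = m f (D (m g s)) \<oplus>\<^bsub>sections L\<^esub> m g (D (m f s)))"

definition jacobi_structure :: "('m, 'e::real_normed_vector, 'v) line_bundle
    \<Rightarrow> (('m \<Rightarrow> 'v) \<Rightarrow> ('m \<Rightarrow> 'v) \<Rightarrow> 'm \<Rightarrow> 'v) \<Rightarrow> bool" where
  "jacobi_structure L B \<longleftrightarrow> is_line_bundle L \<and>
     (\<forall>s\<in>\<Gamma> L. diff_op1 L (B s)) \<and> (\<forall>r\<in>\<Gamma> L. diff_op1 L (\<lambda>s. B s r)) \<and>
     (\<forall>s\<in>\<Gamma> L. B s s = \<zero>\<^bsub>sections L\<^esub>) \<and>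
     (\<forall>s\<in>\<Gamma> L. \<forall>r\<in>\<Gamma> L. \<forall>t\<in>\<Gamma> L.
        B s (B r t) \<oplus>\<^bsub>sections L\<^esub> B r (B t s) \<oplus>\<^bsub>sections L\<^esub> B t (B s r) = \<zero>\<^bsub>sections L\<^esub>)"

definition nondegenerate_jacobi :: "('m, 'e::real_normed_vector, 'v) line_bundle
    \<Rightarrow> (('m \<Rightarrow> 'v) \<Rightarrow> ('m \<Rightarrow> 'v) \<Rightarrow> 'm \<Rightarrow> 'v) \<Rightarrow> bool" where
  "nondegenerate_jacobi L B \<longleftrightarrow> jacobi_structure L B \<and>
     (\<forall>x\<in>pts L. \<exists>F. lin_map (jet_space L x) (der_space L x) F \<and>
        bij_betw F (carrier (jet_space L x)) (carrier (der_space L x)) \<and>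
        (\<forall>s\<in>\<Gamma> L. F (jet L s x) = (\<lambda>r\<in>\<Gamma> L. B s r x)))"

definition is_symbol :: "('m, 'e::real_normed_vector, 'v) line_bundle
    \<Rightarrow> (('m \<Rightarrow> 'v) \<Rightarrow> ('m \<Rightarrow> 'v) \<Rightarrow> 'm \<Rightarrow> 'v)
    \<Rightarrow> (('m \<Rightarrow> 'v) \<Rightarrow> 'm \<Rightarrow> ('m \<Rightarrow> real) \<Rightarrow> real) \<Rightarrow> bool" where
  "is_symbol L B X \<longleftrightarrow> lin_map (sections L) (vfields (base L)) X \<and>
     (\<forall>s\<in>\<Gamma> L. \<forall>r\<in>\<Gamma> L. \<forall>f\<in>carrier (Cinf (base L)).
        B s (fmult (pts L) (fibre L) f r) =
          fmult (pts L) (fibre L) f (B s r) \<oplus>\<^bsub>sections L\<^esub>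
          fmult (pts L) (fibre L) (act (pts L) (X s) f) r)"

definition fibrewise_linear :: "('m, 'e::real_normed_vector, 'v) line_bundle
    \<Rightarrow> ((('m, 'v) jet_point \<Rightarrow> 'v) \<Rightarrow> (('m, 'v) jet_point \<Rightarrow> 'v) \<Rightarrow> ('m, 'v) jet_point \<Rightarrow> 'v) \<Rightarrow> bool" where
  "fibrewise_linear L B \<longleftrightarrow>
     (\<forall>a\<in>derivations L. \<forall>b\<in>derivations L.
        B (lin_section L a) (lin_section L b) \<in> lin_section L ` derivations L) \<and>
     (\<forall>a\<in>derivations L. \<forall>s\<in>\<Gamma> L.
        B (lin_section L a) (const_section L s) \<in> const_section L ` \<Gamma> L) \<and>
     (\<forall>s\<in>\<Gamma> L. \<forall>r\<in>\<Gamma> L.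
        B (const_section L s) (const_section L r) = \<zero>\<^bsub>sections (pi_star L)\<^esub>)"

text \<open>The algebraic structure of derivations acting on sections, as a condition on a bracket on
  \<open>\<Gamma>(\<pi>\<^sup>*L)\<close>.\<close>

definition derivation_relations :: "('m, 'e::real_normed_vector, 'v) line_bundle
    \<Rightarrow> ((('m, 'v) jet_point \<Rightarrow> 'v) \<Rightarrow> (('m, 'v) jet_point \<Rightarrow> 'v) \<Rightarrow> ('m, 'v) jet_point \<Rightarrow> 'v) \<Rightarrow> bool" where
  "derivation_relations L B \<longleftrightarrow>
     (\<forall>a\<in>derivations L. \<forall>b\<in>derivations L.
        B (lin_section L a) (lin_section L b) = lin_section L (der_bracket L a b)) \<and>
     (\<forall>a\<in>derivations L. \<forall>s\<in>\<Gamma> L.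
        B (lin_section L a) (const_section L s) = const_section L (act (pts L) a s)) \<and>
     (\<forall>s\<in>\<Gamma> L. \<forall>r\<in>\<Gamma> L.
        B (const_section L s) (const_section L r) = \<zero>\<^bsub>sections (pi_star L)\<^esub>)"


subsection \<open>Contact structures\<close>

definition hyperplane_distribution :: "('m, 'e::real_normed_vector) atlas
    \<Rightarrow> ('m \<Rightarrow> (('m \<Rightarrow> real) \<Rightarrow> real) set) \<Rightarrow> bool" where
  "hyperplane_distribution A H \<longleftrightarrow>
     (\<forall>x\<in>points A. vec_subspace (H x) (tangent A x) \<and>
        one_dimensional (quotient_space (tangent A x) (H x))) \<and>
     (\<forall>x\<in>points A. \<exists>U F. mfd_open A U \<and> x \<in> U \<and> F \<subseteq> carrier (vfields A) \<and>
        (\<forall>y\<in>U. H y = lin_span (tangent A y) ((\<lambda>Y. Y y) ` F)))"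

definition theta :: "('m, 'e::real_normed_vector) atlas \<Rightarrow> ('m \<Rightarrow> (('m \<Rightarrow> real) \<Rightarrow> real) set)
    \<Rightarrow> 'm \<Rightarrow> (('m \<Rightarrow> real) \<Rightarrow> real) \<Rightarrow> (('m \<Rightarrow> real) \<Rightarrow> real) set" where
  "theta A H x v = H x +>\<^bsub>tangent A x\<^esub> v"

text \<open>\<open>L\<^sub>H = TM/H\<close>; the local frames are the classes of vector fields that are nowhere in \<open>H\<close>.\<close>

definition contact_line_bundle :: "('m, 'e::real_normed_vector) atlas \<Rightarrow> ('m \<Rightarrow> (('m \<Rightarrow> real) \<Rightarrow> real) set)
    \<Rightarrow> ('m, 'e, (('m \<Rightarrow> real) \<Rightarrow> real) set) line_bundle" where
  "contact_line_bundle A H = \<lparr>base = A, fibre = (\<lambda>x. quotient_space (tangent A x) (H x)),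
     frames = {(U, (\<lambda>x. theta A H x (Y x))) |U Y.
       mfd_open A U \<and> Y \<in> carrier (vfields A) \<and> (\<forall>x\<in>U. Y x \<notin> H x)}\<rparr>"

definition curvature :: "('m, 'e::real_normed_vector) atlas \<Rightarrow> ('m \<Rightarrow> (('m \<Rightarrow> real) \<Rightarrow> real) set)
    \<Rightarrow> 'm \<Rightarrow> (('m \<Rightarrow> real) \<Rightarrow> real) \<Rightarrow> (('m \<Rightarrow> real) \<Rightarrow> real) \<Rightarrow> (('m \<Rightarrow> real) \<Rightarrow> real) set" where
  "curvature A H x h k = (THE w. \<exists>X\<in>carrier (vfields A). \<exists>Y\<in>carrier (vfields A).
     (\<forall>y\<in>points A. X y \<in> H y \<and> Y y \<in> H y) \<and> X x = h \<and> Y x = k \<and>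
     w = theta A H x (vf_bracket A X Y x))"

definition contact_structure :: "('m, 'e::real_normed_vector) atlas
    \<Rightarrow> ('m \<Rightarrow> (('m \<Rightarrow> real) \<Rightarrow> real) set) \<Rightarrow> bool" where
  "contact_structure A H \<longleftrightarrow> smooth_manifold A \<and> hyperplane_distribution A H \<and>
     (\<forall>x\<in>points A. \<forall>h\<in>H x.
        (\<forall>k\<in>H x. curvature A H x h k = \<zero>\<^bsub>quotient_space (tangent A x) (H x)\<^esub>)
          \<longrightarrow> h = \<zero>\<^bsub>tangent A x\<^esub>)"

text \<open>\<open>\<omega>\<^sup>\<sharp>(df|\<^sub>H \<otimes> s)\<close>, where \<open>\<omega>\<^sup>\<sharp>\<close> is the inverse of \<open>h \<mapsto> \<omega>\<^sub>H(h, \<cdot>)\<close>.\<close>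

definition omega_sharp :: "('m, 'e::real_normed_vector) atlas \<Rightarrow> ('m \<Rightarrow> (('m \<Rightarrow> real) \<Rightarrow> real) set)
    \<Rightarrow> ('m \<Rightarrow> real) \<Rightarrow> ('m \<Rightarrow> (('m \<Rightarrow> real) \<Rightarrow> real) set) \<Rightarrow> 'm \<Rightarrow> ('m \<Rightarrow> real) \<Rightarrow> real" where
  "omega_sharp A H f s = (\<lambda>x\<in>points A. THE h. h \<in> H x \<and>
     (\<forall>k\<in>H x. curvature A H x h k = k f \<odot>\<^bsub>quotient_space (tangent A x) (H x)\<^esub> s x))"

text \<open>\<open>B\<close> is the bracket on \<open>\<Gamma>(L\<^sub>H)\<close> induced by the contact structure \<open>H\<close>, and \<open>X\<close> is its
  symbol. The condition \<open>\<theta>(X\<^sub>s) = s\<close> and the squiggle only determine \<open>X\<close> up to a vector bundle map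
  \<open>L\<^sub>H \<rightarrow> H\<close>; that \<open>X\<close> is the symbol of \<open>\<theta>([X\<^sub>s, X\<^sub>r])\<close> makes it unique.\<close>

definition induced_bracket :: "('m, 'e::real_normed_vector) atlas \<Rightarrow> ('m \<Rightarrow> (('m \<Rightarrow> real) \<Rightarrow> real) set)
    \<Rightarrow> (('m \<Rightarrow> (('m \<Rightarrow> real) \<Rightarrow> real) set) \<Rightarrow> 'm \<Rightarrow> ('m \<Rightarrow> real) \<Rightarrow> real)
    \<Rightarrow> (('m \<Rightarrow> (('m \<Rightarrow> real) \<Rightarrow> real) set) \<Rightarrow> ('m \<Rightarrow> (('m \<Rightarrow> real) \<Rightarrow> real) set)
          \<Rightarrow> 'm \<Rightarrow> (('m \<Rightarrow> real) \<Rightarrow> real) set) \<Rightarrow> bool" where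
  "induced_bracket A H X B \<longleftrightarrow>
     (let LH = contact_line_bundle A H in
       is_symbol LH B X \<and>
       (\<forall>s\<in>\<Gamma> LH. \<forall>x\<in>points A. theta A H x (X s x) = s x) \<and>
       (\<forall>s\<in>\<Gamma> LH. \<forall>r\<in>\<Gamma> LH. B s r = (\<lambda>x\<in>points A. theta A H x (vf_bracket A (X s) (X r) x))) \<and>
       (\<forall>s\<in>\<Gamma> LH. \<forall>f\<in>carrier (Cinf A).
          X (fmult (points A) (fibre LH) f s) =
            fmult (points A) (tangent A) f (X s) \<oplus>\<^bsub>vfields A\<^esub> omega_sharp A H f s))"

text \<open>The canonical (Cartan) distribution \<open>H\<^sub>L\<close> on \<open>J\<^sup>1L\<close>: at \<open>\<alpha>\<close> it is spanned by the tangent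
  spaces of the graphs of all prolongations \<open>j\<^sup>1s : Q \<rightarrow> J\<^sup>1L\<close> through \<open>\<alpha>\<close>.\<close>

definition cartan :: "('m, 'e::real_normed_vector, 'v) line_bundle \<Rightarrow> ('m, 'v) jet_point
    \<Rightarrow> ((('m, 'v) jet_point \<Rightarrow> real) \<Rightarrow> real) set" where
  "cartan L = (\<lambda>(q, \<alpha>). lin_span (tangent (J1 L) (q, \<alpha>))
     {tangent_map (base L) (J1 L) (\<lambda>x. (x, jet L s x)) w |s w.
        s \<in> \<Gamma> L \<and> jet L s q = \<alpha> \<and> w \<in> carrier (tangent (base L) q)})"

end

theory Submission
  imports Defs
begin

text \<open>In the coordinates \<open>(y, u, p)\<close> that a chart of \<open>Q\<close> and a frame of \<open>L\<close> induce on \<open>J\<^sup>1L\<close>, the Cartan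
  distribution is the kernel of the \<open>L\<close>-valued form \<open>p dy - du\<close>. Its independence of the coordinates
  makes \<open>T(J\<^sup>1L)/H\<^sub>L\<close> isomorphic to \<open>\<pi>\<^sup>*L\<close>. For every section \<open>\<sigma>\<close> of \<open>\<pi>\<^sup>*L\<close> there is exactly one vector
  field \<open>hv \<sigma>\<close> with \<open>\<theta>(hv \<sigma>) = \<sigma>\<close> whose flow preserves \<open>H\<^sub>L\<close>, in coordinates the contact Hamiltonian
  vector field of \<open>\<sigma>\<close>, and \<open>{\<sigma>, \<rho>} = \<theta>([hv \<sigma>, hv \<rho>])\<close>. By uniqueness \<open>[hv \<sigma>, hv \<rho>] = hv {\<sigma>, \<rho>}\<close>, so that the
  Jacobi identity is that of vector fields. The relations between fibre-wise linear and constant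
  sections are read off in coordinates; since these sections together realise all 1-jets, the relations
  determine a bracket that is a first-order differential operator in each argument.\<close>

text \<open>Tangent vectors are derivations of functions and elements of \<open>DL\<close> are
  derivations of sections at a point, so no coordinates are given at the start. Cut-off functions
  make such derivations local, and Hadamard's lemma together with the Leibniz rule on a frame
  identifies them with model vectors (\<open>tvec\<close>, \<open>dvec\<close>). After that the
  geometry of \<open>J1 L\<close> is linear algebra on triples: \<open>cform\<close> is the contact
  form, \<open>cpair\<close> is minus its exterior derivative, and \<open>cpair_hvec\<close> is the
  one identity behind the formula for the bracket, its non-degeneracy and the squiggle. The sign of
  \<open>p dy - du\<close> matters: with it the field of \<open>l_a\<close> projects onto the symbol
  of \<open>a\<close>, and the relations come out as stated; the opposite form would reverse the
  bracket. The contact field of a section is described without a chart, so local formulas agree by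
  uniqueness and nothing is glued. The model space carries a norm only and may have dimension 0:
  bases and their coordinate functionals replace an inner product, and several constants contain a
  \<open>+ 1\<close> for the empty basis.\<close>

abbreviation \<D> where "\<D> f x \<equiv> frechet_derivative f (at x)"
abbreviation \<X> where "\<X> A \<equiv> carrier (vfields A)"
abbreviation \<T> where "\<T> A x \<equiv> carrier (tangent A x)"
abbreviation \<F> where "\<F> L x \<equiv> carrier (fibre L x)"
abbreviation \<L> where "\<L> L x \<equiv> carrier (der_space L x)"
abbreviation \<J> where "\<J> L x \<equiv> carrier (jet_space L x)"
abbreviation \<P> where "\<P> L \<equiv> points (J1 L)"
abbreviation rep where "rep \<equiv> representation"
abbreviation ap where "ap \<equiv> blinfun_apply"
abbreviation \<E> where "\<E> L p \<equiv> fibre L (fst p)"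
abbreviation crd where "crd L e x \<equiv> coord (fibre L x) (e x)"
abbreviation \<I> where "\<I> \<equiv> inv_into"
abbreviation jet_dom where "jet_dom L U V \<equiv> (SIGMA x:U \<inter> V. \<J> L x)"

section \<open>Finite-dimensional normed spaces\<close>

text \<open>The argument is a bare type token. Finite-dimensionality becomes an ordinary hypothesis
  that can be passed on to products and duals of the model space, dimension 0 included.\<close>

definition finite_dim :: "'a::real_normed_vector itself \<Rightarrow> bool" where
  "finite_dim _ \<longleftrightarrow> (\<exists>B::'a set. finite B \<and> span B = UNIV)"

definition is_basis :: "'a::real_normed_vector set \<Rightarrow> bool" where
  "is_basis B \<longleftrightarrow> finite B \<and> independent B \<and> span B = UNIV"

lemma finite_dim_basis:
  assumes "finite_dim TYPE('a::real_normed_vector)"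
  obtains B :: "'a::real_normed_vector set" where "is_basis B"
proof -
  obtain B0 :: "'a set" where B0: "finite B0" "span B0 = UNIV" using assms by (auto simp: finite_dim_def)
  obtain B where "B \<subseteq> B0" "independent B" "B0 \<subseteq> span B" using maximal_independent_subset[of B0] by blast
  moreover have "span B = UNIV" using calculation B0 by (metis span_mono span_span top.extremum_uniqueI)
  ultimately show ?thesis using that[of B] B0 by (auto simp: is_basis_def intro: finite_subset)
qed

lemma is_basis_finite: "is_basis B \<Longrightarrow> finite B" by (simp add: is_basis_def)

lemma basis_sum:
  assumes "is_basis B" shows "(\<Sum>b\<in>B. rep B v b *\<^sub>R b) = v"
  using assms by (intro real_vector.sum_representation_eq) (auto simp: is_basis_def)

lemma basis_add:
  assumes "is_basis B"
  shows "rep B (v + w) b = rep B v b + rep B w b"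
  using assms by (subst real_vector.representation_add) (auto simp: is_basis_def)

lemma basis_scale:
  assumes "is_basis B"
  shows "rep B (c *\<^sub>R v) b = c * rep B v b"
  using assms by (subst real_vector.representation_scale) (auto simp: is_basis_def)

lemma ne_emptyI': "x \<in> A \<Longrightarrow> A \<noteq> {}" by blast

text \<open>Compactness of the coordinate box is what makes coordinates bounded, hence continuous.\<close>

lemma compact_coord_box:
  assumes "finite (B::'a::real_normed_vector set)"
  shows "compact {c::'a \<Rightarrow> real. \<forall>b. c b \<in> (if b \<in> B then {-r..r} else {0})}"
proof -
  have "compactin (product_topology (\<lambda>_. euclidean) UNIV)
     (PiE UNIV (\<lambda>b. if b \<in> B then {-r..r} else {0::real}))" by (auto simp: compactin_PiE)
  moreover have "PiE UNIV (\<lambda>b. if b \<in> B then {-r..r} else {0::real})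
     = {c. \<forall>b. c b \<in> (if b \<in> B then {-r..r} else {0})}" by (auto simp: PiE_def Pi_def)
  ultimately show ?thesis by (simp add: euclidean_product_topology)
qed

lemma continuous_combination: "continuous_on S (\<lambda>c::'a::real_normed_vector \<Rightarrow> real. \<Sum>b\<in>B. c b *\<^sub>R b)"
  by (intro continuous_on_sum continuous_on_scaleR continuous_on_const
      continuous_on_subset[OF continuous_on_product_coordinates]) auto

text \<open>On the coordinate tuples of sup norm 1, a compact set, the norm of the combination
  attains a minimum, which linear independence keeps positive. Its reciprocal bounds every
  coordinate, once a vector is scaled by its largest coordinate.\<close>

lemma representation_bound:
  assumes B: "is_basis (B::'a::real_normed_vector set)"
  shows "\<exists>K>0. \<forall>v b. \<bar>rep B v b\<bar> \<le> K * norm v"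
proof -
  have fin: "finite B" using B by (simp add: is_basis_def)
  let ?K = "{c::'a \<Rightarrow> real. \<forall>b. c b \<in> (if b \<in> B then {-1..1} else {0})}"
  let ?S = "?K \<inter> (\<Union>b\<in>B. {c. \<bar>c b\<bar> = 1})"
  have "closed (\<Union>b\<in>B. {c::'a \<Rightarrow> real. \<bar>c b\<bar> = 1})"
    using fin by (intro closed_UN ballI closed_Collect_eq continuous_on_rabs
        continuous_on_product_coordinates continuous_on_const)
  then have cS: "compact ?S" using compact_coord_box[OF fin, of 1] by (rule compact_Int_closed[rotated])
  have repr0: "rep B v b = 0" if "b \<notin> B" for v b using that real_vector.representation_ne_zero by metis
  show ?thesis
  proof (cases "B = {}")
    case True
    then show ?thesis using repr0 by (intro exI[of _ 1]) simp
  next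
    case False
    define F where "F = (\<lambda>c::'a \<Rightarrow> real. norm (\<Sum>b\<in>B. c b *\<^sub>R b))"
    have contF: "continuous_on ?S F" unfolding F_def by (intro continuous_on_norm continuous_combination)
    obtain b0 where b0: "b0 \<in> B" using False by auto
    have ne: "?S \<noteq> {}"
    proof -
      have "(\<lambda>b. if b = b0 then 1 else 0 :: real) \<in> ?S" using b0 by auto
      then show ?thesis by (rule ne_emptyI')
    qed
    obtain c0 where c0: "c0 \<in> ?S" "\<And>c. c \<in> ?S \<Longrightarrow> F c0 \<le> F c" using continuous_attains_inf[OF cS ne contF] by blast
    have Fpos: "F c0 > 0"
    proof (rule ccontr)
      assume "\<not> F c0 > 0"
      then have "(\<Sum>b\<in>B. c0 b *\<^sub>R b) = 0" unfolding F_def by simp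
      then have "\<forall>b\<in>B. c0 b = 0" using B fin unfolding is_basis_def by (auto simp: real_vector.dependent_finite)
      then show False using c0(1) by auto
    qed
    have bound: "\<bar>rep B v b\<bar> \<le> (1 / F c0) * norm v" for v b
    proof -
      \<comment> \<open>The sup norm of the coordinates of \<open>v\<close>: dividing by it moves
        the tuple into \<open>?S\<close>, where the minimum \<open>F c0\<close> applies.\<close>
      define m where "m = Max ((\<lambda>b. \<bar>rep B v b\<bar>) ` B)"
      have mge: "\<And>b. b \<in> B \<Longrightarrow> \<bar>rep B v b\<bar> \<le> m" unfolding m_def using fin by simp
      have m0: "m \<ge> 0" using mge[OF b0] by linarith
      have "m * F c0 \<le> norm v"
      proof (cases "m = 0")
        case False
        then have mp: "m > 0" using m0 by simp
        define c where "c = (\<lambda>b. rep B v b / m)"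
        obtain b1 where b1: "b1 \<in> B" "\<bar>rep B v b1\<bar> = m"
        proof -
          have "m \<in> (\<lambda>b. \<bar>rep B v b\<bar>) ` B" unfolding m_def using fin b0 by (intro Max_in) auto
          then show ?thesis using that by auto
        qed
        have "c \<in> ?S"
        proof -
          have "\<bar>c b\<bar> \<le> 1" if "b \<in> B" for b using mge[OF that] mp unfolding c_def by simp
          moreover have "c b = 0" if "b \<notin> B" for b using repr0[OF that] by (simp add: c_def)
          moreover have "\<bar>c b1\<bar> = 1" using b1 mp by (simp add: c_def)
          ultimately show ?thesis using b1(1) by (auto simp: abs_le_iff)
        qed
        then have "F c0 \<le> F c" by (rule c0(2))
        also have "F c = norm ((1/m) *\<^sub>R (\<Sum>b\<in>B. rep B v b *\<^sub>R b))"
          unfolding F_def c_def by (simp add: scaleR_sum_right)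
        also have "\<dots> = norm v / m" using mp basis_sum[OF B, of v] by simp
        finally show ?thesis using mp by (simp add: field_simps)
      qed simp
      moreover have "\<bar>rep B v b\<bar> \<le> m" using mge m0 repr0 by (cases "b \<in> B") auto
      ultimately have "\<bar>rep B v b\<bar> * F c0 \<le> norm v" using Fpos by (meson mult_right_mono less_imp_le order_trans)
      then show ?thesis using Fpos by (simp add: field_simps)
    qed
    show ?thesis using Fpos bound by (intro exI[of _ "1 / F c0"]) simp
  qed
qed

lemma bounded_linear_representation:
  assumes B: "is_basis (B::'a::real_normed_vector set)"
  shows "bounded_linear (\<lambda>v. rep B v b)"
proof -
  obtain K where K: "\<And>v b. \<bar>rep B v b\<bar> \<le> K * norm v" using representation_bound[OF B] by auto
  from K show ?thesis
    by (intro bounded_linear_intro[of _ K]) (auto simp: basis_add[OF B] basis_scale[OF B] mult.commute)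
qed

lemma linear_eq_basis_sum:
  assumes "is_basis B" "linear f"
  shows "f v = (\<Sum>b\<in>B. rep B v b *\<^sub>R f b)"
proof -
  have "f v = f (\<Sum>b\<in>B. rep B v b *\<^sub>R b)" by (simp add: basis_sum[OF assms(1)])
  also have "\<dots> = (\<Sum>b\<in>B. rep B v b *\<^sub>R f b)" using assms(2) by (simp add: linear_sum linear_scale)
  finally show ?thesis .
qed

lemma linear_imp_bounded_linear:
  fixes f :: "'a::real_normed_vector \<Rightarrow> 'b::real_normed_vector"
  assumes "finite_dim TYPE('a)" "linear f"
  shows "bounded_linear f"
proof -
  obtain B :: "'a set" where B: "is_basis B" using finite_dim_basis[OF assms(1)] .
  have "f = (\<lambda>v. \<Sum>b\<in>B. rep B v b *\<^sub>R f b)" using linear_eq_basis_sum[OF B assms(2)] by blast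
  moreover have "bounded_linear (\<lambda>v. \<Sum>b\<in>B. rep B v b *\<^sub>R f b)"
    by (intro bounded_linear_sum bounded_linear_scaleR_const bounded_linear_representation B)
  ultimately show ?thesis by simp
qed

lemma finite_dim_real: "finite_dim TYPE(real)"
proof -
  have "(UNIV::real set) \<subseteq> span {1}"
  proof
    fix x :: real
    have "x *\<^sub>R 1 \<in> span {1::real}" by (intro span_scale span_base) auto
    then show "x \<in> span {1}" by simp
  qed
  then show ?thesis unfolding finite_dim_def by (intro exI[of _ "{1}"]) auto
qed

lemma finite_dim_prod:
  assumes "finite_dim TYPE('a::real_normed_vector)" "finite_dim TYPE('b::real_normed_vector)"
  shows "finite_dim TYPE('a::real_normed_vector \<times> 'b::real_normed_vector)"
proof -
  obtain A :: "'a set" where A: "is_basis A" using finite_dim_basis[OF assms(1)] .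
  obtain B :: "'b set" where B: "is_basis B" using finite_dim_basis[OF assms(2)] .
  let ?C = "(\<lambda>a. (a, 0::'b)) ` A \<union> (\<lambda>b. (0::'a, b)) ` B"
  have "(x, y) \<in> span ?C" for x y
  proof -
    have "(x, y) = (\<Sum>a\<in>A. representation A x a *\<^sub>R (a, 0)) + (\<Sum>b\<in>B. rep B y b *\<^sub>R (0, b))"
      by (simp add: prod_eq_iff fst_sum snd_sum basis_sum[OF A] basis_sum[OF B])
    also have "\<dots> \<in> span ?C" by (intro span_add span_sum span_scale span_base) auto
    finally show ?thesis .
  qed
  then have "span ?C = UNIV" by auto
  then show ?thesis using is_basis_finite[OF A] is_basis_finite[OF B] unfolding finite_dim_def
    by (intro exI[of _ ?C]) auto
qed

definition dual_basis :: "'a::real_normed_vector set \<Rightarrow> 'a \<Rightarrow> 'a \<Rightarrow>\<^sub>L real" where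
  "dual_basis B b = Blinfun (\<lambda>v. rep B v b)"

lemma dual_basis_apply [simp]:
  "is_basis B \<Longrightarrow> ap (dual_basis B b) v = rep B v b"
  by (simp add: dual_basis_def bounded_linear_Blinfun_apply bounded_linear_representation)

lemma blinfun_eq_basis_sum:
  fixes p :: "'a::real_normed_vector \<Rightarrow>\<^sub>L real"
  assumes "is_basis B"
  shows "p = (\<Sum>b\<in>B. ap p b *\<^sub>R dual_basis B b)"
proof (rule blinfun_eqI)
  fix v
  show "ap p v = ap (\<Sum>b\<in>B. ap p b *\<^sub>R dual_basis B b) v" using linear_eq_basis_sum[OF assms, of "ap p" v]
    by (simp add: blinfun.sum_left blinfun.scaleR_left assms mult.commute
        bounded_linear.linear[OF blinfun.bounded_linear_right])
qed

lemma finite_dim_blinfun: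
  assumes "finite_dim TYPE('a::real_normed_vector)"
  shows "finite_dim TYPE('a::real_normed_vector \<Rightarrow>\<^sub>L real)"
proof -
  obtain B :: "'a set" where B: "is_basis B" using finite_dim_basis[OF assms(1)] .
  have "p \<in> span (dual_basis B ` B)" for p
    by (subst blinfun_eq_basis_sum[OF B, of p]) (intro span_sum span_scale span_base imageI)
  then show ?thesis using is_basis_finite[OF B] unfolding finite_dim_def
    by (intro exI[of _ "dual_basis B ` B"]) auto
qed

lemma finite_dim_jet_model:
  "finite_dim TYPE('a::real_normed_vector) \<Longrightarrow> finite_dim TYPE('a::real_normed_vector \<times> real \<times> ('a \<Rightarrow>\<^sub>L real))"
  by (intro finite_dim_prod finite_dim_real finite_dim_blinfun)

text \<open>Rational combinations of a basis are dense. Together with rational radii they supply the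
  countable family of balls behind second countability of \<open>J1 L\<close>.\<close>

lemma countable_dense_finite_dim:
  assumes "finite_dim TYPE('a::real_normed_vector)"
  obtains D :: "'a::real_normed_vector set" where "countable D" "\<And>x e. e > 0 \<Longrightarrow> \<exists>d\<in>D. dist d x < e"
proof -
  obtain B :: "'a set" where B: "is_basis B" using finite_dim_basis[OF assms(1)] .
  have fin: "finite B" using B by (rule is_basis_finite)
  define D where "D = (\<lambda>q. \<Sum>b\<in>B. q b *\<^sub>R b) ` (PiE B (\<lambda>_. \<rat>))"
  have "countable D" unfolding D_def by (intro countable_image countable_PiE fin countable_rat)
  moreover have "\<exists>d\<in>D. dist d x < e" if e: "e > 0" for x e
  proof -
    \<comment> \<open>The extra 1 keeps \<open>?M\<close> positive for the empty basis and makes the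
      final estimate \<open>e / ?M * (?M - 1) < e\<close> strict.\<close>
    let ?M = "(\<Sum>b\<in>B. norm b) + 1"
    have M: "?M > 0" by (simp add: add_nonneg_pos sum_nonneg)
    have "\<exists>q\<in>\<rat>. \<bar>q - rep B x b\<bar> < e / ?M" for b
    proof -
      obtain q where "q \<in> \<rat>" "rep B x b < q" "q < rep B x b + e / ?M"
        using Rats_dense_in_real[of "rep B x b" "rep B x b + e / ?M"] e M by auto
      then show ?thesis by (intro bexI[of _ q]) auto
    qed
    then obtain q where q: "\<And>b. q b \<in> \<rat>" "\<And>b. \<bar>q b - rep B x b\<bar> < e / ?M" by metis
    let ?d = "\<Sum>b\<in>B. restrict q B b *\<^sub>R b"
    have "?d \<in> D" unfolding D_def using q by (intro image_eqI[of _ _ "restrict q B"]) auto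
    moreover have "dist ?d x < e"
    proof -
      have "?d - x = (\<Sum>b\<in>B. (q b - rep B x b) *\<^sub>R b)" by (subst (2) basis_sum[OF B, symmetric])
          (simp add: sum_subtractf[symmetric] scaleR_diff_left)
      then have "norm (?d - x) \<le> (\<Sum>b\<in>B. \<bar>q b - rep B x b\<bar> * norm b)"
        by (metis (no_types, lifting) norm_scaleR norm_sum sum.cong order_trans order_refl sum_norm_le)
      also have "\<dots> \<le> (\<Sum>b\<in>B. e / ?M * norm b)"
        by (intro sum_mono mult_right_mono less_imp_le[OF q(2)] norm_ge_zero)
      also have "\<dots> = e / ?M * (?M - 1)" by (simp only: sum_distrib_left[symmetric] add_diff_cancel_right')
      also have "\<dots> < e" using e M by (simp add: field_simps)
      finally show ?thesis by (simp add: dist_norm)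
    qed
    ultimately show ?thesis by blast
  qed
  ultimately show ?thesis using that by blast
qed

section \<open>Smooth maps\<close>

lemma ck_on_cong_imp:
  assumes "open S" "\<And>x. x \<in> S \<Longrightarrow> f x = g x" "ck_on k S f"
  shows "ck_on k S g" using assms(2,3)
proof (induction k arbitrary: f g)
  case 0
  then show ?case by (auto cong: continuous_on_cong)
next
  case (Suc k)
  have d: "g differentiable (at x)" if "x \<in> S" for x
  proof -
    have "(f has_derivative \<D> f x) (at x)" using Suc.prems(2) that by (simp add: frechet_derivative_works)
    from has_derivative_transform_within_open[OF this assms(1) that, of g] Suc.prems(1)
    show ?thesis by (auto simp: differentiable_def)
  qed
  have e: "\<D> f x = \<D> g x" if "x \<in> S" for x
    using Suc.prems that assms(1) by (intro frechet_derivative_transform_within_open[of f x S g]) auto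
  have "ck_on k S (\<lambda>x. \<D> g x v)" for v by (rule Suc.IH[of "\<lambda>x. \<D> f x v"]) (use e Suc.prems in auto)
  then show ?case using d by simp
qed

text \<open>Admits any known derivative in place of the chosen \<open>frechet_derivative\<close>.
  Most closure properties below compute a derivative by a rule of calculus and then come back to
  this rule.\<close>

lemma ck_on_SucI:
  assumes "open S" "\<And>x. x \<in> S \<Longrightarrow> (f has_derivative f' x) (at x)" "\<And>v. ck_on k S (\<lambda>x. f' x v)"
  shows "ck_on (Suc k) S f"
proof -
  have "\<D> f x = f' x" if "x \<in> S" for x using assms(2)[OF that] by (rule frechet_derivative_at[symmetric])
  then have "ck_on k S (\<lambda>x. \<D> f x v)" for v by (intro ck_on_cong_imp[OF assms(1) _ assms(3)[of v]]) auto
  moreover have "\<forall>x\<in>S. f differentiable (at x)" using assms(2) by (auto simp: differentiable_def)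
  ultimately show ?thesis by simp
qed

lemma ck_on_SucD:
  assumes "ck_on (Suc k) S f"
  shows "x \<in> S \<Longrightarrow> (f has_derivative \<D> f x) (at x)"
    "ck_on k S (\<lambda>x. \<D> f x v)" using assms by (auto simp: frechet_derivative_works)

lemma ck_on_subset: "ck_on k S f \<Longrightarrow> T \<subseteq> S \<Longrightarrow> ck_on k T f"
  by (induction k arbitrary: f) (auto intro: continuous_on_subset)

lemma ck_on_Suc_imp: "ck_on (Suc k) S f \<Longrightarrow> ck_on k S f"
proof (induction k arbitrary: f)
  case 0
  then show ?case by (auto intro!: continuous_at_imp_continuous_on differentiable_imp_continuous_within)
qed auto

lemma ck_on_const: "open S \<Longrightarrow> ck_on k S (\<lambda>x. c)"
  by (induction k arbitrary: c) (auto intro!: ck_on_SucI[where f'="\<lambda>_ _. 0"] simp del: ck_on.simps(2))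

lemma ck_on_bounded_linear: "open S \<Longrightarrow> bounded_linear h \<Longrightarrow> ck_on k S h"
  by (cases k) (auto intro!: ck_on_SucI[where f'="\<lambda>_. h"] ck_on_const bounded_linear_imp_has_derivative
      linear_continuous_on simp del: ck_on.simps(2))

lemma ck_on_linear_comp:
  assumes "open S" "bounded_linear h" "ck_on k S f"
  shows "ck_on k S (\<lambda>x. h (f x))" using assms(3)
proof (induction k arbitrary: f)
  case 0
  then show ?case using assms(2) by (auto intro: bounded_linear.continuous_on)
next
  case (Suc k)
  show ?case by (rule ck_on_SucI[where f'="\<lambda>x v. h (\<D> f x v)"])
      (auto intro!: assms bounded_linear.has_derivative[OF assms(2)] ck_on_SucD(1)[OF Suc.prems] Suc.IH
        ck_on_SucD(2)[OF Suc.prems])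
qed

lemma ck_on_add:
  assumes "open S" "ck_on k S f" "ck_on k S g"
  shows "ck_on k S (\<lambda>x. f x + g x)" using assms(2,3)
proof (induction k arbitrary: f g)
  case 0
  then show ?case by (auto intro: continuous_intros)
next
  case (Suc k)
  show ?case by (rule ck_on_SucI[where f'="\<lambda>x v. \<D> f x v + \<D> g x v"])
      (auto intro!: assms has_derivative_add ck_on_SucD(1)[OF Suc.prems(1)] ck_on_SucD(1)[OF Suc.prems(2)]
        Suc.IH ck_on_SucD(2)[OF Suc.prems(1)] ck_on_SucD(2)[OF Suc.prems(2)])
qed

lemma ck_on_sum:
  assumes "open S" "\<And>i. i \<in> I \<Longrightarrow> ck_on k S (f i)"
  shows "ck_on k S (\<lambda>x. \<Sum>i\<in>I. f i x)"
  using assms(2) by (induction I rule: infinite_finite_induct) (auto intro: ck_on_add ck_on_const assms(1))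

lemma ck_on_bilinear:
  assumes "open S" "bounded_bilinear h" "ck_on k S f" "ck_on k S g"
  shows "ck_on k S (\<lambda>x. h (f x) (g x))" using assms(3,4)
proof (induction k arbitrary: f g)
  case 0
  then show ?case using assms(2) by (auto intro: bounded_bilinear.continuous_on)
next
  case (Suc k)
  show ?case by (rule ck_on_SucI[where f'="\<lambda>x v. h (f x) (\<D> g x v) + h (\<D> f x v) (g x)"])
      (auto intro!: assms bounded_bilinear.FDERIV[OF assms(2)] ck_on_SucD(1)[OF Suc.prems(1)] ck_on_SucD(1)[OF Suc.prems(2)]
        ck_on_add Suc.IH ck_on_SucD(2)[OF Suc.prems(1)] ck_on_SucD(2)[OF Suc.prems(2)]
        ck_on_Suc_imp[OF Suc.prems(1)] ck_on_Suc_imp[OF Suc.prems(2)])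
qed

text \<open>In the derivative \<open>g'(f x)(f' x v)\<close> the inner vector varies with
  \<open>x\<close>, whereas the class of \<open>g'\<close> is known for fixed directions only.
  Expanding \<open>f' x v\<close> in a basis of the middle space gives a finite sum of products to
  which the induction hypothesis applies; hence the assumption on that space.\<close>

lemma ck_on_compose:
  fixes f :: "'a::real_normed_vector \<Rightarrow> 'b::real_normed_vector" and g :: "'b \<Rightarrow> 'c::real_normed_vector"
  assumes "finite_dim TYPE('b)" "open S" "open T" "f ` S \<subseteq> T" "ck_on k S f" "ck_on k T g"
  shows "ck_on k S (\<lambda>x. g (f x))" using assms(5,6)
proof (induction k arbitrary: g)
  case 0
  then show ?case using assms(4) by (auto intro: continuous_on_compose2)
next
  case (Suc k)
  obtain B :: "'b set" where B: "is_basis B" using finite_dim_basis[OF assms(1)] .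
  let ?df = "\<lambda>x. \<D> f x" and ?dg = "\<lambda>x. \<D> g x"
  have d: "((\<lambda>x. g (f x)) has_derivative (\<lambda>v. ?dg (f x) (?df x v))) (at x)" if "x \<in> S" for x
  proof -
    have "(g has_derivative ?dg (f x)) (at (f x))"
      using that assms(4) by (intro ck_on_SucD(1)[OF Suc.prems(2)]) auto
    then show ?thesis using diff_chain_at[OF ck_on_SucD(1)[OF Suc.prems(1) that]] by (simp add: o_def)
  qed
  have e: "?dg (f x) w = (\<Sum>b\<in>B. rep B w b *\<^sub>R ?dg (f x) b)" if "x \<in> S" for x w using that assms(4)
    by (intro linear_eq_basis_sum[OF B] has_derivative_linear[OF ck_on_SucD(1)[OF Suc.prems(2)]]) auto
  show ?case
  proof (rule ck_on_SucI[OF assms(2)])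
    fix x assume x: "x \<in> S"
    have "(\<lambda>v. \<Sum>b\<in>B. rep B (?df x v) b *\<^sub>R ?dg (f x) b) = (\<lambda>v. ?dg (f x) (?df x v))"
      by (intro ext e[OF x, symmetric])
    with d[OF x] show "((\<lambda>x. g (f x)) has_derivative (\<lambda>v. \<Sum>b\<in>B. rep B (?df x v) b *\<^sub>R ?dg (f x) b)) (at x)"
      by (simp only:)
  next
    fix v
    show "ck_on k S (\<lambda>x. \<Sum>b\<in>B. rep B (?df x v) b *\<^sub>R ?dg (f x) b)"
      by (intro ck_on_sum assms(2) ck_on_bilinear[OF assms(2) bounded_bilinear_scaleR]
          ck_on_linear_comp[OF assms(2) bounded_linear_representation[OF B]]
          ck_on_SucD(2)[OF Suc.prems(1)] Suc.IH[OF ck_on_Suc_imp[OF Suc.prems(1)]]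
          ck_on_SucD(2)[OF Suc.prems(2)])
  qed
qed

text \<open>The derivative of \<open>1/f\<close> contains \<open>1/f\<close> again, one class lower,
  so the induction hypothesis is exactly what the step consumes.\<close>

lemma ck_on_inverse:
  fixes f :: "'a::real_normed_vector \<Rightarrow> real"
  assumes "open S" "\<And>x. x \<in> S \<Longrightarrow> f x \<noteq> 0" "ck_on k S f"
  shows "ck_on k S (\<lambda>x. inverse (f x))" using assms(3)
proof (induction k)
  case 0
  then show ?case using assms(2) by (auto intro: continuous_intros)
next
  case (Suc k)
  have IH: "ck_on k S (\<lambda>x. inverse (f x))" by (rule Suc.IH[OF ck_on_Suc_imp[OF Suc.prems]])
  show ?case
  proof (rule ck_on_SucI[OF assms(1)])
    fix x assume "x \<in> S"
    then show "((\<lambda>x. inverse (f x)) has_derivative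
        (\<lambda>v. - (inverse (f x) * \<D> f x v * inverse (f x)))) (at x)"
      by (intro Deriv.has_derivative_inverse assms(2) ck_on_SucD(1)[OF Suc.prems])
  next
    fix v
    show "ck_on k S (\<lambda>x. - (inverse (f x) * \<D> f x v * inverse (f x)))"
      by (rule ck_on_linear_comp[OF assms(1) bounded_linear_minus[OF bounded_linear_ident]],
          rule ck_on_bilinear[OF assms(1) bounded_bilinear_mult ck_on_bilinear[OF assms(1) bounded_bilinear_mult IH
              ck_on_SucD(2)[OF Suc.prems]] IH])
  qed
qed

lemma ck_on_local:
  assumes "\<And>x. x \<in> S \<Longrightarrow> \<exists>T. open T \<and> x \<in> T \<and> ck_on k T f"
  shows "ck_on k S f" using assms
proof (induction k arbitrary: f)
  case 0
  show ?case
  proof (simp, rule continuous_at_imp_continuous_on, rule ballI)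
    fix x assume "x \<in> S"
    from 0[OF this] show "isCont f x" by (auto simp: continuous_on_eq_continuous_at)
  qed
next
  case (Suc k)
  have "f differentiable (at x)" if "x \<in> S" for x using Suc.prems[OF that] by auto
  moreover have "ck_on k S (\<lambda>x. \<D> f x v)" for v by (rule Suc.IH) (use Suc.prems in force)
  ultimately show ?case by simp
qed

lemma smooth_on_cong: "open S \<Longrightarrow> (\<And>x. x \<in> S \<Longrightarrow> f x = g x) \<Longrightarrow> smooth_on S f \<longleftrightarrow> smooth_on S g"
  unfolding smooth_on_def by (metis ck_on_cong_imp)

lemma smooth_on_subset: "smooth_on S f \<Longrightarrow> T \<subseteq> S \<Longrightarrow> smooth_on T f"
  unfolding smooth_on_def by (intro allI, rule ck_on_subset) auto

lemma smooth_on_local: "(\<And>x. x \<in> S \<Longrightarrow> \<exists>T. open T \<and> x \<in> T \<and> smooth_on T f) \<Longrightarrow> smooth_on S f"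
  unfolding smooth_on_def by (intro allI, rule ck_on_local) meson

lemma smooth_on_hd:
  "smooth_on S f \<Longrightarrow> x \<in> S \<Longrightarrow> (f has_derivative \<D> f x) (at x)"
  unfolding smooth_on_def by (drule spec[of _ "Suc 0"]) (rule ck_on_SucD(1))

lemma smooth_on_continuous_on: "smooth_on S f \<Longrightarrow> continuous_on S f"
  unfolding smooth_on_def by (drule spec[of _ 0]) simp

lemma smooth_on_const: "open S \<Longrightarrow> smooth_on S (\<lambda>x. c)" by (simp add: smooth_on_def ck_on_const)

lemma smooth_on_bounded_linear: "open S \<Longrightarrow> bounded_linear h \<Longrightarrow> smooth_on S h"
  by (simp add: smooth_on_def ck_on_bounded_linear)

lemma smooth_on_linear_comp: "open S \<Longrightarrow> bounded_linear h \<Longrightarrow> smooth_on S f \<Longrightarrow> smooth_on S (\<lambda>x. h (f x))"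
  by (simp add: smooth_on_def ck_on_linear_comp)

lemma smooth_on_add: "open S \<Longrightarrow> smooth_on S f \<Longrightarrow> smooth_on S g \<Longrightarrow> smooth_on S (\<lambda>x. f x + g x)"
  by (simp add: smooth_on_def ck_on_add)

lemma smooth_on_uminus: "open S \<Longrightarrow> smooth_on S f \<Longrightarrow> smooth_on S (\<lambda>x. - f x)"
  by (rule smooth_on_linear_comp[OF _ bounded_linear_minus[OF bounded_linear_ident]])

lemma smooth_on_diff: "open S \<Longrightarrow> smooth_on S f \<Longrightarrow> smooth_on S g \<Longrightarrow> smooth_on S (\<lambda>x. f x - g x)"
  using smooth_on_add[of S f "\<lambda>x. - g x"] smooth_on_uminus[of S g] by simp

lemma smooth_on_sum:
  "open S \<Longrightarrow> (\<And>i. i \<in> I \<Longrightarrow> smooth_on S (f i)) \<Longrightarrow> smooth_on S (\<lambda>x. \<Sum>i\<in>I. f i x)"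
  by (simp add: smooth_on_def ck_on_sum)

lemma smooth_on_bilinear:
  "open S \<Longrightarrow> bounded_bilinear h \<Longrightarrow> smooth_on S f \<Longrightarrow> smooth_on S g \<Longrightarrow> smooth_on S (\<lambda>x. h (f x) (g x))"
  by (simp add: smooth_on_def ck_on_bilinear)

lemmas smooth_on_mult = smooth_on_bilinear[OF _ bounded_bilinear_mult]
lemmas smooth_on_scaleR = smooth_on_bilinear[OF _ bounded_bilinear_scaleR]
lemmas smooth_on_blinfun_apply = smooth_on_bilinear[OF _ bounded_bilinear_blinfun_apply]

lemma smooth_on_prod:
  fixes f :: "'i \<Rightarrow> 'a::real_normed_vector \<Rightarrow> real"
  shows "open S \<Longrightarrow> (\<And>i. i \<in> I \<Longrightarrow> smooth_on S (f i)) \<Longrightarrow> smooth_on S (\<lambda>x. \<Prod>i\<in>I. f i x)"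
  by (induction I rule: infinite_finite_induct) (auto intro: smooth_on_const smooth_on_mult)

lemma smooth_on_compose:
  fixes f :: "'a::real_normed_vector \<Rightarrow> 'b::real_normed_vector" and g :: "'b \<Rightarrow> 'c::real_normed_vector"
  shows "finite_dim TYPE('b) \<Longrightarrow> open S \<Longrightarrow> open T \<Longrightarrow> f ` S \<subseteq> T \<Longrightarrow> smooth_on S f \<Longrightarrow> smooth_on T g
    \<Longrightarrow> smooth_on S (\<lambda>x. g (f x))" unfolding smooth_on_def by (intro allI, rule ck_on_compose[where T=T]) auto

lemma smooth_on_inverse:
  fixes f :: "'a::real_normed_vector \<Rightarrow> real"
  shows "open S \<Longrightarrow> (\<And>x. x \<in> S \<Longrightarrow> f x \<noteq> 0) \<Longrightarrow> smooth_on S f \<Longrightarrow> smooth_on S (\<lambda>x. inverse (f x))"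
  unfolding smooth_on_def by (intro allI, rule ck_on_inverse) auto

lemma smooth_on_divide:
  fixes f :: "'a::real_normed_vector \<Rightarrow> real"
  shows "open S \<Longrightarrow> (\<And>x. x \<in> S \<Longrightarrow> g x \<noteq> 0) \<Longrightarrow> smooth_on S f \<Longrightarrow> smooth_on S g \<Longrightarrow> smooth_on S (\<lambda>x. f x / g x)"
  unfolding divide_inverse by (intro smooth_on_mult smooth_on_inverse)

lemma smooth_on_Pair:
  assumes "open S" "smooth_on S f" "smooth_on S g"
  shows "smooth_on S (\<lambda>x. (f x, g x))"
proof -
  have "smooth_on S (\<lambda>x. (f x, 0) + (0, g x))"
    by (intro smooth_on_add assms smooth_on_linear_comp[OF assms(1) bounded_linear_Pair[OF bounded_linear_ident bounded_linear_zero]]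
        smooth_on_linear_comp[OF assms(1) bounded_linear_Pair[OF bounded_linear_zero bounded_linear_ident]])
  then show ?thesis by simp
qed

lemma smooth_on_fst: "open S \<Longrightarrow> smooth_on S f \<Longrightarrow> smooth_on S (\<lambda>x. fst (f x))"
  by (rule smooth_on_linear_comp[OF _ bounded_linear_fst])

lemma smooth_on_snd: "open S \<Longrightarrow> smooth_on S f \<Longrightarrow> smooth_on S (\<lambda>x. snd (f x))"
  by (rule smooth_on_linear_comp[OF _ bounded_linear_snd])

lemma smooth_on_ident: "open S \<Longrightarrow> smooth_on S (\<lambda>x. x)"
  by (rule smooth_on_bounded_linear[OF _ bounded_linear_ident])

lemma smooth_on_derivative:
  "smooth_on S f \<Longrightarrow> smooth_on S (\<lambda>x. \<D> f x v)"
  unfolding smooth_on_def by (intro allI, rule ck_on_SucD(2), erule spec)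

text \<open>The direction \<open>g x\<close> moves with the point, whereas smoothness of a
  derivative is known for fixed directions; a basis expansion of \<open>g x\<close> reduces to
  these.\<close>

lemma smooth_on_directional:
  fixes f :: "'a::real_normed_vector \<Rightarrow> 'b::real_normed_vector"
  assumes "finite_dim TYPE('a)" "open S" "smooth_on S f" "smooth_on S g"
  shows "smooth_on S (\<lambda>x. \<D> f x (g x))"
proof -
  obtain B :: "'a set" where B: "is_basis B" using finite_dim_basis[OF assms(1)] .
  have "\<D> f x (g x) = (\<Sum>b\<in>B. rep B (g x) b *\<^sub>R \<D> f x b)"
    if "x \<in> S" for x by (intro linear_eq_basis_sum[OF B] has_derivative_linear[OF smooth_on_hd[OF assms(3) that]])
  moreover have "smooth_on S (\<lambda>x. \<Sum>b\<in>B. rep B (g x) b *\<^sub>R \<D> f x b)"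
    by (intro smooth_on_sum smooth_on_scaleR assms smooth_on_derivative
        smooth_on_linear_comp[OF _ bounded_linear_representation[OF B]])
  ultimately show ?thesis by (rule iffD2[OF smooth_on_cong[OF assms(2)]])
qed

text \<open>A functional is the combination of the dual basis with its values on the basis as
  coefficients, so testing on vectors suffices. This serves the \<open>p\<close> component of jet
  coordinates.\<close>

lemma smooth_on_blinfunI:
  fixes f :: "'a::real_normed_vector \<Rightarrow> 'b::real_normed_vector \<Rightarrow>\<^sub>L real"
  assumes "finite_dim TYPE('b)" "open S" "\<And>v. smooth_on S (\<lambda>x. ap (f x) v)"
  shows "smooth_on S f"
proof -
  obtain B :: "'b set" where B: "is_basis B" using finite_dim_basis[OF assms(1)] .
  have "smooth_on S (\<lambda>x. \<Sum>b\<in>B. ap (f x) b *\<^sub>R dual_basis B b)"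
    by (intro smooth_on_sum smooth_on_scaleR assms smooth_on_const)
  moreover have "(\<lambda>x. \<Sum>b\<in>B. ap (f x) b *\<^sub>R dual_basis B b) = f"
    by (intro ext blinfun_eq_basis_sum[OF B, symmetric])
  ultimately show ?thesis by simp
qed

section \<open>Hadamard's lemma and bump functions\<close>

text \<open>The classical criterion: directional derivatives with continuous coefficients
  \<open>H b\<close> add up to a total derivative. The mean value theorem on the segment from
  \<open>y\<close> to \<open>z\<close> turns the error into differences of the \<open>H b\<close>,
  which are small near \<open>y\<close>.\<close>

lemma has_derivative_from_directional:
  fixes G :: "'a::real_normed_vector \<Rightarrow> real"
  assumes B: "is_basis B" and S: "open S"
    and dir: "\<And>y v. y \<in> S \<Longrightarrow> ((\<lambda>s. G (y + s *\<^sub>R v)) has_real_derivative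
      (\<Sum>b\<in>B. rep B v b * H b y)) (at 0)"
    and cont: "\<And>b. b \<in> B \<Longrightarrow> continuous_on S (H b)" and y: "y \<in> S"
  shows "(G has_derivative (\<lambda>v. \<Sum>b\<in>B. rep B v b * H b y)) (at y)" unfolding has_derivative_at_alt
proof (intro conjI allI impI)
  show "bounded_linear (\<lambda>v. \<Sum>b\<in>B. rep B v b * H b y)"
    by (intro bounded_linear_sum bounded_linear_mult_const bounded_linear_representation B)
next
  fix e :: real assume e: "e > 0"
  obtain K where K: "K > 0" "\<And>v b. \<bar>rep B v b\<bar> \<le> K * norm v" using representation_bound[OF B] by auto
  have fin: "finite B" using B by (rule is_basis_finite)
  \<comment> \<open>Each of the \<open>card B\<close> error terms is at most
    \<open>K * norm v * e'\<close>; this choice makes their sum at most \<open>e * norm v\<close>,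
    also for the empty basis.\<close>
  define e' where "e' = e / (K * (real (card B) + 1))"
  have e': "e' > 0" using e K(1) by (simp add: e'_def)
  have "\<forall>\<^sub>F z in nhds y. z \<in> S" using S y by (rule eventually_nhds_in_open)
  moreover have "\<forall>\<^sub>F z in nhds y. \<forall>b\<in>B. \<bar>H b z - H b y\<bar> < e'"
  proof (intro eventually_ball_finite fin ballI)
    fix b assume "b \<in> B"
    then have "isCont (H b) y" using cont S y continuous_on_eq_continuous_at by blast
    then have "(H b \<longlongrightarrow> H b y) (nhds y)" by (simp add: continuous_at tendsto_at_iff_tendsto_nhds)
    then show "\<forall>\<^sub>F z in nhds y. \<bar>H b z - H b y\<bar> < e'"
      using e' tendstoD[of "H b" "H b y" "nhds y" e'] by (simp add: dist_real_def)
  qed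
  ultimately have "\<forall>\<^sub>F z in nhds y. z \<in> S \<and> (\<forall>b\<in>B. \<bar>H b z - H b y\<bar> < e')" by (rule eventually_conj)
  then obtain d where d: "d > 0" "\<And>z. dist z y < d \<Longrightarrow> z \<in> S \<and> (\<forall>b\<in>B. \<bar>H b z - H b y\<bar> < e')"
    unfolding eventually_nhds_metric by auto
  show "\<exists>d>0. \<forall>z. norm (z - y) < d \<longrightarrow>
      norm (G z - G y - (\<Sum>b\<in>B. rep B (z - y) b * H b y)) \<le> e * norm (z - y)"
  proof (intro exI[of _ d] conjI d(1) allI impI)
    fix z assume z: "norm (z - y) < d"
    define v where "v = z - y"
    have near: "dist (y + s *\<^sub>R v) y < d" if "0 \<le> s" "s \<le> 1" for s
    proof -
      have "norm (s *\<^sub>R v) \<le> norm v" using that by (simp add: mult_left_le_one_le)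
      then show ?thesis using z by (simp add: dist_norm v_def)
    qed
    have D: "((\<lambda>t. G (y + t *\<^sub>R v)) has_real_derivative
        (\<Sum>b\<in>B. rep B v b * H b (y + s *\<^sub>R v))) (at s)" if "0 \<le> s" "s \<le> 1" for s
    proof -
      have "((\<lambda>t. G ((y + s *\<^sub>R v) + t *\<^sub>R v)) has_real_derivative
          (\<Sum>b\<in>B. rep B v b * H b (y + s *\<^sub>R v))) (at 0)" using dir d(2)[OF near[OF that]] by blast
      then have "((\<lambda>t. (\<lambda>t. G (y + t *\<^sub>R v)) (t + s)) has_real_derivative
          (\<Sum>b\<in>B. rep B v b * H b (y + s *\<^sub>R v))) (at 0)" by (simp add: algebra_simps)
      then show ?thesis using DERIV_shift[of "\<lambda>t. G (y + t *\<^sub>R v)" _ 0 s] by simp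
    qed
    obtain \<theta> where \<theta>: "0 < \<theta>" "\<theta> < 1"
      "G (y + 1 *\<^sub>R v) - G (y + 0 *\<^sub>R v) = (1 - 0) * (\<Sum>b\<in>B. rep B v b * H b (y + \<theta> *\<^sub>R v))"
      using MVT2[of 0 1 "\<lambda>t. G (y + t *\<^sub>R v)" "\<lambda>s. \<Sum>b\<in>B. rep B v b * H b (y + s *\<^sub>R v)"] D by auto
    have "G z - G y - (\<Sum>b\<in>B. rep B v b * H b y) =
        (\<Sum>b\<in>B. rep B v b * (H b (y + \<theta> *\<^sub>R v) - H b y))"
      using \<theta>(3) by (simp add: v_def right_diff_distrib sum_subtractf)
    also have "\<bar>\<dots>\<bar> \<le> (\<Sum>b\<in>B. \<bar>rep B v b\<bar> * \<bar>H b (y + \<theta> *\<^sub>R v) - H b y\<bar>)"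
      by (rule order_trans[OF sum_abs]) (simp add: abs_mult)
    also have "\<dots> \<le> (\<Sum>b\<in>B. (K * norm v) * e')"
    proof (intro sum_mono mult_mono K(2))
      fix b assume "b \<in> B"
      then show "\<bar>H b (y + \<theta> *\<^sub>R v) - H b y\<bar> \<le> e'" using d(2)[OF near[of \<theta>]] \<theta>(1,2) by (simp add: less_imp_le)
    qed (use K(1) in auto)
    also have "\<dots> = (K * e' * norm v) * real (card B)" by simp
    also have "\<dots> \<le> (K * e' * norm v) * (real (card B) + 1)" using K(1) e' by (intro mult_left_mono) auto
    also have "\<dots> = e * norm v" using K(1) by (simp add: e'_def)
    finally show "norm (G z - G y - (\<Sum>b\<in>B. rep B (z - y) b * H b y)) \<le> e * norm (z - y)" by (simp add: v_def)
  qed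
qed

lemma ball_contract:
  fixes a :: "'a::real_normed_vector"
  assumes "y \<in> ball a r" "0 \<le> t" "t \<le> 1"
  shows "a + t *\<^sub>R (y - a) \<in> ball a r"
proof -
  have "norm (t *\<^sub>R (y - a)) \<le> norm (y - a)" using assms by (simp add: mult_left_le_one_le)
  then show ?thesis using assms(1) by (simp add: dist_norm norm_minus_commute)
qed

lemma continuous_on_param_integral:
  fixes h :: "'a::real_normed_vector \<Rightarrow> real"
  assumes "continuous_on (ball a r) h"
  shows "continuous_on (ball a r) (\<lambda>y. integral {0..1} (\<lambda>t. t ^ k * h (a + t *\<^sub>R (y - a))))"
    (is "continuous_on ?S _")
proof -
  have "continuous_on (?S \<times> cbox 0 1) (\<lambda>p. snd p ^ k * h (a + snd p *\<^sub>R (fst p - a)))"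
    by (intro continuous_intros continuous_on_compose2[OF assms])
      (auto simp del: mem_ball intro!: ball_contract)
  then have "continuous_on (?S \<times> cbox 0 1) (\<lambda>(y, t). t ^ k * h (a + t *\<^sub>R (y - a)))" by (simp add: split_beta)
  from integral_continuous_on_param[OF this] show ?thesis by simp
qed

text \<open>Differentiation under the integral sign. The chain rule through
  \<open>a + t (y - a)\<close> brings out a factor \<open>t\<close>, hence the weight
  \<open>t ^ k\<close> and its successor in the derivative.\<close>

lemma has_derivative_param_integral:
  fixes h :: "'a::real_normed_vector \<Rightarrow> real"
  assumes B: "is_basis B" and h: "smooth_on (ball a r) h" and y: "y \<in> ball a r"
  shows "((\<lambda>y. integral {0..1} (\<lambda>t. t ^ k * h (a + t *\<^sub>R (y - a)))) has_derivative
    (\<lambda>v. \<Sum>b\<in>B. rep B v b *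
      integral {0..1} (\<lambda>t. t ^ Suc k * \<D> h (a + t *\<^sub>R (y - a)) b))) (at y)"
proof (rule has_derivative_from_directional[OF B open_ball[of a r] _ _ y])
  show "continuous_on (ball a r)
      (\<lambda>y. integral {0..1} (\<lambda>t. t ^ Suc k * \<D> h (a + t *\<^sub>R (y - a)) b))" for b
    by (intro continuous_on_param_integral smooth_on_continuous_on smooth_on_derivative h)
next
  fix y v assume y: "y \<in> ball a r"
  let ?d = "\<lambda>z. \<D> h z"
  have cd: "continuous_on (ball a r) (\<lambda>z. ?d z v)" for v by (intro smooth_on_continuous_on smooth_on_derivative h)
  have "open ((\<lambda>s::real. y + s *\<^sub>R v) -` ball a r)" by (intro open_vimage continuous_intros) auto
  moreover have "0 \<in> (\<lambda>s::real. y + s *\<^sub>R v) -` ball a r" using y by simp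
  ultimately obtain \<delta> where \<delta>: "\<delta> > 0" "ball 0 \<delta> \<subseteq> (\<lambda>s::real. y + s *\<^sub>R v) -` ball a r"
    using open_contains_ball_eq by blast
  have in_ball: "a + t *\<^sub>R (y + s *\<^sub>R v - a) \<in> ball a r" if "s \<in> ball 0 \<delta>" "t \<in> {0..1}" for s t
    using \<delta>(2) that by (intro ball_contract) auto
  \<comment> \<open>The Leibniz rule is applied to the single real parameter \<open>s\<close> of the
    line through \<open>y\<close> in direction \<open>v\<close>; the criterion for total
    differentiability does the rest.\<close>
  have "((\<lambda>s. integral (cbox 0 1) (\<lambda>t. t ^ k * h (a + t *\<^sub>R (y + s *\<^sub>R v - a)))) has_field_derivative
      integral (cbox 0 1) (\<lambda>t. t ^ Suc k * ?d (a + t *\<^sub>R (y + 0 *\<^sub>R v - a)) v)) (at 0 within ball 0 \<delta>)"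
  proof (rule leibniz_rule_field_derivative)
    fix s t :: real assume s: "s \<in> ball 0 \<delta>" and t: "t \<in> cbox 0 1"
    let ?z = "a + t *\<^sub>R (y + s *\<^sub>R v - a)"
    have z: "?z \<in> ball a r" using in_ball[OF s] t by simp
    have l: "linear (?d ?z)" by (rule has_derivative_linear[OF smooth_on_hd[OF h z]])
    have "((\<lambda>s. a + t *\<^sub>R (y + s *\<^sub>R v - a)) has_derivative (\<lambda>u. t *\<^sub>R (u *\<^sub>R v))) (at s within ball 0 \<delta>)"
      by (auto intro!: derivative_eq_intros)
    from has_derivative_compose[OF this smooth_on_hd[OF h z]]
    have "((\<lambda>s. h (a + t *\<^sub>R (y + s *\<^sub>R v - a))) has_derivative (\<lambda>u. ?d ?z (t *\<^sub>R (u *\<^sub>R v)))) (at s within ball 0 \<delta>)" .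
    then have "((\<lambda>s. t ^ k * h (a + t *\<^sub>R (y + s *\<^sub>R v - a))) has_derivative
        (\<lambda>u. t ^ k * ?d ?z (t *\<^sub>R (u *\<^sub>R v)))) (at s within ball 0 \<delta>)" by (rule has_derivative_mult_right)
    moreover have "(\<lambda>u. t ^ k * ?d ?z (t *\<^sub>R (u *\<^sub>R v))) = (*) (t ^ Suc k * ?d ?z v)"
      by (auto simp: linear_scale[OF l] mult_ac)
    ultimately show "((\<lambda>s. t ^ k * h (a + t *\<^sub>R (y + s *\<^sub>R v - a))) has_field_derivative
        t ^ Suc k * ?d ?z v) (at s within ball 0 \<delta>)" by (simp add: has_field_derivative_def)
  next
    fix s :: real assume s: "s \<in> ball 0 \<delta>"
    show "(\<lambda>t. t ^ k * h (a + t *\<^sub>R (y + s *\<^sub>R v - a))) integrable_on cbox 0 1"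
      by (intro integrable_continuous continuous_intros
          continuous_on_compose2[OF smooth_on_continuous_on[OF h]])
        (use in_ball[OF s] in \<open>auto simp del: mem_ball\<close>)
  next
    have "continuous_on (ball 0 \<delta> \<times> cbox 0 1)
        (\<lambda>p. snd p ^ Suc k * ?d (a + snd p *\<^sub>R (y + fst p *\<^sub>R v - a)) v)"
      by (intro continuous_intros continuous_on_compose2[OF cd[of v]])
        (use in_ball in \<open>auto simp del: mem_ball\<close>)
    then show "continuous_on (ball 0 \<delta> \<times> cbox 0 1)
        (\<lambda>(s, t). t ^ Suc k * ?d (a + t *\<^sub>R (y + s *\<^sub>R v - a)) v)" by (simp add: split_beta)
  qed (use \<delta> in auto)
  moreover have "at 0 within ball 0 \<delta> = at (0::real)" using \<delta>(1) by (intro at_within_open) auto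
  ultimately have "((\<lambda>s. integral {0..1} (\<lambda>t. t ^ k * h (a + t *\<^sub>R (y + s *\<^sub>R v - a)))) has_real_derivative
      integral {0..1} (\<lambda>t. t ^ Suc k * ?d (a + t *\<^sub>R (y - a)) v)) (at 0)" by simp
  moreover have "integral {0..1} (\<lambda>t. t ^ Suc k * ?d (a + t *\<^sub>R (y - a)) v) =
      (\<Sum>b\<in>B. rep B v b * integral {0..1} (\<lambda>t. t ^ Suc k * ?d (a + t *\<^sub>R (y - a)) b))"
  proof -
    have int: "(\<lambda>t. t ^ Suc k * ?d (a + t *\<^sub>R (y - a)) b) integrable_on {0..1}" for b
    proof -
      have "continuous_on {0..1} (\<lambda>t. t ^ Suc k * ?d (a + t *\<^sub>R (y - a)) b)"
        by (intro continuous_intros continuous_on_compose2[OF cd[of b]])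
          (use ball_contract[OF y] in \<open>auto simp del: mem_ball\<close>)
      then show ?thesis by (rule integrable_continuous_real)
    qed
    have "integral {0..1} (\<lambda>t. t ^ Suc k * ?d (a + t *\<^sub>R (y - a)) v) =
        integral {0..1} (\<lambda>t. \<Sum>b\<in>B. rep B v b * (t ^ Suc k * ?d (a + t *\<^sub>R (y - a)) b))"
    proof (rule integral_cong)
      fix t :: real assume t: "t \<in> {0..1}"
      have "?d (a + t *\<^sub>R (y - a)) v = (\<Sum>b\<in>B. rep B v b *\<^sub>R ?d (a + t *\<^sub>R (y - a)) b)"
        using t by (intro linear_eq_basis_sum[OF B] has_derivative_linear[OF smooth_on_hd[OF h]]
            ball_contract[OF y]) auto
      then show "t ^ Suc k * ?d (a + t *\<^sub>R (y - a)) v =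
          (\<Sum>b\<in>B. rep B v b * (t ^ Suc k * ?d (a + t *\<^sub>R (y - a)) b))"
        by (simp only: sum_distrib_left) (simp add: mult_ac)
    qed
    also have "\<dots> = (\<Sum>b\<in>B. integral {0..1} (\<lambda>t. rep B v b * (t ^ Suc k * ?d (a + t *\<^sub>R (y - a)) b)))"
      by (intro integral_sum is_basis_finite[OF B] integrable_on_mult_right int)
    also have "\<dots> = (\<Sum>b\<in>B. rep B v b * integral {0..1} (\<lambda>t. t ^ Suc k * ?d (a + t *\<^sub>R (y - a)) b))"
      by (simp only: integral_mult_right)
    finally show ?thesis .
  qed
  ultimately show "((\<lambda>s. integral {0..1} (\<lambda>t. t ^ k * h (a + t *\<^sub>R (y + s *\<^sub>R v - a)))) has_real_derivative
      (\<Sum>b\<in>B. rep B v b * integral {0..1} (\<lambda>t. t ^ Suc k * ?d (a + t *\<^sub>R (y - a)) b))) (at 0)" by simp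
qed

text \<open>Each derivative is a combination of integrals of the same kind, with
  \<open>Suc k\<close> and a derivative of \<open>h\<close>, so the induction on the class runs over
  all \<open>k\<close> and \<open>h\<close> at once.\<close>

lemma smooth_on_param_integral:
  fixes h :: "'a::real_normed_vector \<Rightarrow> real" and B :: "'a set"
  assumes B: "is_basis B" and h: "smooth_on (ball a r) h"
  shows "smooth_on (ball a r) (\<lambda>y. integral {0..1} (\<lambda>t. t ^ k * h (a + t *\<^sub>R (y - a))))"
proof -
  have "ck_on n (ball a r) (\<lambda>y. integral {0..1} (\<lambda>t. t ^ k * h (a + t *\<^sub>R (y - a))))" for n using h
  proof (induction n arbitrary: h k)
    case 0
    then show ?case using continuous_on_param_integral[OF smooth_on_continuous_on] by simp
  next
    case (Suc n)
    show ?case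
    proof (rule ck_on_SucI[OF open_ball has_derivative_param_integral[OF B Suc.prems]])
      fix v
      show "ck_on n (ball a r) (\<lambda>y. \<Sum>b\<in>B. rep B v b *
          integral {0..1} (\<lambda>t. t ^ Suc k * \<D> h (a + t *\<^sub>R (y - a)) b))"
        by (rule ck_on_sum[OF open_ball], rule ck_on_bilinear[OF open_ball bounded_bilinear_mult
              ck_on_const[OF open_ball] Suc.IH[OF smooth_on_derivative[OF Suc.prems]]])
    qed
  qed
  then show ?thesis unfolding smooth_on_def by blast
qed

text \<open>Fundamental theorem of calculus on the segment from \<open>a\<close> to
  \<open>y\<close>, with \<open>y - a\<close> expanded in the basis: \<open>g b\<close> averages the
  partial derivative in direction \<open>b\<close> over the segment and is smooth as a parameter
  integral with \<open>k = 0\<close>.\<close>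

lemma hadamard:
  fixes f :: "'a::real_normed_vector \<Rightarrow> real"
  assumes B: "is_basis B" and f: "smooth_on (ball a r) f" and r: "r > 0"
  obtains g where "\<And>b. smooth_on (ball a r) (g b)" "\<And>b. g b a = \<D> f a b"
    "\<And>y. y \<in> ball a r \<Longrightarrow> f y = f a + (\<Sum>b\<in>B. rep B (y - a) b * g b y)"
proof -
  let ?d = "\<lambda>z. \<D> f z"
  define g where "g = (\<lambda>b y. integral {0..1} (\<lambda>t. t ^ 0 * ?d (a + t *\<^sub>R (y - a)) b))"
  have "smooth_on (ball a r) (g b)" for b
    unfolding g_def by (rule smooth_on_param_integral[OF B smooth_on_derivative[OF f]])
  moreover have "g b a = ?d a b" for b unfolding g_def by simp
  moreover have "f y = f a + (\<Sum>b\<in>B. rep B (y - a) b * g b y)" if y: "y \<in> ball a r" for y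
  proof -
    have cd: "continuous_on {0..1} (\<lambda>t. ?d (a + t *\<^sub>R (y - a)) b)" for b
      by (intro continuous_on_compose2[OF smooth_on_continuous_on[OF smooth_on_derivative[OF f, of b]]]
          continuous_intros) (use ball_contract[OF y] in \<open>auto simp del: mem_ball\<close>)
    have "((\<lambda>t. ?d (a + t *\<^sub>R (y - a)) (y - a)) has_integral
        (f (a + 1 *\<^sub>R (y - a)) - f (a + 0 *\<^sub>R (y - a)))) {0..1}"
    proof (rule fundamental_theorem_of_calculus)
      fix t :: real assume t: "t \<in> {0..1}"
      have z: "a + t *\<^sub>R (y - a) \<in> ball a r" using ball_contract[OF y] t by auto
      have l: "linear (?d (a + t *\<^sub>R (y - a)))" by (rule has_derivative_linear[OF smooth_on_hd[OF f z]])
      have "((\<lambda>t. a + t *\<^sub>R (y - a)) has_derivative (\<lambda>u. u *\<^sub>R (y - a))) (at t within {0..1})"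
        by (auto intro!: derivative_eq_intros)
      from has_derivative_compose[OF this smooth_on_hd[OF f z]]
      have "((\<lambda>t. f (a + t *\<^sub>R (y - a))) has_derivative
          (\<lambda>u. ?d (a + t *\<^sub>R (y - a)) (u *\<^sub>R (y - a)))) (at t within {0..1})" .
      then show "((\<lambda>t. f (a + t *\<^sub>R (y - a))) has_vector_derivative
          ?d (a + t *\<^sub>R (y - a)) (y - a)) (at t within {0..1})"
        by (simp add: has_vector_derivative_def linear_scale[OF l])
    qed simp
    then have "f y - f a = integral {0..1} (\<lambda>t. ?d (a + t *\<^sub>R (y - a)) (y - a))" by (simp add: integral_unique)
    also have "\<dots> = integral {0..1} (\<lambda>t. \<Sum>b\<in>B. rep B (y - a) b * ?d (a + t *\<^sub>R (y - a)) b)"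
    proof (rule integral_cong)
      fix t :: real assume t: "t \<in> {0..1}"
      have "?d (a + t *\<^sub>R (y - a)) (y - a) = (\<Sum>b\<in>B. rep B (y - a) b *\<^sub>R ?d (a + t *\<^sub>R (y - a)) b)"
        using t by (intro linear_eq_basis_sum[OF B] has_derivative_linear[OF smooth_on_hd[OF f]]
            ball_contract[OF y]) auto
      then show "?d (a + t *\<^sub>R (y - a)) (y - a) = (\<Sum>b\<in>B. rep B (y - a) b * ?d (a + t *\<^sub>R (y - a)) b)"
        by (simp only: real_scaleR_def)
    qed
    also have "\<dots> = (\<Sum>b\<in>B. integral {0..1} (\<lambda>t. rep B (y - a) b * ?d (a + t *\<^sub>R (y - a)) b))"
      by (intro integral_sum is_basis_finite[OF B] integrable_on_mult_right integrable_continuous_real cd)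
    also have "\<dots> = (\<Sum>b\<in>B. rep B (y - a) b * g b y)" by (simp only: integral_mult_right g_def power_0 mult_1)
    finally show ?thesis by simp
  qed
  ultimately show ?thesis by (rule that)
qed

section \<open>Smooth cut-off functions on the model space\<close>

definition flat :: "nat \<Rightarrow> real \<Rightarrow> real" where
  "flat m t = (if t \<le> 0 then 0 else exp (- inverse t) * inverse t ^ m)"

lemma flat_tendsto_0: "(flat m \<longlongrightarrow> 0) (at 0)"
proof (rule filterlim_split_at)
  show "(flat m \<longlongrightarrow> 0) (at_left 0)" by (rule tendsto_eventually) (auto simp: flat_def eventually_at_filter)
next
  have "((\<lambda>t. inverse t ^ m / exp (inverse t)) \<longlongrightarrow> 0) (at_right (0::real))"
    by (rule filterlim_compose[OF tendsto_power_div_exp_0 filterlim_inverse_at_top_right])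
  moreover have "\<forall>\<^sub>F t in at_right 0. inverse t ^ m / exp (inverse t) = flat m t"
    by (auto simp: flat_def eventually_at_filter exp_minus field_simps)
  ultimately show "(flat m \<longlongrightarrow> 0) (at_right 0)" by (rule Lim_transform_eventually)
qed

text \<open>Differentiating \<open>exp(-1/t) t^(-m)\<close> gives \<open>t^(-m-2)\<close> from the
  exponential and \<open>-m t^(-m-1)\<close> from the power, so the family is closed under
  derivatives and smoothness follows by induction. At 0 the difference quotient of
  \<open>flat m\<close> is \<open>flat (Suc m)\<close>, which tends to 0.\<close>

lemma flat_derivative:
  "(flat m has_real_derivative (flat (m + 2) t - m * flat (m + 1) t)) (at t)"
proof -
  consider "t < 0" | "t = 0" | "t > 0" by linarith
  then show ?thesis
  proof cases
    case 1
    have "((\<lambda>_. 0) has_real_derivative 0) (at t)" by simp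
    then have "(flat m has_real_derivative 0) (at t)" by (rule DERIV_cong_ev[THEN iffD1, rotated -1])
        (use 1 in \<open>auto simp: flat_def eventually_nhds intro!: exI[of _ "{..<0}"]\<close>)
    then show ?thesis using 1 by (simp add: flat_def)
  next
    case 2
    have "\<forall>\<^sub>F h in at 0. flat (Suc m) h = (flat m h - flat m 0) / (h - 0)"
      by (auto simp: flat_def eventually_at_filter field_simps)
    from Lim_transform_eventually[OF flat_tendsto_0 this]
    show ?thesis using 2 by (simp add: has_field_derivative_iff flat_def)
  next
    case 3
    have "((\<lambda>t. exp (- inverse t) * inverse t ^ m) has_real_derivative
        exp (- inverse t) * inverse t ^ (m + 2) - m * (exp (- inverse t) * inverse t ^ (m + 1))) (at t)"
      using 3 by (auto intro!: derivative_eq_intros simp: power2_eq_square field_simps)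
        (cases m; simp add: field_simps)
    then have "(flat m has_real_derivative
        exp (- inverse t) * inverse t ^ (m + 2) - m * (exp (- inverse t) * inverse t ^ (m + 1))) (at t)"
      by (rule DERIV_cong_ev[THEN iffD1, rotated -1])
        (use 3 in \<open>auto simp: flat_def eventually_nhds intro!: exI[of _ "{0<..}"]\<close>)
    then show ?thesis using 3 by (simp add: flat_def)
  qed
qed

lemma smooth_on_flat: "smooth_on UNIV (flat m)"
proof -
  have "ck_on k UNIV (flat m)" for k
  proof (induction k arbitrary: m)
    case 0
    show ?case using flat_derivative by (auto intro!: continuous_at_imp_continuous_on DERIV_isCont)
  next
    case (Suc k)
    show ?case
    proof (rule ck_on_SucI[OF open_UNIV])
      show "(flat m has_derivative (\<lambda>v. (flat (m + 2) t + (- real m) * flat (m + 1) t) * v)) (at t)" for t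
        using flat_derivative[of m t] by (simp add: has_field_derivative_def)
      show "ck_on k UNIV (\<lambda>t. (flat (m + 2) t + (- real m) * flat (m + 1) t) * v)" for v
        by (rule ck_on_bilinear[OF open_UNIV bounded_bilinear_mult ck_on_add[OF open_UNIV Suc.IH
                ck_on_bilinear[OF open_UNIV bounded_bilinear_mult ck_on_const[OF open_UNIV] Suc.IH]]
              ck_on_const[OF open_UNIV]])
    qed
  qed
  then show ?thesis unfolding smooth_on_def by blast
qed

text \<open>A quotient \<open>A / (A + B)\<close>: \<open>A\<close> vanishes for
  \<open>|s| >= 1\<close>, \<open>B\<close> for \<open>|s| <= 1/2\<close>, never both. So it is
  smooth, 1 on the inner interval and 0 outside the outer one.\<close>

definition plateau :: "real \<Rightarrow> real" where
  "plateau s = flat 0 (1 - s * s) / (flat 0 (1 - s * s) + flat 0 (s * s - 1/4))"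

lemma flat_nonneg: "flat m t \<ge> 0" and flat_pos: "t > 0 \<Longrightarrow> flat m t > 0" by (auto simp: flat_def)

lemma plateau_eq_1: "\<bar>s\<bar> \<le> 1/2 \<Longrightarrow> plateau s = 1"
proof -
  assume s: "\<bar>s\<bar> \<le> 1/2"
  have "s * s \<le> 1/4" using mult_mono[OF s s] by simp
  moreover have "flat 0 (1 - s * s) > 0" using calculation by (intro flat_pos) simp
  ultimately show ?thesis by (simp add: plateau_def flat_def)
qed

lemma plateau_eq_0: "\<bar>s\<bar> \<ge> 1 \<Longrightarrow> plateau s = 0"
proof -
  assume s: "\<bar>s\<bar> \<ge> 1"
  have "s * s \<ge> 1" using mult_mono[OF s s] by simp
  then show ?thesis by (simp add: plateau_def flat_def)
qed

lemma smooth_on_plateau: "smooth_on UNIV plateau"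
proof -
  have sq: "smooth_on UNIV (\<lambda>s::real. s * s)" by (intro smooth_on_mult smooth_on_ident open_UNIV)
  have 1: "smooth_on UNIV (\<lambda>s. flat 0 (1 - s * s))"
    by (rule smooth_on_compose[OF finite_dim_real open_UNIV open_UNIV _ _ smooth_on_flat])
      (auto intro!: smooth_on_diff smooth_on_const sq)
  have 2: "smooth_on UNIV (\<lambda>s. flat 0 (s * s - 1/4))"
    by (rule smooth_on_compose[OF finite_dim_real open_UNIV open_UNIV _ _ smooth_on_flat])
      (auto intro!: smooth_on_diff smooth_on_const sq)
  have "flat 0 (1 - s * s) + flat 0 (s * s - 1/4) \<noteq> 0" for s
  proof (cases "s * s < 1")
    case True
    then show ?thesis using flat_pos[of "1 - s * s" 0] flat_nonneg[of 0 "s * s - 1/4"] by simp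
  next
    case False
    then show ?thesis using flat_pos[of "s * s - 1/4" 0] flat_nonneg[of 0 "1 - s * s"] by simp
  qed
  then show ?thesis unfolding plateau_def[abs_def] by (intro smooth_on_divide open_UNIV smooth_on_add 1 2)
qed

text \<open>A product of plateaus in the basis coordinates, supported in a box: the norm of the
  model space may fail to be differentiable, so radial functions are no option.\<close>

lemma bump_function:
  fixes x :: "'a::real_normed_vector"
  assumes fd: "finite_dim TYPE('a::real_normed_vector)" and S: "open S" "x \<in> S"
  obtains \<rho> :: "'a \<Rightarrow> real" and K U where "smooth_on UNIV \<rho>" "compact K" "K \<subseteq> S" "open U" "x \<in> U" "U \<subseteq> K"
    "\<And>y. y \<in> U \<Longrightarrow> \<rho> y = 1" "\<And>y. y \<notin> K \<Longrightarrow> \<rho> y = 0"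
proof -
  obtain B :: "'a set" where B: "is_basis B" using finite_dim_basis[OF fd] .
  have fin: "finite B" using B by (rule is_basis_finite)
  obtain r where r: "r > 0" "ball x r \<subseteq> S" using S open_contains_ball_eq by blast
  \<comment> \<open>Points of the box differ from \<open>x\<close> in norm by at most \<delta> times
    the sum of the norms of the basis, so this \<delta> keeps the box inside the ball of radius
    \<open>r\<close>; the extra 1 makes the inclusion strict and covers the empty basis.\<close>
  define \<delta> where "\<delta> = r / ((\<Sum>b\<in>B. norm b) + 1)"
  have M: "(\<Sum>b\<in>B. norm b) + 1 > 0" by (simp add: add_nonneg_pos sum_nonneg)
  have \<delta>: "\<delta> > 0" using r M by (simp add: \<delta>_def)
  let ?box = "{c::'a \<Rightarrow> real. \<forall>b. c b \<in> (if b \<in> B then {-\<delta>..\<delta>} else {0})}"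
  define K where "K = (\<lambda>c. x + (\<Sum>b\<in>B. c b *\<^sub>R b)) ` ?box"
  define \<rho> where "\<rho> = (\<lambda>y. \<Prod>b\<in>B. plateau (rep B (y - x) b / \<delta>))"
  define U where "U = (\<Inter>b\<in>B. {y. \<bar>rep B (y - x) b\<bar> < \<delta> / 2})"
  have contr: "continuous_on UNIV (\<lambda>y. rep B (y - x) b)" for b
    by (rule bounded_linear.continuous_on[OF bounded_linear_representation[OF B]]) (intro continuous_intros)
  have sm: "smooth_on UNIV \<rho>" unfolding \<rho>_def
  proof (rule smooth_on_prod[OF open_UNIV])
    fix b
    have "smooth_on UNIV (\<lambda>y. inverse \<delta> * rep B (y - x) b)"
      by (intro smooth_on_mult smooth_on_const open_UNIV smooth_on_diff smooth_on_ident
          smooth_on_linear_comp[OF _ bounded_linear_representation[OF B]])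
    then have "smooth_on UNIV (\<lambda>y. rep B (y - x) b / \<delta>)" by (simp add: field_simps)
    from smooth_on_compose[OF finite_dim_real open_UNIV open_UNIV _ this smooth_on_plateau]
    show "smooth_on UNIV (\<lambda>y. plateau (rep B (y - x) b / \<delta>))" by simp
  qed
  have cK: "compact K" unfolding K_def
    by (intro compact_continuous_image compact_coord_box fin continuous_on_add continuous_on_const
        continuous_combination)
  have KS: "K \<subseteq> S"
  proof
    fix y assume "y \<in> K"
    then obtain c where c: "c \<in> ?box" "y = x + (\<Sum>b\<in>B. c b *\<^sub>R b)" by (auto simp: K_def)
    have "norm (\<Sum>b\<in>B. c b *\<^sub>R b) \<le> (\<Sum>b\<in>B. \<delta> * norm b)"
    proof (rule sum_norm_le)
      fix b assume "b \<in> B"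
      then have "\<bar>c b\<bar> \<le> \<delta>" using c(1) by (auto simp: abs_le_iff dest!: spec[of _ b])
      then show "norm (c b *\<^sub>R b) \<le> \<delta> * norm b" by (simp add: mult_right_mono)
    qed
    also have "\<dots> = \<delta> * (\<Sum>b\<in>B. norm b)" by (rule sum_distrib_left[symmetric])
    also have "\<dots> < \<delta> * ((\<Sum>b\<in>B. norm b) + 1)" using \<delta> by simp
    also have "\<dots> = r" using M by (simp add: \<delta>_def)
    finally have "y \<in> ball x r" using c(2) by (simp add: dist_norm)
    then show "y \<in> S" using r by blast
  qed
  have oU: "open U" unfolding U_def using fin
    by (intro open_INT ballI open_Collect_less continuous_on_rabs contr continuous_on_const)
  have xU: "x \<in> U" using \<delta> B by (simp add: U_def real_vector.representation_zero)
  have inK: "y \<in> K" if "\<And>b. b \<in> B \<Longrightarrow> \<bar>rep B (y - x) b\<bar> \<le> \<delta>" for y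
  proof -
    let ?c = "\<lambda>b. rep B (y - x) b"
    have "?c b \<in> (if b \<in> B then {-\<delta>..\<delta>} else {0})" for b
    proof (cases "b \<in> B")
      case True
      then show ?thesis using that[OF True] by (simp add: abs_le_iff)
    next
      case False
      then have "?c b = 0" using real_vector.representation_ne_zero by metis
      then show ?thesis using False by simp
    qed
    then have "?c \<in> ?box" unfolding mem_Collect_eq by (rule allI)
    then have "(\<lambda>c. x + (\<Sum>b\<in>B. c b *\<^sub>R b)) ?c \<in> K" unfolding K_def by (rule imageI)
    then show ?thesis by (simp add: basis_sum[OF B])
  qed
  have UK: "U \<subseteq> K"
  proof
    fix y assume "y \<in> U"
    then have "\<bar>rep B (y - x) b\<bar> < \<delta> / 2" if "b \<in> B" for b using that by (auto simp: U_def)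
    then have "\<bar>rep B (y - x) b\<bar> \<le> \<delta>" if "b \<in> B" for b using that \<delta> by (smt (verit) field_sum_of_halves)
    then show "y \<in> K" by (rule inK)
  qed
  have r1: "\<rho> y = 1" if "y \<in> U" for y unfolding \<rho>_def
  proof (intro prod.neutral ballI plateau_eq_1)
    fix b assume "b \<in> B"
    then have "\<bar>rep B (y - x) b\<bar> < \<delta> / 2" using that by (auto simp: U_def)
    then show "\<bar>rep B (y - x) b / \<delta>\<bar> \<le> 1 / 2" using \<delta> by (simp add: field_simps)
  qed
  have r0: "\<rho> y = 0" if "y \<notin> K" for y
  proof -
    have "\<exists>b\<in>B. \<bar>rep B (y - x) b\<bar> > \<delta>"
    proof -
      have "\<not> (\<forall>b\<in>B. \<bar>rep B (y - x) b\<bar> \<le> \<delta>)" using inK[of y] that by auto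
      then show ?thesis by (auto simp: not_le)
    qed
    then obtain b where b: "b \<in> B" "\<bar>rep B (y - x) b\<bar> > \<delta>" by auto
    then have "plateau (rep B (y - x) b / \<delta>) = 0" using \<delta> by (intro plateau_eq_0) (simp add: field_simps)
    then show ?thesis unfolding \<rho>_def using b(1) fin by (auto intro: prod_zero)
  qed
  show ?thesis by (rule that[OF sm cK KS oU xU UK r1 r0])
qed

section \<open>Real vector spaces with explicit carrier\<close>

lemma real_space_simps [simp]:
  "carrier real_space = UNIV" "mult real_space = (*)" "one real_space = 1"
  "zero real_space = 0" "add real_space = (+)" "smult real_space = (*)" by (simp_all add: real_space_def)

lemma cring_real_space: "cring real_space"
proof (intro cringI abelian_groupI comm_monoidI)
  show "\<exists>y\<in>carrier real_space. y \<oplus>\<^bsub>real_space\<^esub> x = \<zero>\<^bsub>real_space\<^esub>" for x by (intro bexI[of _ "- x"]) auto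
qed (auto simp: algebra_simps)

text \<open>Additive inverses come from the scalars: \<open>(-1) x\<close> serves, by distributivity
  and the last assumption.\<close>

lemma vec_spaceI:
  fixes V :: "(real, 'v) module" (structure)
  assumes "\<zero> \<in> carrier V"
    and "\<And>x y. x \<in> carrier V \<Longrightarrow> y \<in> carrier V \<Longrightarrow> x \<oplus> y \<in> carrier V"
    and "\<And>x y z. x \<in> carrier V \<Longrightarrow> y \<in> carrier V \<Longrightarrow> z \<in> carrier V \<Longrightarrow> (x \<oplus> y) \<oplus> z = x \<oplus> (y \<oplus> z)"
    and "\<And>x y. x \<in> carrier V \<Longrightarrow> y \<in> carrier V \<Longrightarrow> x \<oplus> y = y \<oplus> x"
    and "\<And>x. x \<in> carrier V \<Longrightarrow> \<zero> \<oplus> x = x"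
    and "\<And>c x. x \<in> carrier V \<Longrightarrow> c \<odot> x \<in> carrier V"
    and "\<And>c d x. x \<in> carrier V \<Longrightarrow> (c + d) \<odot> x = c \<odot> x \<oplus> d \<odot> x"
    and "\<And>c x y. x \<in> carrier V \<Longrightarrow> y \<in> carrier V \<Longrightarrow> c \<odot> (x \<oplus> y) = c \<odot> x \<oplus> c \<odot> y"
    and "\<And>c d x. x \<in> carrier V \<Longrightarrow> (c * d) \<odot> x = c \<odot> (d \<odot> x)"
    and "\<And>x. x \<in> carrier V \<Longrightarrow> 1 \<odot> x = x"
    and "\<And>x. x \<in> carrier V \<Longrightarrow> 0 \<odot> x = \<zero>"
  shows "vec_space V"
proof (intro moduleI cring_real_space abelian_groupI)
  fix x assume x: "x \<in> carrier V"
  have "(-1) \<odot> x \<oplus> x = (-1 + 1) \<odot> x" using assms(7)[OF x, of "-1" 1] assms(10)[OF x] by simp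
  then show "\<exists>y\<in>carrier V. y \<oplus> x = \<zero>" using assms(6,11) x by (intro bexI[of _ "(-1) \<odot> x"]) auto
qed (use assms in auto)

context
  fixes V :: "(real, 'v) module" (structure)
  assumes V: "vec_space V"
begin

interpretation module real_space V by (rule V)

lemma vs_zero: "\<zero> \<in> carrier V" by simp
lemma vs_add: "x \<in> carrier V \<Longrightarrow> y \<in> carrier V \<Longrightarrow> x \<oplus> y \<in> carrier V" by simp
lemma vs_smult: "x \<in> carrier V \<Longrightarrow> c \<odot> x \<in> carrier V" by simp
lemma vs_assoc: "x \<in> carrier V \<Longrightarrow> y \<in> carrier V \<Longrightarrow> z \<in> carrier V \<Longrightarrow> (x \<oplus> y) \<oplus> z = x \<oplus> (y \<oplus> z)" by (rule M.a_assoc)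
lemma vs_comm: "x \<in> carrier V \<Longrightarrow> y \<in> carrier V \<Longrightarrow> x \<oplus> y = y \<oplus> x" by (rule M.a_comm)
lemma vs_l_zero: "x \<in> carrier V \<Longrightarrow> \<zero> \<oplus> x = x" by simp
lemma vs_r_zero: "x \<in> carrier V \<Longrightarrow> x \<oplus> \<zero> = x" by simp
lemma vs_distr_l: "x \<in> carrier V \<Longrightarrow> (c + d) \<odot> x = c \<odot> x \<oplus> d \<odot> x" using smult_l_distr[of c d x] by simp
lemma vs_distr_r: "x \<in> carrier V \<Longrightarrow> y \<in> carrier V \<Longrightarrow> c \<odot> (x \<oplus> y) = c \<odot> x \<oplus> c \<odot> y"
  using smult_r_distr[of c x y] by simp
lemma vs_smult_assoc: "x \<in> carrier V \<Longrightarrow> (c * d) \<odot> x = c \<odot> (d \<odot> x)" using smult_assoc1[of c d x] by simp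
lemma vs_one: "x \<in> carrier V \<Longrightarrow> 1 \<odot> x = x" using smult_one[of x] by simp
lemma vs_smult_0: "x \<in> carrier V \<Longrightarrow> 0 \<odot> x = \<zero>" using smult_l_null[of x] by simp
lemma vs_smult_zero: "c \<odot> \<zero> = \<zero>" using smult_r_null[of c] by simp
lemma vs_uminus: "x \<in> carrier V \<Longrightarrow> \<ominus> x = (-1) \<odot> x"
  by (metis M.minus_equality add.left_inverse vs_distr_l vs_one vs_smult vs_smult_0)
lemma vs_minus: "x \<in> carrier V \<Longrightarrow> y \<in> carrier V \<Longrightarrow> x \<ominus> y = x \<oplus> (-1) \<odot> y" by (simp add: a_minus_def vs_uminus)
lemma vs_subspaceI:
  assumes "W \<subseteq> carrier V" "\<zero> \<in> W" "\<And>x y. x \<in> W \<Longrightarrow> y \<in> W \<Longrightarrow> x \<oplus> y \<in> W" "\<And>c x. x \<in> W \<Longrightarrow> c \<odot> x \<in> W"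
  shows "vec_subspace W V"
proof (rule submoduleI)
  show "\<ominus> a \<in> W" if "a \<in> W" for a
  proof -
    have "\<ominus> a = (-1) \<odot> a" using assms(1) that by (intro vs_uminus) blast
    then show ?thesis using assms(4)[OF that] by simp
  qed
qed (use assms in auto)
lemma vs_subspaceD:
  assumes "vec_subspace W V"
  shows "W \<subseteq> carrier V" "\<zero> \<in> W" "\<And>x y. x \<in> W \<Longrightarrow> y \<in> W \<Longrightarrow> x \<oplus> y \<in> W" "\<And>c x. x \<in> W \<Longrightarrow> c \<odot> x \<in> W"
proof -
  show *: "W \<subseteq> carrier V" "\<And>x y. x \<in> W \<Longrightarrow> y \<in> W \<Longrightarrow> x \<oplus> y \<in> W" using submoduleE[OF assms] by auto
  show sm: "\<And>c x. x \<in> W \<Longrightarrow> c \<odot> x \<in> W" using submoduleE(4)[OF assms] by simp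
  obtain x where "x \<in> W" using submoduleE(2)[OF assms] by auto
  then show "\<zero> \<in> W" using sm[of x 0] vs_smult_0[of x] * by auto
qed

end

lemma fun_space_simps [simp]:
  "carrier (fun_space I V C) = C" "zero (fun_space I V C) = (\<lambda>i\<in>I. \<zero>\<^bsub>V i\<^esub>)"
  "add (fun_space I V C) = (\<lambda>s r. \<lambda>i\<in>I. s i \<oplus>\<^bsub>V i\<^esub> r i)"
  "smult (fun_space I V C) = (\<lambda>c s. \<lambda>i\<in>I. c \<odot>\<^bsub>V i\<^esub> s i)" by (simp_all add: fun_space_def)

lemma fun_space_vec_space:
  assumes V: "\<And>i. i \<in> I \<Longrightarrow> vec_space (V i)" and C: "C \<subseteq> (\<Pi>\<^sub>E i\<in>I. carrier (V i))"
    and "(\<lambda>i\<in>I. \<zero>\<^bsub>V i\<^esub>) \<in> C"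
    and "\<And>s r. s \<in> C \<Longrightarrow> r \<in> C \<Longrightarrow> (\<lambda>i\<in>I. s i \<oplus>\<^bsub>V i\<^esub> r i) \<in> C"
    and "\<And>c s. s \<in> C \<Longrightarrow> (\<lambda>i\<in>I. c \<odot>\<^bsub>V i\<^esub> s i) \<in> C"
  shows "vec_space (fun_space I V C)"
proof -
  have mem: "s i \<in> carrier (V i)" if "s \<in> C" "i \<in> I" for s i using that C by auto
  have ext: "s i = undefined" if "s \<in> C" "i \<notin> I" for s i using that C by (auto simp: PiE_def extensional_def)
  show ?thesis by (rule vec_spaceI; simp add: assms(3-5))
      (auto simp: fun_eq_iff restrict_def mem ext V vs_assoc vs_l_zero vs_distr_l vs_distr_r
        vs_smult_assoc vs_one vs_smult_0 vs_add vs_smult intro!: vs_comm)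
qed

lemma vec_space_real_space: "vec_space real_space" by (rule vec_spaceI) (auto simp: algebra_simps)

text \<open>Functions that agree near \<open>z\<close> have the same derivatives there, so the
  choice inside \<open>frechet_derivative\<close> is made from the same set of maps, whether it is
  empty or not.\<close>

lemma frechet_derivative_cong:
  assumes "open T" "z \<in> T" "\<And>y. y \<in> T \<Longrightarrow> f y = g y"
  shows "\<D> f z = \<D> g z"
proof -
  have "(f has_derivative f') (at z) \<longleftrightarrow> (g has_derivative f') (at z)" for f'
    using has_derivative_transform_within_open[OF _ assms(1,2), of f f' UNIV g]
      has_derivative_transform_within_open[OF _ assms(1,2), of g f' UNIV f] assms(3) by auto
  then show ?thesis unfolding frechet_derivative_def by simp
qed

lemma smooth_on_transform:
  "smooth_on T f \<Longrightarrow> open T \<Longrightarrow> (\<And>z. z \<in> T \<Longrightarrow> f z = g z) \<Longrightarrow> smooth_on T g" using smooth_on_cong[of T f g] by blast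

section \<open>Manifolds\<close>

abbreviation Cs :: "('m, 'e::real_normed_vector) atlas \<Rightarrow> ('m \<Rightarrow> real) set" where
  "Cs A \<equiv> carrier (Cinf A)"

lemma Cinf_simps [simp]:
  "zero (Cinf A) = (\<lambda>x\<in>points A. 0)"
  "add (Cinf A) = (\<lambda>s r. \<lambda>i\<in>points A. s i + r i)"
  "smult (Cinf A) = (\<lambda>c s. \<lambda>i\<in>points A. c * s i)" by (simp_all add: Cinf_def)

lemma Cs_iff: "f \<in> Cs A \<longleftrightarrow> f \<in> extensional (points A) \<and> smooth_fun A (points A) f" by (simp add: Cinf_def)

lemma tangent_simps [simp]:
  "zero (tangent A x) = (\<lambda>i\<in>Cs A. 0)"
  "add (tangent A x) = (\<lambda>s r. \<lambda>i\<in>Cs A. s i + r i)"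
  "smult (tangent A x) = (\<lambda>c s. \<lambda>i\<in>Cs A. c * s i)" by (simp_all add: tangent_def)

lemma tangent_iff: "v \<in> \<T> A x \<longleftrightarrow> v \<in> extensional (Cs A) \<and>
    (\<forall>f\<in>Cs A. \<forall>g\<in>Cs A. v (\<lambda>y\<in>points A. f y + g y) = v f + v g) \<and>
    (\<forall>c. \<forall>f\<in>Cs A. v (\<lambda>y\<in>points A. c * f y) = c * v f) \<and>
    (\<forall>f\<in>Cs A. \<forall>g\<in>Cs A. v (\<lambda>y\<in>points A. f y * g y) = f x * v g + g x * v f)"
  by (auto simp: tangent_def lin_maps_def lin_map_def)

text \<open>Separation is split off into \<open>manifold\<close>: the Hausdorff property of
  \<open>J1 L\<close> is proved with the topology that this locale provides.\<close>

locale atlas =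
  fixes A :: "('m, 'e::real_normed_vector) atlas"
  assumes fd: "finite_dim TYPE('e)"
    and chart_inj: "(U, \<phi>) \<in> A \<Longrightarrow> inj_on \<phi> U"
    and chart_compat: "(U, \<phi>) \<in> A \<Longrightarrow> (V, \<psi>) \<in> A \<Longrightarrow> open (\<phi> ` (U \<inter> V)) \<and>
      smooth_on (\<phi> ` (U \<inter> V)) (\<psi> \<circ> \<I> U \<phi>)"
begin

lemma chart_open: "(U, \<phi>) \<in> A \<Longrightarrow> open (\<phi> ` U)" using chart_compat[of U \<phi> U \<phi>] by simp

lemma chart_points: "(U, \<phi>) \<in> A \<Longrightarrow> U \<subseteq> points A" by (auto simp: points_def)

lemma points_chart: "x \<in> points A \<Longrightarrow> \<exists>U \<phi>. (U, \<phi>) \<in> A \<and> x \<in> U" by (auto simp: points_def)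

lemma chart_inv: "(U, \<phi>) \<in> A \<Longrightarrow> x \<in> U \<Longrightarrow> \<I> U \<phi> (\<phi> x) = x" using chart_inj by (rule inv_into_f_f)

lemma chart_open_Int: "mfd_open A W \<Longrightarrow> (U, \<phi>) \<in> A \<Longrightarrow> open (\<phi> ` (U \<inter> W))" by (auto simp: mfd_open_def)

lemma mfd_open_subset: "mfd_open A W \<Longrightarrow> W \<subseteq> points A" by (simp add: mfd_open_def)

lemma mfd_open_vimage:
  assumes "(U, \<phi>) \<in> A" "open T"
  shows "mfd_open A {x \<in> U. \<phi> x \<in> T}" unfolding mfd_open_def
proof (intro conjI ballI, safe)
  fix x assume "x \<in> U" then show "x \<in> points A" using chart_points assms(1) by blast
next
  fix V \<psi> assume V: "(V, \<psi>) \<in> A"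
  have "\<psi> ` (V \<inter> {x \<in> U. \<phi> x \<in> T}) = \<psi> ` (V \<inter> U) \<inter> (\<phi> \<circ> \<I> V \<psi>) -` T"
    using chart_inv[OF V] by (force simp: image_iff)
  moreover have "open (\<psi> ` (V \<inter> U) \<inter> (\<phi> \<circ> \<I> V \<psi>) -` T)" using chart_compat[OF V assms(1)] assms(2)
    by (intro continuous_open_preimage smooth_on_continuous_on) auto
  ultimately show "open (\<psi> ` (V \<inter> {x \<in> U. \<phi> x \<in> T}))" by simp
qed

lemma mfd_open_chart: "(U, \<phi>) \<in> A \<Longrightarrow> mfd_open A U" using mfd_open_vimage[of U \<phi> UNIV] by simp

lemma mfd_open_Int: "mfd_open A W \<Longrightarrow> mfd_open A W' \<Longrightarrow> mfd_open A (W \<inter> W')" unfolding mfd_open_def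
proof (intro conjI ballI; clarify)
  fix U \<phi> assume *: "\<forall>(U, \<phi>)\<in>A. open (\<phi> ` (U \<inter> W))" "\<forall>(U, \<phi>)\<in>A. open (\<phi> ` (U \<inter> W'))" and U: "(U, \<phi>) \<in> A"
  have "\<phi> ` (U \<inter> (W \<inter> W')) = \<phi> ` (U \<inter> W) \<inter> \<phi> ` (U \<inter> W')" using chart_inj[OF U] by (auto simp: inj_on_def)
  then show "open (\<phi> ` (U \<inter> (W \<inter> W')))" using * U by auto
qed auto

lemma mfd_open_Union: "(\<And>W. W \<in> \<W> \<Longrightarrow> mfd_open A W) \<Longrightarrow> mfd_open A (\<Union>\<W>)" unfolding mfd_open_def
proof (intro conjI ballI; clarify)
  fix U \<phi> assume *: "\<And>W. W \<in> \<W> \<Longrightarrow> W \<subseteq> points A \<and> (\<forall>(U, \<phi>)\<in>A. open (\<phi> ` (U \<inter> W)))" and U: "(U, \<phi>) \<in> A"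
  have "\<phi> ` (U \<inter> \<Union>\<W>) = (\<Union>W\<in>\<W>. \<phi> ` (U \<inter> W))" by auto
  moreover have "open (\<phi> ` (U \<inter> W))" if "W \<in> \<W>" for W using *[OF that] U by auto
  ultimately show "open (\<phi> ` (U \<inter> \<Union>\<W>))" by (simp add: open_UN)
qed auto

lemma mfd_open_local:
  assumes "\<And>x. x \<in> W \<Longrightarrow> \<exists>W'. mfd_open A W' \<and> x \<in> W' \<and> W' \<subseteq> W"
  shows "mfd_open A W"
proof -
  have "W = \<Union>{W'. mfd_open A W' \<and> W' \<subseteq> W}" using assms by blast
  then show ?thesis using mfd_open_Union[of "{W'. mfd_open A W' \<and> W' \<subseteq> W}"] by auto
qed

lemma mfd_open_points: "mfd_open A (points A)"
proof (rule mfd_open_local)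
  fix x assume "x \<in> points A"
  then obtain U \<phi> where "(U, \<phi>) \<in> A" "x \<in> U" using points_chart by meson
  then show "\<exists>W'. mfd_open A W' \<and> x \<in> W' \<and> W' \<subseteq> points A"
    using mfd_open_chart[of U \<phi>] chart_points[of U \<phi>] by auto
qed

lemma openin_mfd: "openin (topology (mfd_open A)) = mfd_open A"
proof (rule topology_inverse')
  show "istopology (mfd_open A)" unfolding istopology_def using mfd_open_Int mfd_open_Union by blast
qed

lemma topspace_mfd: "topspace (topology (mfd_open A)) = points A"
proof
  show "topspace (topology (mfd_open A)) \<subseteq> points A"
    unfolding topspace_def openin_mfd using mfd_open_subset by auto
  show "points A \<subseteq> topspace (topology (mfd_open A))"
    unfolding topspace_def openin_mfd using mfd_open_points by auto
qed

lemma smooth_funD: "smooth_fun A W f \<Longrightarrow> (U, \<phi>) \<in> A \<Longrightarrow> smooth_on (\<phi> ` (U \<inter> W)) (f \<circ> \<I> U \<phi>)"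
  by (auto simp: smooth_fun_def)

lemma smooth_funD_sub:
  "smooth_fun A W f \<Longrightarrow> (U, \<phi>) \<in> A \<Longrightarrow> T \<subseteq> \<phi> ` (U \<inter> W) \<Longrightarrow> smooth_on T (f \<circ> \<I> U \<phi>)"
  using smooth_funD smooth_on_subset by blast

text \<open>Smoothness in one chart around each point passes to every other chart by composition
  with the smooth transition map.\<close>

lemma smooth_funI_local:
  assumes "\<And>x. x \<in> W \<Longrightarrow> \<exists>U \<phi> T. (U, \<phi>) \<in> A \<and> x \<in> U \<and> open T \<and> \<phi> x \<in> T \<and> smooth_on T (f \<circ> \<I> U \<phi>)"
  shows "smooth_fun A W f" unfolding smooth_fun_def
proof (safe, rule smooth_on_local)
  fix V \<psi> z assume V: "(V, \<psi>) \<in> A" and "z \<in> \<psi> ` (V \<inter> W)"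
  then obtain x where x: "x \<in> V" "x \<in> W" "z = \<psi> x" by auto
  obtain U \<phi> T where U: "(U, \<phi>) \<in> A" "x \<in> U" and T: "open T" "\<phi> x \<in> T" "smooth_on T (f \<circ> \<I> U \<phi>)"
    using assms[OF x(2)] by blast
  define N where "N = \<psi> ` (V \<inter> {y \<in> U. \<phi> y \<in> T})"
  have oN: "open N" unfolding N_def by (rule chart_open_Int[OF mfd_open_vimage[OF U(1) T(1)] V])
  have "N \<subseteq> \<psi> ` (V \<inter> U)" unfolding N_def by auto
  then have s1: "smooth_on N (\<phi> \<circ> \<I> V \<psi>)" using chart_compat[OF V U(1)] smooth_on_subset by blast
  have "smooth_on N (\<lambda>z. (f \<circ> \<I> U \<phi>) ((\<phi> \<circ> \<I> V \<psi>) z))"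
    by (rule smooth_on_compose[OF fd oN T(1) _ s1 T(3)]) (auto simp: N_def chart_inv[OF V])
  moreover have "(f \<circ> \<I> U \<phi>) ((\<phi> \<circ> \<I> V \<psi>) z) = (f \<circ> \<I> V \<psi>) z" if "z \<in> N" for z
    using that by (auto simp: N_def chart_inv[OF V] chart_inv[OF U(1)])
  ultimately have "smooth_on N (f \<circ> \<I> V \<psi>)" by (rule smooth_on_transform[OF _ oN])
  moreover have "z \<in> N" using x U T unfolding N_def by auto
  ultimately show "\<exists>T. open T \<and> z \<in> T \<and> smooth_on T (f \<circ> \<I> V \<psi>)" using oN by blast
qed

lemma smooth_fun_subset: "smooth_fun A W f \<Longrightarrow> W' \<subseteq> W \<Longrightarrow> smooth_fun A W' f"
  unfolding smooth_fun_def using smooth_on_subset by (fast elim: smooth_on_subset)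

lemma smooth_fun_cong:
  assumes "mfd_open A W" "\<And>x. x \<in> W \<Longrightarrow> f x = g x" "smooth_fun A W f"
  shows "smooth_fun A W g" unfolding smooth_fun_def
proof safe
  fix U \<phi> assume U: "(U, \<phi>) \<in> A"
  have "(f \<circ> \<I> U \<phi>) z = (g \<circ> \<I> U \<phi>) z" if "z \<in> \<phi> ` (U \<inter> W)" for z using that assms(2) chart_inv[OF U] by auto
  then show "smooth_on (\<phi> ` (U \<inter> W)) (g \<circ> \<I> U \<phi>)"
    using smooth_on_cong[OF chart_open_Int[OF assms(1) U]] smooth_funD[OF assms(3) U] by blast
qed

lemma smooth_fun_patch:
  assumes "\<And>x. x \<in> W \<Longrightarrow> \<exists>W'. mfd_open A W' \<and> x \<in> W' \<and> smooth_fun A W' f"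
  shows "smooth_fun A W f"
proof (rule smooth_funI_local)
  fix x assume "x \<in> W"
  then obtain W' where W': "mfd_open A W'" "x \<in> W'" "smooth_fun A W' f" using assms by blast
  obtain U \<phi> where U: "(U, \<phi>) \<in> A" "x \<in> U" using W' mfd_open_subset points_chart by blast
  show "\<exists>U \<phi> T. (U, \<phi>) \<in> A \<and> x \<in> U \<and> open T \<and> \<phi> x \<in> T \<and> smooth_on T (f \<circ> \<I> U \<phi>)"
    using U W' chart_open_Int[OF W'(1) U(1)] smooth_funD[OF W'(3) U(1)]
    by (intro exI[of _ U] exI[of _ \<phi>] exI[of _ "\<phi> ` (U \<inter> W')"]) auto
qed

lemma smooth_fun_const: "mfd_open A W \<Longrightarrow> smooth_fun A W (\<lambda>x. c)"
  by (auto simp: smooth_fun_def o_def intro!: smooth_on_const chart_open_Int)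

lemma smooth_fun_add: "mfd_open A W \<Longrightarrow> smooth_fun A W f \<Longrightarrow> smooth_fun A W g \<Longrightarrow> smooth_fun A W (\<lambda>x. f x + g x)"
  using smooth_on_add[OF chart_open_Int] by (fastforce simp: smooth_fun_def o_def)

lemma smooth_fun_diff: "mfd_open A W \<Longrightarrow> smooth_fun A W f \<Longrightarrow> smooth_fun A W g \<Longrightarrow> smooth_fun A W (\<lambda>x. f x - g x)"
  using smooth_on_diff[OF chart_open_Int] by (fastforce simp: smooth_fun_def o_def)

lemma smooth_fun_mult: "mfd_open A W \<Longrightarrow> smooth_fun A W f \<Longrightarrow> smooth_fun A W g \<Longrightarrow> smooth_fun A W (\<lambda>x. f x * g x)"
  using smooth_on_mult[OF chart_open_Int] by (fastforce simp: smooth_fun_def o_def)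

lemma smooth_fun_divide:
  assumes "mfd_open A W" "\<And>x. x \<in> W \<Longrightarrow> g x \<noteq> 0" "smooth_fun A W f" "smooth_fun A W g"
  shows "smooth_fun A W (\<lambda>x. f x / g x)" unfolding smooth_fun_def
proof safe
  fix U \<phi> assume U: "(U, \<phi>) \<in> A"
  have "smooth_on (\<phi> ` (U \<inter> W)) (\<lambda>z. (f \<circ> \<I> U \<phi>) z / (g \<circ> \<I> U \<phi>) z)" using assms(2) chart_inv[OF U]
    by (intro smooth_on_divide chart_open_Int[OF assms(1) U] smooth_funD assms(3,4) U) auto
  then show "smooth_on (\<phi> ` (U \<inter> W)) ((\<lambda>x. f x / g x) \<circ> \<I> U \<phi>)" by (simp add: o_def)
qed

lemma Cs_restrict: "smooth_fun A (points A) f \<Longrightarrow> (\<lambda>x\<in>points A. f x) \<in> Cs A"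
  unfolding Cs_iff by (auto intro: smooth_fun_cong[OF mfd_open_points, of f])

lemma Cs_smooth: "f \<in> Cs A \<Longrightarrow> W \<subseteq> points A \<Longrightarrow> smooth_fun A W f" unfolding Cs_iff using smooth_fun_subset by blast

lemma Cs_add: "f \<in> Cs A \<Longrightarrow> g \<in> Cs A \<Longrightarrow> (\<lambda>x\<in>points A. f x + g x) \<in> Cs A"
  by (intro Cs_restrict smooth_fun_add mfd_open_points Cs_smooth subset_refl)

lemma Cs_diff: "f \<in> Cs A \<Longrightarrow> g \<in> Cs A \<Longrightarrow> (\<lambda>x\<in>points A. f x - g x) \<in> Cs A"
  by (intro Cs_restrict smooth_fun_diff mfd_open_points Cs_smooth subset_refl)

lemma Cs_mult: "f \<in> Cs A \<Longrightarrow> g \<in> Cs A \<Longrightarrow> (\<lambda>x\<in>points A. f x * g x) \<in> Cs A"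
  by (intro Cs_restrict smooth_fun_mult mfd_open_points Cs_smooth subset_refl)

lemma Cs_const: "(\<lambda>x\<in>points A. c) \<in> Cs A" by (intro Cs_restrict smooth_fun_const mfd_open_points)

lemma Cs_scale: "f \<in> Cs A \<Longrightarrow> (\<lambda>x\<in>points A. c * f x) \<in> Cs A"
  by (intro Cs_restrict smooth_fun_mult smooth_fun_const mfd_open_points Cs_smooth subset_refl)

lemma Cs_smooth_on: "f \<in> Cs A \<Longrightarrow> (U, \<phi>) \<in> A \<Longrightarrow> smooth_on (\<phi> ` U) (f \<circ> \<I> U \<phi>)"
  using smooth_funD[of "points A" f U \<phi>] chart_points[of U \<phi>] by (simp add: Cs_iff Int_absorb2)

lemma Cs_has_derivative: "f \<in> Cs A \<Longrightarrow> (U, \<phi>) \<in> A \<Longrightarrow> x \<in> U \<Longrightarrow>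
    (f \<circ> \<I> U \<phi> has_derivative \<D> (f \<circ> \<I> U \<phi>) (\<phi> x)) (at (\<phi> x))" by (rule smooth_on_hd[OF Cs_smooth_on]) auto

lemma chart_frechet_cong:
  assumes "(U, \<phi>) \<in> A" "x \<in> U" "mfd_open A W" "x \<in> W" "\<And>y. y \<in> W \<Longrightarrow> f y = g y"
  shows "\<D> (f \<circ> \<I> U \<phi>) (\<phi> x) = \<D> (g \<circ> \<I> U \<phi>) (\<phi> x)"
  by (rule frechet_derivative_cong[OF chart_open_Int[OF assms(3,1)]])
    (use assms chart_inv[OF assms(1)] in auto)

lemma tangent_vec_space: "vec_space (tangent A x)"
proof -
  let ?C = "\<T> A x"
  have e: "tangent A x = fun_space (Cs A) (\<lambda>_. real_space) ?C" by (simp add: tangent_def)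
  have "vec_space (fun_space (Cs A) (\<lambda>_. real_space) ?C)"
  proof (rule fun_space_vec_space)
    show "?C \<subseteq> (\<Pi>\<^sub>E i\<in>Cs A. carrier real_space)" by (auto simp: tangent_iff PiE_def)
  qed (auto simp: vec_space_real_space tangent_iff Cs_add Cs_mult Cs_scale algebra_simps)
  then show ?thesis using e by simp
qed

end

locale manifold = atlas A for A :: "('m, 'e::real_normed_vector) atlas" +
  assumes hausdorff: "Hausdorff_space (topology (mfd_open A))"

lemma smooth_manifold_manifold: "smooth_manifold A \<Longrightarrow> manifold A"
  unfolding smooth_manifold_def manifold_def atlas_def manifold_axioms_def finite_dim_def by fast

context manifold
begin

text \<open>The support is compact inside one chart, hence closed in a Hausdorff space, so its
  complement \<open>N\<close> is open and extension by zero is smooth. \<open>N\<close> belongs to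
  the conclusion because gluing needs an open neighbourhood of the complement of \<open>W\<close> on
  which \<rho> vanishes.\<close>

lemma bump:
  assumes W: "mfd_open A W" "x \<in> W"
  obtains \<rho> N W' where "\<rho> \<in> Cs A" "mfd_open A N" "points A - W \<subseteq> N" "\<And>y. y \<in> N \<Longrightarrow> \<rho> y = 0"
    "mfd_open A W'" "x \<in> W'" "W' \<subseteq> W" "\<And>y. y \<in> W' \<Longrightarrow> \<rho> y = 1"
proof -
  obtain U \<phi> where U: "(U, \<phi>) \<in> A" "x \<in> U" using W mfd_open_subset points_chart by blast
  let ?S = "\<phi> ` (U \<inter> W)" and ?X = "topology (mfd_open A)"
  have "\<phi> x \<in> ?S" using U W by auto
  then obtain \<rho>0 :: "'e \<Rightarrow> real" and K U0 where \<rho>0: "smooth_on UNIV \<rho>0" and K: "compact K" "K \<subseteq> ?S"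
    and U0: "open U0" "\<phi> x \<in> U0" "U0 \<subseteq> K" "\<And>y. y \<in> U0 \<Longrightarrow> \<rho>0 y = 1" and out: "\<And>y. y \<notin> K \<Longrightarrow> \<rho>0 y = 0"
    by (rule bump_function[OF fd chart_open_Int[OF W(1) U(1)]]) blast
  define K' where "K' = \<I> U \<phi> ` K"
  define N where "N = points A - K'"
  define \<rho> where "\<rho> = (\<lambda>y\<in>points A. if y \<in> U then \<rho>0 (\<phi> y) else 0)"
  have K'W: "K' \<subseteq> U \<inter> W" unfolding K'_def using K(2) chart_inv[OF U(1)] by auto
  \<comment> \<open>The inverse chart is continuous for the topology of the atlas and carries
    compactness of \<open>K\<close> over to the manifold.\<close>
  have "continuous_map (subtopology euclidean (\<phi> ` U)) ?X (\<I> U \<phi>)" unfolding continuous_map_def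
  proof (intro conjI allI impI)
    show "\<I> U \<phi> \<in> topspace (subtopology euclidean (\<phi> ` U)) \<rightarrow> topspace ?X"
      using chart_points[OF U(1)] chart_inv[OF U(1)] by (auto simp: topspace_mfd)
    fix V assume "openin ?X V"
    then have V: "mfd_open A V" by (simp add: openin_mfd)
    have "{z \<in> topspace (subtopology euclidean (\<phi> ` U)). \<I> U \<phi> z \<in> V} = \<phi> ` (U \<inter> V)"
      using chart_inv[OF U(1)] by auto
    then show "openin (subtopology euclidean (\<phi> ` U)) {z \<in> topspace (subtopology euclidean (\<phi> ` U)). \<I> U \<phi> z \<in> V}"
      using chart_open_Int[OF V U(1)] by (auto simp: openin_open intro!: exI[of _ "\<phi> ` (U \<inter> V)"])
  qed
  moreover have "compactin (subtopology euclidean (\<phi> ` U)) K" using K by (auto simp: compactin_subtopology)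
  ultimately have "compactin ?X K'" unfolding K'_def by (rule image_compactin[rotated])
  then have "closedin ?X K'" by (rule compactin_imp_closedin[OF hausdorff])
  then have N: "mfd_open A N" unfolding N_def closedin_def openin_mfd topspace_mfd by blast
  have \<rho>N: "\<rho> y = 0" if "y \<in> N" for y
  proof (cases "y \<in> U")
    case True
    then have "\<phi> y \<notin> K" using that chart_inv[OF U(1) True] unfolding N_def K'_def by (metis DiffE imageI)
    then show ?thesis using True that out by (simp add: \<rho>_def N_def)
  next
    case False
    then show ?thesis using that by (simp add: \<rho>_def N_def)
  qed
  have "\<rho> \<in> Cs A" unfolding Cs_iff
  proof
    show "\<rho> \<in> extensional (points A)" unfolding \<rho>_def by simp
    show "smooth_fun A (points A) \<rho>"
    proof (rule smooth_fun_patch)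
      fix y assume y: "y \<in> points A"
      show "\<exists>W'. mfd_open A W' \<and> y \<in> W' \<and> smooth_fun A W' \<rho>"
      proof (cases "y \<in> U")
        case True
        have "smooth_fun A U \<rho>"
        proof (rule smooth_funI_local)
          fix y assume y: "y \<in> U"
          have "smooth_on (\<phi> ` U) \<rho>0" using \<rho>0 smooth_on_subset by blast
          moreover have "\<rho>0 z = (\<rho> \<circ> \<I> U \<phi>) z" if "z \<in> \<phi> ` U" for z
            using that chart_inv[OF U(1)] chart_points[OF U(1)] by (auto simp: \<rho>_def)
          ultimately have "smooth_on (\<phi> ` U) (\<rho> \<circ> \<I> U \<phi>)" by (rule smooth_on_transform[OF _ chart_open[OF U(1)]])
          then show "\<exists>U \<phi> T. (U, \<phi>) \<in> A \<and> y \<in> U \<and> open T \<and> \<phi> y \<in> T \<and> smooth_on T (\<rho> \<circ> \<I> U \<phi>)"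
            using U(1) y chart_open[OF U(1)] by blast
        qed
        then show ?thesis using True mfd_open_chart[OF U(1)] by blast
      next
        case False
        then have "y \<in> N" using y K'W by (auto simp: N_def)
        moreover have "smooth_fun A N \<rho>"
          by (rule smooth_fun_cong[OF N _ smooth_fun_const[OF N, of 0]]) (simp add: \<rho>N)
        ultimately show ?thesis using N by blast
      qed
    qed
  qed
  moreover have "points A - W \<subseteq> N" using K'W unfolding N_def by auto
  moreover have "mfd_open A {y \<in> U. \<phi> y \<in> U0}" by (rule mfd_open_vimage[OF U(1) U0(1)])
  moreover have "{y \<in> U. \<phi> y \<in> U0} \<subseteq> W"
  proof safe
    fix y assume y: "y \<in> U" "\<phi> y \<in> U0"
    then have "\<phi> y \<in> \<phi> ` (U \<inter> W)" using U0(3) K(2) by blast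
    then show "y \<in> W" using chart_inj[OF U(1)] y(1) by (auto simp: inj_on_def)
  qed
  moreover have "\<rho> y = 1" if "y \<in> {y \<in> U. \<phi> y \<in> U0}" for y
    using that U0(4) chart_points[OF U(1)] by (auto simp: \<rho>_def)
  ultimately show ?thesis using N \<rho>N U U0(2) by (intro that[of \<rho> N "{y \<in> U. \<phi> y \<in> U0}"]) auto
qed

text \<open>The open sets \<open>W\<close> and \<open>N\<close> cover the manifold, and on
  \<open>N\<close> the glued function is zero because of the factor \<rho>.\<close>

lemma Cs_glue:
  assumes W: "mfd_open A W" and f: "smooth_fun A W f" and \<rho>: "\<rho> \<in> Cs A"
    and N: "mfd_open A N" "points A - W \<subseteq> N" "\<And>y. y \<in> N \<Longrightarrow> \<rho> y = 0"
  shows "(\<lambda>y\<in>points A. if y \<in> W then \<rho> y * f y else 0) \<in> Cs A"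
proof (intro Cs_restrict smooth_fun_patch)
  let ?g = "\<lambda>y. if y \<in> W then \<rho> y * f y else 0"
  fix y assume "y \<in> points A"
  then consider "y \<in> W" | "y \<in> N" using N by blast
  then show "\<exists>W'. mfd_open A W' \<and> y \<in> W' \<and> smooth_fun A W' ?g"
  proof cases
    case 1
    have "smooth_fun A W (\<lambda>y. \<rho> y * f y)" by (intro smooth_fun_mult W f Cs_smooth \<rho> mfd_open_subset)
    then have "smooth_fun A W ?g" by (rule smooth_fun_cong[OF W, rotated]) simp
    then show ?thesis using 1 W by blast
  next
    case 2
    have "smooth_fun A N ?g" by (rule smooth_fun_cong[OF N(1) _ smooth_fun_const[OF N(1), of 0]]) (simp add: N(3))
    then show ?thesis using 2 N by blast
  qed
qed

lemma Cs_extend: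
  assumes W: "mfd_open A W" "x \<in> W" and f: "smooth_fun A W f"
  obtains g W' where "g \<in> Cs A" "mfd_open A W'" "x \<in> W'" "W' \<subseteq> W" "\<And>y. y \<in> W' \<Longrightarrow> g y = f y"
proof -
  obtain \<rho> N W' where *: "\<rho> \<in> Cs A" "mfd_open A N" "points A - W \<subseteq> N" "\<And>y. y \<in> N \<Longrightarrow> \<rho> y = 0"
    "mfd_open A W'" "x \<in> W'" "W' \<subseteq> W" "\<And>y. y \<in> W' \<Longrightarrow> \<rho> y = 1" using bump[OF W] by blast
  show ?thesis by (rule that[OF Cs_glue[OF W(1) f *(1-4)] *(5-7)]) (use *(7,8) mfd_open_subset[OF W(1)] in auto)
qed

lemma Cs_extend_chart:
  assumes U: "(U, \<phi>) \<in> A" "x \<in> U" and T0: "open T0" "\<phi> x \<in> T0" and h: "smooth_on T0 h"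
  shows "\<exists>f T. f \<in> Cs A \<and> open T \<and> \<phi> x \<in> T \<and> T \<subseteq> T0 \<and> T \<subseteq> \<phi> ` U \<and> (\<forall>z\<in>T. (f \<circ> \<I> U \<phi>) z = h z)"
proof -
  define W where "W = {y \<in> U. \<phi> y \<in> T0}"
  have W: "mfd_open A W" "x \<in> W" unfolding W_def using mfd_open_vimage[OF U(1) T0(1)] U T0 by auto
  have "smooth_fun A W (h \<circ> \<phi>)"
  proof (rule smooth_funI_local)
    fix y assume y: "y \<in> W"
    have o: "open (\<phi> ` (U \<inter> W))" by (rule chart_open_Int[OF W(1) U(1)])
    have "smooth_on (\<phi> ` (U \<inter> W)) h" by (rule smooth_on_subset[OF h]) (auto simp: W_def)
    moreover have "h z = ((h \<circ> \<phi>) \<circ> \<I> U \<phi>) z" if "z \<in> \<phi> ` (U \<inter> W)" for z using that chart_inv[OF U(1)] by auto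
    ultimately have "smooth_on (\<phi> ` (U \<inter> W)) ((h \<circ> \<phi>) \<circ> \<I> U \<phi>)" by (rule smooth_on_transform[OF _ o])
    then show "\<exists>U' \<phi>' T. (U', \<phi>') \<in> A \<and> y \<in> U' \<and> open T \<and> \<phi>' y \<in> T \<and> smooth_on T ((h \<circ> \<phi>) \<circ> \<I> U' \<phi>')"
      using y U(1) o by (intro exI[of _ U] exI[of _ \<phi>] exI[of _ "\<phi> ` (U \<inter> W)"]) (auto simp: W_def)
  qed
  then obtain g W' where g: "g \<in> Cs A" "mfd_open A W'" "x \<in> W'" "W' \<subseteq> W" "\<And>y. y \<in> W' \<Longrightarrow> g y = (h \<circ> \<phi>) y"
    using Cs_extend[OF W] by blast
  show ?thesis using g U chart_inv[OF U(1)] chart_open_Int[OF g(2) U(1)]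
    by (intro exI[of _ g] exI[of _ "\<phi> ` (U \<inter> W')"]) (auto simp: W_def)
qed

text \<open>A bump \<rho> inside \<open>W\<close> times \<open>f - g\<close> is identically zero.
  The Leibniz rule at \<open>x\<close>, where \<rho> is 1 and \<open>f - g\<close> is 0, leaves only
  \<open>v (f - g)\<close>.\<close>

lemma tangent_local:
  assumes v: "v \<in> \<T> A x" and fg: "f \<in> Cs A" "g \<in> Cs A"
    and W: "mfd_open A W" "x \<in> W" "\<And>y. y \<in> W \<Longrightarrow> f y = g y"
  shows "v f = v g"
proof -
  obtain \<rho> N W' where *: "\<rho> \<in> Cs A" "mfd_open A N" "points A - W \<subseteq> N" "\<And>y. y \<in> N \<Longrightarrow> \<rho> y = 0"
    "mfd_open A W'" "x \<in> W'" "W' \<subseteq> W" "\<And>y. y \<in> W' \<Longrightarrow> \<rho> y = 1" using bump[OF W(1,2)] by blast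
  define h where "h = (\<lambda>y\<in>points A. f y - g y)"
  have h: "h \<in> Cs A" unfolding h_def by (rule Cs_diff[OF fg])
  have x: "x \<in> points A" using W mfd_open_subset by blast
  \<comment> \<open>Zero is written as \<open>0 * h\<close> so that homogeneity of \<open>v\<close>
    yields the value 0 directly.\<close>
  have "(\<lambda>y\<in>points A. \<rho> y * h y) = (\<lambda>y\<in>points A. 0 * h y)"
  proof (rule restrict_ext)
    fix y assume "y \<in> points A"
    then show "\<rho> y * h y = 0 * h y" using *(3,4) W(3) unfolding h_def by (cases "y \<in> W") auto
  qed
  note eq = this
  have "\<rho> x * v h + h x * v \<rho> = v (\<lambda>y\<in>points A. \<rho> y * h y)" using v *(1) h unfolding tangent_iff by auto
  also have "\<dots> = v (\<lambda>y\<in>points A. 0 * h y)" by (simp only: eq)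
  also have "\<dots> = 0 * v h" using v h unfolding tangent_iff by blast
  finally have "v h = 0" using *(6,8) W x by (simp add: h_def)
  moreover have "(\<lambda>y\<in>points A. h y + g y) = f" using fg by (auto simp: h_def Cs_iff extensional_def fun_eq_iff)
  moreover have "v (\<lambda>y\<in>points A. h y + g y) = v h + v g" using v h fg unfolding tangent_iff by blast
  ultimately show ?thesis by simp
qed

end

section \<open>Tangent vectors in a chart\<close>

definition tvec where
  "tvec A U \<phi> x w = (\<lambda>f\<in>Cs A. \<D> (f \<circ> \<I> U \<phi>) (\<phi> x) w)"

context manifold
begin

lemma tvec_tangent:
  assumes U: "(U, \<phi>) \<in> A" "x \<in> U"
  shows "tvec A U \<phi> x w \<in> \<T> A x"
proof -
  let ?r = "\<lambda>f. f \<circ> \<I> U \<phi>" and ?z = "\<phi> x"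
  let ?D = "\<lambda>f. \<D> (?r f) ?z"
  have c: "?D (\<lambda>y\<in>points A. f y) = ?D f" for f
    by (rule chart_frechet_cong[OF U mfd_open_chart[OF U(1)] U(2)]) (use chart_points[OF U(1)] in auto)
  note hd = Cs_has_derivative[OF _ U]
  have 1: "?D (\<lambda>y\<in>points A. f y + g y) w = ?D f w + ?D g w" if "f \<in> Cs A" "g \<in> Cs A" for f g
    unfolding c[of "\<lambda>y. f y + g y"]
    using frechet_derivative_at[OF has_derivative_add[OF hd[OF that(1)] hd[OF that(2)]]]
    by (simp add: o_def fun_eq_iff)
  have 2: "?D (\<lambda>y\<in>points A. a * f y) w = a * ?D f w" if "f \<in> Cs A" for f a unfolding c[of "\<lambda>y. a * f y"]
    using frechet_derivative_at[OF has_derivative_mult_right[OF hd[OF that], of a]]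
    by (simp add: o_def fun_eq_iff)
  have 3: "?D (\<lambda>y\<in>points A. f y * g y) w = f x * ?D g w + g x * ?D f w" if "f \<in> Cs A" "g \<in> Cs A" for f g
    unfolding c[of "\<lambda>y. f y * g y"]
    using fun_cong[OF frechet_derivative_at[symmetric, OF has_derivative_mult[OF hd[OF that(1)] hd[OF that(2)]]], of w]
      chart_inv[OF U] by (simp add: o_def mult.commute)
  show ?thesis unfolding tangent_iff tvec_def using 1 2 3 by (auto simp: Cs_add Cs_mult Cs_scale)
qed

text \<open>The Leibniz rule for the finite sums that Hadamard's lemma produces. Membership in
  \<open>Cs A\<close> is proved along with it because the induction applies \<open>v\<close> to
  partial sums.\<close>

lemma tangent_sum:
  assumes v: "v \<in> \<T> A x" and fg: "\<And>b. b \<in> B \<Longrightarrow> f b \<in> Cs A" "\<And>b. b \<in> B \<Longrightarrow> g b \<in> Cs A" and B: "finite B"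
  shows "(\<lambda>y\<in>points A. \<Sum>b\<in>B. f b y * g b y) \<in> Cs A \<and>
    v (\<lambda>y\<in>points A. \<Sum>b\<in>B. f b y * g b y) = (\<Sum>b\<in>B. f b x * v (g b) + g b x * v (f b))" using B fg
proof (induction B)
  case empty
  let ?o = "\<lambda>y\<in>points A. 0::real"
  have "v (\<lambda>y\<in>points A. 0 * ?o y) = 0 * v ?o" using v Cs_const[of 0] unfolding tangent_iff by blast
  moreover have "(\<lambda>y\<in>points A. 0 * ?o y) = ?o" by auto
  ultimately have "v ?o = 0" by simp
  then show ?case unfolding sum.empty using Cs_const[of 0] by (rule conjI[rotated])
next
  case (insert a B)
  let ?s = "\<lambda>y\<in>points A. \<Sum>b\<in>B. f b y * g b y" and ?m = "\<lambda>y\<in>points A. f a y * g a y"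
  have "?s \<in> Cs A \<and> v ?s = (\<Sum>b\<in>B. f b x * v (g b) + g b x * v (f b))"
    by (rule insert.IH) (use insert.prems in auto)
  then have IH: "?s \<in> Cs A" "v ?s = (\<Sum>b\<in>B. f b x * v (g b) + g b x * v (f b))" by blast+
  have m: "?m \<in> Cs A" "v ?m = f a x * v (g a) + g a x * v (f a)"
    using insert.prems v Cs_mult unfolding tangent_iff by auto
  have e: "(\<lambda>y\<in>points A. \<Sum>b\<in>insert a B. f b y * g b y) = (\<lambda>y\<in>points A. ?m y + ?s y)"
    using insert.hyps by (auto simp: fun_eq_iff)
  have "v (\<lambda>y\<in>points A. ?m y + ?s y) = v ?m + v ?s" using v m(1) IH(1) unfolding tangent_iff by blast
  then show ?case unfolding e using Cs_add[OF m(1) IH(1)] m(2) IH(2) by (simp only: sum.insert[OF insert.hyps] simp_thms)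
qed

text \<open>By Hadamard's lemma a derivation at a point is determined by its values on the coordinate functions.\<close>

lemma tangent_tvec:
  assumes U: "(U, \<phi>) \<in> A" "x \<in> U" and v: "v \<in> \<T> A x"
  obtains w where "v = tvec A U \<phi> x w"
proof -
  obtain B :: "'e set" where B: "is_basis B" using finite_dim_basis[OF fd] .
  have fin: "finite B" using B by (rule is_basis_finite)
  let ?a = "\<phi> x"
  obtain r where r: "r > 0" "ball ?a r \<subseteq> \<phi> ` U"
    using chart_open[OF U(1)] U(2) open_contains_ball_eq by (metis imageI)
  have "\<exists>f T. f \<in> Cs A \<and> open T \<and> ?a \<in> T \<and> T \<subseteq> \<phi> ` U \<and> (\<forall>z\<in>T. (f \<circ> \<I> U \<phi>) z = rep B (z - ?a) b)" for b
  proof -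
    have "smooth_on UNIV (\<lambda>z. rep B (z - ?a) b)"
      by (rule smooth_on_linear_comp[OF open_UNIV bounded_linear_representation[OF B]])
        (intro smooth_on_diff smooth_on_ident smooth_on_const open_UNIV)
    from Cs_extend_chart[OF U open_UNIV UNIV_I this] show ?thesis by blast
  qed
  then obtain \<xi> T\<xi> where \<xi>: "\<And>b. \<xi> b \<in> Cs A" "\<And>b. open (T\<xi> b)" "\<And>b. ?a \<in> T\<xi> b" "\<And>b. T\<xi> b \<subseteq> \<phi> ` U"
    "\<And>b z. z \<in> T\<xi> b \<Longrightarrow> (\<xi> b \<circ> \<I> U \<phi>) z = rep B (z - ?a) b" by metis
  \<comment> \<open>The components of \<open>v\<close> are its values on the coordinate functions
    \<open>\<xi> b\<close>, centred at \<open>x\<close>.\<close>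
  define w where "w = (\<Sum>b\<in>B. v (\<xi> b) *\<^sub>R b)"
  have "v f = tvec A U \<phi> x w f" if f: "f \<in> Cs A" for f
  proof -
    have sf: "smooth_on (ball ?a r) (f \<circ> \<I> U \<phi>)" using smooth_on_subset[OF Cs_smooth_on[OF f U(1)] r(2)] .
    obtain g where g: "\<And>b. smooth_on (ball ?a r) (g b)" "\<And>b. g b ?a = \<D> (f \<circ> \<I> U \<phi>) ?a b"
      "\<And>y. y \<in> ball ?a r \<Longrightarrow> (f \<circ> \<I> U \<phi>) y = (f \<circ> \<I> U \<phi>) ?a + (\<Sum>b\<in>B. rep B (y - ?a) b * g b y)"
      using hadamard[OF B sf r(1)] by blast
    have "\<exists>f T. f \<in> Cs A \<and> open T \<and> ?a \<in> T \<and> T \<subseteq> ball ?a r \<and> (\<forall>z\<in>T. (f \<circ> \<I> U \<phi>) z = g b z)" for b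
      using Cs_extend_chart[OF U open_ball _ g(1)[of b]] r(1) by (simp only: centre_in_ball) blast
    then obtain \<gamma> T\<gamma> where \<gamma>: "\<And>b. \<gamma> b \<in> Cs A" "\<And>b. open (T\<gamma> b)" "\<And>b. ?a \<in> T\<gamma> b" "\<And>b. T\<gamma> b \<subseteq> ball ?a r"
      "\<And>b z. z \<in> T\<gamma> b \<Longrightarrow> (\<gamma> b \<circ> \<I> U \<phi>) z = g b z" by metis
    define T where "T = ball ?a r \<inter> (\<Inter>b\<in>B. T\<xi> b \<inter> T\<gamma> b)"
    have T: "open T" "?a \<in> T" unfolding T_def using \<xi> \<gamma> fin r by (auto intro!: open_Int open_INT)
    let ?s = "\<lambda>y\<in>points A. \<Sum>b\<in>B. \<xi> b y * \<gamma> b y" and ?c = "\<lambda>y\<in>points A. f x"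
    have s: "?s \<in> Cs A" "v ?s = (\<Sum>b\<in>B. \<xi> b x * v (\<gamma> b) + \<gamma> b x * v (\<xi> b))"
      using tangent_sum[OF v, of B \<xi> \<gamma>] \<xi>(1) \<gamma>(1) fin by auto
    have cC: "?c \<in> Cs A" by (rule Cs_const)
    \<comment> \<open>A derivation kills constants, by the Leibniz rule for
      \<open>1 * 1 = 1\<close>.\<close>
    have vc: "v ?c = 0"
    proof -
      let ?o = "\<lambda>y\<in>points A. 1::real"
      have 1: "?o \<in> Cs A" by (rule Cs_const)
      have "v (\<lambda>y\<in>points A. ?o y * ?o y) = ?o x * v ?o + ?o x * v ?o" using v 1 unfolding tangent_iff by blast
      moreover have "(\<lambda>y\<in>points A. ?o y * ?o y) = ?o" by auto
      moreover have "?o x = 1" using U chart_points by auto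
      ultimately have "v ?o = 0" by simp
      moreover have "v (\<lambda>y\<in>points A. f x * ?o y) = f x * v ?o" using v 1 unfolding tangent_iff by blast
      moreover have "(\<lambda>y\<in>points A. f x * ?o y) = ?c" by auto
      ultimately show ?thesis by simp
    qed
    \<comment> \<open>The Hadamard expansion holds only near \<open>x\<close>; by locality
      \<open>v\<close> does not see the difference.\<close>
    have "v f = v (\<lambda>y\<in>points A. ?c y + ?s y)"
    proof (rule tangent_local[OF v f Cs_add[OF cC s(1)] mfd_open_vimage[OF U(1) T(1)]])
      show "x \<in> {y \<in> U. \<phi> y \<in> T}" using U T by auto
      fix y assume y: "y \<in> {y \<in> U. \<phi> y \<in> T}"
      then have yU: "y \<in> U" "\<phi> y \<in> ball ?a r" by (auto simp: T_def)
      have "f y = f x + (\<Sum>b\<in>B. rep B (\<phi> y - ?a) b * g b (\<phi> y))"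
        using g(3)[OF yU(2)] chart_inv[OF U] chart_inv[OF U(1) yU(1)] by simp
      also have "(\<Sum>b\<in>B. rep B (\<phi> y - ?a) b * g b (\<phi> y)) = (\<Sum>b\<in>B. \<xi> b y * \<gamma> b y)"
      proof (rule sum.cong[OF refl])
        fix b assume "b \<in> B"
        then have "\<phi> y \<in> T\<xi> b" "\<phi> y \<in> T\<gamma> b" using y by (auto simp: T_def)
        then show "rep B (\<phi> y - ?a) b * g b (\<phi> y) = \<xi> b y * \<gamma> b y"
          using \<xi>(5)[of "\<phi> y" b] \<gamma>(5)[of "\<phi> y" b] chart_inv[OF U(1) yU(1)] by simp
      qed
      finally show "f y = (\<lambda>y\<in>points A. ?c y + ?s y) y" using yU chart_points[OF U(1)] by auto
    qed
    also have "\<dots> = v ?c + v ?s" using v cC s(1) unfolding tangent_iff by blast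
    also have "\<dots> = (\<Sum>b\<in>B. \<D> (f \<circ> \<I> U \<phi>) ?a b * v (\<xi> b))" unfolding vc s(2) add_0
    proof (rule sum.cong[OF refl])
      fix b
      have "\<xi> b x = 0" using \<xi>(5)[OF \<xi>(3), of b] chart_inv[OF U] B by (simp add: real_vector.representation_zero)
      moreover have "\<gamma> b x = \<D> (f \<circ> \<I> U \<phi>) ?a b" using \<gamma>(5)[OF \<gamma>(3), of b] chart_inv[OF U] g(2) by simp
      ultimately show "\<xi> b x * v (\<gamma> b) + \<gamma> b x * v (\<xi> b) = \<D> (f \<circ> \<I> U \<phi>) ?a b * v (\<xi> b)" by simp
    qed
    also have "\<dots> = \<D> (f \<circ> \<I> U \<phi>) ?a w"
    proof -
      have l: "linear (\<D> (f \<circ> \<I> U \<phi>) ?a)" by (rule has_derivative_linear[OF Cs_has_derivative[OF f U]])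
      show ?thesis unfolding w_def by (simp add: linear_sum[OF l] linear_scale[OF l] mult.commute)
    qed
    finally show ?thesis using f by (simp add: tvec_def)
  qed
  moreover have "v f = tvec A U \<phi> x w f" if "f \<notin> Cs A" for f
    using v that unfolding tangent_iff tvec_def by (auto simp: extensional_def)
  ultimately show ?thesis using that[of w] by blast
qed

text \<open>The differential is prescribed on a whole neighbourhood, not only at \<open>x\<close>:
  being constant there, it can be differentiated once more without second derivatives
  appearing.\<close>

lemma coordinate_function:
  assumes U: "(U, \<phi>) \<in> A" "x \<in> U" and h: "bounded_linear h"
  shows "\<exists>f T. f \<in> Cs A \<and> open T \<and> \<phi> x \<in> T \<and> T \<subseteq> \<phi> ` U \<and>
    (\<forall>z\<in>T. \<D> (f \<circ> \<I> U \<phi>) z = h)"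
proof -
  obtain f T where f: "f \<in> Cs A" "open T" "\<phi> x \<in> T" "T \<subseteq> \<phi> ` U" "\<forall>z\<in>T. (f \<circ> \<I> U \<phi>) z = h z"
    using Cs_extend_chart[OF U open_UNIV UNIV_I smooth_on_bounded_linear[OF open_UNIV h]] by blast
  have "\<D> (f \<circ> \<I> U \<phi>) z = h" if "z \<in> T" for z
  proof -
    have "\<D> (f \<circ> \<I> U \<phi>) z = \<D> h z" using f(5) by (intro frechet_derivative_cong[OF f(2) that]) blast
    then show ?thesis by (simp add: frechet_derivative_at[OF bounded_linear_imp_has_derivative[OF h], symmetric])
  qed
  then show ?thesis using f by blast
qed

lemma basis_eqI:
  assumes "is_basis B" "\<And>b. b \<in> B \<Longrightarrow> rep B v b = rep B w b"
  shows "v = w"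
proof -
  have "(\<Sum>b\<in>B. rep B v b *\<^sub>R b) = (\<Sum>b\<in>B. rep B w b *\<^sub>R b)" using assms(2) by (intro sum.cong) auto
  then show ?thesis by (simp add: basis_sum[OF assms(1)])
qed

lemma tvec_inject:
  assumes U: "(U, \<phi>) \<in> A" "x \<in> U" and e: "tvec A U \<phi> x w = tvec A U \<phi> x w'"
  shows "w = w'"
proof -
  obtain B :: "'e set" where B: "is_basis B" using finite_dim_basis[OF fd] .
  show ?thesis
  proof (rule basis_eqI[OF B])
    fix b
    obtain f T where f: "f \<in> Cs A" "\<phi> x \<in> T"
      "\<forall>z\<in>T. \<D> (f \<circ> \<I> U \<phi>) z = (\<lambda>w. rep B w b)"
      using coordinate_function[OF U bounded_linear_representation[OF B, of b]] by blast
    have "tvec A U \<phi> x w f = tvec A U \<phi> x w' f" using e by simp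
    then show "rep B w b = rep B w' b" using f U by (simp add: tvec_def)
  qed
qed

end

section \<open>Vector fields in a chart\<close>

definition tcoord where
  "tcoord A U \<phi> x v = (THE w. v = tvec A U \<phi> x w)"

definition vrep where
  "vrep A U \<phi> X z = tcoord A U \<phi> (\<I> U \<phi> z) (X (\<I> U \<phi> z))"

lemma vfields_iff: "X \<in> \<X> A \<longleftrightarrow> X \<in> (\<Pi>\<^sub>E x\<in>points A. \<T> A x) \<and>
    (\<forall>f\<in>Cs A. act (points A) X f \<in> Cs A)" by (simp add: vfields_def)

lemma vfields_simps [simp]:
  "zero (vfields A) = (\<lambda>x\<in>points A. \<lambda>i\<in>Cs A. 0)"
  "add (vfields A) = (\<lambda>s r. \<lambda>x\<in>points A. \<lambda>i\<in>Cs A. s x i + r x i)"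
  "smult (vfields A) = (\<lambda>c s. \<lambda>x\<in>points A. \<lambda>i\<in>Cs A. c * s x i)" by (simp_all add: vfields_def)

context manifold
begin

context
  fixes U \<phi> x
  assumes U: "(U, \<phi>) \<in> A" and x: "x \<in> U"
begin

lemma tcoord_tvec: "tcoord A U \<phi> x (tvec A U \<phi> x w) = w"
  unfolding tcoord_def using tvec_inject[OF U x] by (intro the_equality) auto

lemma tvec_tcoord: "v \<in> \<T> A x \<Longrightarrow> tvec A U \<phi> x (tcoord A U \<phi> x v) = v"
  by (erule tangent_tvec[OF U x]) (simp add: tcoord_tvec)

lemma tvec_apply: "f \<in> Cs A \<Longrightarrow> tvec A U \<phi> x w f = \<D> (f \<circ> \<I> U \<phi>) (\<phi> x) w" by (simp add: tvec_def)

lemma tangent_apply: "v \<in> \<T> A x \<Longrightarrow> f \<in> Cs A \<Longrightarrow>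
    v f = \<D> (f \<circ> \<I> U \<phi>) (\<phi> x) (tcoord A U \<phi> x v)"
  using tvec_tcoord[of v] tvec_apply[of f "tcoord A U \<phi> x v"] by simp

lemma tvec_add: "tvec A U \<phi> x (w + w') = tvec A U \<phi> x w \<oplus>\<^bsub>tangent A x\<^esub> tvec A U \<phi> x w'"
proof -
  have "linear (\<D> (f \<circ> \<I> U \<phi>) (\<phi> x))" if "f \<in> Cs A" for f
    by (rule has_derivative_linear[OF Cs_has_derivative[OF that U x]])
  then show ?thesis by (auto simp: tvec_def linear_add)
qed

lemma tvec_scale: "tvec A U \<phi> x (c *\<^sub>R w) = c \<odot>\<^bsub>tangent A x\<^esub> tvec A U \<phi> x w"
proof -
  have "linear (\<D> (f \<circ> \<I> U \<phi>) (\<phi> x))" if "f \<in> Cs A" for f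
    by (rule has_derivative_linear[OF Cs_has_derivative[OF that U x]])
  then show ?thesis by (auto simp: tvec_def linear_scale)
qed

lemma tvec_zero: "tvec A U \<phi> x 0 = \<zero>\<^bsub>tangent A x\<^esub>"
  using tvec_scale[of 0 0] vs_smult_0[OF tangent_vec_space tvec_tangent[OF U x]] by (simp del: tangent_simps)

lemma tcoord_add: "v \<in> \<T> A x \<Longrightarrow> v' \<in> \<T> A x \<Longrightarrow>
    tcoord A U \<phi> x (v \<oplus>\<^bsub>tangent A x\<^esub> v') = tcoord A U \<phi> x v + tcoord A U \<phi> x v'"
  using tcoord_tvec[of "tcoord A U \<phi> x v + tcoord A U \<phi> x v'"]
  by (simp add: tvec_add tvec_tcoord del: tangent_simps)

lemma tcoord_scale: "v \<in> \<T> A x \<Longrightarrow>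
    tcoord A U \<phi> x (c \<odot>\<^bsub>tangent A x\<^esub> v) = c *\<^sub>R tcoord A U \<phi> x v"
  using tcoord_tvec[of "c *\<^sub>R tcoord A U \<phi> x v"] by (simp add: tvec_scale tvec_tcoord del: tangent_simps)

lemma vrep_eq: "vrep A U \<phi> X (\<phi> x) = tcoord A U \<phi> x (X x)" by (simp add: vrep_def chart_inv[OF U x])

end

lemma vfield_tangent: "X \<in> \<X> A \<Longrightarrow> x \<in> points A \<Longrightarrow> X x \<in> \<T> A x" by (auto simp: vfields_iff)

lemma vfield_apply:
  assumes "X \<in> \<X> A" "(U, \<phi>) \<in> A" "x \<in> U" "f \<in> Cs A"
  shows "X x f = \<D> (f \<circ> \<I> U \<phi>) (\<phi> x) (vrep A U \<phi> X (\<phi> x))"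
  using tangent_apply[OF assms(2,3) vfield_tangent[OF assms(1)] assms(4)] vrep_eq[OF assms(2,3)]
    chart_points[OF assms(2)] assms(3) by auto

text \<open>The components of the field are its values on local coordinate functions, and these
  values are smooth by definition of a vector field.\<close>

lemma vrep_smooth:
  assumes X: "X \<in> \<X> A" and U: "(U, \<phi>) \<in> A"
  shows "smooth_on (\<phi> ` U) (vrep A U \<phi> X)"
proof (rule smooth_on_local)
  fix z assume "z \<in> \<phi> ` U"
  then obtain x where x: "x \<in> U" "z = \<phi> x" by auto
  obtain B :: "'e set" where B: "is_basis B" using finite_dim_basis[OF fd] .
  obtain f T where f: "\<And>b. f b \<in> Cs A" "\<And>b. open (T b)" "\<And>b. \<phi> x \<in> T b"
    "\<And>b z. z \<in> T b \<Longrightarrow> \<D> (f b \<circ> \<I> U \<phi>) z = (\<lambda>w. rep B w b)"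
    using coordinate_function[OF U x(1) bounded_linear_representation[OF B]] by metis
  define T' where "T' = \<phi> ` U \<inter> (\<Inter>b\<in>B. T b)"
  have T': "open T'" "z \<in> T'" unfolding T'_def x(2) using f x is_basis_finite[OF B] chart_open[OF U]
    by (auto intro!: open_Int open_INT)
  let ?a = "\<lambda>b. act (points A) X (f b)"
  have s: "smooth_on T' (\<lambda>z. \<Sum>b\<in>B. (?a b \<circ> \<I> U \<phi>) z *\<^sub>R b)"
  proof (intro smooth_on_sum smooth_on_scaleR smooth_on_const T')
    fix b
    have "?a b \<in> Cs A" using X f(1) unfolding vfields_iff by blast
    then show "smooth_on T' (?a b \<circ> \<I> U \<phi>)"
      by (rule smooth_on_subset[OF Cs_smooth_on[OF _ U]]) (auto simp: T'_def)
  qed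
  have "(\<Sum>b\<in>B. (?a b \<circ> \<I> U \<phi>) z *\<^sub>R b) = vrep A U \<phi> X z" if "z \<in> T'" for z
  proof -
    obtain y where y: "y \<in> U" "z = \<phi> y" using \<open>z \<in> T'\<close> unfolding T'_def by blast
    have "(?a b \<circ> \<I> U \<phi>) z = rep B (vrep A U \<phi> X z) b" if "b \<in> B" for b
    proof -
      have "\<phi> y \<in> T b" using \<open>z \<in> T'\<close> that y(2) by (auto simp: T'_def)
      then show ?thesis using vfield_apply[OF X U y(1) f(1)] f(4) y chart_inv[OF U y(1)] chart_points[OF U]
        by (auto simp: act_def)
    qed
    then have "(\<Sum>b\<in>B. (?a b \<circ> \<I> U \<phi>) z *\<^sub>R b) = (\<Sum>b\<in>B. rep B (vrep A U \<phi> X z) b *\<^sub>R b)" by (intro sum.cong) auto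
    then show ?thesis by (simp add: basis_sum[OF B])
  qed
  with s have "smooth_on T' (vrep A U \<phi> X)" by (rule smooth_on_transform[OF _ T'(1)])
  then show "\<exists>T. open T \<and> z \<in> T \<and> smooth_on T (vrep A U \<phi> X)" using T' by blast
qed

lemma vfieldsI_local:
  assumes X: "X \<in> (\<Pi>\<^sub>E x\<in>points A. \<T> A x)"
    and loc: "\<And>x. x \<in> points A \<Longrightarrow> \<exists>U \<phi> T \<xi>. (U, \<phi>) \<in> A \<and> x \<in> U \<and> open T \<and> \<phi> x \<in> T \<and> T \<subseteq> \<phi> ` U \<and> smooth_on T \<xi> \<and>
      (\<forall>y\<in>U. \<phi> y \<in> T \<longrightarrow> X y = tvec A U \<phi> y (\<xi> (\<phi> y)))"
  shows "X \<in> \<X> A" unfolding vfields_iff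
proof (intro conjI X ballI)
  fix f assume f: "f \<in> Cs A"
  show "act (points A) X f \<in> Cs A" unfolding act_def
  proof (intro Cs_restrict smooth_funI_local)
    fix x assume x: "x \<in> points A"
    obtain U \<phi> T \<xi> where U: "(U, \<phi>) \<in> A" "x \<in> U" and T: "open T" "\<phi> x \<in> T" "T \<subseteq> \<phi> ` U"
      and \<xi>: "smooth_on T \<xi>" and \<xi>2: "\<forall>y\<in>U. \<phi> y \<in> T \<longrightarrow> X y = tvec A U \<phi> y (\<xi> (\<phi> y))"
      using loc[OF x] by (elim exE conjE) (rule that; assumption)
    have "smooth_on T (\<lambda>z. \<D> (f \<circ> \<I> U \<phi>) z (\<xi> z))"
      by (rule smooth_on_directional[OF fd T(1) smooth_on_subset[OF Cs_smooth_on[OF f U(1)] T(3)] \<xi>])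
    moreover have "\<D> (f \<circ> \<I> U \<phi>) z (\<xi> z) = ((\<lambda>x. X x f) \<circ> \<I> U \<phi>) z" if "z \<in> T" for z
      using that T(3) \<xi>2 f chart_inv[OF U(1)] by (auto simp: tvec_def)
    ultimately have "smooth_on T ((\<lambda>x. X x f) \<circ> \<I> U \<phi>)" by (rule smooth_on_transform[OF _ T(1)])
    then show "\<exists>U \<phi> T. (U, \<phi>) \<in> A \<and> x \<in> U \<and> open T \<and> \<phi> x \<in> T \<and> smooth_on T ((\<lambda>x. X x f) \<circ> \<I> U \<phi>)"
      using U T by blast
  qed
qed

text \<open>The factor \<rho> stays visible on all of \<open>U\<close>, so that a linear condition
  on \<xi>, such as lying in a distribution, holds for \<open>X\<close> on the whole
  manifold.\<close>

lemma vfield_cutoff: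
  assumes U: "(U, \<phi>) \<in> A" "x \<in> U" and \<xi>: "smooth_on (\<phi> ` U) \<xi>"
  obtains X \<rho> W where "X \<in> \<X> A" "\<And>y. y \<in> U \<Longrightarrow> X y = tvec A U \<phi> y (\<rho> y *\<^sub>R \<xi> (\<phi> y))"
    "\<And>y. y \<in> points A - U \<Longrightarrow> X y = \<zero>\<^bsub>tangent A y\<^esub>"
    "mfd_open A W" "x \<in> W" "W \<subseteq> U" "\<And>y. y \<in> W \<Longrightarrow> \<rho> y = 1"
proof -
  obtain \<rho> N W where *: "\<rho> \<in> Cs A" "mfd_open A N" "points A - U \<subseteq> N" "\<And>y. y \<in> N \<Longrightarrow> \<rho> y = 0"
    "mfd_open A W" "x \<in> W" "W \<subseteq> U" "\<And>y. y \<in> W \<Longrightarrow> \<rho> y = 1" using bump[OF mfd_open_chart[OF U(1)] U(2)] by blast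
  define X where "X = (\<lambda>y\<in>points A. if y \<in> U then tvec A U \<phi> y (\<rho> y *\<^sub>R \<xi> (\<phi> y)) else \<zero>\<^bsub>tangent A y\<^esub>)"
  have "X \<in> \<X> A"
  proof (rule vfieldsI_local)
    show "X \<in> (\<Pi>\<^sub>E x\<in>points A. \<T> A x)"
      using tvec_tangent[OF U(1)] vs_zero[OF tangent_vec_space] by (auto simp: X_def simp del: tangent_simps)
    fix y assume y: "y \<in> points A"
    show "\<exists>U \<phi> T \<xi>. (U, \<phi>) \<in> A \<and> y \<in> U \<and> open T \<and> \<phi> y \<in> T \<and> T \<subseteq> \<phi> ` U \<and> smooth_on T \<xi> \<and>
      (\<forall>y\<in>U. \<phi> y \<in> T \<longrightarrow> X y = tvec A U \<phi> y (\<xi> (\<phi> y)))"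
    proof (cases "y \<in> U")
      case True
      have "smooth_on (\<phi> ` U) (\<lambda>z. (\<rho> \<circ> \<I> U \<phi>) z *\<^sub>R \<xi> z)"
        by (intro smooth_on_scaleR chart_open[OF U(1)] Cs_smooth_on[OF *(1) U(1)] \<xi>)
      then show ?thesis using True U(1) chart_open[OF U(1)] chart_points[OF U(1)] chart_inv[OF U(1)]
        by (intro exI[of _ U] exI[of _ \<phi>] exI[of _ "\<phi> ` U"] exI[of _ "\<lambda>z. (\<rho> \<circ> \<I> U \<phi>) z *\<^sub>R \<xi> z"])
          (auto simp: X_def)
    next
      case False
      then have yN: "y \<in> N" using y * by auto
      obtain V \<psi> where V: "(V, \<psi>) \<in> A" "y \<in> V" using points_chart[OF y] by blast
      have "X y' = tvec A V \<psi> y' 0" if "y' \<in> V" "\<psi> y' \<in> \<psi> ` (V \<inter> N)" for y'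
      proof -
        have "y' \<in> N" using that chart_inj[OF V(1)] by (auto simp: inj_on_def)
        then have "X y' = \<zero>\<^bsub>tangent A y'\<^esub>"
          using that chart_points[OF V(1)] *(4) tvec_zero[OF U(1)] by (auto simp: X_def simp del: tangent_simps)
        then show ?thesis using tvec_zero[OF V(1) that(1)] by (simp del: tangent_simps)
      qed
      then show ?thesis using V yN chart_open_Int[OF *(2) V(1)] smooth_on_const
        by (intro exI[of _ V] exI[of _ \<psi>] exI[of _ "\<psi> ` (V \<inter> N)"] exI[of _ "\<lambda>_. 0"]) auto
    qed
  qed
  moreover have "X y = tvec A U \<phi> y (\<rho> y *\<^sub>R \<xi> (\<phi> y))" if "y \<in> U" for y
    using that chart_points[OF U(1)] by (auto simp: X_def)
  moreover have "X y = \<zero>\<^bsub>tangent A y\<^esub>" if "y \<in> points A - U" for y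
    using that by (auto simp: X_def simp del: tangent_simps)
  ultimately show ?thesis using *(5-8) that by blast
qed

lemma act_Cs: "X \<in> \<X> A \<Longrightarrow> f \<in> Cs A \<Longrightarrow> act (points A) X f \<in> Cs A" by (simp add: vfields_iff)

lemma tangent_diff: "v \<in> \<T> A x \<Longrightarrow> f \<in> Cs A \<Longrightarrow> g \<in> Cs A \<Longrightarrow> v (\<lambda>y\<in>points A. f y - g y) = v f - v g"
proof -
  assume *: "v \<in> \<T> A x" "f \<in> Cs A" "g \<in> Cs A"
  let ?h = "\<lambda>y\<in>points A. f y - g y"
  have "(\<lambda>y\<in>points A. ?h y + g y) = f" using * by (auto simp: Cs_iff extensional_def fun_eq_iff)
  moreover have "v (\<lambda>y\<in>points A. ?h y + g y) = v ?h + v g"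
    using *(1,3) Cs_diff[OF *(2,3)] unfolding tangent_iff by blast
  ultimately show ?thesis by simp
qed

lemma vf_bracket_apply:
  "x \<in> points A \<Longrightarrow> f \<in> Cs A \<Longrightarrow>
    vf_bracket A X Y x f = X x (act (points A) Y f) - Y x (act (points A) X f)" by (simp add: vf_bracket_def)

lemma vf_bracket_vfield:
  assumes X: "X \<in> \<X> A" and Y: "Y \<in> \<X> A"
  shows "vf_bracket A X Y \<in> \<X> A"
proof -
  let ?P = "points A"
  have der: "Z x (\<lambda>y\<in>?P. f y + g y) = Z x f + Z x g" "Z x (\<lambda>y\<in>?P. c * f y) = c * Z x f"
    "Z x (\<lambda>y\<in>?P. f y * g y) = f x * Z x g + g x * Z x f"
    if "Z \<in> \<X> A" "x \<in> ?P" "f \<in> Cs A" "g \<in> Cs A" for Z x f g c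
    using vfield_tangent[OF that(1,2)] that(3,4) unfolding tangent_iff by auto
  have act: "act ?P Z (\<lambda>y\<in>?P. f y + g y) = (\<lambda>y\<in>?P. act ?P Z f y + act ?P Z g y)"
    "act ?P Z (\<lambda>y\<in>?P. c * f y) = (\<lambda>y\<in>?P. c * act ?P Z f y)"
    "act ?P Z (\<lambda>y\<in>?P. f y * g y) = (\<lambda>y\<in>?P. f y * act ?P Z g y + g y * act ?P Z f y)"
    if "Z \<in> \<X> A" "f \<in> Cs A" "g \<in> Cs A" for Z f g c
    unfolding act_def using der[OF that(1) _ that(2,3)] by (auto simp: fun_eq_iff)
  note cl = act_Cs Cs_add Cs_mult Cs_scale
  \<comment> \<open>Second-order product rule: the terms with one derivative on each factor are
    symmetric in \<open>W\<close> and \<open>Z\<close>, which is why the commutator is again a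
    derivation.\<close>
  have dact: "W x (\<lambda>y\<in>?P. f y * act ?P Z g y + g y * act ?P Z f y) =
      f x * W x (act ?P Z g) + act ?P Z g x * W x f + (g x * W x (act ?P Z f) + act ?P Z f x * W x g)"
    if "W \<in> \<X> A" "Z \<in> \<X> A" "x \<in> ?P" "f \<in> Cs A" "g \<in> Cs A" for W Z x f g
  proof -
    have "(\<lambda>y\<in>?P. f y * act ?P Z g y + g y * act ?P Z f y) =
        (\<lambda>y\<in>?P. (\<lambda>y\<in>?P. f y * act ?P Z g y) y + (\<lambda>y\<in>?P. g y * act ?P Z f y) y)" by auto
    then show ?thesis using that by (simp only: der(1)[OF that(1,3) Cs_mult Cs_mult] der(3) act_Cs)
  qed
  have "vf_bracket A X Y x \<in> \<T> A x" if x: "x \<in> ?P" for x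
  proof -
    have 1: "vf_bracket A X Y x (\<lambda>y\<in>?P. f y + g y) = vf_bracket A X Y x f + vf_bracket A X Y x g"
      if f: "f \<in> Cs A" "g \<in> Cs A" for f g using f x X Y by (simp add: vf_bracket_apply cl act der)
    have 2: "vf_bracket A X Y x (\<lambda>y\<in>?P. c * f y) = c * vf_bracket A X Y x f"
      if f: "f \<in> Cs A" for f c using f x X Y by (simp add: vf_bracket_apply cl act der algebra_simps)
    have 3: "vf_bracket A X Y x (\<lambda>y\<in>?P. f y * g y) = f x * vf_bracket A X Y x g + g x * vf_bracket A X Y x f"
      if f: "f \<in> Cs A" "g \<in> Cs A" for f g
    proof -
      have a: "act ?P Z f x = Z x f" for Z f using x by (simp add: act_def)
      show ?thesis using f x X Y by (simp add: vf_bracket_apply cl act(3) dact a algebra_simps)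
    qed
    show ?thesis unfolding tangent_iff using 1 2 3 x by (auto simp: vf_bracket_def)
  qed
  then have "vf_bracket A X Y \<in> (\<Pi>\<^sub>E x\<in>?P. \<T> A x)" by (auto simp: vf_bracket_def)
  moreover have "act ?P (vf_bracket A X Y) f \<in> Cs A" if f: "f \<in> Cs A" for f
  proof -
    have "act ?P (vf_bracket A X Y) f = (\<lambda>y\<in>?P. act ?P X (act ?P Y f) y - act ?P Y (act ?P X f) y)"
      using f by (auto simp: act_def vf_bracket_def fun_eq_iff)
    then show ?thesis by (simp only: Cs_diff[OF act_Cs[OF X act_Cs[OF Y f]] act_Cs[OF Y act_Cs[OF X f]]])
  qed
  ultimately show ?thesis unfolding vfields_iff by blast
qed

text \<open>Tested on functions that are linear in the chart near \<open>x\<close>: their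
  differential is constant, so \<open>Z (Z' f)\<close> is the derivative of a component of
  \<open>Z'\<close> along \<open>Z\<close>.\<close>

lemma vf_bracket_coord:
  assumes X: "X \<in> \<X> A" and Y: "Y \<in> \<X> A" and U: "(U, \<phi>) \<in> A" "x \<in> U"
  shows "tcoord A U \<phi> x (vf_bracket A X Y x) =
    \<D> (vrep A U \<phi> Y) (\<phi> x) (vrep A U \<phi> X (\<phi> x)) -
    \<D> (vrep A U \<phi> X) (\<phi> x) (vrep A U \<phi> Y (\<phi> x))" (is "?l = ?r")
proof -
  obtain B :: "'e set" where B: "is_basis B" using finite_dim_basis[OF fd] .
  have xP: "x \<in> points A" using U chart_points by blast
  show ?thesis
  proof (rule basis_eqI[OF B])
    fix b
    note bl = bounded_linear_representation[OF B, of b]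
    obtain f T where f: "f \<in> Cs A" "open T" "\<phi> x \<in> T" "T \<subseteq> \<phi> ` U"
      "\<forall>z\<in>T. \<D> (f \<circ> \<I> U \<phi>) z = (\<lambda>w. rep B w b)" using coordinate_function[OF U bl] by blast
    have iter: "Z x (act (points A) Z' f) =
        rep B (\<D> (vrep A U \<phi> Z') (\<phi> x) (vrep A U \<phi> Z (\<phi> x))) b"
      if Z: "Z \<in> \<X> A" "Z' \<in> \<X> A" for Z Z'
    proof -
      have eq: "(act (points A) Z' f \<circ> \<I> U \<phi>) z = rep B (vrep A U \<phi> Z' z) b" if "z \<in> T" for z
      proof -
        obtain y where y: "y \<in> U" "z = \<phi> y" using f(4) \<open>z \<in> T\<close> by blast
        then show ?thesis
          using vfield_apply[OF Z(2) U(1) y(1) f(1)] f(5) \<open>z \<in> T\<close> chart_inv[OF U(1)] chart_points[OF U(1)]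
          by (auto simp: act_def)
      qed
      have hd: "(vrep A U \<phi> Z' has_derivative \<D> (vrep A U \<phi> Z') (\<phi> x)) (at (\<phi> x))"
        by (rule smooth_on_hd[OF vrep_smooth[OF Z(2) U(1)]]) (use U in auto)
      have "\<D> (act (points A) Z' f \<circ> \<I> U \<phi>) (\<phi> x) =
          \<D> (\<lambda>z. rep B (vrep A U \<phi> Z' z) b) (\<phi> x)" by (rule frechet_derivative_cong[OF f(2,3) eq])
      also have "\<dots> = (\<lambda>w. rep B (\<D> (vrep A U \<phi> Z') (\<phi> x) w) b)"
        by (rule frechet_derivative_at[symmetric, OF bounded_linear.has_derivative[OF bl hd]])
      finally show ?thesis using vfield_apply[OF Z(1) U act_Cs[OF Z(2) f(1)]] by simp
    qed
    have "rep B ?l b = vf_bracket A X Y x f"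
      using tangent_apply[OF U vfield_tangent[OF vf_bracket_vfield[OF X Y] xP] f(1)] f(3,5) by simp
    also have "\<dots> = rep B ?r b" using xP f(1) iter[OF X Y] iter[OF Y X]
      by (simp add: vf_bracket_apply linear_diff[OF bounded_linear.linear[OF bl]])
    finally show "rep B ?l b = rep B ?r b" .
  qed
qed

lemma vf_bracket_jacobi:
  assumes X: "X \<in> \<X> A" and Y: "Y \<in> \<X> A" and Z: "Z \<in> \<X> A"
    and x: "x \<in> points A" and f: "f \<in> Cs A"
  shows "vf_bracket A X (vf_bracket A Y Z) x f + vf_bracket A Y (vf_bracket A Z X) x f +
    vf_bracket A Z (vf_bracket A X Y) x f = 0"
proof -
  let ?P = "points A"
  have "act ?P (vf_bracket A V W) f = (\<lambda>y\<in>?P. act ?P V (act ?P W f) y - act ?P W (act ?P V f) y)" for V W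
    using f by (auto simp: act_def vf_bracket_def fun_eq_iff)
  then have e: "V x (act ?P (vf_bracket A V' W) f) = V x (act ?P V' (act ?P W f)) - V x (act ?P W (act ?P V' f))"
    if "V \<in> \<X> A" "V' \<in> \<X> A" "W \<in> \<X> A" for V V' W
    using tangent_diff[OF vfield_tangent[OF that(1) x] act_Cs[OF that(2) act_Cs[OF that(3) f]]
        act_Cs[OF that(3) act_Cs[OF that(2) f]]] by simp
  show ?thesis using X Y Z by (simp add: vf_bracket_apply[OF x] f act_Cs e)
qed

end

section \<open>One-dimensional spaces\<close>

context
  fixes V :: "(real, 'v) module" (structure) and b :: 'v
  assumes V: "vec_space V" and one: "one_dimensional V" and b: "b \<in> carrier V" "b \<noteq> \<zero>"
begin

lemma line_ex:
  assumes w: "w \<in> carrier V"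
  shows "\<exists>c. w = c \<odot> b"
proof -
  obtain b0 where b0: "b0 \<in> carrier V" "\<forall>w\<in>carrier V. \<exists>c. w = c \<odot> b0"
    using one unfolding one_dimensional_def by blast
  obtain c0 where c0: "b = c0 \<odot> b0" using b0(2) b(1) by blast
  have "c0 \<noteq> 0" using c0 b(2) vs_smult_0[OF V b0(1)] by auto
  obtain d where d: "w = d \<odot> b0" using b0(2) w by blast
  have "(d / c0) \<odot> b = ((d / c0) * c0) \<odot> b0" using vs_smult_assoc[OF V b0(1), of "d / c0" c0] c0 by simp
  then have "w = (d / c0) \<odot> b" using d \<open>c0 \<noteq> 0\<close> by simp
  then show ?thesis by blast
qed

lemma line_inj:
  assumes "c \<odot> b = d \<odot> b" shows "c = d"
proof (rule ccontr)
  assume ne: "c \<noteq> d"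
  have "(c - d) \<odot> b = c \<odot> b \<oplus> (- d) \<odot> b" using vs_distr_l[OF V b(1), of c "- d"] by simp
  also have "\<dots> = (d + - d) \<odot> b" unfolding assms by (rule vs_distr_l[OF V b(1), symmetric])
  also have "\<dots> = \<zero>" using vs_smult_0[OF V b(1)] by simp
  finally have z: "(c - d) \<odot> b = \<zero>" .
  have "b = (1 / (c - d) * (c - d)) \<odot> b" using ne vs_one[OF V b(1)] by simp
  also have "\<dots> = (1 / (c - d)) \<odot> ((c - d) \<odot> b)" by (rule vs_smult_assoc[OF V b(1)])
  also have "\<dots> = \<zero>" unfolding z by (rule vs_smult_zero[OF V])
  finally show False using b(2) by simp
qed

lemma coord_smult: "coord V b (c \<odot> b) = c" unfolding coord_def by (rule the_equality) (auto dest: line_inj)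

lemma coord_eq: "w \<in> carrier V \<Longrightarrow> coord V b w \<odot> b = w" using line_ex[of w] coord_smult by auto

lemma coord_add:
  assumes "w \<in> carrier V" "w' \<in> carrier V"
  shows "coord V b (w \<oplus> w') = coord V b w + coord V b w'"
proof -
  have "w \<oplus> w' = (coord V b w + coord V b w') \<odot> b"
    using coord_eq[OF assms(1)] coord_eq[OF assms(2)] vs_distr_l[OF V b(1)] by simp
  then show ?thesis by (simp add: coord_smult)
qed

lemma coord_scale:
  assumes "w \<in> carrier V"
  shows "coord V b (c \<odot> w) = c * coord V b w"
proof -
  have "c \<odot> w = (c * coord V b w) \<odot> b" using coord_eq[OF assms] vs_smult_assoc[OF V b(1)] by simp
  then show ?thesis by (simp add: coord_smult)
qed

lemma coord_zero: "coord V b \<zero> = 0" using coord_smult[of 0] vs_smult_0[OF V b(1)] by simp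

lemma coord_inject: "w \<in> carrier V \<Longrightarrow> w' \<in> carrier V \<Longrightarrow> coord V b w = coord V b w' \<Longrightarrow> w = w'"
  by (drule arg_cong[where f = "\<lambda>c. c \<odot> b"]) (simp only: coord_eq)

lemma coord_minus:
  assumes "w \<in> carrier V" "w' \<in> carrier V"
  shows "coord V b (w \<ominus> w') = coord V b w - coord V b w'"
  using assms by (simp add: vs_minus[OF V] coord_add coord_scale vs_smult[OF V])

end

lemma coord_change:
  assumes "vec_space V" "one_dimensional V" "b \<in> carrier V" "b \<noteq> \<zero>\<^bsub>V\<^esub>" "b' \<in> carrier V" "b' \<noteq> \<zero>\<^bsub>V\<^esub>" "w \<in> carrier V"
  shows "coord V b' w = coord V b w * coord V b' b"
  using coord_scale[OF assms(1,2,5,6,3), of "coord V b w"] coord_eq[OF assms(1-4,7)] by simp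

section \<open>Line bundles\<close>

definition srep where
  "srep L U \<phi> e s = (\<lambda>y. crd L e y (s y)) \<circ> \<I> U \<phi>"

text \<open>The derivation \<open>s |-> c s + ds(w)\<close> at \<open>x\<close>, in a chart and a
  frame. By \<open>der_dvec\<close> these exhaust \<open>D_xL\<close>.\<close>

definition dvec where
  "dvec L U \<phi> e x c w = (\<lambda>s\<in>\<Gamma> L. (c * srep L U \<phi> e s (\<phi> x) + \<D> (srep L U \<phi> e s) (\<phi> x) w)
     \<odot>\<^bsub>fibre L x\<^esub> e x)"

lemma sections_simps [simp]:
  "zero (sections L) = (\<lambda>x\<in>pts L. \<zero>\<^bsub>fibre L x\<^esub>)"
  "add (sections L) = (\<lambda>s r. \<lambda>x\<in>pts L. s x \<oplus>\<^bsub>fibre L x\<^esub> r x)"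
  "smult (sections L) = (\<lambda>c s. \<lambda>x\<in>pts L. c \<odot>\<^bsub>fibre L x\<^esub> s x)" by (simp_all add: sections_def)

lemma sections_iff: "s \<in> \<Gamma> L \<longleftrightarrow> s \<in> (\<Pi>\<^sub>E x\<in>pts L. \<F> L x) \<and>
    (\<forall>(U, e)\<in>frames L. smooth_fun (base L) U (\<lambda>x. crd L e x (s x)))" by (simp add: sections_def)

lemma der_space_simps [simp]:
  "zero (der_space L x) = (\<lambda>s\<in>\<Gamma> L. \<zero>\<^bsub>fibre L x\<^esub>)"
  "add (der_space L x) = (\<lambda>a b. \<lambda>s\<in>\<Gamma> L. a s \<oplus>\<^bsub>fibre L x\<^esub> b s)"
  "smult (der_space L x) = (\<lambda>c a. \<lambda>s\<in>\<Gamma> L. c \<odot>\<^bsub>fibre L x\<^esub> a s)" by (simp_all add: der_space_def)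

lemma jet_space_simps [simp]:
  "zero (jet_space L x) = (\<lambda>a\<in>\<L> L x. \<zero>\<^bsub>fibre L x\<^esub>)"
  "add (jet_space L x) = (\<lambda>\<alpha> \<beta>. \<lambda>a\<in>\<L> L x. \<alpha> a \<oplus>\<^bsub>fibre L x\<^esub> \<beta> a)"
  "smult (jet_space L x) = (\<lambda>c \<alpha>. \<lambda>a\<in>\<L> L x. c \<odot>\<^bsub>fibre L x\<^esub> \<alpha> a)" by (simp_all add: jet_space_def)

lemma der_space_iff: "a \<in> \<L> L x \<longleftrightarrow> a \<in> extensional (\<Gamma> L) \<and>
    lin_map (sections L) (fibre L x) a \<and>
    (\<exists>\<delta>\<in>\<T> (base L) x. \<forall>f\<in>Cs (base L). \<forall>s\<in>\<Gamma> L.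
      a (fmult (pts L) (fibre L) f s) = f x \<odot>\<^bsub>fibre L x\<^esub> a s \<oplus>\<^bsub>fibre L x\<^esub> \<delta> f \<odot>\<^bsub>fibre L x\<^esub> s x)"
  by (simp add: der_space_def lin_maps_def)

lemma jet_space_iff: "\<alpha> \<in> \<J> L x \<longleftrightarrow> \<alpha> \<in> extensional (\<L> L x) \<and>
    lin_map (der_space L x) (fibre L x) \<alpha>" by (simp add: jet_space_def lin_maps_def)

lemma lin_mapD:
  assumes "lin_map V W F"
  shows "v \<in> carrier V \<Longrightarrow> F v \<in> carrier W"
    "u \<in> carrier V \<Longrightarrow> v \<in> carrier V \<Longrightarrow> F (u \<oplus>\<^bsub>V\<^esub> v) = F u \<oplus>\<^bsub>W\<^esub> F v"
    "v \<in> carrier V \<Longrightarrow> F (c \<odot>\<^bsub>V\<^esub> v) = c \<odot>\<^bsub>W\<^esub> F v" using assms unfolding lin_map_def by auto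

locale lbundle =
  fixes L :: "('m, 'e::real_normed_vector, 'v) line_bundle"
  assumes lb: "is_line_bundle L"

sublocale lbundle \<subseteq> manifold "base L"
  using lb unfolding is_line_bundle_def by (intro smooth_manifold_manifold) blast

context lbundle
begin

lemma fibre_vs: "x \<in> pts L \<Longrightarrow> vec_space (fibre L x)"
  and fibre_one: "x \<in> pts L \<Longrightarrow> one_dimensional (fibre L x)" using lb unfolding is_line_bundle_def by auto

lemma frame_ex: "x \<in> pts L \<Longrightarrow> \<exists>V e. (V, e) \<in> frames L \<and> x \<in> V" using lb unfolding is_line_bundle_def by fast

lemma frame_open: "(V, e) \<in> frames L \<Longrightarrow> mfd_open (base L) V" using lb unfolding is_line_bundle_def by fast

lemma frame_points: "(V, e) \<in> frames L \<Longrightarrow> x \<in> V \<Longrightarrow> x \<in> pts L" using frame_open mfd_open_subset by blast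

lemma frame_carrier: "(V, e) \<in> frames L \<Longrightarrow> x \<in> V \<Longrightarrow> e x \<in> \<F> L x" using lb unfolding is_line_bundle_def by fast

lemma frame_nonzero: "(V, e) \<in> frames L \<Longrightarrow> x \<in> V \<Longrightarrow> e x \<noteq> \<zero>\<^bsub>fibre L x\<^esub>" using lb unfolding is_line_bundle_def by fast

lemma frame_transition: "(V, e) \<in> frames L \<Longrightarrow> (V', e') \<in> frames L \<Longrightarrow>
    smooth_fun (base L) (V \<inter> V') (\<lambda>x. crd L e x (e' x))" using lb unfolding is_line_bundle_def by fast

context
  fixes V e x
  assumes fr: "(V, e) \<in> frames L" and x: "x \<in> V"
begin

lemmas frame_line = fibre_vs[OF frame_points[OF fr x]] fibre_one[OF frame_points[OF fr x]]
  frame_carrier[OF fr x] frame_nonzero[OF fr x]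
lemmas crd_smult = coord_smult[OF frame_line]
lemmas crd_eq = coord_eq[OF frame_line]
lemmas crd_add = coord_add[OF frame_line]
lemmas crd_scale = coord_scale[OF frame_line]
lemmas crd_zero = coord_zero[OF frame_line]
lemmas crd_inject = coord_inject[OF frame_line]
lemmas crd_minus = coord_minus[OF frame_line]
lemmas crd_inj = line_inj[OF frame_line]
lemmas frame_smult = vs_smult[OF fibre_vs[OF frame_points[OF fr x]] frame_carrier[OF fr x]]
lemmas frame_distr = vs_distr_l[OF fibre_vs[OF frame_points[OF fr x]] frame_carrier[OF fr x]]
lemmas frame_assoc = vs_smult_assoc[OF fibre_vs[OF frame_points[OF fr x]] frame_carrier[OF fr x]]
lemmas frame_0 = vs_smult_0[OF fibre_vs[OF frame_points[OF fr x]] frame_carrier[OF fr x]]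
lemmas frame_1 = vs_one[OF fibre_vs[OF frame_points[OF fr x]] frame_carrier[OF fr x]]

lemma crd_change:
  assumes fr': "(V', e') \<in> frames L" "x \<in> V'" and w: "w \<in> \<F> L x"
  shows "crd L e' x w = crd L e x w * crd L e' x (e x)"
  by (rule coord_change[OF frame_line frame_carrier[OF fr'] frame_nonzero[OF fr'] w])

end

lemma sec_carrier: "s \<in> \<Gamma> L \<Longrightarrow> x \<in> pts L \<Longrightarrow> s x \<in> \<F> L x" by (auto simp: sections_iff)

lemma sec_smooth: "s \<in> \<Gamma> L \<Longrightarrow> (V, e) \<in> frames L \<Longrightarrow> smooth_fun (base L) V (\<lambda>x. crd L e x (s x))"
  by (auto simp: sections_iff)

lemma sec_ext: "s \<in> \<Gamma> L \<Longrightarrow> s \<in> extensional (pts L)" by (auto simp: sections_iff PiE_def)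

lemma sec_eqI: "s \<in> \<Gamma> L \<Longrightarrow> t \<in> \<Gamma> L \<Longrightarrow> (\<And>x. x \<in> pts L \<Longrightarrow> s x = t x) \<Longrightarrow> s = t" using sec_ext by (meson extensionalityI)

text \<open>One frame around each point suffices, as a change of frame multiplies the coordinate by
  a smooth transition function.\<close>

lemma sectionI_local:
  assumes s: "\<And>x. x \<in> pts L \<Longrightarrow> s x \<in> \<F> L x" "s \<in> extensional (pts L)"
    and loc: "\<And>x. x \<in> pts L \<Longrightarrow> \<exists>V e W. (V, e) \<in> frames L \<and> mfd_open (base L) W \<and> x \<in> W \<and> W \<subseteq> V \<and>
      smooth_fun (base L) W (\<lambda>x. crd L e x (s x))"
  shows "s \<in> \<Gamma> L"
proof -
  have "smooth_fun (base L) V' (\<lambda>x. crd L e' x (s x))" if fr': "(V', e') \<in> frames L" for V' e'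
  proof (rule smooth_fun_patch)
    fix x assume x: "x \<in> V'"
    obtain V e W where fr: "(V, e) \<in> frames L" and W: "mfd_open (base L) W" "x \<in> W" "W \<subseteq> V"
      "smooth_fun (base L) W (\<lambda>x. crd L e x (s x))" using loc[OF frame_points[OF fr' x]] by blast
    have o: "mfd_open (base L) (W \<inter> V')" by (rule mfd_open_Int[OF W(1) frame_open[OF fr']])
    have "smooth_fun (base L) (W \<inter> V') (\<lambda>x. crd L e x (s x) * crd L e' x (e x))"
      by (rule smooth_fun_mult[OF o smooth_fun_subset[OF W(4)] smooth_fun_subset[OF frame_transition[OF fr' fr]]])
        (use W in auto)
    then have "smooth_fun (base L) (W \<inter> V') (\<lambda>x. crd L e' x (s x))"
    proof (rule smooth_fun_cong[OF o, rotated])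
      fix y assume y: "y \<in> W \<inter> V'"
      then have yV: "y \<in> V" "y \<in> V'" using W by auto
      show "crd L e y (s y) * crd L e' y (e y) = crd L e' y (s y)"
        using crd_change[OF fr yV(1) fr' yV(2) s(1)[OF frame_points[OF fr yV(1)]]] by simp
    qed
    then show "\<exists>W'. mfd_open (base L) W' \<and> x \<in> W' \<and> smooth_fun (base L) W' (\<lambda>x. crd L e' x (s x))"
      using o x W by blast
  qed
  moreover have "s \<in> (\<Pi>\<^sub>E x\<in>pts L. \<F> L x)" using s by (simp add: PiE_iff)
  ultimately show ?thesis unfolding sections_iff by blast
qed

lemma sec_add: "s \<in> \<Gamma> L \<Longrightarrow> t \<in> \<Gamma> L \<Longrightarrow> (\<lambda>x\<in>pts L. s x \<oplus>\<^bsub>fibre L x\<^esub> t x) \<in> \<Gamma> L"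
  and sec_scale: "s \<in> \<Gamma> L \<Longrightarrow> (\<lambda>x\<in>pts L. c \<odot>\<^bsub>fibre L x\<^esub> s x) \<in> \<Gamma> L"
  and sec_zero: "(\<lambda>x\<in>pts L. \<zero>\<^bsub>fibre L x\<^esub>) \<in> \<Gamma> L"
  and sec_fmult: "s \<in> \<Gamma> L \<Longrightarrow> f \<in> Cs (base L) \<Longrightarrow> fmult (pts L) (fibre L) f s \<in> \<Gamma> L"
proof -
  \<comment> \<open>Common scheme of the four claims: in each frame the coordinate of the new
    section is a given smooth expression \<open>g e\<close>.\<close>
  have *: "t \<in> \<Gamma> L" if "\<And>x. x \<in> pts L \<Longrightarrow> t x \<in> \<F> L x" "t \<in> extensional (pts L)"
    "\<And>V e. (V, e) \<in> frames L \<Longrightarrow> smooth_fun (base L) V (g e)"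
    "\<And>V e x. (V, e) \<in> frames L \<Longrightarrow> x \<in> V \<Longrightarrow> g e x = crd L e x (t x)" for t g
  proof -
    have "smooth_fun (base L) V (\<lambda>x. crd L e x (t x))" if fr: "(V, e) \<in> frames L" for V e
      by (rule smooth_fun_cong[OF frame_open[OF fr] _ \<open>\<And>V e. (V, e) \<in> frames L \<Longrightarrow> smooth_fun (base L) V (g e)\<close>[OF fr]])
        (use \<open>\<And>V e x. (V, e) \<in> frames L \<Longrightarrow> x \<in> V \<Longrightarrow> g e x = crd L e x (t x)\<close>[OF fr] in auto)
    then show ?thesis using that(1,2) by (auto simp: sections_iff PiE_def)
  qed
  show "s \<in> \<Gamma> L \<Longrightarrow> t \<in> \<Gamma> L \<Longrightarrow> (\<lambda>x\<in>pts L. s x \<oplus>\<^bsub>fibre L x\<^esub> t x) \<in> \<Gamma> L"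
    by (rule *[where g = "\<lambda>e x. crd L e x (s x) + crd L e x (t x)"])
      (auto intro!: vs_add fibre_vs smooth_fun_add frame_open sec_smooth
        simp: crd_add sec_carrier frame_points)
  show "s \<in> \<Gamma> L \<Longrightarrow> (\<lambda>x\<in>pts L. c \<odot>\<^bsub>fibre L x\<^esub> s x) \<in> \<Gamma> L" by (rule *[where g = "\<lambda>e x. c * crd L e x (s x)"])
      (auto intro!: vs_smult fibre_vs smooth_fun_mult smooth_fun_const frame_open sec_smooth
        simp: crd_scale sec_carrier frame_points)
  show "(\<lambda>x\<in>pts L. \<zero>\<^bsub>fibre L x\<^esub>) \<in> \<Gamma> L" by (rule *[where g = "\<lambda>e x. 0"])
      (auto intro!: vs_zero fibre_vs smooth_fun_const frame_open simp: crd_zero frame_points)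
  have fs: "smooth_fun (base L) V f" if "f \<in> Cs (base L)" "(V, e) \<in> frames L" for V e f
    by (rule Cs_smooth[OF that(1)]) (use frame_points[OF that(2)] in blast)
  show "s \<in> \<Gamma> L \<Longrightarrow> f \<in> Cs (base L) \<Longrightarrow> fmult (pts L) (fibre L) f s \<in> \<Gamma> L" unfolding fmult_def
    by (rule *[where g = "\<lambda>e x. f x * crd L e x (s x)"])
      (auto intro!: vs_smult fibre_vs smooth_fun_mult[OF frame_open fs sec_smooth]
        simp: crd_scale sec_carrier frame_points)
qed

lemma sections_vec_space: "vec_space (sections L)"
proof -
  have e: "sections L = fun_space (pts L) (fibre L) (\<Gamma> L)" by (simp add: sections_def)
  have "vec_space (fun_space (pts L) (fibre L) (\<Gamma> L))"
  proof (rule fun_space_vec_space)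
    show "\<Gamma> L \<subseteq> (\<Pi>\<^sub>E i\<in>pts L. \<F> L i)" by (auto simp: sections_iff)
  qed (simp_all only: fibre_vs sec_add sec_scale sec_zero)
  then show ?thesis using e by simp
qed

lemma section_glue:
  assumes fr: "(V, e) \<in> frames L" and W: "mfd_open (base L) W" "W \<subseteq> V" and h: "smooth_fun (base L) W h"
    and \<rho>: "\<rho> \<in> Cs (base L)" and N: "mfd_open (base L) N" "pts L - W \<subseteq> N" "\<And>y. y \<in> N \<Longrightarrow> \<rho> y = 0"
  shows "(\<lambda>y\<in>pts L. if y \<in> W then (\<rho> y * h y) \<odot>\<^bsub>fibre L y\<^esub> e y else \<zero>\<^bsub>fibre L y\<^esub>) \<in> \<Gamma> L" (is "?s \<in> _")
proof (rule sectionI_local)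
  show "?s y \<in> \<F> L y" if "y \<in> pts L" for y
    using that vs_smult[OF fibre_vs[OF that] frame_carrier[OF fr]] W(2) vs_zero[OF fibre_vs[OF that]] by auto
  show "?s \<in> extensional (pts L)" by simp
  fix x assume x: "x \<in> pts L"
  show "\<exists>V e W. (V, e) \<in> frames L \<and> mfd_open (base L) W \<and> x \<in> W \<and> W \<subseteq> V \<and>
      smooth_fun (base L) W (\<lambda>x. crd L e x (?s x))"
  proof (cases "x \<in> W")
    case True
    have "smooth_fun (base L) W (\<lambda>y. \<rho> y * h y)" by (intro smooth_fun_mult W h Cs_smooth \<rho> mfd_open_subset)
    then have "smooth_fun (base L) W (\<lambda>x. crd L e x (?s x))" by (rule smooth_fun_cong[OF W(1), rotated])
        (use W crd_smult[OF fr] mfd_open_subset[OF W(1)] in auto)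
    then show ?thesis using fr W True by blast
  next
    case False
    then have xN: "x \<in> N" using N x by blast
    obtain V' e' where fr': "(V', e') \<in> frames L" "x \<in> V'" using frame_ex[OF x] by blast
    have o: "mfd_open (base L) (V' \<inter> N)" by (rule mfd_open_Int[OF frame_open[OF fr'(1)] N(1)])
    have "smooth_fun (base L) (V' \<inter> N) (\<lambda>x. crd L e' x (?s x))"
    proof (rule smooth_fun_cong[OF o _ smooth_fun_const[OF o, of 0]])
      fix y assume y: "y \<in> V' \<inter> N"
      then have yP: "y \<in> pts L" using frame_points[OF fr'(1)] by blast
      have "?s y = \<zero>\<^bsub>fibre L y\<^esub>" using yP y N(3) frame_0[OF fr] W(2) by auto
      then show "0 = crd L e' y (?s y)" using crd_zero[OF fr'(1)] y by simp
    qed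
    then show ?thesis using fr' o xN by blast
  qed
qed

lemma local_section:
  assumes fr: "(V, e) \<in> frames L" and W: "mfd_open (base L) W" "x \<in> W" "W \<subseteq> V" and h: "smooth_fun (base L) W h"
  shows "\<exists>s W'. s \<in> \<Gamma> L \<and> mfd_open (base L) W' \<and> x \<in> W' \<and> W' \<subseteq> W \<and> (\<forall>y\<in>W'. s y = h y \<odot>\<^bsub>fibre L y\<^esub> e y)"
proof -
  obtain \<rho> N W' where *: "\<rho> \<in> Cs (base L)" "mfd_open (base L) N" "pts L - W \<subseteq> N" "\<And>y. y \<in> N \<Longrightarrow> \<rho> y = 0"
    "mfd_open (base L) W'" "x \<in> W'" "W' \<subseteq> W" "\<And>y. y \<in> W' \<Longrightarrow> \<rho> y = 1" using bump[OF W(1,2)] by blast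
  let ?s = "\<lambda>y\<in>pts L. if y \<in> W then (\<rho> y * h y) \<odot>\<^bsub>fibre L y\<^esub> e y else \<zero>\<^bsub>fibre L y\<^esub>"
  have "?s \<in> \<Gamma> L" by (rule section_glue[OF fr W(1,3) h *(1-4)])
  moreover have "\<forall>y\<in>W'. ?s y = h y \<odot>\<^bsub>fibre L y\<^esub> e y" using *(7,8) mfd_open_subset[OF W(1)] by auto
  ultimately show ?thesis using *(5-7) by blast
qed

lemma local_frame_section:
  assumes fr: "(V, e) \<in> frames L" and x: "x \<in> V"
  shows "\<exists>s W'. s \<in> \<Gamma> L \<and> mfd_open (base L) W' \<and> x \<in> W' \<and> W' \<subseteq> V \<and> (\<forall>y\<in>W'. s y = e y)"
proof -
  obtain s W' where s: "s \<in> \<Gamma> L" "mfd_open (base L) W'" "x \<in> W'" "W' \<subseteq> V" "\<forall>y\<in>W'. s y = 1 \<odot>\<^bsub>fibre L y\<^esub> e y"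
    using local_section[OF fr frame_open[OF fr] x subset_refl smooth_fun_const[OF frame_open[OF fr], of 1]] by blast
  have "\<forall>y\<in>W'. s y = e y" using s(4,5) frame_1[OF fr] by auto
  then show ?thesis using s by blast
qed

end

section \<open>Sections and derivations in a chart with a frame\<close>

locale triv = lbundle L for L :: "('m, 'e::real_normed_vector, 'v) line_bundle" +
  fixes U \<phi> V e
  assumes ch: "(U, \<phi>) \<in> base L" and fr: "(V, e) \<in> frames L"
begin

abbreviation dom where "dom \<equiv> U \<inter> V"
abbreviation sr where "sr \<equiv> srep L U \<phi> e"
abbreviation dv where "dv \<equiv> dvec L U \<phi> e"

lemma dom_open: "mfd_open (base L) dom" by (rule mfd_open_Int[OF mfd_open_chart[OF ch] frame_open[OF fr]])

lemma dom_pts: "x \<in> dom \<Longrightarrow> x \<in> pts L" using frame_points[OF fr] by blast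

lemma img_open: "open (\<phi> ` dom)" by (rule chart_open_Int[OF frame_open[OF fr] ch])

lemma sr_eq: "x \<in> U \<Longrightarrow> sr s (\<phi> x) = crd L e x (s x)" by (simp add: srep_def chart_inv[OF ch])

lemma sec_eq: "s \<in> \<Gamma> L \<Longrightarrow> x \<in> dom \<Longrightarrow> s x = sr s (\<phi> x) \<odot>\<^bsub>fibre L x\<^esub> e x"
  using crd_eq[OF fr] sec_carrier frame_points[OF fr] by (simp add: sr_eq)

lemma sr_smooth: "s \<in> \<Gamma> L \<Longrightarrow> smooth_on (\<phi> ` dom) (sr s)"
  unfolding srep_def using smooth_funD[OF sec_smooth[OF _ fr] ch] .

lemma sr_hd: "s \<in> \<Gamma> L \<Longrightarrow> x \<in> dom \<Longrightarrow> (sr s has_derivative \<D> (sr s) (\<phi> x)) (at (\<phi> x))"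
  by (rule smooth_on_hd[OF sr_smooth]) auto

lemma sr_linear: "s \<in> \<Gamma> L \<Longrightarrow> x \<in> dom \<Longrightarrow> linear (\<D> (sr s) (\<phi> x))" by (rule has_derivative_linear[OF sr_hd])

lemma sr_frechet_cong:
  assumes W: "mfd_open (base L) W" "x \<in> W" and x: "x \<in> dom"
    and eq: "\<And>y. y \<in> W \<Longrightarrow> y \<in> dom \<Longrightarrow> sr s (\<phi> y) = g (\<phi> y)"
  shows "\<D> (sr s) (\<phi> x) = \<D> g (\<phi> x)"
  by (rule frechet_derivative_cong[OF chart_open_Int[OF mfd_open_Int[OF frame_open[OF fr] W(1)] ch]])
    (use x W eq in auto)

lemma
  assumes x: "x \<in> dom"
  shows sr_add: "s \<in> \<Gamma> L \<Longrightarrow> t \<in> \<Gamma> L \<Longrightarrow> sr (\<lambda>x\<in>pts L. s x \<oplus>\<^bsub>fibre L x\<^esub> t x) (\<phi> x) = sr s (\<phi> x) + sr t (\<phi> x)"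
    and sr_scale: "s \<in> \<Gamma> L \<Longrightarrow> sr (\<lambda>x\<in>pts L. c \<odot>\<^bsub>fibre L x\<^esub> s x) (\<phi> x) = c * sr s (\<phi> x)"
    and sr_fmult: "s \<in> \<Gamma> L \<Longrightarrow> sr (fmult (pts L) (fibre L) f s) (\<phi> x) = f x * sr s (\<phi> x)"
  using x dom_pts[OF x] by (auto simp: sr_eq crd_add[OF fr] crd_scale[OF fr] sec_carrier fmult_def)

lemma D_sr_add:
  assumes x: "x \<in> dom" and s: "s \<in> \<Gamma> L" and t: "t \<in> \<Gamma> L"
  shows "\<D> (sr (\<lambda>x\<in>pts L. s x \<oplus>\<^bsub>fibre L x\<^esub> t x)) (\<phi> x) w =
    \<D> (sr s) (\<phi> x) w + \<D> (sr t) (\<phi> x) w"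
proof -
  have "\<D> (sr (\<lambda>x\<in>pts L. s x \<oplus>\<^bsub>fibre L x\<^esub> t x)) (\<phi> x) =
      \<D> (\<lambda>z. sr s z + sr t z) (\<phi> x)" by (rule sr_frechet_cong[OF dom_open x x]) (use sr_add[OF _ s t] in auto)
  then show ?thesis
    using frechet_derivative_at[OF has_derivative_add[OF sr_hd[OF s x] sr_hd[OF t x]], symmetric] by simp
qed

lemma D_sr_fmult:
  assumes x: "x \<in> dom" and s: "s \<in> \<Gamma> L" and f: "f \<in> Cs (base L)"
  shows "\<D> (sr (fmult (pts L) (fibre L) f s)) (\<phi> x) w =
    f x * \<D> (sr s) (\<phi> x) w +
    \<D> (f \<circ> \<I> U \<phi>) (\<phi> x) w * sr s (\<phi> x)"
proof -
  have xU: "x \<in> U" using x by simp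
  have "\<D> (sr (fmult (pts L) (fibre L) f s)) (\<phi> x) =
      \<D> (\<lambda>z. (f \<circ> \<I> U \<phi>) z * sr s z) (\<phi> x)"
    by (rule sr_frechet_cong[OF dom_open x x]) (use sr_fmult[OF _ s] chart_inv[OF ch] in auto)
  then show ?thesis
    using frechet_derivative_at[OF has_derivative_mult[OF Cs_has_derivative[OF f ch xU] sr_hd[OF s x]], symmetric]
      chart_inv[OF ch xU] by simp
qed

lemma D_sr_scale:
  assumes x: "x \<in> dom" and s: "s \<in> \<Gamma> L"
  shows "\<D> (sr (\<lambda>x\<in>pts L. c \<odot>\<^bsub>fibre L x\<^esub> s x)) (\<phi> x) w =
    c * \<D> (sr s) (\<phi> x) w"
proof -
  have "\<D> (sr (\<lambda>x\<in>pts L. c \<odot>\<^bsub>fibre L x\<^esub> s x)) (\<phi> x) =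
      \<D> (\<lambda>z. c * sr s z) (\<phi> x)" by (rule sr_frechet_cong[OF dom_open x x]) (use sr_scale[OF _ s] in auto)
  then show ?thesis
    using frechet_derivative_at[OF has_derivative_mult_right[OF sr_hd[OF s x], of c], symmetric] by simp
qed

lemma chart_section:
  assumes x: "x \<in> dom" and T0: "open T0" "\<phi> x \<in> T0" and g: "smooth_on T0 g"
  shows "\<exists>s T. s \<in> \<Gamma> L \<and> open T \<and> \<phi> x \<in> T \<and> T \<subseteq> T0 \<and> T \<subseteq> \<phi> ` dom \<and> (\<forall>z\<in>T. sr s z = g z)"
proof -
  have xU: "x \<in> U" using x by simp
  obtain f T where f: "f \<in> Cs (base L)" "open T" "\<phi> x \<in> T" "T \<subseteq> T0" "T \<subseteq> \<phi> ` U" "\<forall>z\<in>T. (f \<circ> \<I> U \<phi>) z = g z"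
    using Cs_extend_chart[OF ch xU T0 g] by blast
  obtain s W where s: "s \<in> \<Gamma> L" "mfd_open (base L) W" "x \<in> W" "W \<subseteq> dom" "\<forall>y\<in>W. s y = f y \<odot>\<^bsub>fibre L y\<^esub> e y"
    using local_section[OF fr dom_open x _ Cs_smooth[OF f(1) mfd_open_subset[OF dom_open]]] by blast
  let ?T = "T \<inter> \<phi> ` (U \<inter> W)"
  have "sr s z = g z" if "z \<in> ?T" for z
  proof -
    have "(f \<circ> \<I> U \<phi>) z = g z" using f(6) that by blast
    moreover obtain y where y: "y \<in> U" "y \<in> W" "z = \<phi> y" using \<open>z \<in> T \<inter> \<phi> ` (U \<inter> W)\<close> by blast
    ultimately show ?thesis using y s(4,5) crd_smult[OF fr] chart_inv[OF ch y(1)] by (auto simp: sr_eq)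
  qed
  moreover have "open ?T" by (intro open_Int f(2) chart_open_Int[OF s(2) ch])
  moreover have "?T \<subseteq> \<phi> ` dom" using s(4) by auto
  ultimately show ?thesis using f(3,4) s(1,3) xU by (intro exI[of _ s] exI[of _ ?T]) auto
qed

text \<open>Value and differential at \<open>x\<close> are arbitrary, so these sections realise all
  1-jets. Being affine on a neighbourhood, they also free iterated derivations from second
  derivatives.\<close>

lemma affine_section:
  assumes x: "x \<in> dom" and p: "bounded_linear p"
  shows "\<exists>s T. s \<in> \<Gamma> L \<and> open T \<and> \<phi> x \<in> T \<and> T \<subseteq> \<phi> ` dom \<and> (\<forall>z\<in>T. sr s z = u + p (z - \<phi> x)) \<and>
    (\<forall>z\<in>T. \<D> (sr s) z = p) \<and> sr s (\<phi> x) = u"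
proof -
  have hd: "((\<lambda>z. u + p (z - \<phi> x)) has_derivative p) (at z)" for z
    by (auto intro!: derivative_eq_intros bounded_linear.has_derivative[OF p])
  have "smooth_on UNIV (\<lambda>z. u + p (z - \<phi> x))"
    by (intro smooth_on_add smooth_on_const open_UNIV smooth_on_linear_comp[OF _ p] smooth_on_diff smooth_on_ident)
  then obtain s T where s: "s \<in> \<Gamma> L" "open T" "\<phi> x \<in> T" "T \<subseteq> \<phi> ` dom" "\<forall>z\<in>T. sr s z = u + p (z - \<phi> x)"
    using chart_section[OF x open_UNIV UNIV_I] by blast
  have "\<D> (sr s) z = p" if "z \<in> T" for z
  proof -
    have "\<D> (sr s) z = \<D> (\<lambda>z. u + p (z - \<phi> x)) z"
      using s(5) by (intro frechet_derivative_cong[OF s(2) that]) blast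
    then show ?thesis using frechet_derivative_at[OF hd, symmetric] by simp
  qed
  moreover have "sr s (\<phi> x) = u" using s(3,5) p by (auto simp: linear_0 bounded_linear.linear)
  ultimately show ?thesis using s by blast
qed

lemma dvec_apply: "s \<in> \<Gamma> L \<Longrightarrow> dv x c w s =
    (c * sr s (\<phi> x) + \<D> (sr s) (\<phi> x) w) \<odot>\<^bsub>fibre L x\<^esub> e x" by (simp add: dvec_def)

lemma dvec_fmult:
  assumes x: "x \<in> dom" and f: "f \<in> Cs (base L)" and s: "s \<in> \<Gamma> L"
  shows "dv x c w (fmult (pts L) (fibre L) f s) =
    f x \<odot>\<^bsub>fibre L x\<^esub> dv x c w s \<oplus>\<^bsub>fibre L x\<^esub> tvec (base L) U \<phi> x w f \<odot>\<^bsub>fibre L x\<^esub> s x"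
proof -
  have xU: "x \<in> U" and xV: "x \<in> V" using x by auto
  have "f x \<odot>\<^bsub>fibre L x\<^esub> dv x c w s \<oplus>\<^bsub>fibre L x\<^esub> tvec (base L) U \<phi> x w f \<odot>\<^bsub>fibre L x\<^esub> s x =
    (f x * (c * sr s (\<phi> x) + \<D> (sr s) (\<phi> x) w) +
      \<D> (f \<circ> \<I> U \<phi>) (\<phi> x) w * sr s (\<phi> x)) \<odot>\<^bsub>fibre L x\<^esub> e x"
    by (simp only: sec_eq[OF s x] dvec_apply[OF s] tvec_apply[OF ch xU f] frame_distr[OF fr xV] frame_assoc[OF fr xV])
  then show ?thesis
    by (simp add: dvec_apply[OF sec_fmult[OF s f]] sr_fmult[OF x s] D_sr_fmult[OF x s f] algebra_simps)
qed

lemma dvec_der: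
  assumes x: "x \<in> dom"
  shows "dv x c w \<in> \<L> L x"
proof -
  have xU: "x \<in> U" and xV: "x \<in> V" using x by auto
  have "lin_map (sections L) (fibre L x) (dv x c w)" unfolding lin_map_def
  proof (intro conjI ballI allI)
    show "dv x c w \<in> \<Gamma> L \<rightarrow> \<F> L x" using frame_smult[OF fr xV] by (simp add: dvec_apply)
    show "dv x c w (s \<oplus>\<^bsub>sections L\<^esub> t) = dv x c w s \<oplus>\<^bsub>fibre L x\<^esub> dv x c w t" if "s \<in> \<Gamma> L" "t \<in> \<Gamma> L" for s t
      using that sec_add[OF that]
      by (simp add: dvec_apply sr_add[OF x] D_sr_add[OF x] frame_distr[OF fr xV, symmetric] algebra_simps)
    show "dv x c w (r \<odot>\<^bsub>sections L\<^esub> s) = r \<odot>\<^bsub>fibre L x\<^esub> dv x c w s" if "s \<in> \<Gamma> L" for r s using that sec_scale[OF that]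
      by (simp add: dvec_apply sr_scale[OF x] D_sr_scale[OF x] frame_assoc[OF fr xV, symmetric] algebra_simps)
  qed
  then show ?thesis unfolding der_space_iff using dvec_fmult[OF x] tvec_tangent[OF ch xU]
    by (auto simp: dvec_def intro!: bexI[of _ "tvec (base L) U \<phi> x w"])
qed

end

context lbundle
begin

lemma der_carrier: "a \<in> \<L> L x \<Longrightarrow> s \<in> \<Gamma> L \<Longrightarrow> a s \<in> \<F> L x" by (auto simp: der_space_iff lin_map_def)

text \<open>The function \<open>1 - \<rho>\<close> is 0 at \<open>x\<close> and 1 outside
  \<open>W\<close>, while \<open>s - t\<close> vanishes on \<open>W\<close>. So multiplying
  \<open>s - t\<close> by it changes nothing, and the Leibniz rule at \<open>x\<close> gives
  \<open>a (s - t) = 0\<close>.\<close>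

lemma der_local:
  assumes a: "a \<in> \<L> L x" and x: "x \<in> pts L" and st: "s \<in> \<Gamma> L" "t \<in> \<Gamma> L"
    and W: "mfd_open (base L) W" "x \<in> W" "\<And>y. y \<in> W \<Longrightarrow> s y = t y"
  shows "a s = a t"
proof -
  note V = fibre_vs[OF x]
  have lin: "lin_map (sections L) (fibre L x) a" using a by (simp add: der_space_iff)
  obtain \<delta> where \<delta>: "\<delta> \<in> \<T> (base L) x"
    "\<forall>f\<in>Cs (base L). \<forall>s\<in>\<Gamma> L. a (fmult (pts L) (fibre L) f s) = f x \<odot>\<^bsub>fibre L x\<^esub> a s \<oplus>\<^bsub>fibre L x\<^esub> \<delta> f \<odot>\<^bsub>fibre L x\<^esub> s x"
    using a unfolding der_space_iff by blast
  obtain \<rho> N W' where *: "\<rho> \<in> Cs (base L)" "mfd_open (base L) N" "pts L - W \<subseteq> N" "\<And>y. y \<in> N \<Longrightarrow> \<rho> y = 0"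
    "mfd_open (base L) W'" "x \<in> W'" "W' \<subseteq> W" "\<And>y. y \<in> W' \<Longrightarrow> \<rho> y = 1" using bump[OF W(1,2)] by blast
  let ?mt = "\<lambda>y\<in>pts L. (-1) \<odot>\<^bsub>fibre L y\<^esub> t y"
  let ?u = "\<lambda>y\<in>pts L. s y \<oplus>\<^bsub>fibre L y\<^esub> ?mt y"
  let ?\<chi> = "\<lambda>y\<in>pts L. 1 - \<rho> y"
  have mt: "?mt \<in> \<Gamma> L" by (rule sec_scale[OF st(2)])
  have u: "?u \<in> \<Gamma> L" by (rule sec_add[OF st(1) mt])
  have \<chi>: "?\<chi> \<in> Cs (base L)"
    by (intro Cs_restrict smooth_fun_diff smooth_fun_const mfd_open_points Cs_smooth[OF *(1)]) simp
  have minus: "v \<oplus>\<^bsub>fibre L y\<^esub> (-1) \<odot>\<^bsub>fibre L y\<^esub> v = \<zero>\<^bsub>fibre L y\<^esub>" if "y \<in> pts L" "v \<in> \<F> L y" for y v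
    using vs_distr_l[OF fibre_vs[OF that(1)] that(2), of 1 "-1"] vs_one[OF fibre_vs[OF that(1)] that(2)]
      vs_smult_0[OF fibre_vs[OF that(1)] that(2)] by simp
  have u0: "?u y = \<zero>\<^bsub>fibre L y\<^esub>" if "y \<in> W" for y
    using that W(3) minus sec_carrier[OF st(2)] mfd_open_subset[OF W(1)] by auto
  have "fmult (pts L) (fibre L) ?\<chi> ?u = ?u"
  proof (rule sec_eqI[OF sec_fmult[OF u \<chi>] u])
    fix y assume y: "y \<in> pts L"
    show "fmult (pts L) (fibre L) ?\<chi> ?u y = ?u y"
    proof (cases "y \<in> W")
      case True
      then have "?u y = \<zero>\<^bsub>fibre L y\<^esub>" by (rule u0)
      then show ?thesis using y vs_smult_zero[OF fibre_vs[OF y]] by (simp only: fmult_def restrict_apply if_True)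
    next
      case False
      then have "?\<chi> y = 1" using *(3,4) y by auto
      then have "fmult (pts L) (fibre L) ?\<chi> ?u y = 1 \<odot>\<^bsub>fibre L y\<^esub> ?u y"
        using y by (simp only: fmult_def restrict_apply if_True)
      then show ?thesis using vs_one[OF fibre_vs[OF y] sec_carrier[OF u y]] by simp
    qed
  qed
  moreover have "a (fmult (pts L) (fibre L) ?\<chi> ?u) = ?\<chi> x \<odot>\<^bsub>fibre L x\<^esub> a ?u \<oplus>\<^bsub>fibre L x\<^esub> \<delta> ?\<chi> \<odot>\<^bsub>fibre L x\<^esub> ?u x"
    using \<delta>(2) \<chi> u by blast
  moreover have "?\<chi> x = 0" using *(6,8) x by simp
  ultimately have "a ?u = 0 \<odot>\<^bsub>fibre L x\<^esub> a ?u \<oplus>\<^bsub>fibre L x\<^esub> \<delta> ?\<chi> \<odot>\<^bsub>fibre L x\<^esub> \<zero>\<^bsub>fibre L x\<^esub>"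
    using u0[OF W(2)] by (simp only:)
  then have au: "a ?u = \<zero>\<^bsub>fibre L x\<^esub>"
    using vs_smult_0[OF V der_carrier[OF a u]] vs_smult_zero[OF V] vs_l_zero[OF V vs_zero[OF V]] by simp
  have "a ?u = a s \<oplus>\<^bsub>fibre L x\<^esub> a ?mt" using lin_mapD(2)[OF lin, of s ?mt] st mt by simp
  moreover have "a ?mt = (-1) \<odot>\<^bsub>fibre L x\<^esub> a t" using lin_mapD(3)[OF lin, of t "-1"] st by simp
  ultimately have e: "a s \<oplus>\<^bsub>fibre L x\<^esub> (-1) \<odot>\<^bsub>fibre L x\<^esub> a t = \<zero>\<^bsub>fibre L x\<^esub>" using au by simp
  obtain V e where fr: "(V, e) \<in> frames L" "x \<in> V" using frame_ex[OF x] by blast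
  note c = der_carrier[OF a st(1)] der_carrier[OF a st(2)]
  have "crd L e x (a s) + (-1) * crd L e x (a t) = 0" using arg_cong[OF e, of "crd L e x"]
    by (simp add: crd_add[OF fr] crd_scale[OF fr] crd_zero[OF fr] c vs_smult[OF V])
  then show ?thesis by (intro crd_inject[OF fr c]) simp
qed

end

context triv
begin

text \<open>Near \<open>x\<close> a section is a function times a section \<open>e0\<close> that
  agrees with the frame. The Leibniz rule then leaves two data: the coordinate of
  \<open>a e0\<close>, which is \<open>c\<close>, and the symbol, which is a tangent vector with
  coordinates \<open>w\<close>.\<close>

lemma der_dvec:
  assumes x: "x \<in> dom" and a: "a \<in> \<L> L x"
  shows "\<exists>c w. a = dv x c w"
proof -
  have xU: "x \<in> U" and xV: "x \<in> V" using x by auto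
  note xP = dom_pts[OF x]
  obtain \<delta> where \<delta>: "\<delta> \<in> \<T> (base L) x"
    "\<forall>f\<in>Cs (base L). \<forall>s\<in>\<Gamma> L. a (fmult (pts L) (fibre L) f s) = f x \<odot>\<^bsub>fibre L x\<^esub> a s \<oplus>\<^bsub>fibre L x\<^esub> \<delta> f \<odot>\<^bsub>fibre L x\<^esub> s x"
    using a unfolding der_space_iff by blast
  obtain w where w: "\<delta> = tvec (base L) U \<phi> x w" by (rule tangent_tvec[OF ch xU \<delta>(1)])
  obtain e0 W where e0: "e0 \<in> \<Gamma> L" "mfd_open (base L) W" "x \<in> W" "W \<subseteq> V" "\<forall>y\<in>W. e0 y = e y"
    using local_frame_section[OF fr xV] by blast
  let ?c = "crd L e x (a e0)"
  have "a s = dv x ?c w s" if s: "s \<in> \<Gamma> L" for s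
  proof -
    obtain f W' where f: "f \<in> Cs (base L)" "mfd_open (base L) W'" "x \<in> W'" "W' \<subseteq> V"
      "\<And>y. y \<in> W' \<Longrightarrow> f y = crd L e y (s y)" using Cs_extend[OF frame_open[OF fr] xV sec_smooth[OF s fr]] by blast
    have eq: "s y = fmult (pts L) (fibre L) f e0 y" if "y \<in> W \<inter> W'" for y
      using that f(4,5) e0(5) crd_eq[OF fr, of y] sec_carrier[OF s, of y] frame_points[OF fr, of y]
      by (auto simp: fmult_def)
    have "a s = a (fmult (pts L) (fibre L) f e0)"
      by (rule der_local[OF a xP s sec_fmult[OF e0(1) f(1)] mfd_open_Int[OF e0(2) f(2)]]) (use e0 f eq in auto)
    also have "\<dots> = f x \<odot>\<^bsub>fibre L x\<^esub> a e0 \<oplus>\<^bsub>fibre L x\<^esub> \<delta> f \<odot>\<^bsub>fibre L x\<^esub> e0 x" using \<delta>(2) f(1) e0(1) by blast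
    also have "\<dots> = f x \<odot>\<^bsub>fibre L x\<^esub> (?c \<odot>\<^bsub>fibre L x\<^esub> e x) \<oplus>\<^bsub>fibre L x\<^esub> \<delta> f \<odot>\<^bsub>fibre L x\<^esub> e x"
      using e0(3,5) crd_eq[OF fr xV der_carrier[OF a e0(1)]] by simp
    also have "\<dots> = (f x * ?c + \<delta> f) \<odot>\<^bsub>fibre L x\<^esub> e x" by (simp only: frame_distr[OF fr xV] frame_assoc[OF fr xV])
    also have "f x = sr s (\<phi> x)" using f(3,5) xU by (simp add: sr_eq)
    also have "\<delta> f = \<D> (f \<circ> \<I> U \<phi>) (\<phi> x) w" by (simp add: w tvec_apply[OF ch xU f(1)])
    also have "\<D> (f \<circ> \<I> U \<phi>) (\<phi> x) = \<D> (sr s) (\<phi> x)"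
      by (rule sr_frechet_cong[OF f(2,3) x, symmetric]) (use f(5) chart_inv[OF ch] in \<open>auto simp: sr_eq\<close>)
    finally show ?thesis by (simp add: dvec_apply[OF s] mult.commute)
  qed
  moreover have "a s = dv x ?c w s" if "s \<notin> \<Gamma> L" for s
    using that a unfolding der_space_iff dvec_def by (auto simp: extensional_def)
  ultimately show ?thesis by blast
qed

text \<open>Affine sections with arbitrary value and differential at \<open>x\<close> separate the
  two coefficients.\<close>

lemma dvec_inject:
  assumes x: "x \<in> dom" and eq: "dv x c w = dv x c' w'"
  shows "c = c'" "w = w'"
proof -
  have xV: "x \<in> V" using x by auto
  have *: "c * u + p w = c' * u + p w'" if p: "bounded_linear p" for u p
  proof -
    obtain s where s: "s \<in> \<Gamma> L" "\<D> (sr s) (\<phi> x) = p" "sr s (\<phi> x) = u" using affine_section[OF x p, of u] by blast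
    then show ?thesis using arg_cong[OF eq, of "\<lambda>a. a s"] crd_inj[OF fr xV] by (simp add: dvec_apply)
  qed
  from *[OF bounded_linear_zero, of 1] show "c = c'" by simp
  obtain B :: "'e set" where B: "is_basis B" using finite_dim_basis[OF fd] .
  show "w = w'" by (rule basis_eqI[OF B]) (use *[OF bounded_linear_representation[OF B], of 0] in simp)
qed

lemma dvec_add:
  assumes x: "x \<in> dom"
  shows "dv x (c + c') (w + w') = dv x c w \<oplus>\<^bsub>der_space L x\<^esub> dv x c' w'"
proof -
  have xV: "x \<in> V" using x by auto
  show ?thesis
    by (auto simp: dvec_def fun_eq_iff frame_distr[OF fr xV, symmetric] linear_add[OF sr_linear[OF _ x]] algebra_simps)
qed

lemma dvec_scale:
  assumes x: "x \<in> dom"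
  shows "dv x (r * c) (r *\<^sub>R w) = r \<odot>\<^bsub>der_space L x\<^esub> dv x c w"
proof -
  have xV: "x \<in> V" using x by auto
  show ?thesis
    by (auto simp: dvec_def fun_eq_iff frame_assoc[OF fr xV, symmetric] linear_scale[OF sr_linear[OF _ x]] algebra_simps)
qed

lemma ev_der_eq: "x \<in> dom \<Longrightarrow> ev_der L x = dv x 1 0"
  using sec_eq linear_0[OF sr_linear] by (auto simp: ev_der_def dvec_def fun_eq_iff)

lemma partial_der_eq: "x \<in> dom \<Longrightarrow> partial_der L U \<phi> e x v = dv x 0 v"
  by (auto simp: partial_der_def dvec_def srep_def fun_eq_iff)

end

context lbundle
begin

lemma triv_ex:
  assumes "x \<in> pts L"
  obtains U \<phi> V e where "triv L U \<phi> V e" "x \<in> U \<inter> V"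
proof -
  obtain V e where "(V, e) \<in> frames L" "x \<in> V" using frame_ex[OF assms] by blast
  moreover obtain U \<phi> where "(U, \<phi>) \<in> base L" "x \<in> U" using points_chart[OF assms] by blast
  ultimately show ?thesis using that[of U \<phi> V e] lbundle_axioms by (simp add: triv_def triv_axioms_def)
qed

text \<open>Closure under the operations is read off from the coordinate form of the elements, where
  the operations act on the pairs \<open>(c, w)\<close>.\<close>

lemma der_space_vec_space:
  assumes x: "x \<in> pts L"
  shows "vec_space (der_space L x)"
proof -
  let ?C = "\<L> L x"
  obtain U \<phi> V e where T: "triv L U \<phi> V e" "x \<in> U \<inter> V" using triv_ex[OF x] .
  interpret triv L U \<phi> V e by (rule T)
  have e: "der_space L x = fun_space (\<Gamma> L) (\<lambda>_. fibre L x) ?C" by (simp add: der_space_def)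
  have "vec_space (fun_space (\<Gamma> L) (\<lambda>_. fibre L x) ?C)"
  proof (rule fun_space_vec_space)
    show "vec_space (fibre L x)" by (rule fibre_vs[OF x])
    show "?C \<subseteq> (\<Pi>\<^sub>E i\<in>\<Gamma> L. \<F> L x)" using der_carrier by (auto simp: der_space_iff PiE_def)
    have "x \<in> V" using T(2) by simp
    have "(\<lambda>i\<in>\<Gamma> L. \<zero>\<^bsub>fibre L x\<^esub>) = dv x 0 0"
      using frame_0[OF fr \<open>x \<in> V\<close>] linear_0[OF sr_linear[OF _ T(2)]] by (auto simp: dvec_def)
    then show "(\<lambda>i\<in>\<Gamma> L. \<zero>\<^bsub>fibre L x\<^esub>) \<in> ?C" using dvec_der[OF T(2), of 0 0] by (simp only:)
  next
    fix a b assume ab: "a \<in> ?C" "b \<in> ?C"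
    obtain c w where 1: "a = dv x c w" using der_dvec[OF T(2) ab(1)] by blast
    obtain c' w' where 2: "b = dv x c' w'" using der_dvec[OF T(2) ab(2)] by blast
    have "(\<lambda>s\<in>\<Gamma> L. a s \<oplus>\<^bsub>fibre L x\<^esub> b s) = dv x (c + c') (w + w')"
      unfolding 1 2 dvec_add[OF T(2)] der_space_simps ..
    then show "(\<lambda>s\<in>\<Gamma> L. a s \<oplus>\<^bsub>fibre L x\<^esub> b s) \<in> ?C" using dvec_der[OF T(2), of "c + c'" "w + w'"] by (simp only:)
  next
    fix r a assume a: "a \<in> ?C"
    obtain c w where 1: "a = dv x c w" using der_dvec[OF T(2) a] by blast
    have "(\<lambda>s\<in>\<Gamma> L. r \<odot>\<^bsub>fibre L x\<^esub> a s) = dv x (r * c) (r *\<^sub>R w)" unfolding 1 dvec_scale[OF T(2)] der_space_simps ..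
    then show "(\<lambda>s\<in>\<Gamma> L. r \<odot>\<^bsub>fibre L x\<^esub> a s) \<in> ?C" using dvec_der[OF T(2), of "r * c" "r *\<^sub>R w"] by (simp only:)
  qed
  then show ?thesis using e by simp
qed

lemma jet_jet_space:
  assumes s: "s \<in> \<Gamma> L" and x: "x \<in> pts L"
  shows "jet L s x \<in> \<J> L x"
proof -
  note D = der_space_vec_space[OF x]
  have "lin_map (der_space L x) (fibre L x) (\<lambda>a\<in>\<L> L x. a s)" unfolding lin_map_def
  proof (intro conjI ballI allI)
    show "(\<lambda>a\<in>\<L> L x. a s) \<in> \<L> L x \<rightarrow> \<F> L x" using der_carrier[OF _ s] by auto
    show "(\<lambda>a\<in>\<L> L x. a s) (a \<oplus>\<^bsub>der_space L x\<^esub> b) =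
        (\<lambda>a\<in>\<L> L x. a s) a \<oplus>\<^bsub>fibre L x\<^esub> (\<lambda>a\<in>\<L> L x. a s) b"
      if "a \<in> \<L> L x" "b \<in> \<L> L x" for a b using vs_add[OF D that] that s by simp
    show "(\<lambda>a\<in>\<L> L x. a s) (r \<odot>\<^bsub>der_space L x\<^esub> a) =
        r \<odot>\<^bsub>fibre L x\<^esub> (\<lambda>a\<in>\<L> L x. a s) a"
      if "a \<in> \<L> L x" for r a using vs_smult[OF D that, of r] that s by simp
  qed
  then show ?thesis unfolding jet_space_iff jet_def by simp
qed

end

section \<open>Coordinates on the fibres of the jet bundle\<close>

definition jco where
  "jco L U \<phi> e x \<alpha> = snd (jet_chart L U \<phi> e (x, \<alpha>))"

context triv
begin

lemma jet_chart_eq: "jet_chart L U \<phi> e (x, \<alpha>) = (\<phi> x, jco L U \<phi> e x \<alpha>)" by (simp add: jco_def jet_chart_def)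

text \<open>\<open>dv x c w\<close> is \<open>c\<close> times the evaluation plus a partial
  derivative, and \<alpha> is linear. Its functional part is bounded because the model space is
  finite-dimensional, so \<open>Blinfun\<close> returns it unchanged.\<close>

lemma jco_apply:
  assumes x: "x \<in> dom" and \<alpha>: "\<alpha> \<in> \<J> L x" and j: "jco L U \<phi> e x \<alpha> = (u, p)"
  shows "\<alpha> (dv x c w) = (c * u + ap p w) \<odot>\<^bsub>fibre L x\<^esub> e x"
proof -
  have xV: "x \<in> V" using x by auto
  let ?F = "fibre L x" and ?cd = "crd L e x"
  note la = lin_mapD[OF conjunct2[OF \<alpha>[unfolded jet_space_iff]]]
  note D = dvec_der[OF x]
  have lin: "linear (\<lambda>v. ?cd (\<alpha> (dv x 0 v)))"
  proof (rule linearI)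
    show "?cd (\<alpha> (dv x 0 (v + w))) = ?cd (\<alpha> (dv x 0 v)) + ?cd (\<alpha> (dv x 0 w))" for v w
      using dvec_add[OF x, of 0 0 v w] la(2)[OF D D] crd_add[OF fr xV la(1)[OF D] la(1)[OF D]] by simp
    show "?cd (\<alpha> (dv x 0 (r *\<^sub>R v))) = r *\<^sub>R ?cd (\<alpha> (dv x 0 v))" for r v
      using dvec_scale[OF x, of r 0 v] la(3)[OF D] crd_scale[OF fr xV la(1)[OF D]] by simp
  qed
  have u: "u = ?cd (\<alpha> (dv x 1 0))" using j by (simp add: jco_def jet_chart_def ev_der_eq[OF x])
  have "p = Blinfun (\<lambda>v. ?cd (\<alpha> (dv x 0 v)))" using j by (simp add: jco_def jet_chart_def partial_der_eq[OF x])
  then have p: "ap p v = ?cd (\<alpha> (dv x 0 v))" for v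
    using linear_imp_bounded_linear[OF fd lin] by (simp add: bounded_linear_Blinfun_apply)
  have "dv x c w = c \<odot>\<^bsub>der_space L x\<^esub> dv x 1 0 \<oplus>\<^bsub>der_space L x\<^esub> dv x 0 w"
    using dvec_add[OF x, of c 0 0 w] dvec_scale[OF x, of c 1 0] by simp
  then have "\<alpha> (dv x c w) = c \<odot>\<^bsub>?F\<^esub> \<alpha> (dv x 1 0) \<oplus>\<^bsub>?F\<^esub> \<alpha> (dv x 0 w)"
    using la(2)[OF vs_smult[OF der_space_vec_space[OF dom_pts[OF x]] D] D] la(3)[OF D] by simp
  then have "?cd (\<alpha> (dv x c w)) = c * u + ap p w"
    using u p la(1)[OF D] crd_add[OF fr xV] crd_scale[OF fr xV] vs_smult[OF fibre_vs[OF dom_pts[OF x]]] by simp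
  moreover have "?cd (\<alpha> (dv x c w)) \<odot>\<^bsub>?F\<^esub> e x = \<alpha> (dv x c w)" by (rule crd_eq[OF fr xV la(1)[OF D]])
  ultimately show ?thesis by (simp only:)
qed

lemma jco_inject:
  assumes x: "x \<in> dom" and \<alpha>\<beta>: "\<alpha> \<in> \<J> L x" "\<beta> \<in> \<J> L x"
    and j: "jco L U \<phi> e x \<alpha> = jco L U \<phi> e x \<beta>"
  shows "\<alpha> = \<beta>"
proof -
  obtain u p where up: "jco L U \<phi> e x \<alpha> = (u, p)" by (cases "jco L U \<phi> e x \<alpha>")
  have "\<alpha> a = \<beta> a" if a: "a \<in> \<L> L x" for a
  proof -
    obtain c w where "a = dv x c w" using der_dvec[OF x a] by blast
    then show ?thesis using jco_apply[OF x \<alpha>\<beta>(1) up] jco_apply[OF x \<alpha>\<beta>(2)] up j by simp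
  qed
  then show ?thesis using \<alpha>\<beta> unfolding jet_space_iff by (meson extensionalityI)
qed

lemma jco_jet:
  assumes x: "x \<in> dom" and s: "s \<in> \<Gamma> L"
  shows "jco L U \<phi> e x (jet L s x) = (sr s (\<phi> x), Blinfun (\<D> (sr s) (\<phi> x)))"
proof -
  have xV: "x \<in> V" using x by auto
  have "crd L e x (dv x c w s) = c * sr s (\<phi> x) + \<D> (sr s) (\<phi> x) w" for c w
    by (simp add: dvec_apply[OF s] crd_smult[OF fr xV])
  then show ?thesis using dvec_der[OF x] linear_0[OF sr_linear[OF s x]]
    by (simp add: jco_def jet_chart_def ev_der_eq[OF x] partial_der_eq[OF x] jet_def)
qed

lemma jco_jet_blinfun:
  assumes "x \<in> dom" "s \<in> \<Gamma> L"
  shows "ap (snd (jco L U \<phi> e x (jet L s x))) = \<D> (sr s) (\<phi> x)"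
  using jco_jet[OF assms] bounded_linear_Blinfun_apply[OF has_derivative_bounded_linear[OF sr_hd[OF assms(2,1)]]]
  by simp

lemma jet_ex:
  assumes x: "x \<in> dom"
  shows "\<exists>s. s \<in> \<Gamma> L \<and> jco L U \<phi> e x (jet L s x) = (u, p)"
proof -
  obtain s where "s \<in> \<Gamma> L" "\<D> (sr s) (\<phi> x) = ap p" "sr s (\<phi> x) = u"
    using affine_section[OF x blinfun.bounded_linear_right, of u p] by blast
  then show ?thesis using jco_jet[OF x] by (intro exI[of _ s]) (simp add: blinfun_apply_inverse)
qed

end

context lbundle
begin

text \<open>Affine sections realise all coordinate values, and coordinates determine a jet.
  Statements about points of \<open>J1 L\<close> may therefore be proved for jets of
  sections.\<close>

lemma jet_surj:
  assumes x: "x \<in> pts L" and \<alpha>: "\<alpha> \<in> \<J> L x"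
  shows "\<exists>s\<in>\<Gamma> L. jet L s x = \<alpha>"
proof -
  obtain U \<phi> V e where T: "triv L U \<phi> V e" "x \<in> U \<inter> V" using triv_ex[OF x] .
  interpret triv L U \<phi> V e by (rule T)
  obtain s where "s \<in> \<Gamma> L" "jco L U \<phi> e x (jet L s x) = (fst (jco L U \<phi> e x \<alpha>), snd (jco L U \<phi> e x \<alpha>))"
    using jet_ex[OF T(2)] by blast
  then show ?thesis using jco_inject[OF T(2) jet_jet_space[OF _ x] \<alpha>] by auto
qed

lemma jet_apply: "a \<in> \<L> L x \<Longrightarrow> jet L s x a = a s" by (simp add: jet_def)

lemma jet_add:
  assumes s: "s \<in> \<Gamma> L" and t: "t \<in> \<Gamma> L"
  shows "jet L (\<lambda>x\<in>pts L. s x \<oplus>\<^bsub>fibre L x\<^esub> t x) x = jet L s x \<oplus>\<^bsub>jet_space L x\<^esub> jet L t x"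
proof -
  have "a (\<lambda>x\<in>pts L. s x \<oplus>\<^bsub>fibre L x\<^esub> t x) = a s \<oplus>\<^bsub>fibre L x\<^esub> a t" if "a \<in> \<L> L x" for a
    using that lin_mapD(2)[of "sections L" "fibre L x" a s t] s t by (simp add: der_space_iff)
  then show ?thesis by (auto simp: jet_def)
qed

lemma jet_scale:
  assumes s: "s \<in> \<Gamma> L"
  shows "jet L (\<lambda>x\<in>pts L. r \<odot>\<^bsub>fibre L x\<^esub> s x) x = r \<odot>\<^bsub>jet_space L x\<^esub> jet L s x"
proof -
  have "a (\<lambda>x\<in>pts L. r \<odot>\<^bsub>fibre L x\<^esub> s x) = r \<odot>\<^bsub>fibre L x\<^esub> a s" if "a \<in> \<L> L x" for a
    using that lin_mapD(3)[of "sections L" "fibre L x" a s r] s by (simp add: der_space_iff)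
  then show ?thesis by (auto simp: jet_def)
qed

end

section \<open>Derivations\<close>

context lbundle
begin

lemma bump_complement:
  assumes W: "mfd_open (base L) W" "x \<in> W"
  shows "\<exists>\<kappa>. \<kappa> \<in> Cs (base L) \<and> \<kappa> x = 0 \<and> (\<forall>y\<in>pts L - W. \<kappa> y = 1)"
proof -
  obtain \<rho> N W' where *: "\<rho> \<in> Cs (base L)" "mfd_open (base L) N" "pts L - W \<subseteq> N" "\<And>y. y \<in> N \<Longrightarrow> \<rho> y = 0"
    "mfd_open (base L) W'" "x \<in> W'" "W' \<subseteq> W" "\<And>y. y \<in> W' \<Longrightarrow> \<rho> y = 1" using bump[OF W] by blast
  have "(\<lambda>y\<in>pts L. 1 - \<rho> y) \<in> Cs (base L)"
    by (intro Cs_restrict smooth_fun_diff smooth_fun_const mfd_open_points Cs_smooth[OF *(1)]) simp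
  moreover have "x \<in> pts L" using W mfd_open_subset by blast
  ultimately show ?thesis using * by (intro exI[of _ "\<lambda>y\<in>pts L. 1 - \<rho> y"]) auto
qed

text \<open>The vanishing double commutator says that \<open>[D, f]\<close> is multiplication by a
  function; its value on a frame section defines the symbol. Reading \<open>D s x\<close> in a
  frame, as \<open>d s\<close>, makes all identities scalar.\<close>

lemma diff_op1_der:
  assumes D: "diff_op1 L D" and x: "x \<in> pts L"
  shows "(\<lambda>s\<in>\<Gamma> L. D s x) \<in> \<L> L x"
proof -
  obtain V e where fr: "(V, e) \<in> frames L" "x \<in> V" using frame_ex[OF x] by blast
  note Vx = fibre_vs[OF x]
  let ?F = "fibre L x" and ?cd = "crd L e x" and ?m = "fmult (pts L) (fibre L)"
  let ?add = "\<lambda>s t. \<lambda>x\<in>pts L. s x \<oplus>\<^bsub>fibre L x\<^esub> t x" and ?sc = "\<lambda>c s. \<lambda>x\<in>pts L. c \<odot>\<^bsub>fibre L x\<^esub> s x"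
  have lin: "lin_map (sections L) (sections L) D" using D by (simp add: diff_op1_def)
  note DG = lin_mapD(1)[OF lin]
  note c = sec_carrier[OF _ x] sec_carrier[OF DG x] vs_smult[OF Vx] vs_add[OF Vx]
  note cc = crd_add[OF fr] crd_scale[OF fr]
  define d where "d = (\<lambda>s. ?cd (D s x))"
  have d_add: "d (?add s t) = d s + d t" if "s \<in> \<Gamma> L" "t \<in> \<Gamma> L" for s t
    using lin_mapD(2)[OF lin that] that x by (simp add: d_def cc c)
  have d_sc: "d (?sc r s) = r * d s" if "s \<in> \<Gamma> L" for s r
    using lin_mapD(3)[OF lin that, of r] that x by (simp add: d_def cc c)
  have d_prod: "d (?m f (?m g s)) = f x * d (?m g s) + g x * d (?m f s) - g x * (f x * d s)"
    if f: "f \<in> Cs (base L)" and g: "g \<in> Cs (base L)" and s: "s \<in> \<Gamma> L" for f g s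
  proof -
    note ms = sec_fmult[OF s]
    have "D (?m f (?m g s)) \<oplus>\<^bsub>sections L\<^esub> ?m g (?m f (D s)) = ?m f (D (?m g s)) \<oplus>\<^bsub>sections L\<^esub> ?m g (D (?m f s))"
      using D f g s unfolding diff_op1_def Let_def by blast
    moreover have mx: "?m h t x = h x \<odot>\<^bsub>fibre L x\<^esub> t x" for h t using x by (simp add: fmult_def)
    ultimately have "D (?m f (?m g s)) x \<oplus>\<^bsub>?F\<^esub> g x \<odot>\<^bsub>?F\<^esub> (f x \<odot>\<^bsub>?F\<^esub> D s x) =
        f x \<odot>\<^bsub>?F\<^esub> D (?m g s) x \<oplus>\<^bsub>?F\<^esub> g x \<odot>\<^bsub>?F\<^esub> D (?m f s) x" using x by (auto dest: fun_cong[of _ _ x])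
    from arg_cong[OF this, of ?cd] show ?thesis by (simp add: d_def cc c f g s ms sec_fmult[OF ms])
  qed
  have d_zero: "d s = 0" if s: "s \<in> \<Gamma> L" and W: "mfd_open (base L) W" "x \<in> W" "\<And>y. y \<in> W \<Longrightarrow> s y = \<zero>\<^bsub>fibre L y\<^esub>" for s W
  proof -
    obtain \<kappa> where \<kappa>: "\<kappa> \<in> Cs (base L)" "\<kappa> x = 0" "\<forall>y\<in>pts L - W. \<kappa> y = 1"
      using bump_complement[OF W(1,2)] by blast
    have "?m \<kappa> s = s"
    proof (rule sec_eqI[OF sec_fmult[OF s \<kappa>(1)] s])
      fix y assume y: "y \<in> pts L"
      show "?m \<kappa> s y = s y"
        using y \<kappa>(3) W(3)[of y] vs_smult_zero[OF fibre_vs[OF y]] vs_one[OF fibre_vs[OF y] sec_carrier[OF s y]]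
        by (cases "y \<in> W") (auto simp: fmult_def)
    qed
    \<comment> \<open>\<open>s\<close> equals \<kappa>\<kappa>\<open>s\<close>, and every term of
      the product formula for the latter contains the factor \<open>\<kappa> x = 0\<close>.\<close>
    then show ?thesis using d_prod[OF \<kappa>(1) \<kappa>(1) s] \<kappa>(2) by simp
  qed
  have d_local: "d s = d t" if s: "s \<in> \<Gamma> L" and t: "t \<in> \<Gamma> L"
    and W: "mfd_open (base L) W" "x \<in> W" "\<And>y. y \<in> W \<Longrightarrow> s y = t y" for s t W
  proof -
    have "d (?add s (?sc (-1) t)) = 0"
    proof (rule d_zero[OF sec_add[OF s sec_scale[OF t]] W(1,2)])
      fix y assume yW: "y \<in> W"
      then have y: "y \<in> pts L" using mfd_open_subset[OF W(1)] by blast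
      show "?add s (?sc (-1) t) y = \<zero>\<^bsub>fibre L y\<^esub>"
        using vs_distr_l[OF fibre_vs[OF y] sec_carrier[OF t y], of 1 "-1"] vs_one[OF fibre_vs[OF y] sec_carrier[OF t y]]
          vs_smult_0[OF fibre_vs[OF y] sec_carrier[OF t y]] W(3)[OF yW] y by simp
    qed
    then show ?thesis using d_add[OF s sec_scale[OF t]] d_sc[OF t] by simp
  qed
  obtain e0 W where e0: "e0 \<in> \<Gamma> L" "mfd_open (base L) W" "x \<in> W" "W \<subseteq> V" "\<forall>y\<in>W. e0 y = e y"
    using local_frame_section[OF fr] by blast
  \<comment> \<open>The symbol: \<open>[D, f]\<close> applied to a section that equals the frame
    near \<open>x\<close>, read in that frame.\<close>
  define \<delta> where "\<delta> = (\<lambda>f\<in>Cs (base L). d (?m f e0) - f x * d e0)"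
  have "\<delta> \<in> \<T> (base L) x" unfolding tangent_iff
  proof (intro conjI ballI allI)
    show "\<delta> \<in> extensional (Cs (base L))" by (simp add: \<delta>_def)
    fix f g assume f: "f \<in> Cs (base L)" and g: "g \<in> Cs (base L)"
    have "?m (\<lambda>y\<in>pts L. f y + g y) e0 = ?add (?m f e0) (?m g e0)"
      using vs_distr_l[OF fibre_vs sec_carrier[OF e0(1)]] by (auto simp: fmult_def)
    then show "\<delta> (\<lambda>y\<in>pts L. f y + g y) = \<delta> f + \<delta> g"
      using f g x d_add[OF sec_fmult[OF e0(1) f] sec_fmult[OF e0(1) g]] by (simp add: \<delta>_def Cs_add algebra_simps)
    have "?m (\<lambda>y\<in>pts L. f y * g y) e0 = ?m f (?m g e0)"
      using vs_smult_assoc[OF fibre_vs sec_carrier[OF e0(1)]] by (auto simp: fmult_def)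
    then show "\<delta> (\<lambda>y\<in>pts L. f y * g y) = f x * \<delta> g + g x * \<delta> f"
      using f g x d_prod[OF f g e0(1)] by (simp add: \<delta>_def Cs_mult algebra_simps)
  next
    fix r f assume f: "f \<in> Cs (base L)"
    have "?m (\<lambda>y\<in>pts L. r * f y) e0 = ?sc r (?m f e0)"
      using vs_smult_assoc[OF fibre_vs sec_carrier[OF e0(1)]] by (auto simp: fmult_def)
    then show "\<delta> (\<lambda>y\<in>pts L. r * f y) = r * \<delta> f"
      using f x d_sc[OF sec_fmult[OF e0(1) f]] by (simp add: \<delta>_def Cs_scale algebra_simps)
  qed
  moreover have "d (?m f s) = f x * d s + \<delta> f * ?cd (s x)" if f: "f \<in> Cs (base L)" and s: "s \<in> \<Gamma> L" for f s
  proof -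
    obtain g W' where g: "g \<in> Cs (base L)" "mfd_open (base L) W'" "x \<in> W'" "W' \<subseteq> V"
      "\<And>y. y \<in> W' \<Longrightarrow> g y = crd L e y (s y)"
      using Cs_extend[OF frame_open[OF fr(1)] fr(2) sec_smooth[OF s fr(1)]] by blast
    have o: "mfd_open (base L) (W \<inter> W')" "x \<in> W \<inter> W'" using mfd_open_Int[OF e0(2) g(2)] e0 g by auto
    have eq: "s y = ?m g e0 y" if "y \<in> W \<inter> W'" for y
      using that g(4,5) e0(5) crd_eq[OF fr(1), of y] sec_carrier[OF s, of y] frame_points[OF fr(1), of y]
      by (auto simp: fmult_def)
    have "d s = d (?m g e0)" by (rule d_local[OF s sec_fmult[OF e0(1) g(1)] o eq])
    moreover have "d (?m f s) = d (?m f (?m g e0))"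
      by (rule d_local[OF sec_fmult[OF s f] sec_fmult[OF sec_fmult[OF e0(1) g(1)] f] o]) (simp add: fmult_def[of _ _ f] eq)
    moreover have "g x = ?cd (s x)" using g by blast
    ultimately show ?thesis using d_prod[OF f g(1) e0(1)] f by (simp add: \<delta>_def algebra_simps)
  qed
  ultimately show ?thesis unfolding der_space_iff lin_map_def
  proof (intro conjI ballI allI bexI[of _ \<delta>])
    show "(\<lambda>s\<in>\<Gamma> L. D s x) \<in> \<Gamma> L \<rightarrow> carrier ?F" by (auto intro: c)
  next
    fix f s assume fs: "f \<in> Cs (base L)" "s \<in> \<Gamma> L" and *: "\<And>f s. f \<in> Cs (base L) \<Longrightarrow> s \<in> \<Gamma> L \<Longrightarrow> d (?m f s) = f x * d s + \<delta> f * ?cd (s x)"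
    have "D (?m f s) x = f x \<odot>\<^bsub>?F\<^esub> D s x \<oplus>\<^bsub>?F\<^esub> \<delta> f \<odot>\<^bsub>?F\<^esub> s x"
      by (rule crd_inject[OF fr]) (use *[OF fs] fs in \<open>simp_all add: c cc d_def sec_fmult\<close>)
    then show "(\<lambda>s\<in>\<Gamma> L. D s x) (?m f s) = f x \<odot>\<^bsub>?F\<^esub> (\<lambda>s\<in>\<Gamma> L. D s x) s \<oplus>\<^bsub>?F\<^esub> \<delta> f \<odot>\<^bsub>?F\<^esub> s x"
      using fs by (simp add: sec_fmult)
  qed (use lin_mapD(2,3)[OF lin] x in \<open>simp_all add: sec_add sec_scale\<close>)
qed

lemma derivation_der: "a \<in> derivations L \<Longrightarrow> x \<in> pts L \<Longrightarrow> a x \<in> \<L> L x"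
  and derivation_act: "a \<in> derivations L \<Longrightarrow> s \<in> \<Gamma> L \<Longrightarrow> act (pts L) a s \<in> \<Gamma> L" by (auto simp: derivations_def)

end

context triv
begin

lemma smooth_funI_chart:
  assumes W: "mfd_open (base L) W" "W \<subseteq> U" and h: "smooth_on (\<phi> ` W) (h \<circ> \<I> U \<phi>)"
  shows "smooth_fun (base L) W h"
proof (rule smooth_funI_local)
  fix x assume "x \<in> W"
  then show "\<exists>U \<phi> T. (U, \<phi>) \<in> base L \<and> x \<in> U \<and> open T \<and> \<phi> x \<in> T \<and> smooth_on T (h \<circ> \<I> U \<phi>)"
    using ch h W chart_open_Int[OF W(1) ch]
    by (intro exI[of _ U] exI[of _ \<phi>] exI[of _ "\<phi> ` W"]) (auto simp: Int_absorb1)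
qed

text \<open>Acting on affine sections recovers the coefficients: the locally constant one gives
  \<open>c\<close>, and the linear coordinate sections give the components of \<xi>.\<close>

lemma derivation_coeffs:
  assumes a: "a \<in> derivations L"
  shows "\<exists>c \<xi>. smooth_on (\<phi> ` dom) c \<and> smooth_on (\<phi> ` dom) \<xi> \<and> (\<forall>x\<in>dom. a x = dv x (c (\<phi> x)) (\<xi> (\<phi> x)))"
proof -
  have "\<forall>x\<in>dom. \<exists>cw. a x = dv x (fst cw) (snd cw)"
    using der_dvec[OF _ derivation_der[OF a]] dom_pts by (metis fst_conv snd_conv)
  then obtain cw where cw: "\<forall>x\<in>dom. a x = dv x (fst (cw x)) (snd (cw x))" by (rule bchoice[THEN exE])
  define c where "c = (\<lambda>z. fst (cw (\<I> U \<phi> z)))"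
  define \<xi> where "\<xi> = (\<lambda>z. snd (cw (\<I> U \<phi> z)))"
  have ax: "a x = dv x (c (\<phi> x)) (\<xi> (\<phi> x))" if "x \<in> dom" for x
    using cw that chart_inv[OF ch, of x] by (simp add: c_def \<xi>_def)
  have act: "sr (act (pts L) a s) (\<phi> x) = c (\<phi> x) * sr s (\<phi> x) + \<D> (sr s) (\<phi> x) (\<xi> (\<phi> x))"
    if "s \<in> \<Gamma> L" "x \<in> dom" for s x
    using that dom_pts[OF that(2)] crd_smult[OF fr, of x] by (simp add: sr_eq act_def ax dvec_apply)
  have cs: "smooth_on (\<phi> ` dom) c"
  proof (rule smooth_on_local)
    fix z assume "z \<in> \<phi> ` dom"
    then obtain x where x: "x \<in> dom" "z = \<phi> x" by blast
    obtain s T where s: "s \<in> \<Gamma> L" "open T" "\<phi> x \<in> T" "T \<subseteq> \<phi> ` dom" "\<forall>z\<in>T. sr s z = 1 + 0"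
      "\<forall>z\<in>T. \<D> (sr s) z = (\<lambda>x. 0)" using affine_section[OF x(1) bounded_linear_zero, of 1] by blast
    have "smooth_on T (sr (act (pts L) a s))"
      using smooth_on_subset[OF sr_smooth[OF derivation_act[OF a s(1)]] s(4)] .
    then have "smooth_on T c"
    proof (rule smooth_on_transform[OF _ s(2)])
      fix z assume z: "z \<in> T"
      then obtain y where y: "y \<in> dom" "z = \<phi> y" using s(4) by blast
      show "sr (act (pts L) a s) z = c z" using act[OF s(1) y(1)] s(5,6) z y(2) by simp
    qed
    then show "\<exists>T. open T \<and> z \<in> T \<and> smooth_on T c" using s x by blast
  qed
  have \<xi>s: "smooth_on (\<phi> ` dom) \<xi>"
  proof (rule smooth_on_local)
    fix z assume "z \<in> \<phi> ` dom"
    then obtain x where x: "x \<in> dom" "z = \<phi> x" by blast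
    obtain B :: "'e set" where B: "is_basis B" using finite_dim_basis[OF fd] .
    have "\<exists>s T. s \<in> \<Gamma> L \<and> open T \<and> \<phi> x \<in> T \<and> T \<subseteq> \<phi> ` dom \<and> (\<forall>z\<in>T. sr s z = 0 + rep B (z - \<phi> x) b) \<and>
        (\<forall>z\<in>T. \<D> (sr s) z = (\<lambda>v. rep B v b))" for b
      using affine_section[OF x(1) bounded_linear_representation[OF B, of b], of 0] by blast
    then obtain s T where s: "\<And>b. s b \<in> \<Gamma> L" "\<And>b. open (T b)" "\<And>b. \<phi> x \<in> T b" "\<And>b. T b \<subseteq> \<phi> ` dom"
      "\<And>b. \<forall>z\<in>T b. sr (s b) z = 0 + rep B (z - \<phi> x) b"
      "\<And>b. \<forall>z\<in>T b. \<D> (sr (s b)) z = (\<lambda>v. rep B v b)" by metis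
    define T' where "T' = \<phi> ` dom \<inter> (\<Inter>b\<in>B. T b)"
    have T': "open T'" "z \<in> T'" unfolding T'_def x(2) using s(2,3) x(1) is_basis_finite[OF B] img_open
      by (auto intro!: open_Int open_INT)
    have T'sub: "T' \<subseteq> \<phi> ` dom" by (auto simp: T'_def)
    \<comment> \<open>On the section with coordinate \<open>rep B (z - \<phi> x) b\<close> the
      derivation gives \<open>c\<close> times this coordinate plus component \<open>b\<close> of
      \<xi>; subtracting the first term isolates the component.\<close>
    have "smooth_on T' (\<lambda>z. \<Sum>b\<in>B. (sr (act (pts L) a (s b)) z - c z * rep B (z - \<phi> x) b) *\<^sub>R b)"
      by (intro smooth_on_sum smooth_on_scaleR smooth_on_const T' smooth_on_diff smooth_on_mult
          smooth_on_linear_comp[OF _ bounded_linear_representation[OF B]] smooth_on_ident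
          smooth_on_subset[OF sr_smooth[OF derivation_act[OF a s(1)]] T'sub] smooth_on_subset[OF cs T'sub])
    then have "smooth_on T' \<xi>"
    proof (rule smooth_on_transform[OF _ T'(1)])
      fix z assume z: "z \<in> T'"
      then obtain y where y: "y \<in> dom" "z = \<phi> y" using T'sub by blast
      have "(\<Sum>b\<in>B. (sr (act (pts L) a (s b)) z - c z * rep B (z - \<phi> x) b) *\<^sub>R b) =
          (\<Sum>b\<in>B. rep B (\<xi> z) b *\<^sub>R b)"
      proof (rule sum.cong[OF refl])
        fix b assume "b \<in> B"
        then have "z \<in> T b" using z by (auto simp: T'_def)
        then show "(sr (act (pts L) a (s b)) z - c z * rep B (z - \<phi> x) b) *\<^sub>R b =
            rep B (\<xi> z) b *\<^sub>R b" using act[OF s(1) y(1), of b] s(5,6) y(2) by simp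
      qed
      then show "(\<Sum>b\<in>B. (sr (act (pts L) a (s b)) z - c z * rep B (z - \<phi> x) b) *\<^sub>R b) = \<xi> z"
        by (simp add: basis_sum[OF B])
    qed
    then show "\<exists>T. open T \<and> z \<in> T \<and> smooth_on T \<xi>" using T' by blast
  qed
  show ?thesis using cs \<xi>s ax by blast
qed

text \<open>Scaling both coefficients by a bump keeps the value at \<open>x\<close> and permits
  extension by zero; with \<open>der_dvec\<close>, every element of \<open>D_xL\<close> is the value
  of a global derivation.\<close>

lemma derivation_cutoff:
  assumes x: "x \<in> dom"
  shows "\<exists>a\<in>derivations L. a x = dv x c w"
proof -
  obtain \<rho> N W' where *: "\<rho> \<in> Cs (base L)" "mfd_open (base L) N" "pts L - dom \<subseteq> N" "\<And>y. y \<in> N \<Longrightarrow> \<rho> y = 0"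
    "mfd_open (base L) W'" "x \<in> W'" "W' \<subseteq> dom" "\<And>y. y \<in> W' \<Longrightarrow> \<rho> y = 1" using bump[OF dom_open x] by blast
  define a where "a = (\<lambda>y\<in>pts L. if y \<in> dom then dv y (\<rho> y * c) (\<rho> y *\<^sub>R w) else \<zero>\<^bsub>der_space L y\<^esub>)"
  have "act (pts L) a s \<in> \<Gamma> L" if s: "s \<in> \<Gamma> L" for s
  proof -
    let ?h = "\<lambda>y. c * sr s (\<phi> y) + \<D> (sr s) (\<phi> y) w"
    have "smooth_fun (base L) dom ?h"
    proof (rule smooth_funI_chart[OF dom_open])
      have "smooth_on (\<phi> ` dom) (\<lambda>z. c * sr s z + \<D> (sr s) z w)"
        by (intro smooth_on_add smooth_on_mult smooth_on_const img_open sr_smooth s smooth_on_derivative)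
      then show "smooth_on (\<phi> ` dom) (?h \<circ> \<I> U \<phi>)"
        by (rule smooth_on_transform[OF _ img_open]) (use chart_inv[OF ch] in auto)
    qed simp
    from section_glue[OF fr dom_open _ this *(1-4)]
    have "(\<lambda>y\<in>pts L. if y \<in> dom then (\<rho> y * ?h y) \<odot>\<^bsub>fibre L y\<^esub> e y else \<zero>\<^bsub>fibre L y\<^esub>) \<in> \<Gamma> L" by simp
    moreover have "act (pts L) a s = (\<lambda>y\<in>pts L. if y \<in> dom then (\<rho> y * ?h y) \<odot>\<^bsub>fibre L y\<^esub> e y else \<zero>\<^bsub>fibre L y\<^esub>)"
      unfolding act_def
    proof (rule restrict_ext)
      fix y assume y: "y \<in> pts L"
      show "a y s = (if y \<in> dom then (\<rho> y * ?h y) \<odot>\<^bsub>fibre L y\<^esub> e y else \<zero>\<^bsub>fibre L y\<^esub>)"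
        using y s linear_scale[OF sr_linear[OF s, of y]] by (simp add: a_def dvec_apply algebra_simps)
    qed
    ultimately show ?thesis by simp
  qed
  moreover have "a \<in> (\<Pi>\<^sub>E y\<in>pts L. \<L> L y)"
    using dvec_der vs_zero[OF der_space_vec_space] by (auto simp: a_def simp del: der_space_simps)
  moreover have "a x = dv x c w" using x dom_pts[OF x] *(6,8) by (simp add: a_def)
  ultimately show ?thesis unfolding derivations_def by blast
qed

end

context lbundle
begin

text \<open>Symbols exist point by point by definition of \<open>DL\<close>. Their smoothness comes
  from the coefficient \<xi> of the derivation: both satisfy the Leibniz rule, and a section equal
  to the frame forces them to agree.\<close>

lemma derivation_symbol:
  assumes a: "a \<in> derivations L"
  shows "\<exists>X\<in>\<X> (base L). \<forall>x\<in>pts L. \<forall>f\<in>Cs (base L). \<forall>s\<in>\<Gamma> L.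
    a x (fmult (pts L) (fibre L) f s) = f x \<odot>\<^bsub>fibre L x\<^esub> a x s \<oplus>\<^bsub>fibre L x\<^esub> X x f \<odot>\<^bsub>fibre L x\<^esub> s x"
proof -
  let ?P = "\<lambda>x \<delta>. \<delta> \<in> \<T> (base L) x \<and> (\<forall>f\<in>Cs (base L). \<forall>s\<in>\<Gamma> L.
    a x (fmult (pts L) (fibre L) f s) = f x \<odot>\<^bsub>fibre L x\<^esub> a x s \<oplus>\<^bsub>fibre L x\<^esub> \<delta> f \<odot>\<^bsub>fibre L x\<^esub> s x)"
  have "\<forall>x\<in>pts L. \<exists>\<delta>. ?P x \<delta>"
  proof
    fix x assume "x \<in> pts L"
    from derivation_der[OF a this] show "\<exists>\<delta>. ?P x \<delta>" unfolding der_space_iff by blast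
  qed
  then obtain X0 where X0: "\<forall>x\<in>pts L. ?P x (X0 x)" by (rule bchoice[THEN exE])
  define X where "X = restrict X0 (pts L)"
  have X: "?P x (X x)" if "x \<in> pts L" for x using X0 that by (simp add: X_def)
  have "X \<in> \<X> (base L)"
  proof (rule vfieldsI_local)
    show "X \<in> (\<Pi>\<^sub>E x\<in>pts L. \<T> (base L) x)" using X0 by (auto simp: X_def)
    fix x assume x: "x \<in> pts L"
    obtain U \<phi> V e where T: "triv L U \<phi> V e" "x \<in> U \<inter> V" using triv_ex[OF x] .
    interpret triv L U \<phi> V e by (rule T)
    obtain c \<xi> where c\<xi>: "smooth_on (\<phi> ` dom) \<xi>" "\<forall>x\<in>dom. a x = dv x (c (\<phi> x)) (\<xi> (\<phi> x))"
      using derivation_coeffs[OF a] by blast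
    have Xy: "X y = tvec (base L) U \<phi> y (\<xi> (\<phi> y))" if y: "y \<in> dom" for y
    proof -
      have yU: "y \<in> U" and yV: "y \<in> V" using y by auto
      note yP = dom_pts[OF y]
      obtain e0 W where e0: "e0 \<in> \<Gamma> L" "y \<in> W" "\<forall>y\<in>W. e0 y = e y" using local_frame_section[OF fr yV] by blast
      have eq: "X y f = tvec (base L) U \<phi> y (\<xi> (\<phi> y)) f" if f: "f \<in> Cs (base L)" for f
      proof -
        have 1: "a y (fmult (pts L) (fibre L) f e0) = f y \<odot>\<^bsub>fibre L y\<^esub> a y e0 \<oplus>\<^bsub>fibre L y\<^esub> X y f \<odot>\<^bsub>fibre L y\<^esub> e0 y"
          using X[OF yP] f e0(1) by blast
        have 2: "a y (fmult (pts L) (fibre L) f e0) = f y \<odot>\<^bsub>fibre L y\<^esub> a y e0 \<oplus>\<^bsub>fibre L y\<^esub>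
            tvec (base L) U \<phi> y (\<xi> (\<phi> y)) f \<odot>\<^bsub>fibre L y\<^esub> e0 y" using dvec_fmult[OF y f e0(1)] c\<xi>(2) y by simp
        have ay: "a y e0 \<in> \<F> L y" by (rule der_carrier[OF derivation_der[OF a yP] e0(1)])
        have e0y: "e0 y = e y" using e0 by blast
        have cr: "crd L e y (f y \<odot>\<^bsub>fibre L y\<^esub> a y e0 \<oplus>\<^bsub>fibre L y\<^esub> r \<odot>\<^bsub>fibre L y\<^esub> e y) =
            f y * crd L e y (a y e0) + r" for r
          using crd_add[OF fr yV] crd_scale[OF fr yV] crd_smult[OF fr yV] frame_smult[OF fr yV] ay
            vs_smult[OF fibre_vs[OF yP] ay] by simp
        from 1 2 show ?thesis using cr[of "X y f"] cr[of "tvec (base L) U \<phi> y (\<xi> (\<phi> y)) f"] by (simp add: e0y)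
      qed
      have "X y \<in> extensional (Cs (base L))" using X[OF yP] by (simp add: tangent_iff)
      moreover have "tvec (base L) U \<phi> y (\<xi> (\<phi> y)) \<in> extensional (Cs (base L))" by (simp add: tvec_def)
      ultimately show ?thesis by (rule extensionalityI) (rule eq)
    qed
    show "\<exists>U \<phi> T \<xi>. (U, \<phi>) \<in> base L \<and> x \<in> U \<and> open T \<and> \<phi> x \<in> T \<and> T \<subseteq> \<phi> ` U \<and> smooth_on T \<xi> \<and>
        (\<forall>y\<in>U. \<phi> y \<in> T \<longrightarrow> X y = tvec (base L) U \<phi> y (\<xi> (\<phi> y)))"
    proof (intro exI conjI ballI impI)
      fix y assume "y \<in> U" "\<phi> y \<in> \<phi> ` dom"
      then have "y \<in> dom" using chart_inj[OF ch] by (auto simp: inj_on_def)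
      then show "X y = tvec (base L) U \<phi> y (\<xi> (\<phi> y))" by (rule Xy)
    qed (use ch T img_open c\<xi> in auto)
  qed
  then show ?thesis using X by blast
qed

lemma der_bracket_apply: "x \<in> pts L \<Longrightarrow> s \<in> \<Gamma> L \<Longrightarrow>
    der_bracket L a b x s = a x (act (pts L) b s) \<ominus>\<^bsub>fibre L x\<^esub> b x (act (pts L) a s)" by (simp add: der_bracket_def)

text \<open>The cross terms \<open>X f b[s]\<close> and \<open>Y f a[s]\<close> occur in both orders
  and cancel, which leaves the bracket of the symbols as symbol.\<close>

lemma der_bracket_derivation:
  assumes a: "a \<in> derivations L" and b: "b \<in> derivations L"
  shows "der_bracket L a b \<in> derivations L"
proof -
  let ?m = "fmult (pts L) (fibre L)"
  let ?add = "\<lambda>s t. \<lambda>x\<in>pts L. s x \<oplus>\<^bsub>fibre L x\<^esub> t x" and ?sc = "\<lambda>c s. \<lambda>x\<in>pts L. c \<odot>\<^bsub>fibre L x\<^esub> s x"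
  obtain X where X: "X \<in> \<X> (base L)" "\<And>x f s. x \<in> pts L \<Longrightarrow> f \<in> Cs (base L) \<Longrightarrow> s \<in> \<Gamma> L \<Longrightarrow>
    a x (?m f s) = f x \<odot>\<^bsub>fibre L x\<^esub> a x s \<oplus>\<^bsub>fibre L x\<^esub> X x f \<odot>\<^bsub>fibre L x\<^esub> s x" using derivation_symbol[OF a] by metis
  obtain Y where Y: "Y \<in> \<X> (base L)" "\<And>x f s. x \<in> pts L \<Longrightarrow> f \<in> Cs (base L) \<Longrightarrow> s \<in> \<Gamma> L \<Longrightarrow>
    b x (?m f s) = f x \<odot>\<^bsub>fibre L x\<^esub> b x s \<oplus>\<^bsub>fibre L x\<^esub> Y x f \<odot>\<^bsub>fibre L x\<^esub> s x" using derivation_symbol[OF b] by metis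
  note actC = derivation_act
  have dl: "d x (?add s t) = d x s \<oplus>\<^bsub>fibre L x\<^esub> d x t" "d x (?sc r s) = r \<odot>\<^bsub>fibre L x\<^esub> d x s"
    if "d \<in> derivations L" "x \<in> pts L" "s \<in> \<Gamma> L" "t \<in> \<Gamma> L" for d x s t r
    using derivation_der[OF that(1,2)] lin_mapD(2,3)[of "sections L" "fibre L x" "d x"] that(3,4)
    by (auto simp: der_space_iff)
  have act_add: "act (pts L) d (?add s t) = ?add (act (pts L) d s) (act (pts L) d t)"
    "act (pts L) d (?sc r s) = ?sc r (act (pts L) d s)"
    if "d \<in> derivations L" "s \<in> \<Gamma> L" "t \<in> \<Gamma> L" for d s t r
    using dl[OF that(1) _ that(2,3)] by (auto simp: act_def)
  have act_m: "act (pts L) d (?m f s) = ?add (?m f (act (pts L) d s)) (?m (act (pts L) Z f) s)"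
    if "\<And>x f s. x \<in> pts L \<Longrightarrow> f \<in> Cs (base L) \<Longrightarrow> s \<in> \<Gamma> L \<Longrightarrow>
      d x (?m f s) = f x \<odot>\<^bsub>fibre L x\<^esub> d x s \<oplus>\<^bsub>fibre L x\<^esub> Z x f \<odot>\<^bsub>fibre L x\<^esub> s x" "f \<in> Cs (base L)" "s \<in> \<Gamma> L" for d Z f s
    using that by (auto simp: act_def fmult_def)
  have "der_bracket L a b x \<in> \<L> L x" if x: "x \<in> pts L" for x
  proof -
    obtain V e where fr: "(V, e) \<in> frames L" "x \<in> V" using frame_ex[OF x] by blast
    note Vx = fibre_vs[OF x]
    have dc: "d x s \<in> \<F> L x" if "d \<in> derivations L" "s \<in> \<Gamma> L" for d s
      by (rule der_carrier[OF derivation_der[OF that(1) x] that(2)])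
    note c = dc[OF a] dc[OF b] sec_carrier[OF _ x] vs_smult[OF Vx] vs_add[OF Vx] actC[OF a] actC[OF b]
    note cc = crd_add[OF fr] crd_scale[OF fr] crd_minus[OF fr]
    have mc: "v \<ominus>\<^bsub>fibre L x\<^esub> w \<in> \<F> L x" if "v \<in> \<F> L x" "w \<in> \<F> L x" for v w
      using that by (simp add: vs_minus[OF Vx] c)
    note XC = act_Cs[OF X(1)] act_Cs[OF Y(1)]
    show ?thesis unfolding der_space_iff lin_map_def
    proof (intro conjI ballI allI bexI[of _ "vf_bracket (base L) X Y x"])
      show "der_bracket L a b x \<in> extensional (\<Gamma> L)" using x by (simp add: der_bracket_def)
      show "der_bracket L a b x \<in> \<Gamma> L \<rightarrow> \<F> L x" using x by (intro funcsetI) (simp add: der_bracket_apply mc c)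
      show "vf_bracket (base L) X Y x \<in> \<T> (base L) x"
        by (rule vfield_tangent[OF vf_bracket_vfield[OF X(1) Y(1)] x])
      show "der_bracket L a b x (s \<oplus>\<^bsub>sections L\<^esub> t) = der_bracket L a b x s \<oplus>\<^bsub>fibre L x\<^esub> der_bracket L a b x t"
        if st: "s \<in> \<Gamma> L" "t \<in> \<Gamma> L" for s t by (rule crd_inject[OF fr])
          (use st x in \<open>simp_all add: der_bracket_apply sec_add act_add[OF a st] act_add[OF b st]
            dl[OF a x] dl[OF b x] c mc cc\<close>)
      show "der_bracket L a b x (r \<odot>\<^bsub>sections L\<^esub> s) = r \<odot>\<^bsub>fibre L x\<^esub> der_bracket L a b x s"
        if st: "s \<in> \<Gamma> L" for r s by (rule crd_inject[OF fr])
          (use st x in \<open>simp_all add: der_bracket_apply sec_scale act_add[OF a st st] act_add[OF b st st]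
            dl[OF a x] dl[OF b x] c mc cc algebra_simps\<close>)
      show "der_bracket L a b x (?m f s) = f x \<odot>\<^bsub>fibre L x\<^esub> der_bracket L a b x s \<oplus>\<^bsub>fibre L x\<^esub>
          vf_bracket (base L) X Y x f \<odot>\<^bsub>fibre L x\<^esub> s x"
        if f: "f \<in> Cs (base L)" and s: "s \<in> \<Gamma> L" for f s
      proof (rule crd_inject[OF fr])
        have ax: "act (pts L) d s x = d x s" for d s using x by (simp add: act_def)
        have Zx: "act (pts L) Z f x = Z x f" for Z using x by (simp add: act_def)
        show "crd L e x (der_bracket L a b x (?m f s)) = crd L e x
          (f x \<odot>\<^bsub>fibre L x\<^esub> der_bracket L a b x s \<oplus>\<^bsub>fibre L x\<^esub> vf_bracket (base L) X Y x f \<odot>\<^bsub>fibre L x\<^esub> s x)"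
          using s f x by (simp add: der_bracket_apply sec_fmult act_m[OF X(2) f s] act_m[OF Y(2) f s]
              dl[OF a x] dl[OF b x] X(2) Y(2) XC c mc cc ax Zx vf_bracket_apply algebra_simps)
      qed (use s f x in \<open>simp_all add: der_bracket_apply sec_fmult c mc\<close>)
    qed
  qed
  then have "der_bracket L a b \<in> (\<Pi>\<^sub>E x\<in>pts L. \<L> L x)" by (auto simp: der_bracket_def)
  moreover have "act (pts L) (der_bracket L a b) s \<in> \<Gamma> L" if s: "s \<in> \<Gamma> L" for s
  proof -
    have "act (pts L) (der_bracket L a b) s = ?add (act (pts L) a (act (pts L) b s))
        (?sc (-1) (act (pts L) b (act (pts L) a s)))" unfolding act_def[of _ "der_bracket L a b"]
    proof (rule restrict_ext)
      fix x assume x: "x \<in> pts L"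
      have "a x (act (pts L) b s) \<in> \<F> L x" "b x (act (pts L) a s) \<in> \<F> L x"
        using der_carrier[OF derivation_der[OF a x] actC[OF b s]] der_carrier[OF derivation_der[OF b x] actC[OF a s]] .
      then show "der_bracket L a b x s = act (pts L) a (act (pts L) b s) x \<oplus>\<^bsub>fibre L x\<^esub>
          (?sc (-1) (act (pts L) b (act (pts L) a s))) x"
        using x s by (simp add: der_bracket_apply vs_minus[OF fibre_vs[OF x]] act_def[of _ a "act (pts L) b s"]
            act_def[of _ b "act (pts L) a s"])
    qed
    then show ?thesis using sec_add[OF actC[OF a actC[OF b s]] sec_scale[OF actC[OF b actC[OF a s]]]] by simp
  qed
  ultimately show ?thesis unfolding derivations_def by blast
qed

end

section \<open>The jet bundle as a manifold\<close>

lemma smooth_on_fst_comp: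
  fixes f :: "'a::real_normed_vector \<Rightarrow> 'c::real_normed_vector"
  assumes "finite_dim TYPE('a::real_normed_vector)" "open S" "smooth_on S f"
  shows "smooth_on (S \<times> (UNIV :: 'b::real_normed_vector set)) (\<lambda>z. f (fst z))"
  by (rule smooth_on_compose[OF assms(1) _ assms(2) _ _ assms(3)])
    (auto intro!: smooth_on_bounded_linear bounded_linear_fst open_Times assms(2))

context triv
begin

abbreviation jdom where "jdom \<equiv> (SIGMA x:dom. \<J> L x)"
abbreviation \<Phi> where "\<Phi> \<equiv> jet_chart L U \<phi> e"

lemma \<Phi>_eq: "\<Phi> p = (\<phi> (fst p), jco L U \<phi> e (fst p) (snd p))" by (cases p) (simp add: jet_chart_eq)

lemma \<Phi>_in_J1: "(jdom, \<Phi>) \<in> J1 L" using ch fr unfolding J1_def by blast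

lemma dom_inject: "x \<in> dom \<Longrightarrow> y \<in> dom \<Longrightarrow> \<phi> x = \<phi> y \<Longrightarrow> x = y" using chart_inj[OF ch] by (auto simp: inj_on_def)

text \<open>Chart images are full cylinders over the base, since every value of the fibre
  coordinates belongs to the jet of a section.\<close>

lemma \<Phi>_image: "\<Phi> ` (jdom \<inter> {p. fst p \<in> W}) = (\<phi> ` (dom \<inter> W)) \<times> UNIV"
proof
  show "\<Phi> ` (jdom \<inter> {p. fst p \<in> W}) \<subseteq> (\<phi> ` (dom \<inter> W)) \<times> UNIV" by (auto simp: \<Phi>_eq)
  show "(\<phi> ` (dom \<inter> W)) \<times> UNIV \<subseteq> \<Phi> ` (jdom \<inter> {p. fst p \<in> W})"
  proof
    fix z assume "z \<in> (\<phi> ` (dom \<inter> W)) \<times> (UNIV :: (real \<times> ('e \<Rightarrow>\<^sub>L real)) set)"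
    then obtain x u p where x: "x \<in> dom" "x \<in> W" and z: "z = (\<phi> x, u, p)" by (cases z) auto
    obtain s where s: "s \<in> \<Gamma> L" "jco L U \<phi> e x (jet L s x) = (u, p)" using jet_ex[OF x(1)] by blast
    have "z = \<Phi> (x, jet L s x)" using s(2) z by (simp add: jet_chart_eq)
    moreover have "(x, jet L s x) \<in> jdom \<inter> {p. fst p \<in> W}" using x jet_jet_space[OF s(1) dom_pts[OF x(1)]] by simp
    ultimately show "z \<in> \<Phi> ` (jdom \<inter> {p. fst p \<in> W})" by (rule image_eqI)
  qed
qed

lemma \<Phi>_image_jdom: "\<Phi> ` jdom = (\<phi> ` dom) \<times> UNIV" using \<Phi>_image[of UNIV] by simp

lemma \<Phi>_inj: "inj_on \<Phi> jdom"
proof (rule inj_onI)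
  fix p q assume pq: "p \<in> jdom" "q \<in> jdom" "\<Phi> p = \<Phi> q"
  then have "fst p \<in> dom" "fst q \<in> dom" "\<phi> (fst p) = \<phi> (fst q)" by (auto simp: \<Phi>_eq)
  then have e: "fst p = fst q" by (rule dom_inject)
  then have "snd p = snd q" using pq by (intro jco_inject[of "fst p"]) (auto simp: \<Phi>_eq)
  then show "p = q" using e by (simp add: prod_eq_iff)
qed

end

section \<open>Change of chart and frame on the jet bundle\<close>

locale triv2 = triv L U \<phi> V e + T': triv L U' \<phi>' V' e'
  for L :: "('m, 'e::real_normed_vector, 'v) line_bundle" and U \<phi> V e U' \<phi>' V' e'
begin

definition \<tau> where "\<tau> = \<phi>' \<circ> \<I> U \<phi>"
definition \<tau>' where "\<tau>' = \<phi> \<circ> \<I> U' \<phi>'"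
text \<open>Frame transition in the first chart: \<open>e = h e'\<close>.\<close>

definition h where "h = (\<lambda>x. crd L e' x (e x)) \<circ> \<I> U \<phi>"
text \<open>The inverse Jacobian of \<tau> at \<open>y\<close>, written as a derivative of
  \<tau>\<open>'\<close> so that no linear map has to be inverted.\<close>

definition K where "K y w = \<D> \<tau>' (\<tau> y) w"
abbreviation dom2 where "dom2 \<equiv> dom \<inter> T'.dom"

lemma h_eq: "x \<in> U \<Longrightarrow> h (\<phi> x) = crd L e' x (e x)"
  and \<tau>_eq: "x \<in> U \<Longrightarrow> \<tau> (\<phi> x) = \<phi>' x" by (simp_all add: h_def \<tau>_def chart_inv[OF ch])

lemma \<tau>'_eq: "x \<in> U' \<Longrightarrow> \<tau>' (\<phi>' x) = \<phi> x" by (simp add: \<tau>'_def chart_inv[OF T'.ch])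

lemma dom2_open: "open (\<phi> ` dom2)" "open (\<phi>' ` dom2)"
proof -
  have o: "mfd_open (base L) dom2" by (rule mfd_open_Int[OF dom_open T'.dom_open])
  have "U \<inter> dom2 = dom2" "U' \<inter> dom2 = dom2" by auto
  then show "open (\<phi> ` dom2)" "open (\<phi>' ` dom2)"
    using chart_open_Int[OF o ch] chart_open_Int[OF o T'.ch] by simp_all
qed

lemma \<tau>_smooth: "smooth_on (\<phi> ` dom2) \<tau>"
  using chart_compat[OF ch T'.ch] unfolding \<tau>_def by (auto intro: smooth_on_subset)

lemma \<tau>'_smooth: "smooth_on (\<phi>' ` dom2) \<tau>'"
  using chart_compat[OF T'.ch ch] unfolding \<tau>'_def by (auto intro: smooth_on_subset)

lemma h_smooth: "smooth_on (\<phi> ` dom2) h"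
  using smooth_funD_sub[OF frame_transition[OF T'.fr fr] ch, of "\<phi> ` dom2"] unfolding h_def by blast

lemma K_linear: "x \<in> dom2 \<Longrightarrow> linear (K (\<phi> x))" unfolding K_def
  by (rule has_derivative_linear[OF smooth_on_hd[OF \<tau>'_smooth]]) (simp add: \<tau>_eq)

lemma K_\<tau>:
  assumes x: "x \<in> dom2"
  shows "K (\<phi> x) (\<D> \<tau> (\<phi> x) w) = w"
proof -
  have "(\<tau> has_derivative \<D> \<tau> (\<phi> x)) (at (\<phi> x))" by (rule smooth_on_hd[OF \<tau>_smooth]) (use x in auto)
  moreover have "(\<tau>' has_derivative \<D> \<tau>' (\<tau> (\<phi> x))) (at (\<tau> (\<phi> x)))"
    by (rule smooth_on_hd[OF \<tau>'_smooth]) (use x in \<open>auto simp: \<tau>_eq\<close>)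
  ultimately have "((\<tau>' \<circ> \<tau>) has_derivative (\<lambda>w. K (\<phi> x) (\<D> \<tau> (\<phi> x) w))) (at (\<phi> x))"
    using diff_chain_at unfolding K_def o_def by fastforce
  moreover have "((\<tau>' \<circ> \<tau>) has_derivative (\<lambda>w. w)) (at (\<phi> x))"
    by (rule has_derivative_transform_within_open[OF has_derivative_ident dom2_open(1)])
      (use x in \<open>auto simp: \<tau>_eq \<tau>'_eq\<close>)
  ultimately show ?thesis using has_derivative_unique by metis
qed

lemma sr_transition:
  assumes s: "s \<in> \<Gamma> L" and x: "x \<in> dom2"
  shows "T'.sr s (\<phi>' x) = h (\<phi> x) * sr s (\<phi> x)"
  using x crd_change[OF fr, of x V' e' "s x"] T'.fr sec_carrier[OF s dom_pts, of x]
  by (simp add: sr_eq T'.sr_eq h_eq mult.commute)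

lemma D_sr_transition:
  assumes s: "s \<in> \<Gamma> L" and x: "x \<in> dom2"
  shows "\<D> (T'.sr s) (\<phi>' x) w =
    h (\<phi> x) * \<D> (sr s) (\<phi> x) (K (\<phi> x) w) + \<D> h (\<phi> x) (K (\<phi> x) w) * sr s (\<phi> x)"
proof -
  have xd: "x \<in> dom" "x \<in> T'.dom" "x \<in> U" "x \<in> U'" using x by auto
  have t: "(\<tau>' has_derivative K (\<phi> x)) (at (\<phi>' x))"
    using smooth_on_hd[OF \<tau>'_smooth, of "\<phi>' x"] x by (simp add: K_def[abs_def] \<tau>_eq[OF xd(3)])
  have hh: "(h has_derivative \<D> h (\<phi> x)) (at (\<tau>' (\<phi>' x)))"
    using smooth_on_hd[OF h_smooth, of "\<phi> x"] x by (simp add: \<tau>'_eq[OF xd(4)])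
  have ss: "(sr s has_derivative \<D> (sr s) (\<phi> x)) (at (\<tau>' (\<phi>' x)))"
    using sr_hd[OF s xd(1)] by (simp add: \<tau>'_eq[OF xd(4)])
  have "((\<lambda>z. h (\<tau>' z) * sr s (\<tau>' z)) has_derivative
      (\<lambda>w. h (\<tau>' (\<phi>' x)) * \<D> (sr s) (\<phi> x) (K (\<phi> x) w) +
        \<D> h (\<phi> x) (K (\<phi> x) w) * sr s (\<tau>' (\<phi>' x)))) (at (\<phi>' x))"
    by (rule has_derivative_mult[OF has_derivative_compose[OF t hh] has_derivative_compose[OF t ss]])
  moreover have "\<D> (T'.sr s) (\<phi>' x) = \<D> (\<lambda>z. h (\<tau>' z) * sr s (\<tau>' z)) (\<phi>' x)"
    by (rule frechet_derivative_cong[OF dom2_open(2)]) (use x in \<open>auto simp: sr_transition[OF s] \<tau>'_eq\<close>)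
  ultimately show ?thesis by (simp add: frechet_derivative_at[symmetric] \<tau>'_eq[OF xd(4)])
qed

text \<open>Transition of 1-jets, from the product rule for \<open>h\<close> times the component of
  a section in the new chart. Because of the term \<open>u dh\<close>, the differential alone has no
  invariant meaning.\<close>

definition \<Psi> where "\<Psi> z = (\<tau> (fst z), h (fst z) * fst (snd z),
  Blinfun (\<lambda>w. h (fst z) * ap (snd (snd z)) (K (fst z) w) + \<D> h (fst z) (K (fst z) w) * fst (snd z)))"

lemma \<Psi>_blinfun:
  assumes x: "x \<in> dom2"
  shows "ap (snd (snd (\<Psi> (\<phi> x, u, p)))) w =
    h (\<phi> x) * ap p (K (\<phi> x) w) + \<D> h (\<phi> x) (K (\<phi> x) w) * u"
proof -
  have lh: "linear (\<D> h (\<phi> x))" by (rule has_derivative_linear[OF smooth_on_hd[OF h_smooth]]) (use x in auto)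
  have "linear (\<lambda>w. h (\<phi> x) * ap p (K (\<phi> x) w) + \<D> h (\<phi> x) (K (\<phi> x) w) * u)" by (rule linearI)
      (simp_all add: linear_add[OF K_linear[OF x]] linear_scale[OF K_linear[OF x]] linear_add[OF lh] linear_scale[OF lh]
        blinfun.add_right blinfun.scaleR_right algebra_simps)
  from linear_imp_bounded_linear[OF fd this] show ?thesis by (simp add: \<Psi>_def bounded_linear_Blinfun_apply)
qed

text \<open>Every point of a fibre is the jet of a section, so the transition is the chain and
  product rule for that section.\<close>

lemma \<Phi>_transition:
  assumes x: "x \<in> dom2" and \<alpha>: "\<alpha> \<in> \<J> L x"
  shows "T'.\<Phi> (x, \<alpha>) = \<Psi> (\<Phi> (x, \<alpha>))"
proof -
  have xd: "x \<in> dom" "x \<in> T'.dom" "x \<in> U" using x by auto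
  obtain s where s: "s \<in> \<Gamma> L" "jet L s x = \<alpha>" using jet_surj[OF dom_pts[OF xd(1)] \<alpha>] by blast
  obtain u p where up: "jco L U \<phi> e x \<alpha> = (u, p)" by (cases "jco L U \<phi> e x \<alpha>")
  obtain u' p' where up': "jco L U' \<phi>' e' x \<alpha> = (u', p')" by (cases "jco L U' \<phi>' e' x \<alpha>")
  have 1: "u = sr s (\<phi> x)" "ap p = \<D> (sr s) (\<phi> x)"
    using jco_jet[OF xd(1) s(1)] jco_jet_blinfun[OF xd(1) s(1)] s(2) up by auto
  have 2: "u' = T'.sr s (\<phi>' x)" "ap p' = \<D> (T'.sr s) (\<phi>' x)"
    using T'.jco_jet[OF xd(2) s(1)] T'.jco_jet_blinfun[OF xd(2) s(1)] s(2) up' by auto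
  have "p' = snd (snd (\<Psi> (\<phi> x, u, p)))"
    by (rule blinfun_eqI) (simp only: \<Psi>_blinfun[OF x] 1 2 D_sr_transition[OF s(1) x])
  moreover have "u' = h (\<phi> x) * u" using 1 2 sr_transition[OF s(1) x] by simp
  moreover have "\<phi>' x = \<tau> (\<phi> x)" by (simp add: \<tau>_eq[OF xd(3)])
  ultimately show ?thesis by (simp add: jet_chart_eq T'.jet_chart_eq up up' \<Psi>_def)
qed

lemma \<Psi>_smooth: "smooth_on (\<phi> ` dom2 \<times> UNIV) \<Psi>"
proof -
  let ?S = "\<phi> ` dom2 \<times> (UNIV :: (real \<times> ('e \<Rightarrow>\<^sub>L real)) set)"
  have oS: "open ?S" by (intro open_Times dom2_open open_UNIV)
  note fc = smooth_on_fst_comp[OF fd dom2_open(1)]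
  have \<tau>m: "\<tau> ` (\<phi> ` dom2) \<subseteq> \<phi>' ` dom2" by (auto simp: \<tau>_eq)
  have K: "smooth_on (\<phi> ` dom2) (\<lambda>y. K y w)" for w unfolding K_def
    by (rule smooth_on_compose[OF fd dom2_open \<tau>m \<tau>_smooth smooth_on_derivative[OF \<tau>'_smooth]])
  have Dh: "smooth_on (\<phi> ` dom2) (\<lambda>y. \<D> h y (K y w))" for w
    by (rule smooth_on_directional[OF fd dom2_open(1) h_smooth K])
  have u: "smooth_on ?S (\<lambda>z. fst (snd z))" and p: "smooth_on ?S (\<lambda>z. snd (snd z))"
    by (intro smooth_on_fst smooth_on_snd smooth_on_ident oS)+
  have "smooth_on ?S (\<lambda>z. snd (snd (\<Psi> z)))"
  proof (rule smooth_on_blinfunI[OF fd oS])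
    fix w
    have "smooth_on ?S (\<lambda>z. h (fst z) * ap (snd (snd z)) (K (fst z) w) +
        \<D> h (fst z) (K (fst z) w) * fst (snd z))"
      by (intro smooth_on_add smooth_on_mult oS fc[OF h_smooth] smooth_on_blinfun_apply p fc[OF K] fc[OF Dh] u)
    then show "smooth_on ?S (\<lambda>z. ap (snd (snd (\<Psi> z))) w)"
      by (rule smooth_on_transform[OF _ oS]) (auto simp: \<Psi>_blinfun)
  qed
  moreover have "smooth_on ?S (\<lambda>z. fst (\<Psi> z))" unfolding \<Psi>_def fst_conv by (rule fc[OF \<tau>_smooth])
  moreover have "smooth_on ?S (\<lambda>z. fst (snd (\<Psi> z)))"
    unfolding \<Psi>_def fst_conv snd_conv by (intro smooth_on_mult oS fc[OF h_smooth] u)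
  ultimately have "smooth_on ?S (\<lambda>z. (fst (\<Psi> z), fst (snd (\<Psi> z)), snd (snd (\<Psi> z))))" by (intro smooth_on_Pair oS)
  then show ?thesis by simp
qed

lemma jdom_Int: "jdom \<inter> T'.jdom = jdom \<inter> {p. fst p \<in> T'.dom}" by auto

lemma \<Phi>_image_Int: "\<Phi> ` (jdom \<inter> T'.jdom) = \<phi> ` dom2 \<times> UNIV" unfolding jdom_Int by (rule \<Phi>_image)

lemma dom2_UNIV_open: "open (\<phi> ` dom2 \<times> (UNIV :: (real \<times> ('e \<Rightarrow>\<^sub>L real)) set))"
  by (intro open_Times dom2_open open_UNIV)

lemma transition_eq_\<Psi>:
  assumes "z \<in> \<phi> ` dom2 \<times> UNIV"
  shows "(T'.\<Phi> \<circ> \<I> jdom \<Phi>) z = \<Psi> z"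
proof -
  obtain p where p: "p \<in> jdom" "p \<in> T'.jdom" "z = \<Phi> p" using assms unfolding \<Phi>_image_Int[symmetric] by blast
  have "\<I> jdom \<Phi> z = p" using p \<Phi>_inj by simp
  moreover have "T'.\<Phi> p = \<Psi> (\<Phi> p)" using \<Phi>_transition[of "fst p" "snd p"] p by auto
  ultimately show ?thesis using p(3) by simp
qed

lemma jet_transition:
  "open (\<Phi> ` (jdom \<inter> T'.jdom)) \<and> smooth_on (\<Phi> ` (jdom \<inter> T'.jdom)) (T'.\<Phi> \<circ> \<I> jdom \<Phi>)" unfolding \<Phi>_image_Int
  using dom2_UNIV_open smooth_on_transform[OF \<Psi>_smooth dom2_UNIV_open] transition_eq_\<Psi> by metis

end

context lbundle
begin

lemma J1_cases:
  assumes "(D, \<Psi>) \<in> J1 L"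
  obtains U \<phi> V e where "triv L U \<phi> V e" "D = jet_dom L U V" "\<Psi> = jet_chart L U \<phi> e"
proof -
  obtain U \<phi> V e where "(U, \<phi>) \<in> base L" "(V, e) \<in> frames L"
    "D = jet_dom L U V" "\<Psi> = jet_chart L U \<phi> e" using assms unfolding J1_def by blast
  then show ?thesis using that lbundle_axioms by (simp add: triv_def triv_axioms_def)
qed

lemma J1_atlas: "atlas (J1 L)"
proof
  show "finite_dim TYPE('e \<times> real \<times> ('e \<Rightarrow>\<^sub>L real))" by (rule finite_dim_jet_model[OF fd])
next
  fix D \<Psi> assume D: "(D, \<Psi>) \<in> J1 L"
  obtain U \<phi> V e where T: "triv L U \<phi> V e" and e: "D = jet_dom L U V" "\<Psi> = jet_chart L U \<phi> e"
    using J1_cases[OF D] .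
  show "inj_on \<Psi> D" unfolding e by (rule triv.\<Phi>_inj[OF T])
next
  fix D \<Psi> D' \<Psi>' assume D: "(D, \<Psi>) \<in> J1 L" and D': "(D', \<Psi>') \<in> J1 L"
  obtain U \<phi> V e where T: "triv L U \<phi> V e" and e: "D = jet_dom L U V" "\<Psi> = jet_chart L U \<phi> e"
    using J1_cases[OF D] .
  obtain U' \<phi>' V' e' where T': "triv L U' \<phi>' V' e'" and e': "D' = (SIGMA x:U' \<inter> V'. \<J> L x)" "\<Psi>' = jet_chart L U' \<phi>' e'"
    using J1_cases[OF D'] .
  have "triv2 L U \<phi> V e U' \<phi>' V' e'" using T T' by (simp add: triv2_def)
  from triv2.jet_transition[OF this]
  show "open (\<Psi> ` (D \<inter> D')) \<and> smooth_on (\<Psi> ` (D \<inter> D')) (\<Psi>' \<circ> \<I> D \<Psi>)" unfolding e e' .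
qed

lemma points_J1: "\<P> L = (SIGMA x:pts L. \<J> L x)"
proof
  show "\<P> L \<subseteq> (SIGMA x:pts L. \<J> L x)"
  proof
    fix p assume "p \<in> \<P> L"
    then obtain D \<Psi> where D: "(D, \<Psi>) \<in> J1 L" "p \<in> D" by (auto simp: points_def)
    obtain U \<phi> V e where T: "triv L U \<phi> V e" and e: "D = jet_dom L U V" using J1_cases[OF D(1)] .
    show "p \<in> (SIGMA x:pts L. \<J> L x)" using D(2) triv.dom_pts[OF T] unfolding e by auto
  qed
  show "(SIGMA x:pts L. \<J> L x) \<subseteq> \<P> L"
  proof
    fix p assume p: "p \<in> (SIGMA x:pts L. \<J> L x)"
    then have "fst p \<in> pts L" by auto
    then obtain U \<phi> V e where T: "triv L U \<phi> V e" "fst p \<in> U \<inter> V" by (rule triv_ex)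
    have "p \<in> jet_dom L U V" using p T(2) by auto
    then show "p \<in> \<P> L" using triv.\<Phi>_in_J1[OF T(1)] unfolding points_def by fast
  qed
qed

lemma fst_vimage_open:
  assumes W: "mfd_open (base L) W"
  shows "mfd_open (J1 L) {p \<in> \<P> L. fst p \<in> W}" unfolding mfd_open_def
proof (intro conjI ballI; clarify)
  fix D \<Psi> assume D: "(D, \<Psi>) \<in> J1 L"
  obtain U \<phi> V e where T: "triv L U \<phi> V e" and e: "D = jet_dom L U V" "\<Psi> = jet_chart L U \<phi> e"
    using J1_cases[OF D] .
  interpret triv L U \<phi> V e by (rule T)
  have "D \<inter> {p \<in> \<P> L. fst p \<in> W} = jdom \<inter> {p. fst p \<in> W}" unfolding e points_J1 using dom_pts by auto
  moreover have "open (\<phi> ` (dom \<inter> W))"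
    using chart_open_Int[OF mfd_open_Int[OF frame_open[OF fr] W] ch] by (simp add: Int_assoc)
  ultimately show "open (\<Psi> ` (D \<inter> {p \<in> \<P> L. fst p \<in> W}))" using \<Phi>_image[of W] by (simp add: e(2) open_Times)
qed

text \<open>Points over different base points are separated by preimages of base sets. Points of one
  fibre lie in a common chart, because chart domains contain whole fibres.\<close>

lemma J1_hausdorff: "Hausdorff_space (topology (mfd_open (J1 L)))"
proof -
  interpret J: atlas "J1 L" by (rule J1_atlas)
  show ?thesis unfolding Hausdorff_space_def J.openin_mfd J.topspace_mfd
  proof (intro allI impI, elim conjE)
    fix p q assume pq: "p \<in> \<P> L" "q \<in> \<P> L" "p \<noteq> q"
    then have b: "fst p \<in> pts L" "fst q \<in> pts L" by (auto simp: points_J1)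
    show "\<exists>U V. mfd_open (J1 L) U \<and> mfd_open (J1 L) V \<and> p \<in> U \<and> q \<in> V \<and> disjnt U V"
    proof (cases "fst p = fst q")
      case False
      then obtain U V where UV: "mfd_open (base L) U" "mfd_open (base L) V" "fst p \<in> U" "fst q \<in> V" "disjnt U V"
        using hausdorff b unfolding Hausdorff_space_def openin_mfd topspace_mfd by meson
      show ?thesis using fst_vimage_open[OF UV(1)] fst_vimage_open[OF UV(2)] UV(3-5) pq
        by (intro exI[of _ "{p \<in> \<P> L. fst p \<in> U}"] exI[of _ "{p \<in> \<P> L. fst p \<in> V}"])
          (auto simp: disjnt_iff)
    next
      case True
      obtain U \<phi> V e where T: "triv L U \<phi> V e" "fst p \<in> U \<inter> V" using triv_ex[OF b(1)] .
      interpret triv L U \<phi> V e by (rule T)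
      have pq': "p \<in> jdom" "q \<in> jdom" using pq T(2) True by (auto simp: points_J1)
      then have "\<Phi> p \<noteq> \<Phi> q" using \<Phi>_inj pq(3) by (auto simp: inj_on_def)
      then obtain A B where AB: "open A" "open B" "\<Phi> p \<in> A" "\<Phi> q \<in> B" "A \<inter> B = {}"
        using separation_t2[of "\<Phi> p" "\<Phi> q"] by auto
      show ?thesis using J.mfd_open_vimage[OF \<Phi>_in_J1 AB(1)] J.mfd_open_vimage[OF \<Phi>_in_J1 AB(2)] AB(3-5) pq'
        by (intro exI[of _ "{x \<in> jdom. \<Phi> x \<in> A}"] exI[of _ "{x \<in> jdom. \<Phi> x \<in> B}"])
          (auto simp: disjnt_iff)
    qed
  qed
qed

text \<open>Countably many charts suffice, one for each basic open set of the base that fits into a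
  chart and a frame. Inside them, balls with dense centres and rational radii form a base.\<close>

lemma J1_second_countable: "second_countable (topology (mfd_open (J1 L)))"
proof -
  interpret J: atlas "J1 L" by (rule J1_atlas)
  have "second_countable (topology (mfd_open (base L)))"
    using lb unfolding is_line_bundle_def smooth_manifold_def by blast
  then obtain \<B> where \<B>: "countable \<B>" "\<forall>B\<in>\<B>. mfd_open (base L) B"
    "\<forall>W x. mfd_open (base L) W \<and> x \<in> W \<longrightarrow> (\<exists>B\<in>\<B>. x \<in> B \<and> B \<subseteq> W)" unfolding second_countable_def openin_mfd by blast
  define \<C> where "\<C> = {B \<in> \<B>. \<exists>U \<phi> V e. triv L U \<phi> V e \<and> B \<subseteq> U \<inter> V}"
  have "\<forall>B\<in>\<C>. \<exists>D\<Psi>. D\<Psi> \<in> J1 L \<and> (\<forall>p\<in>\<P> L. fst p \<in> B \<longrightarrow> p \<in> fst D\<Psi>)"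
  proof
    fix B assume "B \<in> \<C>"
    then obtain U \<phi> V e where T: "triv L U \<phi> V e" "B \<subseteq> U \<inter> V" unfolding \<C>_def by blast
    show "\<exists>D\<Psi>. D\<Psi> \<in> J1 L \<and> (\<forall>p\<in>\<P> L. fst p \<in> B \<longrightarrow> p \<in> fst D\<Psi>)" using triv.\<Phi>_in_J1[OF T(1)] T(2)
      by (intro exI[of _ "(SIGMA x:U \<inter> V. \<J> L x, jet_chart L U \<phi> e)"]) (auto simp: points_J1)
  qed
  then obtain c where c: "\<forall>B\<in>\<C>. c B \<in> J1 L \<and> (\<forall>p\<in>\<P> L. fst p \<in> B \<longrightarrow> p \<in> fst (c B))" by (rule bchoice[THEN exE])
  obtain Q :: "('e \<times> real \<times> ('e \<Rightarrow>\<^sub>L real)) set" where Q: "countable Q" "\<And>x e. e > 0 \<Longrightarrow> \<exists>d\<in>Q. dist d x < e"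
    using countable_dense_finite_dim[OF finite_dim_jet_model[OF fd]] by blast
  define \<D> where "\<D> = (\<lambda>(B, z, r). {p \<in> fst (c B). snd (c B) p \<in> ball z r}) ` (\<C> \<times> Q \<times> (\<rat> :: real set))"
  have "countable \<C>" using \<B>(1) unfolding \<C>_def by (rule countable_subset[rotated]) auto
  then have \<D>1: "countable \<D>" unfolding \<D>_def by (intro countable_image countable_SIGMA Q(1) countable_rat)
  have \<D>2: "\<forall>V\<in>\<D>. mfd_open (J1 L) V"
  proof
    fix V assume "V \<in> \<D>"
    then obtain B z r where B: "B \<in> \<C>" and V: "V = {p \<in> fst (c B). snd (c B) p \<in> ball z r}"
      unfolding \<D>_def by auto
    have "(fst (c B), snd (c B)) \<in> J1 L" using c B by simp
    then show "mfd_open (J1 L) V" unfolding V by (rule J.mfd_open_vimage) simp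
  qed
  have \<D>3: "\<exists>V\<in>\<D>. p \<in> V \<and> V \<subseteq> W" if W: "mfd_open (J1 L) W" "p \<in> W" for W p
  proof -
    have pP: "p \<in> \<P> L" using W J.mfd_open_subset by blast
    then have b: "fst p \<in> pts L" by (auto simp: points_J1)
    obtain U \<phi> V e where T: "triv L U \<phi> V e" "fst p \<in> U \<inter> V" using triv_ex[OF b] .
    obtain B where B: "B \<in> \<B>" "fst p \<in> B" "B \<subseteq> U \<inter> V" using \<B>(3) triv.dom_open[OF T(1)] T(2) by meson
    have BC: "B \<in> \<C>" using B T(1) unfolding \<C>_def by blast
    define D \<Psi> where "D = fst (c B)" and "\<Psi> = snd (c B)"
    have D: "(D, \<Psi>) \<in> J1 L" "p \<in> D" using c BC pP B(2) unfolding D_def \<Psi>_def by auto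
    have "open (\<Psi> ` (D \<inter> W))" by (rule J.chart_open_Int[OF W(1) D(1)])
    then obtain r where r: "r > 0" "ball (\<Psi> p) r \<subseteq> \<Psi> ` (D \<inter> W)"
      using D(2) W(2) by (meson Int_iff imageI open_contains_ball_eq)
    \<comment> \<open>Less than half of \<open>r\<close>, so that a ball of radius \<open>r'\<close>
      containing \<open>\<Psi> p\<close> stays inside the ball of radius \<open>r\<close> around
      that point.\<close>
    obtain r' where r': "r' \<in> \<rat>" "0 < r'" "r' < r / 2" using Rats_dense_in_real[of 0 "r / 2"] r(1) by auto
    obtain z where z: "z \<in> Q" "dist z (\<Psi> p) < r'" using Q(2)[OF r'(2)] by blast
    let ?V = "{p \<in> D. \<Psi> p \<in> ball z r'}"
    have "?V \<in> \<D>" unfolding \<D>_def D_def \<Psi>_def using BC z(1) r'(1) by (intro image_eqI[of _ _ "(B, z, r')"]) auto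
    moreover have "p \<in> ?V" using D(2) z(2) by simp
    moreover have "?V \<subseteq> W"
    proof
      fix q assume q: "q \<in> ?V"
      have "dist (\<Psi> p) (\<Psi> q) \<le> dist (\<Psi> p) z + dist z (\<Psi> q)" by (rule dist_triangle)
      also have "\<dots> < r" using z(2) q r'(3) by (simp add: dist_commute)
      finally have "\<Psi> q \<in> \<Psi> ` (D \<inter> W)" using r(2) by auto
      then show "q \<in> W" using J.chart_inj[OF D(1)] q by (auto simp: inj_on_def)
    qed
    ultimately show ?thesis by (intro bexI[of _ ?V] conjI)
  qed
  show ?thesis unfolding second_countable_def J.openin_mfd
    by (intro exI[of _ \<D>] conjI allI impI \<D>1 \<D>2) (elim conjE, rule \<D>3)
qed

lemma J1_manifold: "manifold (J1 L)" using J1_atlas J1_hausdorff by (simp add: manifold_def manifold_axioms_def)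

lemma J1_smooth_manifold: "smooth_manifold (J1 L)"
proof -
  interpret J: manifold "J1 L" by (rule J1_manifold)
  have "\<exists>B :: ('e \<times> real \<times> ('e \<Rightarrow>\<^sub>L real)) set. finite B \<and> span B = UNIV" using J.fd unfolding finite_dim_def .
  moreover have "\<forall>(U, \<phi>)\<in>J1 L. inj_on \<phi> U" using J.chart_inj by auto
  moreover have "\<forall>(U, \<phi>)\<in>J1 L. \<forall>(V, \<psi>)\<in>J1 L. open (\<phi> ` (U \<inter> V)) \<and> smooth_on (\<phi> ` (U \<inter> V)) (\<psi> \<circ> \<I> U \<phi>)"
    using J.chart_compat by auto
  ultimately show ?thesis unfolding smooth_manifold_def by (intro conjI J1_hausdorff J1_second_countable)
qed

lemma pi_star_simps [simp]: "base (pi_star L) = J1 L" "fibre (pi_star L) = (\<lambda>p. \<E> L p)"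
  by (simp_all add: pi_star_def pullback_def)

lemma frames_pi_star: "frames (pi_star L) = {({p \<in> \<P> L. fst p \<in> V}, (\<lambda>p. e (fst p))) |V e. (V, e) \<in> frames L}"
  by (simp add: pi_star_def pullback_def)

text \<open>In a jet chart the pulled-back function depends on the base coordinate only.\<close>

lemma pullback_smooth:
  assumes f: "smooth_fun (base L) W f" and W: "mfd_open (base L) W"
  shows "smooth_fun (J1 L) {p \<in> \<P> L. fst p \<in> W} (\<lambda>p. f (fst p))"
proof -
  interpret J: manifold "J1 L" by (rule J1_manifold)
  show ?thesis
  proof (rule J.smooth_funI_local)
    fix p assume p: "p \<in> {p \<in> \<P> L. fst p \<in> W}"
    then have b: "fst p \<in> pts L" by (auto simp: points_J1)
    obtain U \<phi> V e where T: "triv L U \<phi> V e" "fst p \<in> U \<inter> V" using triv_ex[OF b] .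
    interpret triv L U \<phi> V e by (rule T)
    let ?T = "\<phi> ` (dom \<inter> W)"
    have oT: "open ?T" using chart_open_Int[OF mfd_open_Int[OF frame_open[OF fr] W] ch] by (simp add: Int_assoc)
    have "smooth_on ?T (f \<circ> \<I> U \<phi>)" by (rule smooth_funD_sub[OF f ch]) auto
    from smooth_on_fst_comp[OF fd oT this]
    have "smooth_on (?T \<times> (UNIV :: (real \<times> ('e \<Rightarrow>\<^sub>L real)) set)) (\<lambda>z. (f \<circ> \<I> U \<phi>) (fst z))" .
    then have "smooth_on (?T \<times> UNIV) ((\<lambda>p. f (fst p)) \<circ> \<I> jdom \<Phi>)"
    proof (rule smooth_on_transform)
      fix z :: "'e \<times> real \<times> ('e \<Rightarrow>\<^sub>L real)" assume "z \<in> ?T \<times> UNIV"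
      then have "z \<in> \<Phi> ` (jdom \<inter> {p. fst p \<in> W})" unfolding \<Phi>_image .
      then obtain q where q: "q \<in> jdom" "z = \<Phi> q" by blast
      then have "\<I> jdom \<Phi> z = q" using \<Phi>_inj by simp
      moreover have "\<I> U \<phi> (fst z) = fst q" using q chart_inv[OF ch, of "fst q"] by (auto simp: \<Phi>_eq)
      ultimately show "(f \<circ> \<I> U \<phi>) (fst z) = ((\<lambda>p. f (fst p)) \<circ> \<I> jdom \<Phi>) z" by simp
    qed (intro open_Times oT open_UNIV)
    then show "\<exists>U \<phi> T. (U, \<phi>) \<in> J1 L \<and> p \<in> U \<and> open T \<and> \<phi> p \<in> T \<and> smooth_on T ((\<lambda>p. f (fst p)) \<circ> \<I> U \<phi>)"
      using \<Phi>_in_J1 p T(2) oT by (intro exI[of _ jdom] exI[of _ \<Phi>] exI[of _ "?T \<times> UNIV"])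
        (auto simp: points_J1 \<Phi>_eq intro!: open_Times)
  qed
qed

lemma pi_star_line_bundle: "is_line_bundle (pi_star L)"
proof -
  interpret J: manifold "J1 L" by (rule J1_manifold)
  have "\<forall>(V, e)\<in>frames (pi_star L). \<forall>(V', e')\<in>frames (pi_star L).
      smooth_fun (J1 L) (V \<inter> V') (\<lambda>p. coord (\<E> L p) (e p) (e' p))"
  proof (clarify)
  fix V e V' e' assume fr: "(V, e) \<in> frames (pi_star L)" "(V', e') \<in> frames (pi_star L)"
  show "smooth_fun (J1 L) (V \<inter> V') (\<lambda>p. coord (\<E> L p) (e p) (e' p))"
  proof -
    obtain W d where 1: "V = {p \<in> \<P> L. fst p \<in> W}" "e = (\<lambda>p. d (fst p))" "(W, d) \<in> frames L"
      using fr(1) unfolding frames_pi_star by blast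
    obtain W' d' where 2: "V' = {p \<in> \<P> L. fst p \<in> W'}" "e' = (\<lambda>p. d' (fst p))" "(W', d') \<in> frames L"
      using fr(2) unfolding frames_pi_star by blast
    have "V \<inter> V' = {p \<in> \<P> L. fst p \<in> W \<inter> W'}" unfolding 1 2 by auto
    then show ?thesis
      using pullback_smooth[OF frame_transition[OF 1(3) 2(3)] mfd_open_Int[OF frame_open[OF 1(3)] frame_open[OF 2(3)]]]
      unfolding 1(2) 2(2) by simp
  qed
  qed
  moreover have "\<forall>(V, e)\<in>frames (pi_star L). mfd_open (J1 L) V \<and>
      (\<forall>p\<in>V. e p \<in> \<F> L (fst p) \<and> e p \<noteq> \<zero>\<^bsub>\<E> L p\<^esub>)"
  proof (rule ballI, clarify del: conjI)
    fix V e assume fr: "(V, e) \<in> frames (pi_star L)"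
    obtain W d where 1: "V = {p \<in> \<P> L. fst p \<in> W}" "e = (\<lambda>p. d (fst p))" "(W, d) \<in> frames L"
      using fr unfolding frames_pi_star by blast
    show "mfd_open (J1 L) V \<and> (\<forall>p\<in>V. e p \<in> \<F> L (fst p) \<and> e p \<noteq> \<zero>\<^bsub>\<E> L p\<^esub>)"
      using fst_vimage_open[OF frame_open[OF 1(3)]] frame_carrier[OF 1(3)] frame_nonzero[OF 1(3)]
      unfolding 1(1,2) by auto
  qed
  moreover have "\<forall>p\<in>\<P> L. \<exists>(V, e)\<in>frames (pi_star L). p \<in> V"
  proof
    fix p assume p: "p \<in> \<P> L"
    obtain V e where "(V, e) \<in> frames L" "fst p \<in> V" using frame_ex[of "fst p"] p by (auto simp: points_J1)
    then show "\<exists>(V, e)\<in>frames (pi_star L). p \<in> V"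
      using p by (intro bexI[of _ "({p \<in> \<P> L. fst p \<in> V}, (\<lambda>p. e (fst p)))"]) (auto simp: frames_pi_star)
  qed
  moreover have "\<forall>p\<in>\<P> L. vec_space (\<E> L p) \<and> one_dimensional (\<E> L p)"
    using fibre_vs fibre_one by (auto simp: points_J1)
  ultimately show ?thesis unfolding is_line_bundle_def pi_star_simps by (intro conjI J1_smooth_manifold)
qed

end

section \<open>Quotients by kernels\<close>

text \<open>Cosets of the kernel of \<open>T\<close> are fibres of \<open>T\<close>. So the quotient
  is indexed by the target space, and its operations are computed there.\<close>

definition fib :: "(real, 'v) module \<Rightarrow> ('v \<Rightarrow> 'w) \<Rightarrow> 'w \<Rightarrow> 'v set" where
  "fib V T l = {v \<in> carrier V. T v = l}"

context
  fixes V :: "(real, 'v) module" and F :: "(real, 'w) module" and T :: "'v \<Rightarrow> 'w"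
  assumes V: "vec_space V" and F: "vec_space F" and T: "lin_map V F T"
    and surj: "\<And>l. l \<in> carrier F \<Longrightarrow> \<exists>v\<in>carrier V. T v = l"
begin

abbreviation (input) Q where "Q \<equiv> quotient_space V (fib V T \<zero>\<^bsub>F\<^esub>)"

lemma cancel_minus:
  assumes "v \<in> carrier V" "w \<in> carrier V"
  shows "(v \<oplus>\<^bsub>V\<^esub> (-1) \<odot>\<^bsub>V\<^esub> w) \<oplus>\<^bsub>V\<^esub> w = v"
proof -
  have "(-1) \<odot>\<^bsub>V\<^esub> w \<oplus>\<^bsub>V\<^esub> w = \<zero>\<^bsub>V\<^esub>"
    using vs_distr_l[OF V assms(2), of "-1" 1] vs_one[OF V assms(2)] vs_smult_0[OF V assms(2)] by simp
  then show ?thesis using assms by (simp add: vs_assoc[OF V] vs_smult[OF V] vs_r_zero[OF V])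
qed

lemma minus_self:
  assumes "l \<in> carrier F"
  shows "l \<oplus>\<^bsub>F\<^esub> (-1) \<odot>\<^bsub>F\<^esub> l = \<zero>\<^bsub>F\<^esub>"
  using vs_distr_l[OF F assms, of 1 "-1"] vs_one[OF F assms] vs_smult_0[OF F assms] by simp

lemma coset_fib:
  assumes v: "v \<in> carrier V"
  shows "fib V T \<zero>\<^bsub>F\<^esub> +>\<^bsub>V\<^esub> v = fib V T (T v)"
proof
  show "fib V T \<zero>\<^bsub>F\<^esub> +>\<^bsub>V\<^esub> v \<subseteq> fib V T (T v)" using v lin_mapD(2)[OF T] vs_l_zero[OF F lin_mapD(1)[OF T v]]
    by (auto simp: a_r_coset_def r_coset_def fib_def vs_add[OF V])
  show "fib V T (T v) \<subseteq> fib V T \<zero>\<^bsub>F\<^esub> +>\<^bsub>V\<^esub> v"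
  proof
    fix w assume "w \<in> fib V T (T v)"
    then have w: "w \<in> carrier V" "T w = T v" by (auto simp: fib_def)
    let ?d = "w \<oplus>\<^bsub>V\<^esub> (-1) \<odot>\<^bsub>V\<^esub> v"
    have "T ?d = \<zero>\<^bsub>F\<^esub>"
      using w v lin_mapD(2)[OF T w(1) vs_smult[OF V v]] lin_mapD(3)[OF T v] minus_self[OF lin_mapD(1)[OF T v]] by simp
    moreover have "?d \<in> carrier V" by (intro vs_add[OF V] vs_smult[OF V] w v)
    ultimately have "?d \<in> fib V T \<zero>\<^bsub>F\<^esub>" by (simp add: fib_def)
    then show "w \<in> fib V T \<zero>\<^bsub>F\<^esub> +>\<^bsub>V\<^esub> v" using cancel_minus[OF w(1) v] by (force simp: a_r_coset_def r_coset_def)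
  qed
qed

lemma quot_carrier: "carrier Q = fib V T ` carrier F"
proof
  show "carrier Q \<subseteq> fib V T ` carrier F"
    using coset_fib lin_mapD(1)[OF T] by (auto simp: quotient_space_def A_RCOSETS_def' )
  show "fib V T ` carrier F \<subseteq> carrier Q"
  proof
    fix C assume "C \<in> fib V T ` carrier F"
    then obtain l where l: "l \<in> carrier F" "C = fib V T l" by blast
    obtain v where "v \<in> carrier V" "T v = l" using surj[OF l(1)] by blast
    then show "C \<in> carrier Q" using coset_fib[of v] l(2) by (auto simp: quotient_space_def A_RCOSETS_def')
  qed
qed

lemma quot_zero: "\<zero>\<^bsub>Q\<^esub> = fib V T \<zero>\<^bsub>F\<^esub>" by (simp add: quotient_space_def)

lemma quot_add:
  assumes l: "l \<in> carrier F" and l': "l' \<in> carrier F"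
  shows "fib V T l \<oplus>\<^bsub>Q\<^esub> fib V T l' = fib V T (l \<oplus>\<^bsub>F\<^esub> l')"
proof
  show "fib V T l \<oplus>\<^bsub>Q\<^esub> fib V T l' \<subseteq> fib V T (l \<oplus>\<^bsub>F\<^esub> l')"
    by (auto simp: quotient_space_def set_add_def set_mult_def fib_def vs_add[OF V] lin_mapD(2)[OF T])
  show "fib V T (l \<oplus>\<^bsub>F\<^esub> l') \<subseteq> fib V T l \<oplus>\<^bsub>Q\<^esub> fib V T l'"
  proof
    fix w assume "w \<in> fib V T (l \<oplus>\<^bsub>F\<^esub> l')"
    then have w: "w \<in> carrier V" "T w = l \<oplus>\<^bsub>F\<^esub> l'" by (auto simp: fib_def)
    obtain v where v: "v \<in> carrier V" "T v = l'" using surj[OF l'] by blast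
    let ?d = "w \<oplus>\<^bsub>V\<^esub> (-1) \<odot>\<^bsub>V\<^esub> v"
    have "T ?d = l \<oplus>\<^bsub>F\<^esub> (l' \<oplus>\<^bsub>F\<^esub> (-1) \<odot>\<^bsub>F\<^esub> l')"
      using w v l l' lin_mapD(2)[OF T w(1) vs_smult[OF V v(1)]] lin_mapD(3)[OF T v(1)]
      by (simp add: vs_assoc[OF F] vs_smult[OF F])
    then have "T ?d = l" using minus_self[OF l'] vs_r_zero[OF F l] by simp
    moreover have "?d \<in> carrier V" by (intro vs_add[OF V] vs_smult[OF V] w v)
    ultimately have "?d \<in> fib V T l" "v \<in> fib V T l'" using v by (auto simp: fib_def)
    then show "w \<in> fib V T l \<oplus>\<^bsub>Q\<^esub> fib V T l'"
      using cancel_minus[OF w(1) v(1)] by (force simp: quotient_space_def set_add_def set_mult_def)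
  qed
qed

lemma quot_smult:
  assumes l: "l \<in> carrier F"
  shows "c \<odot>\<^bsub>Q\<^esub> fib V T l = fib V T (c \<odot>\<^bsub>F\<^esub> l)"
proof -
  have "fib V T \<zero>\<^bsub>F\<^esub> +>\<^bsub>V\<^esub> (c \<odot>\<^bsub>V\<^esub> v) = fib V T (c \<odot>\<^bsub>F\<^esub> l)" if "v \<in> fib V T l" for v
    using that coset_fib[of "c \<odot>\<^bsub>V\<^esub> v"] lin_mapD(3)[OF T] by (auto simp: fib_def vs_smult[OF V])
  moreover have "fib V T l \<noteq> {}" using surj[OF l] by (auto simp: fib_def)
  ultimately show ?thesis by (simp add: quotient_space_def)
qed

lemma fib_inject:
  assumes "l \<in> carrier F" "fib V T l = fib V T l'"
  shows "l = l'"
proof -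
  obtain v where "v \<in> carrier V" "T v = l" using surj[OF assms(1)] by blast
  then have "v \<in> fib V T l'" using assms(2) by (auto simp: fib_def)
  then show ?thesis using \<open>T v = l\<close> by (simp add: fib_def)
qed

lemma quot_vec_space: "vec_space Q"
proof (rule vec_spaceI)
  show "\<zero>\<^bsub>Q\<^esub> \<in> carrier Q" unfolding quot_carrier quot_zero using vs_zero[OF F] by blast
  show "x \<oplus>\<^bsub>Q\<^esub> y = y \<oplus>\<^bsub>Q\<^esub> x" if "x \<in> carrier Q" "y \<in> carrier Q" for x y
    using that unfolding quot_carrier by (auto simp: quot_add vs_comm[OF F])
qed (unfold quot_carrier quot_zero, auto simp: quot_add quot_smult vs_add[OF F] vs_smult[OF F] vs_zero[OF F]
    vs_l_zero[OF F] vs_assoc[OF F] vs_distr_l[OF F] vs_distr_r[OF F] vs_smult_assoc[OF F] vs_one[OF F] vs_smult_0[OF F])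

lemma quot_one_dimensional:
  assumes "one_dimensional F"
  shows "one_dimensional Q"
proof -
  obtain b where b: "b \<in> carrier F" "b \<noteq> \<zero>\<^bsub>F\<^esub>" "\<forall>w\<in>carrier F. \<exists>c. w = c \<odot>\<^bsub>F\<^esub> b"
    using assms unfolding one_dimensional_def by blast
  show ?thesis unfolding one_dimensional_def quot_zero
  proof (intro bexI[of _ "fib V T b"] conjI ballI)
    show "fib V T b \<noteq> fib V T \<zero>\<^bsub>F\<^esub>" using fib_inject[OF b(1)] b(2) by blast
    fix C assume "C \<in> carrier Q"
    then obtain l where l: "l \<in> carrier F" "C = fib V T l" unfolding quot_carrier by blast
    obtain c where "l = c \<odot>\<^bsub>F\<^esub> b" using b(3) l(1) by blast
    then show "\<exists>c. C = c \<odot>\<^bsub>Q\<^esub> fib V T b" using quot_smult[OF b(1)] l(2) by auto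
  qed (use b(1) quot_carrier in blast)
qed

lemma quot_coord:
  assumes "l0 \<in> carrier F" "l \<in> carrier F"
  shows "coord Q (fib V T l0) (fib V T l) = coord F l0 l"
proof -
  have "fib V T l = c \<odot>\<^bsub>Q\<^esub> fib V T l0 \<longleftrightarrow> l = c \<odot>\<^bsub>F\<^esub> l0" for c
    unfolding quot_smult[OF assms(1)] using fib_inject[OF assms(2)] by blast
  then show ?thesis unfolding coord_def by simp
qed

end

section \<open>The contact form\<close>

text \<open>The chain rule on test functions: a change of chart acts on tangent coordinates by its
  Jacobian.\<close>

lemma (in manifold) tcoord_change:
  assumes U: "(U, \<phi>) \<in> A" "x \<in> U" and V: "(V, \<psi>) \<in> A" "x \<in> V" and v: "v \<in> \<T> A x"
  shows "tcoord A V \<psi> x v = \<D> (\<psi> \<circ> \<I> U \<phi>) (\<phi> x) (tcoord A U \<phi> x v)"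
proof -
  let ?\<tau> = "\<psi> \<circ> \<I> U \<phi>"
  have o: "open (\<phi> ` (U \<inter> V))" and sm: "smooth_on (\<phi> ` (U \<inter> V)) ?\<tau>" using chart_compat[OF U(1) V(1)] by auto
  have hd: "(?\<tau> has_derivative \<D> ?\<tau> (\<phi> x)) (at (\<phi> x))" by (rule smooth_on_hd[OF sm]) (use U V in auto)
  have \<tau>x: "?\<tau> (\<phi> x) = \<psi> x" using chart_inv[OF U] by simp
  have "tvec A V \<psi> x (\<D> ?\<tau> (\<phi> x) w) = tvec A U \<phi> x w" for w
  proof -
    have "\<D> (f \<circ> \<I> U \<phi>) (\<phi> x) w =
        \<D> (f \<circ> \<I> V \<psi>) (\<psi> x) (\<D> ?\<tau> (\<phi> x) w)" if f: "f \<in> Cs A" for f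
    proof -
      have "(f \<circ> \<I> V \<psi> has_derivative \<D> (f \<circ> \<I> V \<psi>) (\<psi> x)) (at (?\<tau> (\<phi> x)))"
        using Cs_has_derivative[OF f V] by (simp only: \<tau>x)
      from frechet_derivative_at[OF has_derivative_compose[OF hd this]]
      have "\<D> (\<lambda>z. (f \<circ> \<I> V \<psi>) (?\<tau> z)) (\<phi> x) =
          (\<lambda>w. \<D> (f \<circ> \<I> V \<psi>) (\<psi> x) (\<D> ?\<tau> (\<phi> x) w))" by (rule sym)
      moreover have "\<D> (f \<circ> \<I> U \<phi>) (\<phi> x) = \<D> (\<lambda>z. (f \<circ> \<I> V \<psi>) (?\<tau> z)) (\<phi> x)"
        by (rule frechet_derivative_cong[OF o]) (use U V chart_inv[OF U(1)] chart_inv[OF V(1)] in auto)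
      ultimately show ?thesis by simp
    qed
    then show ?thesis by (auto simp: tvec_def)
  qed
  then show ?thesis using tcoord_tvec[OF V] tvec_tcoord[OF U v] by metis
qed

definition cform :: "'e \<times> real \<times> ('e::real_normed_vector \<Rightarrow>\<^sub>L real) \<Rightarrow> 'e \<times> real \<times> ('e \<Rightarrow>\<^sub>L real) \<Rightarrow> real" where
  "cform z w = ap (snd (snd z)) (fst w) - fst (snd w)"

text \<open>Minus the exterior derivative of \<open>cform\<close>, evaluated on two vectors; on
  horizontal vectors it is the curvature form.\<close>

definition cpair :: "'e \<times> real \<times> ('e::real_normed_vector \<Rightarrow>\<^sub>L real) \<Rightarrow> 'e \<times> real \<times> ('e \<Rightarrow>\<^sub>L real) \<Rightarrow> real" where
  "cpair \<xi> \<eta> = ap (snd (snd \<eta>)) (fst \<xi>) - ap (snd (snd \<xi>)) (fst \<eta>)"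

lemma cform_add: "cform z (v + w) = cform z v + cform z w"
  and cform_scale: "cform z (r *\<^sub>R v) = r * cform z v"
  and cform_zero: "cform z 0 = 0"
  by (simp_all add: cform_def blinfun.add_right blinfun.scaleR_right algebra_simps)

text \<open>Some chart and frame around the point are chosen; \<open>cform_invariant\<close> makes
  the choice irrelevant, and \<open>contact_form_eq\<close> then permits any other.\<close>

definition contact_form where
  "contact_form L p v = (let (U, \<phi>, V, e) = (SOME (U, \<phi>, V, e). triv L U \<phi> V e \<and> fst p \<in> U \<inter> V) in
     cform (jet_chart L U \<phi> e p)
       (tcoord (J1 L) (jet_dom L U V) (jet_chart L U \<phi> e) p v) \<odot>\<^bsub>\<E> L p\<^esub> e (fst p))"

locale jets = lbundle L + J: manifold "J1 L" + P: lbundle "pi_star L"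
  for L :: "('m, 'e::real_normed_vector, 'v) line_bundle"

lemma (in lbundle) jets: "jets L"
  by (intro jets.intro lbundle_axioms J1_manifold lbundle.intro pi_star_line_bundle)

locale jtriv = jets L + triv L U \<phi> V e
  for L :: "('m, 'e::real_normed_vector, 'v) line_bundle" and U \<phi> V e

sublocale jtriv \<subseteq> Pt: triv "pi_star L" jdom \<Phi> "{p \<in> \<P> L. fst p \<in> V}" "\<lambda>p. e (fst p)"
  by unfold_locales (use \<Phi>_in_J1 fr in \<open>auto simp: frames_pi_star\<close>)

context jets
begin

abbreviation \<Gamma>P where "\<Gamma>P \<equiv> \<Gamma> (pi_star L)"

lemma jtriv_ex:
  assumes "p \<in> \<P> L"
  obtains U \<phi> V e where "jtriv L U \<phi> V e" "p \<in> jet_dom L U V"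
proof -
  have "fst p \<in> pts L" "snd p \<in> \<J> L (fst p)" using assms by (auto simp: points_J1)
  then obtain U \<phi> V e where "triv L U \<phi> V e" "fst p \<in> U \<inter> V" using triv_ex by blast
  moreover have "p \<in> jet_dom L U V" using \<open>fst p \<in> U \<inter> V\<close> assms by (auto simp: points_J1)
  ultimately show ?thesis using that[of U \<phi> V e] jets_axioms by (simp add: jtriv_def)
qed

text \<open>Since \<open>K\<close> inverts the Jacobian of \<tau>,
  \<open>p' dy' = h p dy + u dh\<close>, while \<open>du' = h du + u dh\<close>. The inhomogeneous
  terms cancel, the form picks up the factor \<open>h\<close>, and \<open>e = h e'\<close> absorbs
  it.\<close>

lemma cform_invariant:
  assumes T: "triv L U \<phi> V e" and T': "triv L U' \<phi>' V' e'" and p: "fst p \<in> U \<inter> V" "fst p \<in> U' \<inter> V'" "p \<in> \<P> L"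
    and v: "v \<in> \<T> (J1 L) p"
  shows "cform (jet_chart L U' \<phi>' e' p)
       (tcoord (J1 L) (SIGMA x:U' \<inter> V'. \<J> L x) (jet_chart L U' \<phi>' e') p v) \<odot>\<^bsub>\<E> L p\<^esub> e' (fst p) =
    cform (jet_chart L U \<phi> e p)
       (tcoord (J1 L) (jet_dom L U V) (jet_chart L U \<phi> e) p v) \<odot>\<^bsub>\<E> L p\<^esub> e (fst p)"
proof -
  interpret triv2 L U \<phi> V e U' \<phi>' V' e' using T T' by (simp add: triv2_def)
  let ?x = "fst p" and ?z = "\<Phi> p" and ?D = "\<D> \<Psi> (\<Phi> p)"
  have x: "?x \<in> dom2" "?x \<in> V" "?x \<in> V'" "?x \<in> U" using p by auto
  have pj: "p \<in> jdom" "p \<in> T'.jdom" using p by (auto simp: points_J1)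
  have zS: "?z \<in> \<phi> ` dom2 \<times> UNIV" using x by (auto simp: \<Phi>_eq)
  obtain u q where up: "jco L U \<phi> e ?x (snd p) = (u, q)" by (cases "jco L U \<phi> e ?x (snd p)")
  have z: "?z = (\<phi> ?x, u, q)" by (simp add: \<Phi>_eq up)
  let ?w = "tcoord (J1 L) jdom \<Phi> p v" and ?w' = "tcoord (J1 L) T'.jdom T'.\<Phi> p v"
  have hd: "(\<Psi> has_derivative ?D) (at ?z)" by (rule smooth_on_hd[OF \<Psi>_smooth zS])
  have "\<D> (T'.\<Phi> \<circ> \<I> jdom \<Phi>) ?z = ?D" by (rule frechet_derivative_cong[OF dom2_UNIV_open zS transition_eq_\<Psi>])
  then have w': "?w' = ?D ?w" using J.tcoord_change[OF \<Phi>_in_J1 pj(1) T'.\<Phi>_in_J1 pj(2) v] by simp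
  have h\<tau>: "(\<tau> has_derivative \<D> \<tau> (\<phi> ?x)) (at (fst ?z))" using smooth_on_hd[OF \<tau>_smooth, of "\<phi> ?x"] x(1) z by auto
  have hh: "(h has_derivative \<D> h (\<phi> ?x)) (at (fst ?z))" using smooth_on_hd[OF h_smooth, of "\<phi> ?x"] x(1) z by auto
  note f1 = has_derivative_fst[OF has_derivative_ident, of "at ?z"]
    and f2 = has_derivative_fst[OF has_derivative_snd[OF has_derivative_ident], of "at ?z"]
  have "((\<lambda>z. \<tau> (fst z)) has_derivative (\<lambda>w. fst (?D w))) (at ?z)"
    using has_derivative_fst[OF hd] by (simp add: \<Psi>_def)
  from fun_cong[OF has_derivative_unique[OF this has_derivative_compose[OF f1 h\<tau>]], of ?w]
  have 1: "fst ?w' = \<D> \<tau> (\<phi> ?x) (fst ?w)" by (simp add: w')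
  have "((\<lambda>z. h (fst z) * fst (snd z)) has_derivative (\<lambda>w. fst (snd (?D w)))) (at ?z)"
    using has_derivative_fst[OF has_derivative_snd[OF hd]] by (simp add: \<Psi>_def)
  from fun_cong[OF has_derivative_unique[OF this has_derivative_mult[OF has_derivative_compose[OF f1 hh] f2]], of ?w]
  have 2: "fst (snd ?w') = h (\<phi> ?x) * fst (snd ?w) + \<D> h (\<phi> ?x) (fst ?w) * u" by (simp add: w' z)
  have "T'.\<Phi> p = \<Psi> ?z" using \<Phi>_transition[OF x(1), of "snd p"] pj by auto
  then have "ap (snd (snd (T'.\<Phi> p))) (fst ?w') =
      h (\<phi> ?x) * ap q (fst ?w) + \<D> h (\<phi> ?x) (fst ?w) * u" by (simp add: z 1 \<Psi>_blinfun[OF x(1)] K_\<tau>[OF x(1)])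
  then have "cform (T'.\<Phi> p) ?w' = h (\<phi> ?x) * cform ?z ?w" using 2 by (simp add: cform_def z algebra_simps)
  then have "cform (T'.\<Phi> p) ?w' \<odot>\<^bsub>fibre L ?x\<^esub> e' ?x = cform ?z ?w \<odot>\<^bsub>fibre L ?x\<^esub> (h (\<phi> ?x) \<odot>\<^bsub>fibre L ?x\<^esub> e' ?x)"
    using frame_assoc[OF T'.fr x(3), of "cform ?z ?w" "h (\<phi> ?x)"] by (simp add: mult.commute)
  also have "h (\<phi> ?x) \<odot>\<^bsub>fibre L ?x\<^esub> e' ?x = e ?x"
    using crd_eq[OF T'.fr x(3) frame_carrier[OF fr x(2)]] by (simp add: h_eq[OF x(4)])
  finally show ?thesis .
qed

end

context jtriv
begin

abbreviation tc where "tc \<equiv> tcoord (J1 L) jdom \<Phi>"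
abbreviation tv where "tv \<equiv> tvec (J1 L) jdom \<Phi>"
abbreviation vr where "vr \<equiv> vrep (J1 L) jdom \<Phi>"
abbreviation jimg where "jimg \<equiv> \<phi> ` dom \<times> (UNIV :: (real \<times> ('e \<Rightarrow>\<^sub>L real)) set)"

lemma jdom_frame: "jdom \<inter> {p \<in> \<P> L. fst p \<in> V} = jdom" using dom_pts by (auto simp: points_J1)

lemma jdom_points: "p \<in> jdom \<Longrightarrow> p \<in> \<P> L" using J.chart_points[OF \<Phi>_in_J1] by blast

lemma jimg_open: "open jimg" by (intro open_Times img_open open_UNIV)

lemma jframe: "p \<in> jdom \<Longrightarrow> fst p \<in> V" by auto

lemma contact_form_eq:
  assumes p: "p \<in> jdom" and v: "v \<in> \<T> (J1 L) p"
  shows "contact_form L p v = cform (\<Phi> p) (tc p v) \<odot>\<^bsub>\<E> L p\<^esub> e (fst p)"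
proof -
  let ?P = "\<lambda>(U, \<phi>, V, e). triv L U \<phi> V e \<and> fst p \<in> U \<inter> V"
  have x: "fst p \<in> dom" using p by auto
  have "?P (U, \<phi>, V, e)" using triv_axioms x by simp
  then have "?P (SOME c. ?P c)" by (rule someI[of ?P])
  moreover obtain U' \<phi>' V' e' where c: "(SOME c. ?P c) = (U', \<phi>', V', e')" by (rule prod_cases4[of "SOME c. ?P c"])
  ultimately have T': "triv L U' \<phi>' V' e'" "fst p \<in> U' \<inter> V'" by auto
  have "contact_form L p v = cform (jet_chart L U' \<phi>' e' p)
       (tcoord (J1 L) (SIGMA x:U' \<inter> V'. \<J> L x) (jet_chart L U' \<phi>' e') p v) \<odot>\<^bsub>\<E> L p\<^esub> e' (fst p)"
    unfolding contact_form_def c by simp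
  then show ?thesis using cform_invariant[OF triv_axioms T'(1) x T'(2) jdom_points[OF p] v] by simp
qed

lemma contact_form_tv:
  assumes p: "p \<in> jdom"
  shows "contact_form L p (tv p w) = cform (\<Phi> p) w \<odot>\<^bsub>\<E> L p\<^esub> e (fst p)"
  using contact_form_eq[OF p J.tvec_tangent[OF \<Phi>_in_J1 p]] J.tcoord_tvec[OF \<Phi>_in_J1 p] by simp

lemma contact_form_coord:
  assumes p: "p \<in> jdom" and v: "v \<in> \<T> (J1 L) p"
  shows "crd L e (fst p) (contact_form L p v) = cform (\<Phi> p) (tc p v)"
  using contact_form_eq[OF p v] crd_smult[OF fr jframe[OF p]] by simp

end

context jets
begin

lemma fst_pts: "p \<in> \<P> L \<Longrightarrow> fst p \<in> pts L" by (auto simp: points_J1)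

lemma contact_form_lin:
  assumes p: "p \<in> \<P> L"
  shows "lin_map (tangent (J1 L) p) (\<E> L p) (contact_form L p)"
proof -
  obtain U \<phi> V e where T: "jtriv L U \<phi> V e" "p \<in> jet_dom L U V" using jtriv_ex[OF p] .
  interpret jtriv L U \<phi> V e by (rule T)
  note pV = jframe[OF T(2)]
  note TT = J.tangent_vec_space[of p]
  show ?thesis unfolding lin_map_def
  proof (intro conjI ballI allI)
    show "contact_form L p \<in> \<T> (J1 L) p \<rightarrow> \<F> L (fst p)"
      using contact_form_eq[OF T(2)] frame_smult[OF fr pV] by simp
    fix u v assume uv: "u \<in> \<T> (J1 L) p" "v \<in> \<T> (J1 L) p"
    show "contact_form L p (u \<oplus>\<^bsub>tangent (J1 L) p\<^esub> v) = contact_form L p u \<oplus>\<^bsub>\<E> L p\<^esub> contact_form L p v"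
      by (simp only: contact_form_eq[OF T(2)] vs_add[OF TT uv] uv J.tcoord_add[OF \<Phi>_in_J1 T(2) uv] cform_add
          frame_distr[OF fr pV])
  next
    fix r v assume v: "v \<in> \<T> (J1 L) p"
    show "contact_form L p (r \<odot>\<^bsub>tangent (J1 L) p\<^esub> v) = r \<odot>\<^bsub>\<E> L p\<^esub> contact_form L p v"
      by (simp only: contact_form_eq[OF T(2)] vs_smult[OF TT v] v J.tcoord_scale[OF \<Phi>_in_J1 T(2) v] cform_scale
          frame_assoc[OF fr pV])
  qed
qed

lemma contact_form_surj:
  assumes p: "p \<in> \<P> L" and l: "l \<in> \<F> L (fst p)"
  shows "\<exists>v\<in>\<T> (J1 L) p. contact_form L p v = l"
proof -
  obtain U \<phi> V e where T: "jtriv L U \<phi> V e" "p \<in> jet_dom L U V" using jtriv_ex[OF p] .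
  interpret jtriv L U \<phi> V e by (rule T)
  \<comment> \<open>The form takes the value -1 on \<open>(0, 1, 0)\<close>, whence the
    sign.\<close>
  have "contact_form L p (tv p (0, - crd L e (fst p) l, 0)) = l"
    using contact_form_tv[OF T(2)] crd_eq[OF fr jframe[OF T(2)] l] by (simp add: cform_def)
  then show ?thesis using J.tvec_tangent[OF \<Phi>_in_J1 T(2)] by blast
qed

lemma contact_kernel_subspace:
  assumes p: "p \<in> \<P> L"
  shows "vec_subspace (fib (tangent (J1 L) p) (contact_form L p) \<zero>\<^bsub>\<E> L p\<^esub>) (tangent (J1 L) p)"
proof -
  note lin = lin_mapD[OF contact_form_lin[OF p]] and TT = J.tangent_vec_space[of p] and F = fibre_vs[OF fst_pts[OF p]]
  show ?thesis
  proof (rule vs_subspaceI[OF TT])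
    show "\<zero>\<^bsub>tangent (J1 L) p\<^esub> \<in> fib (tangent (J1 L) p) (contact_form L p) \<zero>\<^bsub>\<E> L p\<^esub>"
      using lin(3)[OF vs_zero[OF TT], of 0] vs_smult_0[OF TT vs_zero[OF TT]] vs_smult_0[OF F lin(1)[OF vs_zero[OF TT]]]
        vs_zero[OF TT] by (simp add: fib_def del: tangent_simps)
  qed (auto simp: fib_def vs_add[OF TT] vs_smult[OF TT] lin(2,3) vs_l_zero[OF F vs_zero[OF F]] vs_smult_zero[OF F]
      simp del: tangent_simps)
qed

end

section \<open>The Cartan distribution is the kernel of the contact form\<close>

context jtriv
begin

definition pr where "pr s y = (y, sr s y, Blinfun (\<D> (sr s) y))"

lemma Blinfun_D_sr:
  assumes s: "s \<in> \<Gamma> L" and y: "y \<in> \<phi> ` dom"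
  shows "ap (Blinfun (\<D> (sr s) y)) = \<D> (sr s) y"
  by (rule bounded_linear_Blinfun_apply[OF has_derivative_bounded_linear[OF smooth_on_hd[OF sr_smooth[OF s] y]]])

lemma pr_eq: "s \<in> \<Gamma> L \<Longrightarrow> x \<in> dom \<Longrightarrow> \<Phi> (x, jet L s x) = pr s (\<phi> x)" using jco_jet by (simp add: jet_chart_eq pr_def)

lemma pr_smooth: "s \<in> \<Gamma> L \<Longrightarrow> smooth_on (\<phi> ` dom) (pr s)"
proof -
  assume s: "s \<in> \<Gamma> L"
  have "smooth_on (\<phi> ` dom) (\<lambda>y. Blinfun (\<D> (sr s) y))"
  proof (rule smooth_on_blinfunI[OF fd img_open])
    fix v
    show "smooth_on (\<phi> ` dom) (\<lambda>y. ap (Blinfun (\<D> (sr s) y)) v)"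
      by (rule smooth_on_transform[OF smooth_on_derivative[OF sr_smooth[OF s]] img_open]) (simp add: Blinfun_D_sr[OF s])
  qed
  then show ?thesis unfolding pr_def[abs_def] by (intro smooth_on_Pair smooth_on_ident img_open sr_smooth s)
qed

lemma jet_in_jdom: "s \<in> \<Gamma> L \<Longrightarrow> x \<in> dom \<Longrightarrow> (x, jet L s x) \<in> jdom" using jet_jet_space dom_pts by auto

lemma inv_pr: "s \<in> \<Gamma> L \<Longrightarrow> x \<in> dom \<Longrightarrow> \<I> jdom \<Phi> (pr s (\<phi> x)) = (x, jet L s x)"
  using inv_into_f_f[OF \<Phi>_inj jet_in_jdom] pr_eq by metis

end

context jets
begin

text \<open>Composition with the prolongation preserves smooth functions, so
  \<open>tangent_map\<close> feeds tangent vectors of the base with legitimate arguments.\<close>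

lemma prolong_Cs:
  assumes s: "s \<in> \<Gamma> L" and f: "f \<in> Cs (J1 L)"
  shows "(\<lambda>x\<in>pts L. f (x, jet L s x)) \<in> Cs (base L)"
proof (rule Cs_restrict, rule smooth_funI_local)
  fix x assume x: "x \<in> pts L"
  obtain U \<phi> V e where T: "triv L U \<phi> V e" "x \<in> U \<inter> V" using triv_ex[OF x] .
  interpret jtriv L U \<phi> V e using T(1) jets_axioms by (simp add: jtriv_def)
  have "pr s ` (\<phi> ` dom) \<subseteq> \<Phi> ` jdom"
  proof
    fix z assume "z \<in> pr s ` (\<phi> ` dom)"
    then obtain y where y: "y \<in> dom" "z = pr s (\<phi> y)" by blast
    then have "z = \<Phi> (y, jet L s y)" using pr_eq[OF s] by simp
    then show "z \<in> \<Phi> ` jdom" using jet_in_jdom[OF s y(1)] by (rule image_eqI)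
  qed
  from smooth_on_compose[OF J.fd img_open J.chart_open[OF \<Phi>_in_J1] this pr_smooth[OF s] J.Cs_smooth_on[OF f \<Phi>_in_J1]]
  have "smooth_on (\<phi> ` dom) (\<lambda>y. (f \<circ> \<I> jdom \<Phi>) (pr s y))" .
  then have "smooth_on (\<phi> ` dom) ((\<lambda>x. f (x, jet L s x)) \<circ> \<I> U \<phi>)"
    by (rule smooth_on_transform[OF _ img_open]) (use inv_pr[OF s] chart_inv[OF ch] in auto)
  then show "\<exists>U \<phi> T. (U, \<phi>) \<in> base L \<and> x \<in> U \<and> open T \<and> \<phi> x \<in> T \<and> smooth_on T ((\<lambda>x. f (x, jet L s x)) \<circ> \<I> U \<phi>)"
    using ch T(2) img_open by blast
qed

end

context jtriv
begin

lemma prolong_tangent: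
  assumes s: "s \<in> \<Gamma> L" and x: "x \<in> dom"
  shows "tangent_map (base L) (J1 L) (\<lambda>x. (x, jet L s x)) (tvec (base L) U \<phi> x w) =
    tv (x, jet L s x) (\<D> (pr s) (\<phi> x) w)" unfolding tangent_map_def tvec_def[of "J1 L"]
proof (rule restrict_ext)
  fix f assume f: "f \<in> Cs (J1 L)"
  have xU: "x \<in> U" using x by simp
  let ?p = "(x, jet L s x)"
  have hd: "(pr s has_derivative \<D> (pr s) (\<phi> x)) (at (\<phi> x))"
    by (rule smooth_on_hd[OF pr_smooth[OF s]]) (use x in auto)
  have "(f \<circ> \<I> jdom \<Phi> has_derivative \<D> (f \<circ> \<I> jdom \<Phi>) (\<Phi> ?p)) (at (pr s (\<phi> x)))"
    using J.Cs_has_derivative[OF f \<Phi>_in_J1 jet_in_jdom[OF s x]] by (simp only: pr_eq[OF s x])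
  from frechet_derivative_at[OF has_derivative_compose[OF hd this], symmetric]
  have "\<D> (\<lambda>y. (f \<circ> \<I> jdom \<Phi>) (pr s y)) (\<phi> x) w =
      \<D> (f \<circ> \<I> jdom \<Phi>) (\<Phi> ?p) (\<D> (pr s) (\<phi> x) w)" by simp
  moreover have "\<D> ((\<lambda>x\<in>pts L. f (x, jet L s x)) \<circ> \<I> U \<phi>) (\<phi> x) =
      \<D> (\<lambda>y. (f \<circ> \<I> jdom \<Phi>) (pr s y)) (\<phi> x)"
    by (rule frechet_derivative_cong[OF img_open]) (use x inv_pr[OF s] chart_inv[OF ch] dom_pts in auto)
  ultimately show "tvec (base L) U \<phi> x w (\<lambda>x\<in>pts L. f (x, jet L s x)) =
      \<D> (f \<circ> \<I> jdom \<Phi>) (\<Phi> ?p) (\<D> (pr s) (\<phi> x) w)" using prolong_Cs[OF s f] by (simp add: tvec_apply[OF ch xU])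
qed

lemma D_pr:
  assumes s: "s \<in> \<Gamma> L" and x: "x \<in> dom"
  shows "fst (\<D> (pr s) (\<phi> x) w) = w"
    "fst (snd (\<D> (pr s) (\<phi> x) w)) = \<D> (sr s) (\<phi> x) w"
    "ap (snd (snd (\<D> (pr s) (\<phi> x) w))) v =
      \<D> (\<lambda>y. \<D> (sr s) y v) (\<phi> x) w"
proof -
  have hd: "(pr s has_derivative \<D> (pr s) (\<phi> x)) (at (\<phi> x))"
    by (rule smooth_on_hd[OF pr_smooth[OF s]]) (use x in auto)
  have "((\<lambda>y. y) has_derivative (\<lambda>w. fst (\<D> (pr s) (\<phi> x) w))) (at (\<phi> x))"
    using has_derivative_fst[OF hd] by (simp add: pr_def)
  from fun_cong[OF has_derivative_unique[OF this has_derivative_ident], of w]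
  show "fst (\<D> (pr s) (\<phi> x) w) = w" .
  have "(sr s has_derivative (\<lambda>w. fst (snd (\<D> (pr s) (\<phi> x) w)))) (at (\<phi> x))"
    using has_derivative_fst[OF has_derivative_snd[OF hd]] by (simp add: pr_def)
  from fun_cong[OF has_derivative_unique[OF this sr_hd[OF s x]], of w]
  show "fst (snd (\<D> (pr s) (\<phi> x) w)) = \<D> (sr s) (\<phi> x) w" .
  have 1: "((\<lambda>y. ap (snd (snd (pr s y))) v) has_derivative
      (\<lambda>w. ap (snd (snd (\<D> (pr s) (\<phi> x) w))) v)) (at (\<phi> x))"
    by (rule bounded_linear.has_derivative[OF blinfun.bounded_linear_left has_derivative_snd[OF has_derivative_snd[OF hd]]])
  have "\<D> (\<lambda>y. ap (snd (snd (pr s y))) v) (\<phi> x) =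
      \<D> (\<lambda>y. \<D> (sr s) y v) (\<phi> x)"
    by (rule frechet_derivative_cong[OF img_open]) (use x in \<open>auto simp: pr_def Blinfun_D_sr[OF s]\<close>)
  then show "ap (snd (snd (\<D> (pr s) (\<phi> x) w))) v =
      \<D> (\<lambda>y. \<D> (sr s) y v) (\<phi> x) w" using frechet_derivative_at[OF 1] by metis
qed

text \<open>A quadratic polynomial with prescribed 1-jet at \<open>x\<close> whose Hessian maps \<open>w\<close> to \<open>\<pi>\<close>.\<close>

lemma generator_ex:
  assumes p: "p \<in> jdom" and w: "w \<noteq> 0"
  shows "\<exists>s. s \<in> \<Gamma> L \<and> jet L s (fst p) = snd p \<and>
    tangent_map (base L) (J1 L) (\<lambda>x. (x, jet L s x)) (tvec (base L) U \<phi> (fst p) w) =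
      tv p (w, ap (snd (snd (\<Phi> p))) w, \<pi>)"
proof -
  let ?x = "fst p" and ?a = "\<phi> (fst p)"
  have x: "?x \<in> dom" and \<alpha>: "snd p \<in> \<J> L ?x" using p by auto
  obtain u q where up: "jco L U \<phi> e ?x (snd p) = (u, q)" by (cases "jco L U \<phi> e ?x (snd p)")
  obtain B :: "'e set" where B: "is_basis B" using finite_dim_basis[OF fd] .
  have "\<exists>b\<in>B. rep B w b \<noteq> 0"
  proof (rule ccontr)
    assume "\<not> ?thesis"
    then have "(\<Sum>b\<in>B. rep B w b *\<^sub>R b) = 0" by (intro sum.neutral) auto
    then show False using w basis_sum[OF B, of w] by simp
  qed
  then obtain b where b: "rep B w b \<noteq> 0" by blast
  \<comment> \<open>A linear form with \<open>l w = 1\<close>; the assumption that \<open>w\<close>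
    is non-zero enters here.\<close>
  define l where "l v = rep B v b * inverse (rep B w b)" for v
  have l: "bounded_linear l"
    unfolding l_def by (rule bounded_linear_mult_const[OF bounded_linear_representation[OF B]])
  have lw: "l w = 1" using b by (simp add: l_def)
  note bl = blinfun.bounded_linear_right
  \<comment> \<open>The product of \<pi> and \<open>l\<close> has a Hessian that sends
    \<open>w\<close> to \<open>\<pi> + \<pi>(w) l\<close>; the last summand cancels the
    surplus.\<close>
  define g where "g z = u + ap q (z - ?a) + ap \<pi> (z - ?a) * l (z - ?a)
    + (- ap \<pi> w / 2) * (l (z - ?a) * l (z - ?a))" for z
  define dg where "dg z k = ap q k + (ap \<pi> k * l (z - ?a) + ap \<pi> (z - ?a) * l k)
    + (- ap \<pi> w) * (l (z - ?a) * l k)" for z k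
  have lin: "linear l" "linear (ap q)" "linear (ap \<pi>)" using l bl by (auto intro: bounded_linear.linear)
  have sh: "((\<lambda>z. f (z - ?a)) has_derivative f) (at z)" if "bounded_linear f" for f :: "'e \<Rightarrow> real" and z
    by (auto intro!: derivative_eq_intros bounded_linear.has_derivative[OF that])
  have hg: "(g has_derivative dg z) (at z)" for z unfolding g_def[abs_def] dg_def[abs_def]
    by (rule has_derivative_eq_rhs, (rule has_derivative_add has_derivative_const has_derivative_mult sh l bl)+)
      (auto simp: algebra_simps)
  have sl: "smooth_on UNIV (\<lambda>z. f (z - ?a))" if "bounded_linear f" for f :: "'e \<Rightarrow> real"
    by (intro smooth_on_linear_comp[OF open_UNIV that] smooth_on_diff smooth_on_ident smooth_on_const open_UNIV)
  have "smooth_on UNIV g"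
    unfolding g_def[abs_def] by (intro smooth_on_add smooth_on_mult smooth_on_const open_UNIV sl[OF l] sl[OF bl])
  then obtain s T where s: "s \<in> \<Gamma> L" "open T" "?a \<in> T" "T \<subseteq> \<phi> ` dom" "\<forall>z\<in>T. sr s z = g z"
    using chart_section[OF x open_UNIV UNIV_I] by blast
  have Ds: "\<D> (sr s) z = dg z" if "z \<in> T" for z
  proof -
    have "\<D> (sr s) z = \<D> g z" using s(5) by (intro frechet_derivative_cong[OF s(2) that]) blast
    then show ?thesis using frechet_derivative_at[OF hg[of z]] by simp
  qed
  have dga: "dg ?a = ap q" using linear_0[OF lin(1)] linear_0[OF lin(3)] by (auto simp: dg_def)
  have "jco L U \<phi> e ?x (jet L s ?x) = (u, q)"
    using jco_jet[OF x s(1)] Ds[OF s(3)] dga s(3,5) linear_0[OF lin(1)] linear_0[OF lin(2)]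
    by (simp add: g_def blinfun_apply_inverse)
  then have js: "jet L s ?x = snd p"
    by (intro jco_inject[OF x jet_jet_space[OF s(1) dom_pts[OF x]] \<alpha>]) (simp add: up)
  let ?D = "\<D> (pr s) ?a w"
  have "snd (snd ?D) = \<pi>"
  proof (rule blinfun_eqI)
    fix k
    have hk: "((\<lambda>z. dg z k) has_derivative (\<lambda>v. ap \<pi> k * l v + ap \<pi> v * l k
        + (- ap \<pi> w) * (l v * l k))) (at ?a)" unfolding dg_def
      by (rule has_derivative_eq_rhs, (rule has_derivative_add has_derivative_const has_derivative_mult sh l bl)+)
        (auto simp: algebra_simps)
    have "\<D> (\<lambda>y. \<D> (sr s) y k) ?a = \<D> (\<lambda>z. dg z k) ?a" by (rule frechet_derivative_cong[OF s(2,3)]) (simp add: Ds)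
    then have "\<D> (\<lambda>y. \<D> (sr s) y k) ?a w =
        ap \<pi> k * l w + ap \<pi> w * l k + (- ap \<pi> w) * (l w * l k)"
      unfolding frechet_derivative_at[OF hk, symmetric] by (rule fun_cong)
    then show "ap (snd (snd ?D)) k = ap \<pi> k" using D_pr(3)[OF s(1) x, of w k] lw by simp
  qed
  moreover have "fst ?D = w" "fst (snd ?D) = ap q w" using D_pr(1,2)[OF s(1) x, of w] Ds[OF s(3)] dga by auto
  ultimately have "?D = (w, ap (snd (snd (\<Phi> p))) w, \<pi>)" by (simp add: prod_eq_iff \<Phi>_eq up)
  then show ?thesis using prolong_tangent[OF s(1) x, of w] js s(1) by (intro exI[of _ s]) simp
qed

end

context jets
begin

text \<open>Along a prolongation \<open>du = p dy\<close>, so the generators lie in the kernel.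
  Conversely \<open>generator_ex\<close> reaches every kernel vector with non-zero base part, and a
  kernel vector \<open>(0, 0, \<pi>)\<close> is the difference of two generators over the same base
  vector \<open>k\<close>.\<close>

lemma cartan_eq:
  assumes p: "p \<in> \<P> L"
  shows "cartan L p = fib (tangent (J1 L) p) (contact_form L p) \<zero>\<^bsub>\<E> L p\<^esub>"
proof -
  obtain U \<phi> V e where T: "jtriv L U \<phi> V e" "p \<in> jet_dom L U V" using jtriv_ex[OF p] .
  interpret jtriv L U \<phi> V e by (rule T)
  let ?T = "tangent (J1 L) p" and ?F = "\<E> L p"
  let ?H = "fib ?T (contact_form L p) \<zero>\<^bsub>?F\<^esub>"
  define S where "S = {tangent_map (base L) (J1 L) (\<lambda>x. (x, jet L s x)) w |s w.
        s \<in> \<Gamma> L \<and> jet L s (fst p) = snd p \<and> w \<in> \<T> (base L) (fst p)}"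
  have c: "cartan L p = lin_span ?T S" unfolding cartan_def S_def by (simp add: case_prod_beta)
  have x: "fst p \<in> dom" and xU: "fst p \<in> U" using T(2) by auto
  note TT = J.tangent_vec_space[of p]
  have "S \<subseteq> ?H"
  proof
    fix v assume "v \<in> S"
    then obtain s w0 where s: "s \<in> \<Gamma> L" "jet L s (fst p) = snd p" "w0 \<in> \<T> (base L) (fst p)"
      and v: "v = tangent_map (base L) (J1 L) (\<lambda>x. (x, jet L s x)) w0" unfolding S_def by blast
    obtain w where w: "w0 = tvec (base L) U \<phi> (fst p) w" by (rule tangent_tvec[OF ch xU s(3)])
    have pe: "(fst p, jet L s (fst p)) = p" using s(2) by (simp add: prod_eq_iff)
    have v': "v = tv p (\<D> (pr s) (\<phi> (fst p)) w)" using prolong_tangent[OF s(1) x, of w] unfolding v w pe .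
    have "\<Phi> p = pr s (\<phi> (fst p))" using pr_eq[OF s(1) x] unfolding pe .
    then have "cform (\<Phi> p) (\<D> (pr s) (\<phi> (fst p)) w) = 0"
      using D_pr(1,2)[OF s(1) x, of w] Blinfun_D_sr[OF s(1), of "\<phi> (fst p)"] x by (simp add: cform_def pr_def)
    then have "contact_form L p v = \<zero>\<^bsub>?F\<^esub>"
      unfolding v' contact_form_tv[OF T(2)] using frame_0[OF fr jframe[OF T(2)]] by simp
    then show "v \<in> ?H" using J.tvec_tangent[OF \<Phi>_in_J1 T(2)] by (simp add: fib_def v')
  qed
  then have "lin_span ?T S \<subseteq> ?H" using contact_kernel_subspace[OF p] unfolding lin_span_def by blast
  moreover have "v \<in> W" if v: "v \<in> ?H" and W: "vec_subspace W ?T" "S \<subseteq> W" for v W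
  proof -
    have vT: "v \<in> carrier ?T" and v0: "contact_form L p v = \<zero>\<^bsub>?F\<^esub>" using v by (auto simp: fib_def)
    obtain w r \<pi> where tcv: "tc p v = (w, r, \<pi>)" by (cases "tc p v")
    let ?q = "ap (snd (snd (\<Phi> p)))"
    have "cform (\<Phi> p) (tc p v) = 0"
      using contact_form_coord[OF T(2) vT] v0 crd_zero[OF fr jframe[OF T(2)]] by simp
    then have r: "r = ?q w" by (simp add: cform_def tcv)
    have vtv: "v = tv p (w, ?q w, \<pi>)" using J.tvec_tcoord[OF \<Phi>_in_J1 T(2) vT] tcv r by simp
    have gen: "tv p (w, ?q w, \<pi>) \<in> W" if w: "w \<noteq> 0" for w \<pi>
    proof -
      obtain s where "s \<in> \<Gamma> L" "jet L s (fst p) = snd p"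
        "tangent_map (base L) (J1 L) (\<lambda>x. (x, jet L s x)) (tvec (base L) U \<phi> (fst p) w) = tv p (w, ?q w, \<pi>)"
        using generator_ex[OF T(2) w] by blast
      moreover from this have "tangent_map (base L) (J1 L) (\<lambda>x. (x, jet L s x)) (tvec (base L) U \<phi> (fst p) w) \<in> S"
        unfolding S_def using tvec_tangent[OF ch xU, of w] by blast
      ultimately have "tv p (w, ?q w, \<pi>) \<in> S" by simp
      then show ?thesis using W(2) by blast
    qed
    show "v \<in> W"
    proof (cases "w = 0")
      case False then show ?thesis using gen vtv by simp
    next
      case True
      show ?thesis
      proof (cases "\<pi> = 0")
        case True
        then have "v = \<zero>\<^bsub>?T\<^esub>" using vtv \<open>w = 0\<close> J.tvec_zero[OF \<Phi>_in_J1 T(2)] by (simp del: tangent_simps add: zero_prod_def)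
        then show ?thesis using vs_subspaceD(2)[OF TT W(1)] by simp
      next
        case False
        \<comment> \<open>A non-zero \<pi> guarantees a non-zero base direction, which the
          generators require; in dimension 0 this case cannot occur.\<close>
        then obtain k where k: "ap \<pi> k \<noteq> 0" by (metis blinfun_eqI zero_blinfun.rep_eq)
        then have k0: "k \<noteq> 0" by (auto simp: blinfun.zero_right)
        have "(w, ?q w, \<pi>) = (k, ?q k, \<pi>) + (-1) *\<^sub>R (k, ?q k, 0)" using True by (simp add: blinfun.zero_right)
        then have "v = tv p (k, ?q k, \<pi>) \<oplus>\<^bsub>?T\<^esub> (-1) \<odot>\<^bsub>?T\<^esub> tv p (k, ?q k, 0)"
          unfolding vtv by (simp only: J.tvec_add[OF \<Phi>_in_J1 T(2)] J.tvec_scale[OF \<Phi>_in_J1 T(2)])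
        then show ?thesis using vs_subspaceD(3,4)[OF TT W(1)] gen[OF k0] by (simp del: tangent_simps)
      qed
    qed
  qed
  ultimately show ?thesis unfolding c lin_span_def by blast
qed

lemma cartan_iff: "p \<in> \<P> L \<Longrightarrow> v \<in> cartan L p \<longleftrightarrow>
    v \<in> \<T> (J1 L) p \<and> contact_form L p v = \<zero>\<^bsub>\<E> L p\<^esub>" by (simp add: cartan_eq fib_def)

end

section \<open>The contact structure\<close>

text \<open>The test vectors \<open>(w, p w, 0)\<close> force the \<open>p\<close> part of \<xi> to
  vanish and \<open>(0, 0, \<pi>)\<close> its base part; the \<open>u\<close> part then vanishes
  because \<xi> is horizontal.\<close>

lemma cpair_nondegenerate:
  assumes fd: "finite_dim TYPE('e::real_normed_vector)" and \<xi>: "cform z \<xi> = 0"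
    and "\<And>\<eta> :: 'e \<times> real \<times> ('e \<Rightarrow>\<^sub>L real). cform z \<eta> = 0 \<Longrightarrow> cpair \<xi> \<eta> = 0"
  shows "\<xi> = 0"
proof -
  obtain B :: "'e set" where B: "is_basis B" using finite_dim_basis[OF fd] .
  have "ap (snd (snd \<xi>)) w = 0" for w
    using assms(3)[of "(w, ap (snd (snd z)) w, 0)"] by (simp add: cform_def cpair_def)
  then have 3: "snd (snd \<xi>) = 0" by (intro blinfun_eqI) simp
  have "ap \<pi> (fst \<xi>) = 0" for \<pi> :: "'e \<Rightarrow>\<^sub>L real" using assms(3)[of "(0, 0, \<pi>)"] by (simp add: cform_def cpair_def)
  then have "rep B (fst \<xi>) b = 0" for b using dual_basis_apply[OF B, of b "fst \<xi>"] by metis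
  then have 1: "fst \<xi> = 0" using basis_sum[OF B, of "fst \<xi>"] by simp
  then have "fst (snd \<xi>) = 0" using \<xi> by (simp add: cform_def)
  then show ?thesis using 1 3 by (simp add: prod_eq_iff)
qed

definition theta_sec where
  "theta_sec L Y = (\<lambda>p\<in>\<P> L. contact_form L p (Y p))"

definition hfields where
  "hfields L = {Y \<in> \<X> (J1 L). \<forall>p\<in>\<P> L. contact_form L p (Y p) = \<zero>\<^bsub>\<E> L p\<^esub>}"

context jtriv
begin

abbreviation jsr where "jsr \<equiv> Pt.sr"

lemma \<Phi>_jimg: "p \<in> jdom \<Longrightarrow> \<Phi> p \<in> jimg" using \<Phi>_image_jdom by blast

lemma Psr_smooth: "\<sigma> \<in> \<Gamma>P \<Longrightarrow> smooth_on jimg (jsr \<sigma>)"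
  using Pt.sr_smooth[of \<sigma>] by (simp only: jdom_frame \<Phi>_image_jdom)

lemma Psr_eq: "p \<in> jdom \<Longrightarrow> jsr \<sigma> (\<Phi> p) = crd L e (fst p) (\<sigma> p)" using Pt.sr_eq[of p \<sigma>] by simp

lemma Psec_eq: "\<sigma> \<in> \<Gamma>P \<Longrightarrow> p \<in> jdom \<Longrightarrow> \<sigma> p = jsr \<sigma> (\<Phi> p) \<odot>\<^bsub>\<E> L p\<^esub> e (fst p)"
  using Pt.sec_eq[of \<sigma> p] jdom_frame by (auto simp: points_J1 dom_pts)

lemma vr_smooth: "X \<in> \<X> (J1 L) \<Longrightarrow> smooth_on jimg (vr X)"
  using J.vrep_smooth[OF _ \<Phi>_in_J1] by (simp only: \<Phi>_image_jdom)

lemma vr_eq: "p \<in> jdom \<Longrightarrow> vr X (\<Phi> p) = tc p (X p)" by (rule J.vrep_eq[OF \<Phi>_in_J1])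

lemma vfield_tv: "X \<in> \<X> (J1 L) \<Longrightarrow> p \<in> jdom \<Longrightarrow> X p = tv p (vr X (\<Phi> p))"
  using vr_eq J.tvec_tcoord[OF \<Phi>_in_J1 _ J.vfield_tangent] jdom_points by simp

lemma contact_form_field:
  "Y \<in> \<X> (J1 L) \<Longrightarrow> p \<in> jdom \<Longrightarrow>
    contact_form L p (Y p) = cform (\<Phi> p) (vr Y (\<Phi> p)) \<odot>\<^bsub>\<E> L p\<^esub> e (fst p)"
  using contact_form_eq[OF _ J.vfield_tangent] jdom_points vr_eq by simp

lemma smooth_on_cform: "smooth_on jimg \<xi> \<Longrightarrow> smooth_on jimg (\<lambda>z. cform z (\<xi> z))" unfolding cform_def
  by (intro smooth_on_diff smooth_on_blinfun_apply smooth_on_fst smooth_on_snd smooth_on_ident jimg_open)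

lemma jsr_theta_sec: "Y \<in> \<X> (J1 L) \<Longrightarrow> p \<in> jdom \<Longrightarrow>
    jsr (theta_sec L Y) (\<Phi> p) = cform (\<Phi> p) (vr Y (\<Phi> p))"
  using crd_smult[OF fr jframe] by (simp add: Psr_eq theta_sec_def jdom_points contact_form_field)

lemma has_derivative_cform:
  assumes "smooth_on jimg \<eta>" "z \<in> jimg"
  shows "((\<lambda>z. cform z (\<eta> z)) has_derivative (\<lambda>w. ap (snd (snd z)) (fst (\<D> \<eta> z w))
     + ap (snd (snd w)) (fst (\<eta> z)) - fst (snd (\<D> \<eta> z w)))) (at z)"
proof -
  have hd: "(\<eta> has_derivative \<D> \<eta> z) (at z)" by (rule smooth_on_hd[OF assms])
  show ?thesis unfolding cform_def
    by (intro has_derivative_diff bounded_bilinear.FDERIV[OF bounded_bilinear_blinfun_apply]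
        has_derivative_fst has_derivative_snd has_derivative_ident hd)
qed

text \<open>Cartan's formula for the exterior derivative. Differentiating \<open>p dy - du\<close>
  on a field produces, besides the derivative of the field, a term in which \<open>p\<close> itself
  moves; these terms combine to \<open>cpair\<close>.\<close>

lemma bracket_cform:
  assumes X: "X \<in> \<X> (J1 L)" and Y: "Y \<in> \<X> (J1 L)" and p: "p \<in> jdom"
  shows "cform (\<Phi> p) (vr (vf_bracket (J1 L) X Y) (\<Phi> p)) =
    \<D> (\<lambda>z. cform z (vr Y z)) (\<Phi> p) (vr X (\<Phi> p)) -
    \<D> (\<lambda>z. cform z (vr X z)) (\<Phi> p) (vr Y (\<Phi> p)) + cpair (vr X (\<Phi> p)) (vr Y (\<Phi> p))"
proof -
  note z = \<Phi>_jimg[OF p]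
  show ?thesis unfolding vr_eq[OF p, of "vf_bracket (J1 L) X Y"] J.vf_bracket_coord[OF X Y \<Phi>_in_J1 p]
      frechet_derivative_at[OF has_derivative_cform[OF vr_smooth[OF X] z], symmetric]
      frechet_derivative_at[OF has_derivative_cform[OF vr_smooth[OF Y] z], symmetric]
    by (simp add: cform_def cpair_def blinfun.diff_right)
qed

lemma cutoff_ex:
  assumes p: "p \<in> jdom" and \<xi>: "smooth_on (\<Phi> ` jdom) \<xi>"
  shows "\<exists>X \<rho> W. X \<in> \<X> (J1 L) \<and> (\<forall>y\<in>jdom. X y = tv y (\<rho> y *\<^sub>R \<xi> (\<Phi> y))) \<and>
    (\<forall>y\<in>\<P> L - jdom. X y = \<zero>\<^bsub>tangent (J1 L) y\<^esub>) \<and>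
    mfd_open (J1 L) W \<and> p \<in> W \<and> W \<subseteq> jdom \<and> (\<forall>y\<in>W. \<rho> y = 1)"
proof (rule J.vfield_cutoff[OF \<Phi>_in_J1 p \<xi>])
  fix X \<rho> W
  assume *: "X \<in> \<X> (J1 L)" "\<And>y. y \<in> jdom \<Longrightarrow> X y = tv y (\<rho> y *\<^sub>R \<xi> (\<Phi> y))"
    "\<And>y. y \<in> \<P> L - jdom \<Longrightarrow> X y = \<zero>\<^bsub>tangent (J1 L) y\<^esub>"
    "mfd_open (J1 L) W" "p \<in> W" "W \<subseteq> jdom" "\<And>y. y \<in> W \<Longrightarrow> \<rho> y = 1"
  have "\<forall>y\<in>jdom. X y = tv y (\<rho> y *\<^sub>R \<xi> (\<Phi> y))" "\<forall>y\<in>\<P> L - jdom. X y = \<zero>\<^bsub>tangent (J1 L) y\<^esub>" "\<forall>y\<in>W. \<rho> y = 1"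
    by (rule ballI, erule *)+
  then show ?thesis using *(1,4-6) by (intro exI[of _ X] exI[of _ \<rho>] exI[of _ W] conjI)
qed

lemma field_ext:
  assumes p: "p \<in> jdom" and \<xi>: "smooth_on jimg \<xi>"
  shows "\<exists>Z W. Z \<in> \<X> (J1 L) \<and> mfd_open (J1 L) W \<and> p \<in> W \<and> W \<subseteq> jdom \<and> (\<forall>q\<in>W. Z q = tv q (\<xi> (\<Phi> q)))"
proof -
  have \<xi>': "smooth_on (\<Phi> ` jdom) \<xi>" using \<xi> by (simp only: \<Phi>_image_jdom)
  obtain X \<rho> W where X: "X \<in> \<X> (J1 L)" "\<forall>y\<in>jdom. X y = tv y (\<rho> y *\<^sub>R \<xi> (\<Phi> y))"
    "\<forall>y\<in>\<P> L - jdom. X y = \<zero>\<^bsub>tangent (J1 L) y\<^esub>"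
    "mfd_open (J1 L) W" "p \<in> W" "W \<subseteq> jdom" "\<forall>y\<in>W. \<rho> y = 1" using cutoff_ex[OF p \<xi>'] by blast
  have "\<forall>q\<in>W. X q = tv q (\<xi> (\<Phi> q))"
  proof
    fix q assume q: "q \<in> W"
    then have "q \<in> jdom" using X(6) by blast
    from X(2)[rule_format, OF this] show "X q = tv q (\<xi> (\<Phi> q))" using X(7)[rule_format, OF q] by simp
  qed
  then show ?thesis using X(1,4-6) by (intro exI[of _ X] exI[of _ W] conjI)
qed

text \<open>Base and \<open>p\<close> components are kept constant and the \<open>u\<close>
  component is adjusted at each point so that the form vanishes. As a linear condition this survives
  the cut-off factor and the extension by zero.\<close>

lemma hfield_ext:
  assumes p: "p \<in> jdom" and \<omega>: "cform (\<Phi> p) \<omega> = 0"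
  shows "\<exists>Y\<in>hfields L. Y p = tv p \<omega>"
proof -
  define \<xi> where "\<xi> z = (fst \<omega>, ap (snd (snd z)) (fst \<omega>), snd (snd \<omega>))" for z :: "'e \<times> real \<times> ('e \<Rightarrow>\<^sub>L real)"
  have "smooth_on jimg \<xi>" unfolding \<xi>_def[abs_def]
    by (intro smooth_on_Pair smooth_on_const smooth_on_blinfun_apply smooth_on_snd smooth_on_ident jimg_open)
  then have \<xi>': "smooth_on (\<Phi> ` jdom) \<xi>" by (simp only: \<Phi>_image_jdom)
  obtain X \<rho> W where X: "X \<in> \<X> (J1 L)" "\<forall>y\<in>jdom. X y = tv y (\<rho> y *\<^sub>R \<xi> (\<Phi> y))"
    "\<forall>y\<in>\<P> L - jdom. X y = \<zero>\<^bsub>tangent (J1 L) y\<^esub>"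
    "mfd_open (J1 L) W" "p \<in> W" "W \<subseteq> jdom" "\<forall>y\<in>W. \<rho> y = 1" using cutoff_ex[OF p \<xi>'] by blast
  have c0: "cform z (\<xi> z) = 0" for z by (simp add: \<xi>_def cform_def)
  have "contact_form L q (X q) = \<zero>\<^bsub>\<E> L q\<^esub>" if q: "q \<in> \<P> L" for q
  proof (cases "q \<in> jdom")
    case True
    then show ?thesis
      using X(2)[rule_format, OF True] contact_form_tv[OF True] frame_0[OF fr jframe[OF True]] by (simp add: cform_scale c0)
  next
    case False
    then have "X q = \<zero>\<^bsub>tangent (J1 L) q\<^esub>" using X(3) q by blast
    then show ?thesis using lin_mapD(3)[OF contact_form_lin[OF q] vs_zero[OF J.tangent_vec_space], of 0]
        vs_smult_0[OF J.tangent_vec_space vs_zero[OF J.tangent_vec_space]]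
        vs_smult_0[OF fibre_vs[OF fst_pts[OF q]] lin_mapD(1)[OF contact_form_lin[OF q] vs_zero[OF J.tangent_vec_space]]]
      by (simp del: tangent_simps)
  qed
  then have "X \<in> hfields L" using X(1) by (simp add: hfields_def)
  moreover have "\<xi> (\<Phi> p) = \<omega>" using \<omega> by (simp add: \<xi>_def cform_def prod_eq_iff)
  then have "X p = tv p \<omega>" using X(2)[rule_format, OF p] X(7)[rule_format, OF X(5)] by simp
  ultimately show ?thesis by blast
qed

lemma hfield_cform:
  assumes Y: "Y \<in> hfields L" and z: "z \<in> jimg"
  shows "cform z (vr Y z) = 0"
proof -
  obtain p where p: "p \<in> jdom" "z = \<Phi> p" using z \<Phi>_image_jdom by blast
  have Yv: "Y \<in> \<X> (J1 L)" "contact_form L p (Y p) = \<zero>\<^bsub>\<E> L p\<^esub>"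
    using Y jdom_points[OF p(1)] by (auto simp: hfields_def)
  have "cform (\<Phi> p) (vr Y (\<Phi> p)) \<odot>\<^bsub>\<E> L p\<^esub> e (fst p) = 0 \<odot>\<^bsub>\<E> L p\<^esub> e (fst p)"
    using contact_form_field[OF Yv(1) p(1)] Yv(2) frame_0[OF fr jframe[OF p(1)]] by simp
  then show ?thesis using crd_inj[OF fr jframe[OF p(1)]] p(2) by simp
qed

lemma hfield_D_cform:
  assumes Y: "Y \<in> hfields L" and z: "z \<in> jimg"
  shows "\<D> (\<lambda>z. cform z (vr Y z)) z w = 0"
proof -
  have "\<D> (\<lambda>z. cform z (vr Y z)) z = \<D> (\<lambda>z. 0::real) z"
    by (rule frechet_derivative_cong[OF jimg_open z]) (rule hfield_cform[OF Y])
  then show ?thesis by (simp add: frechet_derivative_const)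
qed

end

section \<open>Horizontal fields, curvature and the quotient line bundle\<close>

context jets
begin

lemma hfields_vfields: "Y \<in> hfields L \<Longrightarrow> Y \<in> \<X> (J1 L)" by (simp add: hfields_def)

lemma hfields_iff: "Y \<in> hfields L \<longleftrightarrow> Y \<in> \<X> (J1 L) \<and> (\<forall>p\<in>\<P> L. Y p \<in> cartan L p)"
  unfolding hfields_def using cartan_iff J.vfield_tangent by auto

lemma cartan_hfield:
  assumes p: "p \<in> \<P> L" and h: "h \<in> cartan L p"
  shows "\<exists>Y\<in>hfields L. Y p = h"
proof -
  obtain U \<phi> V e where T: "jtriv L U \<phi> V e" "p \<in> jet_dom L U V" using jtriv_ex[OF p] .
  interpret jtriv L U \<phi> V e by (rule T)
  have h': "h \<in> \<T> (J1 L) p" "contact_form L p h = \<zero>\<^bsub>\<E> L p\<^esub>" using h cartan_iff[OF p] by auto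
  have "cform (\<Phi> p) (tc p h) = 0"
    using contact_form_coord[OF T(2) h'(1)] h'(2) crd_zero[OF fr jframe[OF T(2)]] by simp
  from hfield_ext[OF T(2) this] show ?thesis using J.tvec_tcoord[OF \<Phi>_in_J1 T(2) h'(1)] by simp
qed

abbreviation fibp where "fibp p \<equiv> fib (tangent (J1 L) p) (contact_form L p)"
abbreviation LH where "LH \<equiv> contact_line_bundle (J1 L) (cartan L)"

context
  fixes p assumes p: "p \<in> \<P> L"
begin

lemmas Qfacts = J.tangent_vec_space fibre_vs[OF fst_pts[OF p]] contact_form_lin[OF p] contact_form_surj[OF p]

lemma theta_eq: "v \<in> \<T> (J1 L) p \<Longrightarrow> theta (J1 L) (cartan L) p v = fibp p (contact_form L p v)"
  unfolding theta_def cartan_eq[OF p] by (rule coset_fib[OF Qfacts])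

lemma LH_carrier: "\<F> LH p = fibp p ` \<F> L (fst p)"
  unfolding contact_line_bundle_def line_bundle.simps cartan_eq[OF p] by (rule quot_carrier[OF Qfacts])

lemma LH_zero: "\<zero>\<^bsub>fibre LH p\<^esub> = fibp p \<zero>\<^bsub>\<E> L p\<^esub>"
  unfolding contact_line_bundle_def line_bundle.simps cartan_eq[OF p] by (rule quot_zero[OF Qfacts])

lemma LH_add: "l \<in> \<F> L (fst p) \<Longrightarrow> l' \<in> \<F> L (fst p) \<Longrightarrow>
    fibp p l \<oplus>\<^bsub>fibre LH p\<^esub> fibp p l' = fibp p (l \<oplus>\<^bsub>\<E> L p\<^esub> l')"
  unfolding contact_line_bundle_def line_bundle.simps cartan_eq[OF p] by (rule quot_add[OF Qfacts])

lemma LH_smult: "l \<in> \<F> L (fst p) \<Longrightarrow> c \<odot>\<^bsub>fibre LH p\<^esub> fibp p l = fibp p (c \<odot>\<^bsub>\<E> L p\<^esub> l)"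
  unfolding contact_line_bundle_def line_bundle.simps cartan_eq[OF p] by (rule quot_smult[OF Qfacts])

lemma fibp_inject: "l \<in> \<F> L (fst p) \<Longrightarrow> fibp p l = fibp p l' \<Longrightarrow> l = l'" by (rule fib_inject[OF Qfacts])

lemma LH_vec_space: "vec_space (fibre LH p)"
  unfolding contact_line_bundle_def line_bundle.simps cartan_eq[OF p] by (rule quot_vec_space[OF Qfacts])

lemma LH_one_dimensional: "one_dimensional (fibre LH p)"
  unfolding contact_line_bundle_def line_bundle.simps cartan_eq[OF p]
  by (rule quot_one_dimensional[OF Qfacts fibre_one[OF fst_pts[OF p]]])

lemma LH_coord: "l0 \<in> \<F> L (fst p) \<Longrightarrow> l \<in> \<F> L (fst p) \<Longrightarrow>
    coord (fibre LH p) (fibp p l0) (fibp p l) = coord (\<E> L p) l0 l"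
  unfolding contact_line_bundle_def line_bundle.simps cartan_eq[OF p] by (rule quot_coord[OF Qfacts])

end

lemma LH_fibre: "fibre LH p = quotient_space (tangent (J1 L) p) (cartan L p)"
  by (simp add: contact_line_bundle_def)

lemma contact_form_carrier: "p \<in> \<P> L \<Longrightarrow> v \<in> \<T> (J1 L) p \<Longrightarrow> contact_form L p v \<in> \<F> L (fst p)"
  by (rule lin_mapD(1)[OF contact_form_lin])

text \<open>For horizontal fields the derivative terms of \<open>bracket_cform\<close> vanish and
  \<open>cpair\<close> sees only the values at \<open>p\<close>. So all horizontal extensions give
  one value, and the definite description in \<open>curvature\<close> denotes it.\<close>

lemma curvature_eq:
  assumes T: "jtriv L U \<phi> V e" and p: "p \<in> jet_dom L U V"
    and h: "h \<in> cartan L p" and k: "k \<in> cartan L p"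
  shows "curvature (J1 L) (cartan L) p h k =
    fibp p (cpair (tcoord (J1 L) (jet_dom L U V) (jet_chart L U \<phi> e) p h)
      (tcoord (J1 L) (jet_dom L U V) (jet_chart L U \<phi> e) p k) \<odot>\<^bsub>\<E> L p\<^esub> e (fst p))"
proof -
  interpret jtriv L U \<phi> V e by (rule T)
  note pP = jdom_points[OF p]
  have *: "theta (J1 L) (cartan L) p (vf_bracket (J1 L) X Y p) = fibp p (cpair (tc p h) (tc p k) \<odot>\<^bsub>\<E> L p\<^esub> e (fst p))"
    if "X \<in> hfields L" "Y \<in> hfields L" "X p = h" "Y p = k" for X Y
  proof -
    note v = hfields_vfields[OF that(1)] hfields_vfields[OF that(2)]
    have "theta (J1 L) (cartan L) p (vf_bracket (J1 L) X Y p) = fibp p (contact_form L p (vf_bracket (J1 L) X Y p))"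
      by (rule theta_eq[OF pP J.vfield_tangent[OF J.vf_bracket_vfield[OF v] pP]])
    also have "contact_form L p (vf_bracket (J1 L) X Y p) = cpair (tc p h) (tc p k) \<odot>\<^bsub>\<E> L p\<^esub> e (fst p)"
      unfolding that(3,4)[symmetric] vr_eq[OF p, symmetric]
      by (simp add: contact_form_field[OF J.vf_bracket_vfield[OF v] p] bracket_cform[OF v p]
          hfield_D_cform[OF that(1) \<Phi>_jimg[OF p]] hfield_D_cform[OF that(2) \<Phi>_jimg[OF p]])
    finally show ?thesis .
  qed
  obtain X where X: "X \<in> hfields L" "X p = h" using cartan_hfield[OF pP h] by blast
  obtain Y where Y: "Y \<in> hfields L" "Y p = k" using cartan_hfield[OF pP k] by blast
  show ?thesis unfolding curvature_def
  proof (rule the_equality)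
    show "\<exists>X\<in>\<X> (J1 L). \<exists>Y\<in>\<X> (J1 L).
        (\<forall>y\<in>\<P> L. X y \<in> cartan L y \<and> Y y \<in> cartan L y) \<and> X p = h \<and> Y p = k \<and>
        fibp p (cpair (tc p h) (tc p k) \<odot>\<^bsub>\<E> L p\<^esub> e (fst p)) = theta (J1 L) (cartan L) p (vf_bracket (J1 L) X Y p)"
      using X Y *[OF X(1) Y(1) X(2) Y(2)] hfields_iff by (intro bexI[of _ X] bexI[of _ Y]) auto
    fix w assume "\<exists>X\<in>\<X> (J1 L). \<exists>Y\<in>\<X> (J1 L).
        (\<forall>y\<in>\<P> L. X y \<in> cartan L y \<and> Y y \<in> cartan L y) \<and> X p = h \<and> Y p = k \<and>
        w = theta (J1 L) (cartan L) p (vf_bracket (J1 L) X Y p)"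
    then obtain X Y where "X \<in> hfields L" "Y \<in> hfields L" "X p = h" "Y p = k"
      "w = theta (J1 L) (cartan L) p (vf_bracket (J1 L) X Y p)" using hfields_iff by blast
    then show "w = fibp p (cpair (tc p h) (tc p k) \<odot>\<^bsub>\<E> L p\<^esub> e (fst p))" using * by simp
  qed
qed

lemma lin_span_subspace: "vec_subspace W V \<Longrightarrow> lin_span V W = W" unfolding lin_span_def by blast

lemma contact_structure_cartan: "contact_structure (J1 L) (cartan L)" unfolding contact_structure_def
proof (intro conjI J1_smooth_manifold)
  show "hyperplane_distribution (J1 L) (cartan L)" unfolding hyperplane_distribution_def
  proof (intro conjI ballI)
    fix p assume p: "p \<in> \<P> L"
    show "vec_subspace (cartan L p) (tangent (J1 L) p)"
      unfolding cartan_eq[OF p] by (rule contact_kernel_subspace[OF p])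
    show "one_dimensional (quotient_space (tangent (J1 L) p) (cartan L p))"
      using LH_one_dimensional[OF p] by (simp only: LH_fibre)
  next
    fix p assume p: "p \<in> \<P> L"
    \<comment> \<open>Every Cartan vector extends to a global horizontal field, so the whole
      manifold with all horizontal fields serves as local spanning data.\<close>
    have "cartan L q = lin_span (tangent (J1 L) q) ((\<lambda>Y. Y q) ` hfields L)" if q: "q \<in> \<P> L" for q
    proof -
      have "(\<lambda>Y. Y q) ` hfields L = cartan L q" using cartan_hfield[OF q] hfields_iff q by blast
      then show ?thesis using lin_span_subspace[OF contact_kernel_subspace[OF q]] by (simp add: cartan_eq[OF q])
    qed
    then show "\<exists>U F. mfd_open (J1 L) U \<and> p \<in> U \<and> F \<subseteq> \<X> (J1 L) \<and>
        (\<forall>y\<in>U. cartan L y = lin_span (tangent (J1 L) y) ((\<lambda>Y. Y y) ` F))"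
      using J.mfd_open_points p hfields_vfields by (intro exI[of _ "\<P> L"] exI[of _ "hfields L"]) blast
  qed
next
  show "\<forall>p\<in>\<P> L. \<forall>h\<in>cartan L p.
      (\<forall>k\<in>cartan L p. curvature (J1 L) (cartan L) p h k = \<zero>\<^bsub>quotient_space (tangent (J1 L) p) (cartan L p)\<^esub>)
      \<longrightarrow> h = \<zero>\<^bsub>tangent (J1 L) p\<^esub>"
  proof (intro ballI impI)
    fix p h assume p: "p \<in> \<P> L" and h: "h \<in> cartan L p"
      and 0: "\<forall>k\<in>cartan L p. curvature (J1 L) (cartan L) p h k = \<zero>\<^bsub>quotient_space (tangent (J1 L) p) (cartan L p)\<^esub>"
    obtain U \<phi> V e where T: "jtriv L U \<phi> V e" "p \<in> jet_dom L U V" using jtriv_ex[OF p] .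
    interpret jtriv L U \<phi> V e by (rule T)
    have h': "h \<in> \<T> (J1 L) p" "contact_form L p h = \<zero>\<^bsub>\<E> L p\<^esub>" using h cartan_iff[OF p] by auto
    have "cform (\<Phi> p) (tc p h) = 0"
      using contact_form_coord[OF T(2) h'(1)] h'(2) crd_zero[OF fr jframe[OF T(2)]] by simp
    moreover have "cpair (tc p h) \<eta> = 0" if \<eta>: "cform (\<Phi> p) \<eta> = 0" for \<eta>
    proof -
      have k: "tv p \<eta> \<in> cartan L p"
        using cartan_iff[OF p] J.tvec_tangent[OF \<Phi>_in_J1 T(2)] contact_form_tv[OF T(2), of \<eta>] \<eta> frame_0[OF fr jframe[OF T(2)]]
        by simp
      have "fibp p (cpair (tc p h) \<eta> \<odot>\<^bsub>\<E> L p\<^esub> e (fst p)) = fibp p \<zero>\<^bsub>\<E> L p\<^esub>"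
        using 0[rule_format, OF k] curvature_eq[OF T h k] J.tcoord_tvec[OF \<Phi>_in_J1 T(2), of \<eta>]
        unfolding LH_fibre[symmetric] LH_zero[OF p] by simp
      from fibp_inject[OF p frame_smult[OF fr jframe[OF T(2)]] this]
      have "cpair (tc p h) \<eta> \<odot>\<^bsub>\<E> L p\<^esub> e (fst p) = 0 \<odot>\<^bsub>\<E> L p\<^esub> e (fst p)" using frame_0[OF fr jframe[OF T(2)]] by simp
      then show ?thesis by (rule crd_inj[OF fr jframe[OF T(2)]])
    qed
    ultimately have "tc p h = 0" by (rule cpair_nondegenerate[OF fd])
    then show "h = \<zero>\<^bsub>tangent (J1 L) p\<^esub>"
      using J.tvec_tcoord[OF \<Phi>_in_J1 T(2) h'(1)] J.tvec_zero[OF \<Phi>_in_J1 T(2)] by simp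
  qed
qed

lemma theta_sec_section:
  assumes Y: "Y \<in> \<X> (J1 L)"
  shows "theta_sec L Y \<in> \<Gamma>P"
proof (rule P.sectionI_local)
  show "theta_sec L Y p \<in> \<F> (pi_star L) p" if "p \<in> pts (pi_star L)" for p
    using that contact_form_carrier J.vfield_tangent[OF Y] by (simp add: theta_sec_def)
  show "theta_sec L Y \<in> extensional (pts (pi_star L))" by (simp add: theta_sec_def)
  fix p assume "p \<in> pts (pi_star L)"
  then have p: "p \<in> \<P> L" by simp
  obtain U \<phi> V e where T: "jtriv L U \<phi> V e" "p \<in> jet_dom L U V" using jtriv_ex[OF p] .
  interpret jtriv L U \<phi> V e by (rule T)
  have "smooth_fun (base (pi_star L)) jdom (\<lambda>q. crd L e (fst q) (theta_sec L Y q))"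
  proof (rule Pt.smooth_funI_chart)
    show "mfd_open (base (pi_star L)) jdom" using J.mfd_open_chart[OF \<Phi>_in_J1] by simp
    have "smooth_on jimg (\<lambda>z. cform z (vr Y z))" by (rule smooth_on_cform[OF vr_smooth[OF Y]])
    then show "smooth_on (\<Phi> ` jdom) ((\<lambda>q. crd L e (fst q) (theta_sec L Y q)) \<circ> \<I> jdom \<Phi>)" unfolding \<Phi>_image_jdom
    proof (rule smooth_on_transform[OF _ jimg_open])
      fix z assume "z \<in> jimg"
      then obtain q where q: "q \<in> jdom" "z = \<Phi> q" using \<Phi>_image_jdom by blast
      then show "cform z (vr Y z) = ((\<lambda>q. crd L e (fst q) (theta_sec L Y q)) \<circ> \<I> jdom \<Phi>) z"
        using jsr_theta_sec[OF Y q(1)] inv_into_f_f[OF \<Phi>_inj q(1)] by (simp add: Psr_eq)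
    qed
  qed simp
  then show "\<exists>V e W. (V, e) \<in> frames (pi_star L) \<and> mfd_open (base (pi_star L)) W \<and> p \<in> W \<and> W \<subseteq> V \<and>
      smooth_fun (base (pi_star L)) W (\<lambda>x. coord (fibre (pi_star L) x) (e x) (theta_sec L Y x))"
    using Pt.fr T(2) J.mfd_open_chart[OF \<Phi>_in_J1] jdom_frame
    by (intro exI[of _ "{p \<in> \<P> L. fst p \<in> V}"] exI[of _ "\<lambda>p. e (fst p)"] exI[of _ jdom]) auto
qed

end

text \<open>In a frame the coefficient is the quotient of two smooth coordinates. This makes the
  classes of transversal vector fields compatible frames of the quotient bundle.\<close>

lemma (in lbundle) coord_sections_smooth:
  assumes s: "s \<in> \<Gamma> L" and t: "t \<in> \<Gamma> L" and W: "mfd_open (base L) W" and ne: "\<And>x. x \<in> W \<Longrightarrow> s x \<noteq> \<zero>\<^bsub>fibre L x\<^esub>"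
  shows "smooth_fun (base L) W (\<lambda>x. coord (fibre L x) (s x) (t x))"
proof (rule smooth_fun_patch)
  fix x assume x: "x \<in> W"
  then have xP: "x \<in> pts L" using mfd_open_subset[OF W] by blast
  obtain V e where fr: "(V, e) \<in> frames L" "x \<in> V" using frame_ex[OF xP] by blast
  have o: "mfd_open (base L) (W \<inter> V)" by (rule mfd_open_Int[OF W frame_open[OF fr(1)]])
  have nz: "crd L e y (s y) \<noteq> 0" and
    eq: "crd L e y (t y) / crd L e y (s y) = coord (fibre L y) (s y) (t y)"
    if y: "y \<in> W \<inter> V" for y
  proof -
    have yV: "y \<in> V" and yW: "y \<in> W" using y by auto
    note yP = frame_points[OF fr(1) yV]
    have "s y = crd L e y (s y) \<odot>\<^bsub>fibre L y\<^esub> e y" using crd_eq[OF fr(1) yV sec_carrier[OF s yP]] by simp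
    then show nz: "crd L e y (s y) \<noteq> 0" using frame_0[OF fr(1) yV] ne[OF yW] by metis
    show "crd L e y (t y) / crd L e y (s y) = coord (fibre L y) (s y) (t y)"
      using coord_change[OF fibre_vs[OF yP] fibre_one[OF yP] sec_carrier[OF s yP] ne[OF yW] frame_carrier[OF fr(1) yV]
          frame_nonzero[OF fr(1) yV] sec_carrier[OF t yP]] nz by simp
  qed
  have "smooth_fun (base L) (W \<inter> V) (\<lambda>y. crd L e y (t y) / crd L e y (s y))"
    by (rule smooth_fun_divide[OF o nz smooth_fun_subset[OF sec_smooth[OF t fr(1)]] smooth_fun_subset[OF sec_smooth[OF s fr(1)]]]) auto
  then have "smooth_fun (base L) (W \<inter> V) (\<lambda>x. coord (fibre L x) (s x) (t x))"
    by (rule smooth_fun_cong[OF o, rotated]) (rule eq)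
  then show "\<exists>W'. mfd_open (base L) W' \<and> x \<in> W' \<and> smooth_fun (base L) W' (\<lambda>x. coord (fibre L x) (s x) (t x))"
    using o x fr(2) by blast
qed

section \<open>The contact line bundle\<close>

text \<open>The inverse of \<open>fibp p\<close>: it sends the class of a tangent vector to the
  value of the contact form on that vector.\<close>

definition theta_iso where
  "theta_iso L p C = (THE l. l \<in> \<F> L (fst p) \<and> C = fib (tangent (J1 L) p) (contact_form L p) l)"

context jets
begin

lemma theta_iso_fib: "p \<in> \<P> L \<Longrightarrow> l \<in> \<F> L (fst p) \<Longrightarrow> theta_iso L p (fibp p l) = l"
  unfolding theta_iso_def using fibp_inject by (intro the_equality) blast+

lemma fib_theta_iso: "p \<in> \<P> L \<Longrightarrow> C \<in> \<F> LH p \<Longrightarrow> fibp p (theta_iso L p C) = C"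
  by (auto simp: LH_carrier theta_iso_fib)

lemma theta_iso_carrier: "p \<in> \<P> L \<Longrightarrow> C \<in> \<F> LH p \<Longrightarrow> theta_iso L p C \<in> \<F> L (fst p)"
  by (auto simp: LH_carrier theta_iso_fib)

lemma theta_iso_lin: "p \<in> \<P> L \<Longrightarrow> lin_map (fibre LH p) (\<E> L p) (theta_iso L p)" unfolding lin_map_def LH_carrier
  by (auto simp: theta_iso_fib LH_add LH_smult vs_add vs_smult fibre_vs fst_pts)

lemma theta_iso_bij: "p \<in> \<P> L \<Longrightarrow> bij_betw (theta_iso L p) (\<F> LH p) (\<F> L (fst p))"
  by (rule bij_betw_byWitness[where f' = "fibp p"]) (auto simp: theta_iso_fib LH_carrier)

lemma LH_base: "base LH = J1 L" by (simp add: contact_line_bundle_def)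

lemma LH_frames: "frames LH = {(U, (\<lambda>x. theta (J1 L) (cartan L) x (Y x))) |U Y.
       mfd_open (J1 L) U \<and> Y \<in> \<X> (J1 L) \<and> (\<forall>x\<in>U. Y x \<notin> cartan L x)}" by (simp add: contact_line_bundle_def)

definition frame_field where
  "frame_field U E Y \<longleftrightarrow> mfd_open (J1 L) U \<and> Y \<in> \<X> (J1 L) \<and> (\<forall>x\<in>U. Y x \<notin> cartan L x) \<and>
     E = (\<lambda>x. theta (J1 L) (cartan L) x (Y x))"

lemma frame_field_ex: "(U, E) \<in> frames LH \<Longrightarrow> \<exists>Y. frame_field U E Y" unfolding LH_frames frame_field_def by blast

lemma frame_fieldD:
  assumes Y: "frame_field U E Y"
  shows "mfd_open (J1 L) U" "Y \<in> \<X> (J1 L)" and "x \<in> U \<Longrightarrow> x \<in> \<P> L" and "x \<in> U \<Longrightarrow> E x = fibp x (theta_sec L Y x)"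
    "x \<in> U \<Longrightarrow> theta_sec L Y x \<in> \<F> L (fst x)" "x \<in> U \<Longrightarrow> theta_sec L Y x \<noteq> \<zero>\<^bsub>\<E> L x\<^esub>"
proof -
  show U: "mfd_open (J1 L) U" and YX: "Y \<in> \<X> (J1 L)" using Y by (auto simp: frame_field_def)
  assume x: "x \<in> U"
  show xP: "x \<in> \<P> L" using x J.mfd_open_subset[OF U] by blast
  note v = J.vfield_tangent[OF YX xP]
  show "E x = fibp x (theta_sec L Y x)" using theta_eq[OF xP v] xP Y by (simp add: frame_field_def theta_sec_def)
  show "theta_sec L Y x \<in> \<F> L (fst x)" using contact_form_carrier[OF xP v] xP by (simp add: theta_sec_def)
  have "Y x \<notin> cartan L x" using Y x by (simp add: frame_field_def)
  then show "theta_sec L Y x \<noteq> \<zero>\<^bsub>\<E> L x\<^esub>" using cartan_iff[OF xP] v xP by (simp add: theta_sec_def)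
qed

lemma LH_frame_ex:
  assumes p: "p \<in> \<P> L"
  shows "\<exists>(U, E)\<in>frames LH. p \<in> U"
proof -
  obtain U \<phi> V e where T: "jtriv L U \<phi> V e" "p \<in> jet_dom L U V" using jtriv_ex[OF p] .
  interpret jtriv L U \<phi> V e by (rule T)
  \<comment> \<open>The coordinate field of \<open>u\<close>, on which the contact form is -1 times
    the frame, hence nowhere horizontal on \<open>W\<close>.\<close>
  obtain Z W where Z: "Z \<in> \<X> (J1 L)" "mfd_open (J1 L) W" "p \<in> W" "W \<subseteq> jdom" "\<forall>q\<in>W. Z q = tv q (0, 1, 0)"
    using field_ext[OF T(2) smooth_on_const[OF jimg_open]] by blast
  have "\<forall>q\<in>W. Z q \<notin> cartan L q"
  proof
    fix q assume q: "q \<in> W"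
    then have qj: "q \<in> jdom" using Z(4) by blast
    have "contact_form L q (Z q) = (-1) \<odot>\<^bsub>\<E> L q\<^esub> e (fst q)"
      using Z(5) q contact_form_tv[OF qj] by (simp add: cform_def)
    then have "contact_form L q (Z q) \<noteq> 0 \<odot>\<^bsub>\<E> L q\<^esub> e (fst q)" using crd_inj[OF fr jframe[OF qj], of "-1" 0] by auto
    then show "Z q \<notin> cartan L q" using cartan_iff[OF jdom_points[OF qj]] frame_0[OF fr jframe[OF qj]] by auto
  qed
  then have "(W, (\<lambda>x. theta (J1 L) (cartan L) x (Z x))) \<in> frames LH" using Z unfolding LH_frames by blast
  then show ?thesis using Z(3) by (intro bexI[of _ "(W, (\<lambda>x. theta (J1 L) (cartan L) x (Z x)))"]) auto
qed

lemma LH_line_bundle: "is_line_bundle LH"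
proof -
  have "\<forall>(U, E)\<in>frames LH. mfd_open (J1 L) U \<and> (\<forall>x\<in>U. E x \<in> \<F> LH x \<and> E x \<noteq> \<zero>\<^bsub>fibre LH x\<^esub>)"
  proof (rule ballI, clarify del: conjI)
    fix U E assume "(U, E) \<in> frames LH"
    then obtain Y where "frame_field U E Y" using frame_field_ex by blast
    note Y = frame_fieldD[OF this]
    have "E x \<in> \<F> LH x \<and> E x \<noteq> \<zero>\<^bsub>fibre LH x\<^esub>" if x: "x \<in> U" for x
      using Y(4,5,6)[OF x] LH_carrier[OF Y(3)[OF x]] LH_zero[OF Y(3)[OF x]] fibp_inject[OF Y(3)[OF x] Y(5)[OF x]] by auto
    then show "mfd_open (J1 L) U \<and> (\<forall>x\<in>U. E x \<in> \<F> LH x \<and> E x \<noteq> \<zero>\<^bsub>fibre LH x\<^esub>)" using Y(1) by blast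
  qed
  moreover have "\<forall>(U, E)\<in>frames LH. \<forall>(U', E')\<in>frames LH. smooth_fun (J1 L) (U \<inter> U') (\<lambda>x. coord (fibre LH x) (E x) (E' x))"
  proof clarify
    fix U E U' E' assume "(U, E) \<in> frames LH"
    then obtain Y where "frame_field U E Y" using frame_field_ex by blast
    note Y = frame_fieldD[OF this]
    assume "(U', E') \<in> frames LH"
    then obtain Y' where "frame_field U' E' Y'" using frame_field_ex by blast
    note Y' = frame_fieldD[OF this]
    have o: "mfd_open (J1 L) (U \<inter> U')" by (rule J.mfd_open_Int[OF Y(1) Y'(1)])
    have "smooth_fun (J1 L) (U \<inter> U') (\<lambda>x. coord (\<E> L x) (theta_sec L Y x) (theta_sec L Y' x))"
      using P.coord_sections_smooth[OF theta_sec_section[OF Y(2)] theta_sec_section[OF Y'(2)], of "U \<inter> U'"] o Y(6) by simp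
    then show "smooth_fun (J1 L) (U \<inter> U') (\<lambda>x. coord (fibre LH x) (E x) (E' x))"
    proof (rule J.smooth_fun_cong[OF o, rotated])
      fix x assume "x \<in> U \<inter> U'"
      then have x: "x \<in> U" "x \<in> U'" by auto
      show "coord (\<E> L x) (theta_sec L Y x) (theta_sec L Y' x) = coord (fibre LH x) (E x) (E' x)"
        unfolding Y(4)[OF x(1)] Y'(4)[OF x(2)] by (rule LH_coord[OF Y(3)[OF x(1)] Y(5)[OF x(1)] Y'(5)[OF x(2)], symmetric])
    qed
  qed
  moreover have "\<forall>x\<in>\<P> L. vec_space (fibre LH x) \<and> one_dimensional (fibre LH x)"
    using LH_vec_space LH_one_dimensional by blast
  moreover have "\<forall>x\<in>\<P> L. \<exists>(U, E)\<in>frames LH. x \<in> U" using LH_frame_ex by blast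
  ultimately show ?thesis unfolding is_line_bundle_def LH_base by (intro conjI J1_smooth_manifold)
qed

text \<open>On the frame given by a vector field \<open>Y\<close> the isomorphism returns
  \<open>theta_sec L Y\<close>, whose smoothness is known.\<close>

lemma LH_isomorphism: "lb_isomorphism LH (pi_star L) (theta_iso L)"
proof -
  have "\<forall>(U, E)\<in>frames LH. \<forall>(U', e')\<in>frames (pi_star L).
      smooth_fun (J1 L) (U \<inter> U') (\<lambda>x. coord (\<E> L x) (e' x) (theta_iso L x (E x)))"
  proof clarify
    fix U E U' e' assume "(U, E) \<in> frames LH"
    then obtain Y where "frame_field U E Y" using frame_field_ex by blast
    note Y = frame_fieldD[OF this]
    assume fr': "(U', e') \<in> frames (pi_star L)"
    have o: "mfd_open (J1 L) (U \<inter> U')" using J.mfd_open_Int[OF Y(1)] P.frame_open[OF fr'] by simp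
    have "smooth_fun (J1 L) U' (\<lambda>x. coord (\<E> L x) (e' x) (theta_sec L Y x))"
      using P.sec_smooth[OF theta_sec_section[OF Y(2)] fr'] by simp
    then have "smooth_fun (J1 L) (U \<inter> U') (\<lambda>x. coord (\<E> L x) (e' x) (theta_sec L Y x))"
      by (rule J.smooth_fun_subset) blast
    then show "smooth_fun (J1 L) (U \<inter> U') (\<lambda>x. coord (\<E> L x) (e' x) (theta_iso L x (E x)))"
    proof (rule J.smooth_fun_cong[OF o, rotated])
      fix x assume "x \<in> U \<inter> U'"
      then have x: "x \<in> U" by blast
      show "coord (\<E> L x) (e' x) (theta_sec L Y x) = coord (\<E> L x) (e' x) (theta_iso L x (E x))"
        unfolding Y(4)[OF x] theta_iso_fib[OF Y(3)[OF x] Y(5)[OF x]] ..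
    qed
  qed
  moreover have "\<forall>x\<in>\<P> L. lin_map (fibre LH x) (\<E> L x) (theta_iso L x) \<and>
      bij_betw (theta_iso L x) (\<F> LH x) (\<F> L (fst x))" using theta_iso_lin theta_iso_bij by blast
  ultimately show ?thesis unfolding lb_isomorphism_def LH_base pi_star_simps
    by (intro conjI LH_line_bundle pi_star_line_bundle refl)
qed

text \<open>The coordinate of the image is the coefficient of \<open>S\<close> in the class of a
  field \<open>Y\<close> times the coordinate of \<open>theta_sec L Y\<close>, both smooth.\<close>

lemma LH_section_to:
  assumes S: "S \<in> \<Gamma> LH"
  shows "on_sections (\<P> L) (theta_iso L) S \<in> \<Gamma>P"
proof -
  interpret H: lbundle LH by (rule lbundle.intro[OF LH_line_bundle])
  have SP: "S p \<in> \<F> LH p" if "p \<in> \<P> L" for p using H.sec_carrier[OF S] that by (simp add: LH_base)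
  show ?thesis
  proof (rule P.sectionI_local)
    show "on_sections (\<P> L) (theta_iso L) S p \<in> \<F> (pi_star L) p" if "p \<in> pts (pi_star L)" for p
      using that SP theta_iso_carrier by (simp add: on_sections_def)
    show "on_sections (\<P> L) (theta_iso L) S \<in> extensional (pts (pi_star L))" by (simp add: on_sections_def)
    fix p assume "p \<in> pts (pi_star L)"
    then have p: "p \<in> \<P> L" by simp
    obtain V e where fr: "(V, e) \<in> frames (pi_star L)" "p \<in> V" using P.frame_ex[of p] p by auto
    obtain U E where FR: "(U, E) \<in> frames LH" "p \<in> U" using LH_frame_ex[OF p] by blast
    obtain Y where "frame_field U E Y" using frame_field_ex[OF FR(1)] by blast
    note Y = frame_fieldD[OF this]
    have o: "mfd_open (J1 L) (U \<inter> V)" using J.mfd_open_Int[OF Y(1)] P.frame_open[OF fr(1)] by simp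
    have 1: "smooth_fun (J1 L) U (\<lambda>x. coord (fibre LH x) (E x) (S x))" using H.sec_smooth[OF S FR(1)] by (simp add: LH_base)
    have 2: "smooth_fun (J1 L) V (\<lambda>x. coord (\<E> L x) (e x) (theta_sec L Y x))"
      using P.sec_smooth[OF theta_sec_section[OF Y(2)] fr(1)] by simp
    have "smooth_fun (J1 L) (U \<inter> V) (\<lambda>x. coord (fibre LH x) (E x) (S x) * coord (\<E> L x) (e x) (theta_sec L Y x))"
      by (rule J.smooth_fun_mult[OF o J.smooth_fun_subset[OF 1] J.smooth_fun_subset[OF 2]]) auto
    then have "smooth_fun (J1 L) (U \<inter> V) (\<lambda>x. coord (\<E> L x) (e x) (on_sections (\<P> L) (theta_iso L) S x))"
    proof (rule J.smooth_fun_cong[OF o, rotated])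
      fix x assume "x \<in> U \<inter> V"
      then have x: "x \<in> U" "x \<in> V" by auto
      note xP = Y(3)[OF x(1)]
      note ti = theta_iso_carrier[OF xP SP[OF xP]]
      have "coord (fibre LH x) (E x) (S x) = coord (\<E> L x) (theta_sec L Y x) (theta_iso L x (S x))"
        using LH_coord[OF xP Y(5)[OF x(1)] ti] by (simp add: Y(4)[OF x(1)] fib_theta_iso[OF xP SP[OF xP]])
      then show "coord (fibre LH x) (E x) (S x) * coord (\<E> L x) (e x) (theta_sec L Y x) =
          coord (\<E> L x) (e x) (on_sections (\<P> L) (theta_iso L) S x)"
        using coord_change[OF fibre_vs[OF fst_pts[OF xP]] fibre_one[OF fst_pts[OF xP]] Y(5)[OF x(1)] Y(6)[OF x(1)], of "e x"]
          P.frame_carrier[OF fr(1) x(2)] P.frame_nonzero[OF fr(1) x(2)] ti xP by (simp add: on_sections_def)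
    qed
    then show "\<exists>V e W. (V, e) \<in> frames (pi_star L) \<and> mfd_open (base (pi_star L)) W \<and> p \<in> W \<and> W \<subseteq> V \<and>
        smooth_fun (base (pi_star L)) W (\<lambda>x. coord (fibre (pi_star L) x) (e x) (on_sections (\<P> L) (theta_iso L) S x))"
      using fr FR(2) o by (intro exI[of _ V] exI[of _ e] exI[of _ "U \<inter> V"]) auto
  qed
qed

end

section \<open>Contact vector fields\<close>

text \<open>The partial differential in \<open>p\<close> is a functional on functionals, in finite
  dimension a vector of the model space. A fixed basis writes it down; \<open>hgrad_apply\<close>
  gives its basis-free meaning.\<close>

definition hgrad :: "('e::real_normed_vector \<times> real \<times> ('e \<Rightarrow>\<^sub>L real) \<Rightarrow> real) \<Rightarrow> 'e" where
  "hgrad d = (\<Sum>b\<in>(SOME B. is_basis B). d (0, 0, dual_basis (SOME B. is_basis B) b) *\<^sub>R b)"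

text \<open>The contact Hamiltonian vector field of a function with value \<open>f\<close> and differential \<open>d\<close> at \<open>z\<close>.\<close>

definition hvec :: "'e::real_normed_vector \<times> real \<times> ('e \<Rightarrow>\<^sub>L real) \<Rightarrow> real
    \<Rightarrow> ('e \<times> real \<times> ('e \<Rightarrow>\<^sub>L real) \<Rightarrow> real) \<Rightarrow> 'e \<times> real \<times> ('e \<Rightarrow>\<^sub>L real)" where
  "hvec z f d = (hgrad d, ap (snd (snd z)) (hgrad d) - f,
     Blinfun (\<lambda>w. - d (w, ap (snd (snd z)) w, 0)))"

lemma hgrad_apply:
  fixes d :: "'e::real_normed_vector \<times> real \<times> ('e \<Rightarrow>\<^sub>L real) \<Rightarrow> real"
  assumes fd: "finite_dim TYPE('e)" and d: "linear d"
  shows "ap \<pi> (hgrad d) = d (0, 0, \<pi>)"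
proof -
  define B where "B = (SOME B::'e set. is_basis B)"
  obtain B' :: "'e set" where "is_basis B'" using finite_dim_basis[OF fd] .
  then have B: "is_basis B" unfolding B_def by (rule someI)
  have l: "linear (\<lambda>\<rho>. d (0, 0, \<rho>))" by (rule linear_compose[unfolded o_def, OF _ d]) (rule linearI, auto)
  have "d (0, 0, \<pi>) = d (0, 0, \<Sum>b\<in>B. ap \<pi> b *\<^sub>R dual_basis B b)" using blinfun_eq_basis_sum[OF B, of \<pi>] by simp
  also have "\<dots> = (\<Sum>b\<in>B. ap \<pi> b * d (0, 0, dual_basis B b))" by (simp add: linear_sum[OF l] linear_scale[OF l])
  finally show ?thesis
    by (simp add: hgrad_def B_def[symmetric] blinfun.sum_right blinfun.scaleR_right mult.commute)
qed

lemma hgrad_lin: "hgrad (\<lambda>v. a * d v + b * d' v) = a *\<^sub>R hgrad d + b *\<^sub>R hgrad d'"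
  by (simp add: hgrad_def sum.distrib scaleR_add_left scaleR_sum_right)

lemma hvec_bounded_linear:
  fixes d :: "'e::real_normed_vector \<times> real \<times> ('e \<Rightarrow>\<^sub>L real) \<Rightarrow> real"
  assumes "bounded_linear d"
  shows "bounded_linear (\<lambda>w. - d (w, ap q w, 0))"
proof -
  have "bounded_linear (\<lambda>w. (w, ap q w, 0 :: 'e \<Rightarrow>\<^sub>L real))"
    by (intro bounded_linear_Pair bounded_linear_ident blinfun.bounded_linear_right bounded_linear_zero)
  from bounded_linear_minus[OF bounded_linear_compose[OF assms this]] show ?thesis .
qed

lemma hvec_simps:
  "fst (hvec z f d) = hgrad d" "fst (snd (hvec z f d)) = ap (snd (snd z)) (hgrad d) - f"
  by (simp_all add: hvec_def)

lemma hvec_3: "bounded_linear d \<Longrightarrow>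
    ap (snd (snd (hvec z f d))) w = - d (w, ap (snd (snd z)) w, 0)"
  unfolding hvec_def snd_conv by (subst bounded_linear_Blinfun_apply[OF hvec_bounded_linear]) auto

lemma cform_hvec: "cform z (hvec z f d) = f" by (simp add: cform_def hvec_simps)

text \<open>Contracting \<open>cpair\<close> with the Hamiltonian vector returns the differential up
  to a multiple of the contact form, with the derivative along \<open>u\<close> as coefficient. The
  proof writes \<eta> as a horizontal vector minus a multiple of \<open>(0, 1, 0)\<close>.\<close>

lemma cpair_hvec:
  fixes d :: "'e::real_normed_vector \<times> real \<times> ('e \<Rightarrow>\<^sub>L real) \<Rightarrow> real"
  assumes fd: "finite_dim TYPE('e)" and d: "bounded_linear d"
  shows "cpair (hvec z f d) \<eta> = d \<eta> + cform z \<eta> * d (0, 1, 0)"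
proof -
  note l = bounded_linear.linear[OF d]
  obtain a b \<pi> where \<eta>: "\<eta> = (a, b, \<pi>)" by (cases \<eta>)
  let ?q = "ap (snd (snd z))"
  have "(0, 0, \<pi>) + (a, ?q a, 0) = \<eta> + (?q a - b) *\<^sub>R (0, 1, 0)" by (simp add: \<eta>)
  then have "d (0, 0, \<pi>) + d (a, ?q a, 0) = d \<eta> + (?q a - b) * d (0, 1, 0)"
    using linear_add[OF l, of "(0, 0, \<pi>)" "(a, ?q a, 0)"] linear_add[OF l, of \<eta> "(?q a - b) *\<^sub>R (0, 1, 0)"]
      linear_scale[OF l, of "?q a - b" "(0, 1, 0)"] by simp
  then show ?thesis by (simp add: cpair_def hvec_3[OF d] hgrad_apply[OF fd l] hvec_simps cform_def \<eta>)
qed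

lemma hvec_lin:
  assumes "bounded_linear d" "bounded_linear d'"
  shows "hvec z (a * f + b * g) (\<lambda>v. a * d v + b * d' v) = a *\<^sub>R hvec z f d + b *\<^sub>R hvec z g d'"
proof -
  have dd: "bounded_linear (\<lambda>v. a * d v + b * d' v)" by (intro bounded_linear_add bounded_linear_const_mult assms)
  have "snd (snd (hvec z (a * f + b * g) (\<lambda>v. a * d v + b * d' v))) = snd (snd (a *\<^sub>R hvec z f d + b *\<^sub>R hvec z g d'))"
    by (rule blinfun_eqI) (simp add: hvec_3[OF dd] hvec_3[OF assms(1)] hvec_3[OF assms(2)] blinfun.add_left blinfun.scaleR_left)
  then show ?thesis
    by (simp add: prod_eq_iff hvec_simps hgrad_lin blinfun.add_right blinfun.scaleR_right algebra_simps)
qed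

text \<open>The difference from the Hamiltonian vector is horizontal and pairs to zero with all
  horizontal vectors, so non-degeneracy applies.\<close>

lemma hvec_eqI:
  fixes d :: "'e::real_normed_vector \<times> real \<times> ('e \<Rightarrow>\<^sub>L real) \<Rightarrow> real"
  assumes fd: "finite_dim TYPE('e)" and d: "bounded_linear d" and "cform z \<xi> = f"
    and "\<And>\<eta>. cform z \<eta> = 0 \<Longrightarrow> cpair \<xi> \<eta> = d \<eta>"
  shows "\<xi> = hvec z f d"
proof -
  have 1: "cform z (\<xi> + (-1) *\<^sub>R hvec z f d) = 0"
    unfolding cform_add cform_scale by (simp add: assms(3) cform_hvec)
  have "cpair (\<xi> + (-1) *\<^sub>R hvec z f d) \<eta> = 0" if \<eta>: "cform z \<eta> = 0" for \<eta>
  proof -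
    have "cpair (\<xi> + (-1) *\<^sub>R hvec z f d) \<eta> = cpair \<xi> \<eta> - cpair (hvec z f d) \<eta>"
      by (simp add: cpair_def blinfun.add_left blinfun.diff_left blinfun.diff_right blinfun.scaleR_left)
    then show ?thesis using assms(4)[OF \<eta>] cpair_hvec[OF fd d, of z f \<eta>] \<eta> by simp
  qed
  from cpair_nondegenerate[OF fd 1 this] show ?thesis by simp
qed

text \<open>A definite description instead of a coordinate formula, so that nothing has to be glued.
  Only agreement with \<sigma> near \<open>p\<close> is required, since a field with contact value
  \<sigma> is at first available only locally.\<close>

definition hv where
  "hv L \<sigma> = (\<lambda>p\<in>\<P> L. THE v. \<exists>Z\<in>\<X> (J1 L). Z p = v \<and>
     (\<exists>W. mfd_open (J1 L) W \<and> p \<in> W \<and> (\<forall>q\<in>W. contact_form L q (Z q) = \<sigma> q)) \<and>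
     (\<forall>Y\<in>hfields L. contact_form L p (vf_bracket (J1 L) Z Y p) = \<zero>\<^bsub>\<E> L p\<^esub>))"

context jtriv
begin

abbreviation Djsr where "Djsr \<sigma> z \<equiv> \<D> (jsr \<sigma>) z"
abbreviation hc where "hc \<sigma> z \<equiv> hvec z (jsr \<sigma> z) (Djsr \<sigma> z)"

lemma frame_zero_iff:
  assumes p: "p \<in> jdom"
  shows "c \<odot>\<^bsub>\<E> L p\<^esub> e (fst p) = \<zero>\<^bsub>\<E> L p\<^esub> \<longleftrightarrow> c = 0"
proof
  assume "c \<odot>\<^bsub>\<E> L p\<^esub> e (fst p) = \<zero>\<^bsub>\<E> L p\<^esub>"
  then have "c \<odot>\<^bsub>\<E> L p\<^esub> e (fst p) = 0 \<odot>\<^bsub>\<E> L p\<^esub> e (fst p)" by (simp only: frame_0[OF fr jframe[OF p]])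
  then show "c = 0" by (rule crd_inj[OF fr jframe[OF p]])
qed (simp only: frame_0[OF fr jframe[OF p]])

lemma Djsr_bounded_linear: "\<sigma> \<in> \<Gamma>P \<Longrightarrow> z \<in> jimg \<Longrightarrow> bounded_linear (Djsr \<sigma> z)"
  using has_derivative_bounded_linear[OF smooth_on_hd[OF Psr_smooth]] by blast

lemma hc_smooth:
  assumes \<sigma>: "\<sigma> \<in> \<Gamma>P"
  shows "smooth_on jimg (hc \<sigma>)"
proof -
  note F = Psr_smooth[OF \<sigma>] and o = jimg_open and jfd = J.fd
  have g: "smooth_on jimg (\<lambda>z. hgrad (Djsr \<sigma> z))"
    unfolding hgrad_def by (intro smooth_on_sum smooth_on_scaleR smooth_on_derivative smooth_on_const o F)
  have "smooth_on jimg (\<lambda>z. Blinfun (\<lambda>w. - Djsr \<sigma> z (w, ap (snd (snd z)) w, 0)))"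
  proof (rule smooth_on_blinfunI[OF fd o])
    fix w
    have "smooth_on jimg (\<lambda>z. - Djsr \<sigma> z (w, ap (snd (snd z)) w, 0))"
      by (intro smooth_on_uminus smooth_on_directional jfd F o smooth_on_Pair smooth_on_const smooth_on_blinfun_apply
          smooth_on_snd smooth_on_ident)
    then show "smooth_on jimg (\<lambda>z. ap (Blinfun (\<lambda>w. - Djsr \<sigma> z (w, ap (snd (snd z)) w, 0))) w)"
      by (rule smooth_on_transform[OF _ o])
        (simp only: bounded_linear_Blinfun_apply[OF hvec_bounded_linear[OF Djsr_bounded_linear[OF \<sigma>]]])
  qed
  then show ?thesis unfolding hvec_def
    by (intro smooth_on_Pair smooth_on_diff smooth_on_blinfun_apply smooth_on_snd smooth_on_ident g o F)
qed

text \<open>Agreement near \<open>p\<close> fixes value and differential of the contact value in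
  coordinates, the two inputs of the Hamiltonian vector.\<close>

lemma local_cform:
  assumes Z: "Z \<in> \<X> (J1 L)" and W: "mfd_open (J1 L) W" "p \<in> W" and p: "p \<in> jdom"
    and eq: "\<forall>q\<in>W. contact_form L q (Z q) = \<sigma> q"
  shows "cform (\<Phi> p) (vr Z (\<Phi> p)) = jsr \<sigma> (\<Phi> p)"
    "\<D> (\<lambda>z. cform z (vr Z z)) (\<Phi> p) = Djsr \<sigma> (\<Phi> p)"
proof -
  have *: "cform (\<Phi> q) (vr Z (\<Phi> q)) = jsr \<sigma> (\<Phi> q)" if "q \<in> jdom" "q \<in> W" for q
    using contact_form_field[OF Z that(1)] eq that crd_smult[OF fr jframe[OF that(1)]] by (simp add: Psr_eq)
  show "cform (\<Phi> p) (vr Z (\<Phi> p)) = jsr \<sigma> (\<Phi> p)" using * p W(2) .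
  have "open (\<Phi> ` (jdom \<inter> W))" by (rule J.chart_open_Int[OF W(1) \<Phi>_in_J1])
  then show "\<D> (\<lambda>z. cform z (vr Z z)) (\<Phi> p) = Djsr \<sigma> (\<Phi> p)"
    by (rule frechet_derivative_cong) (use p W(2) * in auto)
qed

text \<open>A field \<open>Z\<close> with \<open>\<theta>(Z) = \<sigma>\<close> preserves the Cartan distribution at \<open>p\<close> iff
  \<open>\<omega>(Z, \<sqdot>) = d\<sigma>\<close> on the distribution, which determines \<open>Z\<close> at \<open>p\<close>.\<close>

lemma contact_field_iff:
  assumes \<sigma>: "\<sigma> \<in> \<Gamma>P" and Z: "Z \<in> \<X> (J1 L)" and p: "p \<in> jdom"
    and W: "mfd_open (J1 L) W" "p \<in> W" "\<forall>q\<in>W. contact_form L q (Z q) = \<sigma> q"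
  shows "(\<forall>Y\<in>hfields L. contact_form L p (vf_bracket (J1 L) Z Y p) = \<zero>\<^bsub>\<E> L p\<^esub>) \<longleftrightarrow> Z p = tv p (hc \<sigma> (\<Phi> p))"
proof -
  note z = \<Phi>_jimg[OF p] and lc = local_cform[OF Z W(1,2) p W(3)]
  note d = Djsr_bounded_linear[OF \<sigma> z]
  \<comment> \<open>For horizontal \<open>Y\<close> the function \<open>cform z (vr Y z)\<close> is
    zero, so the bracket formula retains only \<open>cpair\<close> and the derivative of \<sigma>
    along \<open>Y\<close>.\<close>
  have br: "contact_form L p (vf_bracket (J1 L) Z Y p) = \<zero>\<^bsub>\<E> L p\<^esub> \<longleftrightarrow>
      cpair (vr Z (\<Phi> p)) (vr Y (\<Phi> p)) = Djsr \<sigma> (\<Phi> p) (vr Y (\<Phi> p))" if Y: "Y \<in> hfields L" for Y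
  proof -
    note Yv = hfields_vfields[OF Y]
    have "contact_form L p (vf_bracket (J1 L) Z Y p) =
        (cpair (vr Z (\<Phi> p)) (vr Y (\<Phi> p)) - Djsr \<sigma> (\<Phi> p) (vr Y (\<Phi> p))) \<odot>\<^bsub>\<E> L p\<^esub> e (fst p)"
      unfolding contact_form_field[OF J.vf_bracket_vfield[OF Z Yv] p] bracket_cform[OF Z Yv p] lc(2)
        hfield_D_cform[OF Y z] by simp
    then show ?thesis by (simp only: frame_zero_iff[OF p] right_minus_eq)
  qed
  show ?thesis
  proof
    assume l: "\<forall>Y\<in>hfields L. contact_form L p (vf_bracket (J1 L) Z Y p) = \<zero>\<^bsub>\<E> L p\<^esub>"
    have "vr Z (\<Phi> p) = hc \<sigma> (\<Phi> p)"
    proof (rule hvec_eqI[OF fd d lc(1)])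
      fix \<eta> assume "cform (\<Phi> p) \<eta> = 0"
      then obtain Y where Y: "Y \<in> hfields L" "Y p = tv p \<eta>" using hfield_ext[OF p] by blast
      have "vr Y (\<Phi> p) = \<eta>" using vr_eq[OF p, of Y] J.tcoord_tvec[OF \<Phi>_in_J1 p] by (simp add: Y(2))
      then show "cpair (vr Z (\<Phi> p)) \<eta> = Djsr \<sigma> (\<Phi> p) \<eta>" using br[OF Y(1)] l Y(1) by simp
    qed
    then show "Z p = tv p (hc \<sigma> (\<Phi> p))" using vfield_tv[OF Z p] by simp
  next
    assume "Z p = tv p (hc \<sigma> (\<Phi> p))"
    then have e: "vr Z (\<Phi> p) = hc \<sigma> (\<Phi> p)" using vr_eq[OF p, of Z] J.tcoord_tvec[OF \<Phi>_in_J1 p] by simp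
    show "\<forall>Y\<in>hfields L. contact_form L p (vf_bracket (J1 L) Z Y p) = \<zero>\<^bsub>\<E> L p\<^esub>"
    proof
      fix Y assume Y: "Y \<in> hfields L"
      show "contact_form L p (vf_bracket (J1 L) Z Y p) = \<zero>\<^bsub>\<E> L p\<^esub>"
        unfolding br[OF Y] e cpair_hvec[OF fd d] hfield_cform[OF Y z] by simp
    qed
  qed
qed

text \<open>A local extension of the coordinate field gives existence, and
  \<open>contact_field_iff\<close> pins down every competitor at \<open>p\<close>. As the definition
  mentions no chart, the formulas in different charts agree automatically.\<close>

lemma hv_eq:
  assumes \<sigma>: "\<sigma> \<in> \<Gamma>P" and p: "p \<in> jdom"
  shows "hv L \<sigma> p = tv p (hc \<sigma> (\<Phi> p))"
proof -
  obtain Z W where Z: "Z \<in> \<X> (J1 L)" "mfd_open (J1 L) W" "p \<in> W" "W \<subseteq> jdom"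
    "\<forall>q\<in>W. Z q = tv q (hc \<sigma> (\<Phi> q))" using field_ext[OF p hc_smooth[OF \<sigma>]] by blast
  have c: "\<forall>q\<in>W. contact_form L q (Z q) = \<sigma> q"
  proof
    fix q assume q: "q \<in> W"
    then have qj: "q \<in> jdom" using Z(4) by blast
    show "contact_form L q (Z q) = \<sigma> q"
      using Z(5) q contact_form_tv[OF qj] Psec_eq[OF \<sigma> qj] by (simp add: cform_hvec)
  qed
  have Zp: "Z p = tv p (hc \<sigma> (\<Phi> p))" using Z(3,5) by blast
  show ?thesis unfolding hv_def restrict_apply'[OF jdom_points[OF p]]
  proof (rule the_equality)
    show "\<exists>Z\<in>\<X> (J1 L). Z p = tv p (hc \<sigma> (\<Phi> p)) \<and>
       (\<exists>W. mfd_open (J1 L) W \<and> p \<in> W \<and> (\<forall>q\<in>W. contact_form L q (Z q) = \<sigma> q)) \<and>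
       (\<forall>Y\<in>hfields L. contact_form L p (vf_bracket (J1 L) Z Y p) = \<zero>\<^bsub>\<E> L p\<^esub>)"
      using Z(1-3) c Zp contact_field_iff[OF \<sigma> Z(1) p Z(2,3) c] by (intro bexI[of _ Z] conjI exI[of _ W]) simp_all
    fix v
    assume "\<exists>Z\<in>\<X> (J1 L). Z p = v \<and>
       (\<exists>W. mfd_open (J1 L) W \<and> p \<in> W \<and> (\<forall>q\<in>W. contact_form L q (Z q) = \<sigma> q)) \<and>
       (\<forall>Y\<in>hfields L. contact_form L p (vf_bracket (J1 L) Z Y p) = \<zero>\<^bsub>\<E> L p\<^esub>)"
    then obtain Z' W' where "Z' \<in> \<X> (J1 L)" "Z' p = v" "mfd_open (J1 L) W'" "p \<in> W'"
       "\<forall>q\<in>W'. contact_form L q (Z' q) = \<sigma> q"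
       "\<forall>Y\<in>hfields L. contact_form L p (vf_bracket (J1 L) Z' Y p) = \<zero>\<^bsub>\<E> L p\<^esub>" by blast
    then show "v = tv p (hc \<sigma> (\<Phi> p))" using contact_field_iff[OF \<sigma>, of Z' p W'] p by simp
  qed
qed

lemma vr_hv: "\<sigma> \<in> \<Gamma>P \<Longrightarrow> z \<in> jimg \<Longrightarrow> vr (hv L \<sigma>) z = hc \<sigma> z"
proof -
  assume \<sigma>: "\<sigma> \<in> \<Gamma>P" and "z \<in> jimg"
  then obtain p where p: "p \<in> jdom" "z = \<Phi> p" using \<Phi>_image_jdom by blast
  show "vr (hv L \<sigma>) z = hc \<sigma> z"
    unfolding p(2) vr_eq[OF p(1)] hv_eq[OF \<sigma> p(1)] by (rule J.tcoord_tvec[OF \<Phi>_in_J1 p(1)])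
qed

end

context jets
begin

lemma hv_tangent:
  assumes \<sigma>: "\<sigma> \<in> \<Gamma>P" and p: "p \<in> \<P> L"
  shows "hv L \<sigma> p \<in> \<T> (J1 L) p"
proof -
  obtain U \<phi> V e where T: "jtriv L U \<phi> V e" "p \<in> jet_dom L U V" using jtriv_ex[OF p] .
  interpret jtriv L U \<phi> V e by (rule T)
  show ?thesis unfolding hv_eq[OF \<sigma> T(2)] by (rule J.tvec_tangent[OF \<Phi>_in_J1 T(2)])
qed

lemma hv_vfield:
  assumes \<sigma>: "\<sigma> \<in> \<Gamma>P"
  shows "hv L \<sigma> \<in> \<X> (J1 L)"
proof (rule J.vfieldsI_local)
  show "hv L \<sigma> \<in> (\<Pi>\<^sub>E x\<in>\<P> L. \<T> (J1 L) x)"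
  proof (rule PiE_I)
    show "hv L \<sigma> p \<in> \<T> (J1 L) p" if "p \<in> \<P> L" for p by (rule hv_tangent[OF \<sigma> that])
    show "hv L \<sigma> p = undefined" if "p \<notin> \<P> L" for p using that by (simp add: hv_def)
  qed
  fix p assume p: "p \<in> \<P> L"
  obtain U \<phi> V e where T: "jtriv L U \<phi> V e" "p \<in> jet_dom L U V" using jtriv_ex[OF p] .
  interpret jtriv L U \<phi> V e by (rule T)
  have "\<forall>y\<in>jdom. \<Phi> y \<in> jimg \<longrightarrow> hv L \<sigma> y = tv y (hc \<sigma> (\<Phi> y))" using hv_eq[OF \<sigma>] by blast
  moreover have "jimg \<subseteq> \<Phi> ` jdom" by (simp only: \<Phi>_image_jdom order_refl)
  ultimately show "\<exists>U \<phi> T \<xi>. (U, \<phi>) \<in> J1 L \<and> p \<in> U \<and> open T \<and> \<phi> p \<in> T \<and> T \<subseteq> \<phi> ` U \<and> smooth_on T \<xi> \<and>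
      (\<forall>y\<in>U. \<phi> y \<in> T \<longrightarrow> hv L \<sigma> y = tvec (J1 L) U \<phi> y (\<xi> (\<phi> y)))"
    using \<Phi>_in_J1 T(2) jimg_open \<Phi>_jimg[OF T(2)] hc_smooth[OF \<sigma>]
    by (intro exI[of _ jdom] exI[of _ \<Phi>] exI[of _ jimg] exI[of _ "hc \<sigma>"] conjI)
qed

lemma contact_form_hv:
  assumes \<sigma>: "\<sigma> \<in> \<Gamma>P" and p: "p \<in> \<P> L"
  shows "contact_form L p (hv L \<sigma> p) = \<sigma> p"
proof -
  obtain U \<phi> V e where T: "jtriv L U \<phi> V e" "p \<in> jet_dom L U V" using jtriv_ex[OF p] .
  interpret jtriv L U \<phi> V e by (rule T)
  show ?thesis using contact_form_tv[OF T(2)] Psec_eq[OF \<sigma> T(2)] by (simp add: hv_eq[OF \<sigma> T(2)] cform_hvec)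
qed

lemma theta_sec_hv: "\<sigma> \<in> \<Gamma>P \<Longrightarrow> theta_sec L (hv L \<sigma>) = \<sigma>"
  using P.sec_ext[of \<sigma>] contact_form_hv by (intro extensionalityI[of _ "\<P> L"]) (simp_all add: theta_sec_def)

text \<open>Describes the fields \<open>hv L \<sigma>\<close> as the normaliser of the horizontal
  fields under the bracket, a description that is stable under brackets.\<close>

lemma contact_field_eq_hv:
  assumes Z: "Z \<in> \<X> (J1 L)"
  shows "(\<forall>Y\<in>hfields L. vf_bracket (J1 L) Z Y \<in> hfields L) \<longleftrightarrow> Z = hv L (theta_sec L Z)"
proof -
  let ?\<sigma> = "theta_sec L Z"
  note \<sigma> = theta_sec_section[OF Z]
  have *: "(\<forall>Y\<in>hfields L. contact_form L p (vf_bracket (J1 L) Z Y p) = \<zero>\<^bsub>\<E> L p\<^esub>) \<longleftrightarrow> Z p = hv L ?\<sigma> p"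
    if p: "p \<in> \<P> L" for p
  proof -
    obtain U \<phi> V e where T: "jtriv L U \<phi> V e" "p \<in> jet_dom L U V" using jtriv_ex[OF p] .
    interpret jtriv L U \<phi> V e by (rule T)
    have "\<forall>q\<in>\<P> L. contact_form L q (Z q) = ?\<sigma> q" by (simp add: theta_sec_def)
    from contact_field_iff[OF \<sigma> Z T(2) J.mfd_open_points p this] show ?thesis unfolding hv_eq[OF \<sigma> T(2)] .
  qed
  have "Z = hv L ?\<sigma> \<longleftrightarrow> (\<forall>p\<in>\<P> L. Z p = hv L ?\<sigma> p)"
  proof
    assume r: "\<forall>p\<in>\<P> L. Z p = hv L ?\<sigma> p"
    show "Z = hv L ?\<sigma>"
    proof (rule extensionalityI[of _ "\<P> L"])
      show "Z \<in> extensional (\<P> L)" using Z by (auto simp: vfields_iff PiE_def)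
      show "hv L ?\<sigma> \<in> extensional (\<P> L)" by (simp add: hv_def)
    qed (use r in blast)
  qed simp
  moreover have "(\<forall>Y\<in>hfields L. vf_bracket (J1 L) Z Y \<in> hfields L) \<longleftrightarrow>
      (\<forall>p\<in>\<P> L. \<forall>Y\<in>hfields L. contact_form L p (vf_bracket (J1 L) Z Y p) = \<zero>\<^bsub>\<E> L p\<^esub>)"
    using J.vf_bracket_vfield[OF Z hfields_vfields] unfolding hfields_def[of L] by auto
  ultimately show ?thesis using * by simp
qed

end

section \<open>The Jacobi bracket\<close>

text \<open>Converse to \<open>diff_op1_der\<close>: if \<open>D\<close> is at each point an element
  of \<open>DL\<close>, then \<open>[D, f]\<close> is multiplication by the symbol applied to
  \<open>f\<close>, which commutes with multiplication by \<open>g\<close>.\<close>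

lemma (in lbundle) diff_op1I_der:
  assumes D: "\<And>s. s \<in> \<Gamma> L \<Longrightarrow> D s \<in> \<Gamma> L" and der: "\<And>x. x \<in> pts L \<Longrightarrow> (\<lambda>s\<in>\<Gamma> L. D s x) \<in> \<L> L x"
  shows "diff_op1 L D" unfolding diff_op1_def
proof (intro conjI ballI)
  note lin = lin_mapD[OF der[unfolded der_space_iff, THEN conjunct2, THEN conjunct1]]
  show "lin_map (sections L) (sections L) D" unfolding lin_map_def
  proof (intro conjI ballI allI)
    show "D \<in> \<Gamma> L \<rightarrow> \<Gamma> L" using D by blast
    fix s t assume st: "s \<in> \<Gamma> L" "t \<in> \<Gamma> L"
    have a: "s \<oplus>\<^bsub>sections L\<^esub> t \<in> \<Gamma> L" "D s \<oplus>\<^bsub>sections L\<^esub> D t \<in> \<Gamma> L" using sec_add st D by simp_all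
    show "D (s \<oplus>\<^bsub>sections L\<^esub> t) = D s \<oplus>\<^bsub>sections L\<^esub> D t"
    proof (rule sec_eqI[OF D[OF a(1)] a(2)])
      fix x assume x: "x \<in> pts L"
      have "D (s \<oplus>\<^bsub>sections L\<^esub> t) x = D s x \<oplus>\<^bsub>fibre L x\<^esub> D t x"
        using lin(2)[OF x st] a(1) st by (simp only: restrict_apply')
      then show "D (s \<oplus>\<^bsub>sections L\<^esub> t) x = (D s \<oplus>\<^bsub>sections L\<^esub> D t) x" using x by simp
    qed
  next
    fix c s assume s: "s \<in> \<Gamma> L"
    have a: "c \<odot>\<^bsub>sections L\<^esub> s \<in> \<Gamma> L" "c \<odot>\<^bsub>sections L\<^esub> D s \<in> \<Gamma> L" using sec_scale s D by simp_all
    show "D (c \<odot>\<^bsub>sections L\<^esub> s) = c \<odot>\<^bsub>sections L\<^esub> D s"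
    proof (rule sec_eqI[OF D[OF a(1)] a(2)])
      fix x assume x: "x \<in> pts L"
      have "D (c \<odot>\<^bsub>sections L\<^esub> s) x = c \<odot>\<^bsub>fibre L x\<^esub> D s x"
        using lin(3)[OF x s, of c] a(1) s by (simp only: restrict_apply')
      then show "D (c \<odot>\<^bsub>sections L\<^esub> s) x = (c \<odot>\<^bsub>sections L\<^esub> D s) x" using x by simp
    qed
  qed
  fix f g s assume f: "f \<in> Cs (base L)" and g: "g \<in> Cs (base L)" and s: "s \<in> \<Gamma> L"
  let ?m = "fmult (pts L) (fibre L)"
  note gs = sec_fmult[OF s g] and fs = sec_fmult[OF s f]
  have "D (?m f (?m g s)) \<oplus>\<^bsub>sections L\<^esub> ?m g (?m f (D s)) = ?m f (D (?m g s)) \<oplus>\<^bsub>sections L\<^esub> ?m g (D (?m f s))"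
  proof (rule sec_eqI)
    show "D (?m f (?m g s)) \<oplus>\<^bsub>sections L\<^esub> ?m g (?m f (D s)) \<in> \<Gamma> L"
      "?m f (D (?m g s)) \<oplus>\<^bsub>sections L\<^esub> ?m g (D (?m f s)) \<in> \<Gamma> L"
      using sec_add[OF D[OF sec_fmult[OF gs f]] sec_fmult[OF sec_fmult[OF D[OF s] f] g]]
        sec_add[OF sec_fmult[OF D[OF gs] f] sec_fmult[OF D[OF fs] g]] by simp_all
    fix x assume x: "x \<in> pts L"
    obtain V e where fr: "(V, e) \<in> frames L" "x \<in> V" using frame_ex[OF x] by blast
    obtain \<delta> where \<delta>0: "\<forall>f\<in>Cs (base L). \<forall>s\<in>\<Gamma> L. (\<lambda>s\<in>\<Gamma> L. D s x) (?m f s) =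
        f x \<odot>\<^bsub>fibre L x\<^esub> (\<lambda>s\<in>\<Gamma> L. D s x) s \<oplus>\<^bsub>fibre L x\<^esub> \<delta> f \<odot>\<^bsub>fibre L x\<^esub> s x"
      using der[OF x] unfolding der_space_iff by blast
    have \<delta>: "D (?m f t) x = f x \<odot>\<^bsub>fibre L x\<^esub> D t x \<oplus>\<^bsub>fibre L x\<^esub> \<delta> f \<odot>\<^bsub>fibre L x\<^esub> t x" if "t \<in> \<Gamma> L" for t
      using \<delta>0[rule_format, OF f that] that sec_fmult[OF that f] by simp
    note c = sec_carrier[OF s x] sec_carrier[OF D[OF s] x] sec_carrier[OF D[OF gs] x]
    note V = fibre_vs[OF x]
    have gx: "?m g s x = g x \<odot>\<^bsub>fibre L x\<^esub> s x" using x by (simp add: fmult_def)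
    have "D (?m f (?m g s)) x \<oplus>\<^bsub>fibre L x\<^esub> g x \<odot>\<^bsub>fibre L x\<^esub> (f x \<odot>\<^bsub>fibre L x\<^esub> D s x) =
        f x \<odot>\<^bsub>fibre L x\<^esub> D (?m g s) x \<oplus>\<^bsub>fibre L x\<^esub> g x \<odot>\<^bsub>fibre L x\<^esub> D (?m f s) x"
      unfolding \<delta>[OF gs] \<delta>[OF s] gx by (rule crd_inject[OF fr])
        (simp_all add: vs_add[OF V] vs_smult[OF V] c crd_add[OF fr] crd_scale[OF fr] algebra_simps)
    then show "(D (?m f (?m g s)) \<oplus>\<^bsub>sections L\<^esub> ?m g (?m f (D s))) x =
        (?m f (D (?m g s)) \<oplus>\<^bsub>sections L\<^esub> ?m g (D (?m f s))) x" using x by (simp add: fmult_def)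
  qed
  then show "let m = ?m in D (m f (m g s)) \<oplus>\<^bsub>sections L\<^esub> m g (m f (D s)) = m f (D (m g s)) \<oplus>\<^bsub>sections L\<^esub> m g (D (m f s))"
    unfolding Let_def .
qed

context manifold
begin

lemma act_vf_bracket: "f \<in> Cs A \<Longrightarrow> act (points A) (vf_bracket A X Y) f =
    (\<lambda>y\<in>points A. act (points A) X (act (points A) Y f) y - act (points A) Y (act (points A) X f) y)"
  by (auto simp: act_def vf_bracket_def)

lemma vf_bracket_swap: "x \<in> points A \<Longrightarrow> vf_bracket A Y X x = (-1) \<odot>\<^bsub>tangent A x\<^esub> vf_bracket A X Y x"
  by (auto simp: vf_bracket_def)

lemma vf_bracket_self: "x \<in> points A \<Longrightarrow> vf_bracket A X X x = \<zero>\<^bsub>tangent A x\<^esub>" by (auto simp: vf_bracket_def)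

text \<open>The Jacobi identity in Leibniz form, the shape needed to see that normalising fields are
  closed under the bracket.\<close>

lemma vf_bracket_bracket:
  assumes X: "X \<in> \<X> A" and Y: "Y \<in> \<X> A" and Z: "Z \<in> \<X> A"
    and x: "x \<in> points A"
  shows "vf_bracket A (vf_bracket A X Y) Z x =
    vf_bracket A X (vf_bracket A Y Z) x \<oplus>\<^bsub>tangent A x\<^esub> (-1) \<odot>\<^bsub>tangent A x\<^esub> vf_bracket A Y (vf_bracket A X Z) x"
proof (rule extensionalityI[of _ "Cs A"])
  show "vf_bracket A (vf_bracket A X Y) Z x \<in> extensional (Cs A)" using x by (simp add: vf_bracket_def)
  fix f assume f: "f \<in> Cs A"
  note t = vfield_tangent[OF X x] vfield_tangent[OF Y x] vfield_tangent[OF Z x]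
  have ba: "vf_bracket A X' Y' x g = X' x (act (points A) Y' g) - Y' x (act (points A) X' g)" if "g \<in> Cs A" for X' Y' g
    by (rule vf_bracket_apply[OF x that])
  note d = tangent_diff[OF _ act_Cs[OF _ act_Cs[OF _ f]] act_Cs[OF _ act_Cs[OF _ f]]]
  show "vf_bracket A (vf_bracket A X Y) Z x f =
    (vf_bracket A X (vf_bracket A Y Z) x \<oplus>\<^bsub>tangent A x\<^esub> (-1) \<odot>\<^bsub>tangent A x\<^esub> vf_bracket A Y (vf_bracket A X Z) x) f"
    using f by (simp add: ba act_Cs X Y Z act_vf_bracket d[OF t(1) Y Z Z Y] d[OF t(2) X Z Z X] d[OF t(3) X Y Y X])
qed simp

end

definition cbr where
  "cbr L \<sigma> \<rho> = theta_sec L (vf_bracket (J1 L) (hv L \<sigma>) (hv L \<rho>))"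

context jtriv
begin

lemma jdom_Pt: "p \<in> jdom \<Longrightarrow> p \<in> jdom \<inter> {p \<in> \<P> L. fst p \<in> V}" by (simp only: jdom_frame)

text \<open>In \<open>bracket_cform\<close> the derivative of \<sigma> along the field of \<rho>
  cancels against the same term of \<open>cpair_hvec\<close>. What remains is of order one in \<rho>
  with explicit coefficients.\<close>

lemma cbr_coord:
  assumes \<sigma>: "\<sigma> \<in> \<Gamma>P" and \<rho>: "\<rho> \<in> \<Gamma>P" and p: "p \<in> jdom"
  shows "jsr (cbr L \<sigma> \<rho>) (\<Phi> p) = Djsr \<sigma> (\<Phi> p) (0, 1, 0) * jsr \<rho> (\<Phi> p) + Djsr \<rho> (\<Phi> p) (hc \<sigma> (\<Phi> p))"
proof -
  note v = hv_vfield[OF \<sigma>] hv_vfield[OF \<rho>] and z = \<Phi>_jimg[OF p]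
  have D: "\<D> (\<lambda>z. cform z (vr (hv L \<tau>) z)) (\<Phi> p) = Djsr \<tau> (\<Phi> p)" if \<tau>: "\<tau> \<in> \<Gamma>P" for \<tau>
    using local_cform(2)[OF hv_vfield[OF \<tau>] J.mfd_open_points jdom_points[OF p] p] contact_form_hv[OF \<tau>] by blast
  show ?thesis
    unfolding cbr_def jsr_theta_sec[OF J.vf_bracket_vfield[OF v] p] bracket_cform[OF v p] D[OF \<sigma>] D[OF \<rho>]
      vr_hv[OF \<sigma> z] vr_hv[OF \<rho> z] cpair_hvec[OF fd Djsr_bounded_linear[OF \<sigma> z]] cform_hvec by simp
qed

lemma cbr_dvec:
  assumes \<sigma>: "\<sigma> \<in> \<Gamma>P" and p: "p \<in> jdom"
  shows "(\<lambda>\<rho>\<in>\<Gamma>P. cbr L \<sigma> \<rho> p) = Pt.dv p (Djsr \<sigma> (\<Phi> p) (0, 1, 0)) (hc \<sigma> (\<Phi> p))"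
proof (rule extensionalityI[of _ "\<Gamma>P"])
  show "Pt.dv p (Djsr \<sigma> (\<Phi> p) (0, 1, 0)) (hc \<sigma> (\<Phi> p)) \<in> extensional (\<Gamma>P)" by (simp add: dvec_def)
  fix \<rho> assume \<rho>: "\<rho> \<in> \<Gamma>P"
  have s: "cbr L \<sigma> \<rho> \<in> \<Gamma>P"
    unfolding cbr_def by (rule theta_sec_section[OF J.vf_bracket_vfield[OF hv_vfield[OF \<sigma>] hv_vfield[OF \<rho>]]])
  show "(\<lambda>\<rho>\<in>\<Gamma>P. cbr L \<sigma> \<rho> p) \<rho> = Pt.dv p (Djsr \<sigma> (\<Phi> p) (0, 1, 0)) (hc \<sigma> (\<Phi> p)) \<rho>"
    unfolding restrict_apply'[OF \<rho>] Psec_eq[OF s p] cbr_coord[OF \<sigma> \<rho> p] Pt.dvec_apply[OF \<rho>] by simp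
qed simp

text \<open>The Hamiltonian vector is linear in value and differential together. The product rule
  for \<open>f \<sigma>\<close> leaves over the differential \<open>\<sigma> df\<close> with value
  0, which is the squiggle.\<close>

lemma jsr_lin:
  assumes p: "p \<in> jdom" and \<sigma>: "\<sigma> \<in> \<Gamma>P" and \<rho>: "\<rho> \<in> \<Gamma>P" and f: "f \<in> Cs (J1 L)"
  shows "hc (\<sigma> \<oplus>\<^bsub>sections (pi_star L)\<^esub> \<rho>) (\<Phi> p) = hc \<sigma> (\<Phi> p) + hc \<rho> (\<Phi> p)"
    "hc (c \<odot>\<^bsub>sections (pi_star L)\<^esub> \<sigma>) (\<Phi> p) = c *\<^sub>R hc \<sigma> (\<Phi> p)"
    "hc (fmult (\<P> L) (fibre (pi_star L)) f \<sigma>) (\<Phi> p) = f p *\<^sub>R hc \<sigma> (\<Phi> p) +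
      hvec (\<Phi> p) 0 (\<lambda>v. jsr \<sigma> (\<Phi> p) * \<D> (f \<circ> \<I> jdom \<Phi>) (\<Phi> p) v)"
proof -
  note pd = jdom_Pt[OF p] and z = \<Phi>_jimg[OF p]
  note b = Djsr_bounded_linear[OF \<sigma> z] Djsr_bounded_linear[OF \<rho> z]
  have bf: "bounded_linear (\<D> (f \<circ> \<I> jdom \<Phi>) (\<Phi> p))"
    by (rule has_derivative_bounded_linear[OF J.Cs_has_derivative[OF f \<Phi>_in_J1 p]])
  have "Djsr (\<sigma> \<oplus>\<^bsub>sections (pi_star L)\<^esub> \<rho>) (\<Phi> p) = (\<lambda>v. 1 * Djsr \<sigma> (\<Phi> p) v + 1 * Djsr \<rho> (\<Phi> p) v)"
    using Pt.D_sr_add[OF pd \<sigma> \<rho>] by auto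
  moreover have "jsr (\<sigma> \<oplus>\<^bsub>sections (pi_star L)\<^esub> \<rho>) (\<Phi> p) = 1 * jsr \<sigma> (\<Phi> p) + 1 * jsr \<rho> (\<Phi> p)"
    using Pt.sr_add[OF pd \<sigma> \<rho>] by simp
  ultimately show "hc (\<sigma> \<oplus>\<^bsub>sections (pi_star L)\<^esub> \<rho>) (\<Phi> p) = hc \<sigma> (\<Phi> p) + hc \<rho> (\<Phi> p)"
    using hvec_lin[OF b, of "\<Phi> p" 1 "jsr \<sigma> (\<Phi> p)" 1 "jsr \<rho> (\<Phi> p)"] by (simp del: sections_simps)
  have "Djsr (c \<odot>\<^bsub>sections (pi_star L)\<^esub> \<sigma>) (\<Phi> p) = (\<lambda>v. c * Djsr \<sigma> (\<Phi> p) v + 0 * Djsr \<sigma> (\<Phi> p) v)"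
    using Pt.D_sr_scale[OF pd \<sigma>] by auto
  moreover have "jsr (c \<odot>\<^bsub>sections (pi_star L)\<^esub> \<sigma>) (\<Phi> p) = c * jsr \<sigma> (\<Phi> p) + 0 * jsr \<sigma> (\<Phi> p)"
    using Pt.sr_scale[OF pd \<sigma>] by simp
  ultimately show "hc (c \<odot>\<^bsub>sections (pi_star L)\<^esub> \<sigma>) (\<Phi> p) = c *\<^sub>R hc \<sigma> (\<Phi> p)"
    using hvec_lin[OF b(1) b(1), of "\<Phi> p" c "jsr \<sigma> (\<Phi> p)" 0 "jsr \<sigma> (\<Phi> p)"] by (simp del: sections_simps)
  have "Djsr (fmult (\<P> L) (fibre (pi_star L)) f \<sigma>) (\<Phi> p) =
      (\<lambda>v. f p * Djsr \<sigma> (\<Phi> p) v + 1 * (jsr \<sigma> (\<Phi> p) * \<D> (f \<circ> \<I> jdom \<Phi>) (\<Phi> p) v))"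
    using Pt.D_sr_fmult[OF pd \<sigma>, of f] f by (auto simp: mult.commute)
  moreover have "jsr (fmult (\<P> L) (fibre (pi_star L)) f \<sigma>) (\<Phi> p) = f p * jsr \<sigma> (\<Phi> p) + 1 * 0"
    using Pt.sr_fmult[OF pd \<sigma>, of f] by simp
  ultimately show "hc (fmult (\<P> L) (fibre (pi_star L)) f \<sigma>) (\<Phi> p) = f p *\<^sub>R hc \<sigma> (\<Phi> p) +
      hvec (\<Phi> p) 0 (\<lambda>v. jsr \<sigma> (\<Phi> p) * \<D> (f \<circ> \<I> jdom \<Phi>) (\<Phi> p) v)"
    using hvec_lin[OF b(1) bounded_linear_const_mult[OF bf], of "\<Phi> p" "f p" "jsr \<sigma> (\<Phi> p)" 1 0 "jsr \<sigma> (\<Phi> p)"] by simp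
qed

text \<open>By \<open>cpair_hvec\<close>, the Hamiltonian vector with value 0 and differential
  \<open>\<sigma> df\<close> is horizontal and pairs with a horizontal \<open>k\<close> to
  \<open>\<sigma> df(k)\<close>; \<open>hvec_eqI\<close> makes it the only such vector.\<close>

lemma omega_sharp_eq:
  assumes p: "p \<in> jdom" and f: "f \<in> Cs (J1 L)" and \<sigma>: "\<sigma> \<in> \<Gamma>P" and S: "S p = fibp p (\<sigma> p)"
  shows "omega_sharp (J1 L) (cartan L) f S p =
    tv p (hvec (\<Phi> p) 0 (\<lambda>v. jsr \<sigma> (\<Phi> p) * \<D> (f \<circ> \<I> jdom \<Phi>) (\<Phi> p) v))"
    (is "_ = tv p (hvec _ 0 ?d)")
proof -
  note pP = jdom_points[OF p] and pV = jframe[OF p]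
  note tcv = J.tcoord_tvec[OF \<Phi>_in_J1 p] and tvc = J.tvec_tcoord[OF \<Phi>_in_J1 p] and tvt = J.tvec_tangent[OF \<Phi>_in_J1 p]
  have jt: "jtriv L U \<phi> V e" by (rule jtriv_axioms)
  have d: "bounded_linear ?d"
    by (rule bounded_linear_const_mult[OF has_derivative_bounded_linear[OF J.Cs_has_derivative[OF f \<Phi>_in_J1 p]]])
  have ct: "v \<in> cartan L p \<longleftrightarrow> v \<in> \<T> (J1 L) p \<and> cform (\<Phi> p) (tc p v) = 0" for v
    using cartan_iff[OF pP] contact_form_eq[OF p] frame_zero_iff[OF p] by auto
  have iff: "curvature (J1 L) (cartan L) p h k = k f \<odot>\<^bsub>quotient_space (tangent (J1 L) p) (cartan L p)\<^esub> S p \<longleftrightarrow>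
      cpair (tc p h) (tc p k) = ?d (tc p k)" if hk: "h \<in> cartan L p" "k \<in> cartan L p" for h k
  proof -
    have kT: "k \<in> \<T> (J1 L) p" using hk(2) ct by blast
    have "k f \<odot>\<^bsub>\<E> L p\<^esub> \<sigma> p = ?d (tc p k) \<odot>\<^bsub>\<E> L p\<^esub> e (fst p)"
      unfolding Psec_eq[OF \<sigma> p] J.tangent_apply[OF \<Phi>_in_J1 p kT f] frame_assoc[OF fr pV, symmetric]
      by (simp add: mult.commute)
    then have r: "k f \<odot>\<^bsub>quotient_space (tangent (J1 L) p) (cartan L p)\<^esub> S p = fibp p (?d (tc p k) \<odot>\<^bsub>\<E> L p\<^esub> e (fst p))"
      unfolding LH_fibre[symmetric] S using LH_smult[OF pP, of "\<sigma> p" "k f"] P.sec_carrier[OF \<sigma>, of p] pP by simp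
    show ?thesis unfolding r curvature_eq[OF jt p hk]
    proof
      assume "fibp p (cpair (tc p h) (tc p k) \<odot>\<^bsub>\<E> L p\<^esub> e (fst p)) = fibp p (?d (tc p k) \<odot>\<^bsub>\<E> L p\<^esub> e (fst p))"
      from fibp_inject[OF pP frame_smult[OF fr pV] this] show "cpair (tc p h) (tc p k) = ?d (tc p k)"
        by (rule crd_inj[OF fr pV])
    qed simp
  qed
  show ?thesis unfolding omega_sharp_def restrict_apply'[OF pP]
  proof (rule the_equality)
    let ?h = "tv p (hvec (\<Phi> p) 0 ?d)"
    have h: "?h \<in> cartan L p" using ct tvt tcv by (simp add: cform_hvec)
    moreover have "curvature (J1 L) (cartan L) p ?h k = k f \<odot>\<^bsub>quotient_space (tangent (J1 L) p) (cartan L p)\<^esub> S p"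
      if k: "k \<in> cartan L p" for k unfolding iff[OF h k] tcv cpair_hvec[OF fd d] using k ct by simp
    ultimately show "?h \<in> cartan L p \<and> (\<forall>k\<in>cartan L p. curvature (J1 L) (cartan L) p ?h k =
        k f \<odot>\<^bsub>quotient_space (tangent (J1 L) p) (cartan L p)\<^esub> S p)" by blast
    fix h
    assume *: "h \<in> cartan L p \<and> (\<forall>k\<in>cartan L p. curvature (J1 L) (cartan L) p h k =
        k f \<odot>\<^bsub>quotient_space (tangent (J1 L) p) (cartan L p)\<^esub> S p)"
    then have hT: "h \<in> \<T> (J1 L) p" and h0: "cform (\<Phi> p) (tc p h) = 0" using ct by auto
    have "tc p h = hvec (\<Phi> p) 0 ?d"
    proof (rule hvec_eqI[OF fd d h0])
      fix \<eta> assume "cform (\<Phi> p) \<eta> = 0"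
      then have k: "tv p \<eta> \<in> cartan L p" using ct tvt tcv by simp
      show "cpair (tc p h) \<eta> = ?d \<eta>" using iff[of h "tv p \<eta>"] * k tcv by simp
    qed
    then show "h = ?h" using tvc[OF hT] by simp
  qed
qed

end

section \<open>The Jacobi structure on the pull-back bundle\<close>

context jets
begin

lemma cbr_section: "\<sigma> \<in> \<Gamma>P \<Longrightarrow> \<rho> \<in> \<Gamma>P \<Longrightarrow> cbr L \<sigma> \<rho> \<in> \<Gamma>P"
  unfolding cbr_def by (intro theta_sec_section J.vf_bracket_vfield hv_vfield)

lemma cbr_apply: "p \<in> \<P> L \<Longrightarrow> cbr L \<sigma> \<rho> p = contact_form L p (vf_bracket (J1 L) (hv L \<sigma>) (hv L \<rho>) p)"
  by (simp add: cbr_def theta_sec_def)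

lemma cbr_der:
  assumes \<sigma>: "\<sigma> \<in> \<Gamma>P" and p: "p \<in> \<P> L"
  shows "(\<lambda>\<rho>\<in>\<Gamma>P. cbr L \<sigma> \<rho> p) \<in> \<L> (pi_star L) p"
proof -
  obtain U \<phi> V e where T: "jtriv L U \<phi> V e" "p \<in> jet_dom L U V" using jtriv_ex[OF p] .
  interpret jtriv L U \<phi> V e by (rule T)
  show ?thesis unfolding cbr_dvec[OF \<sigma> T(2)] by (rule Pt.dvec_der[OF jdom_Pt[OF T(2)]])
qed

text \<open>At \<open>p\<close> the bracket with \<sigma> is an element of \<open>DL\<close> in
  coordinate form, and its vector part is the field \<open>hv L \<sigma>\<close>.\<close>

lemma cbr_symbol:
  assumes \<sigma>: "\<sigma> \<in> \<Gamma>P" and \<rho>: "\<rho> \<in> \<Gamma>P" and f: "f \<in> Cs (J1 L)" and p: "p \<in> \<P> L"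
  shows "cbr L \<sigma> (fmult (\<P> L) (fibre (pi_star L)) f \<rho>) p =
    f p \<odot>\<^bsub>\<E> L p\<^esub> cbr L \<sigma> \<rho> p \<oplus>\<^bsub>\<E> L p\<^esub> hv L \<sigma> p f \<odot>\<^bsub>\<E> L p\<^esub> \<rho> p"
proof -
  obtain U \<phi> V e where T: "jtriv L U \<phi> V e" "p \<in> jet_dom L U V" using jtriv_ex[OF p] .
  interpret jtriv L U \<phi> V e by (rule T)
  have fm: "fmult (\<P> L) (fibre (pi_star L)) f \<rho> \<in> \<Gamma>P" using P.sec_fmult[OF \<rho>, of f] f by simp
  note d = cbr_dvec[OF \<sigma> T(2), THEN fun_cong]
  show ?thesis using Pt.dvec_fmult[OF jdom_Pt[OF T(2)] _ \<rho>, of f "Djsr \<sigma> (\<Phi> p) (0, 1, 0)" "hc \<sigma> (\<Phi> p)"] f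
      d[of \<rho>, unfolded restrict_apply'[OF \<rho>]] d[of "fmult (\<P> L) (fibre (pi_star L)) f \<rho>", unfolded restrict_apply'[OF fm]]
    by (simp add: hv_eq[OF \<sigma> T(2)])
qed

lemma cbr_swap: "p \<in> \<P> L \<Longrightarrow> \<sigma> \<in> \<Gamma>P \<Longrightarrow> \<rho> \<in> \<Gamma>P \<Longrightarrow> cbr L \<rho> \<sigma> p = (-1) \<odot>\<^bsub>\<E> L p\<^esub> cbr L \<sigma> \<rho> p"
  using lin_mapD(3)[OF contact_form_lin J.vfield_tangent[OF J.vf_bracket_vfield[OF hv_vfield hv_vfield]]]
  by (simp only: cbr_apply J.vf_bracket_swap[of p "hv L \<rho>" "hv L \<sigma>"])

lemma contact_form_zero: "p \<in> \<P> L \<Longrightarrow> contact_form L p \<zero>\<^bsub>tangent (J1 L) p\<^esub> = \<zero>\<^bsub>\<E> L p\<^esub>"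
  using vs_subspaceD(2)[OF J.tangent_vec_space contact_kernel_subspace] by (auto simp: fib_def simp del: tangent_simps)

lemma cbr_self: "p \<in> \<P> L \<Longrightarrow> cbr L \<sigma> \<sigma> p = \<zero>\<^bsub>\<E> L p\<^esub>" by (simp only: cbr_apply J.vf_bracket_self contact_form_zero)

text \<open>By the Jacobi identity the bracket of two fields that normalise \<open>hfields L\<close>
  normalises it too, and a normalising field is \<open>hv\<close> of its own contact value, here
  \<open>cbr L \<sigma> \<rho>\<close>.\<close>

lemma hv_bracket:
  assumes \<sigma>: "\<sigma> \<in> \<Gamma>P" and \<rho>: "\<rho> \<in> \<Gamma>P"
  shows "vf_bracket (J1 L) (hv L \<sigma>) (hv L \<rho>) = hv L (cbr L \<sigma> \<rho>)"
proof -
  note s = hv_vfield[OF \<sigma>] and r = hv_vfield[OF \<rho>]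
  note b = J.vf_bracket_vfield[OF s r]
  have cl: "vf_bracket (J1 L) (hv L \<tau>) Y \<in> hfields L" if "\<tau> \<in> \<Gamma>P" "Y \<in> hfields L" for \<tau> Y
    using contact_field_eq_hv[OF hv_vfield[OF that(1)]] theta_sec_hv[OF that(1)] that(2) by simp
  have "vf_bracket (J1 L) (vf_bracket (J1 L) (hv L \<sigma>) (hv L \<rho>)) Y \<in> hfields L" if Y: "Y \<in> hfields L" for Y
  proof -
    note y = hfields_vfields[OF Y]
    have "contact_form L p (vf_bracket (J1 L) (vf_bracket (J1 L) (hv L \<sigma>) (hv L \<rho>)) Y p) = \<zero>\<^bsub>\<E> L p\<^esub>"
      if p: "p \<in> \<P> L" for p
    proof -
      let ?a = "vf_bracket (J1 L) (hv L \<sigma>) (vf_bracket (J1 L) (hv L \<rho>) Y)"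
      let ?b = "vf_bracket (J1 L) (hv L \<rho>) (vf_bracket (J1 L) (hv L \<sigma>) Y)"
      have ab: "?a \<in> hfields L" "?b \<in> hfields L" using cl \<sigma> \<rho> Y by blast+
      have 0: "contact_form L p (?a p) = \<zero>\<^bsub>\<E> L p\<^esub>" "contact_form L p (?b p) = \<zero>\<^bsub>\<E> L p\<^esub>"
        using ab p unfolding hfields_def by blast+
      note F = fibre_vs[OF fst_pts[OF p]] and TT = J.tangent_vec_space[of p]
      note t = J.vfield_tangent[OF hfields_vfields[OF ab(1)] p] J.vfield_tangent[OF hfields_vfields[OF ab(2)] p]
      note lin = lin_mapD[OF contact_form_lin[OF p]]
      show ?thesis
        by (simp only: J.vf_bracket_bracket[OF s r y p] lin(2)[OF t(1) vs_smult[OF TT t(2)]] lin(3)[OF t(2)] 0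
            vs_smult_zero[OF F] vs_l_zero[OF F vs_zero[OF F]])
    qed
    then show ?thesis using J.vf_bracket_vfield[OF b y] unfolding hfields_def by blast
  qed
  then show ?thesis using contact_field_eq_hv[OF b] by (simp add: cbr_def)
qed

lemma cbr_jacobi:
  assumes \<sigma>: "\<sigma> \<in> \<Gamma>P" and \<rho>: "\<rho> \<in> \<Gamma>P" and \<tau>: "\<tau> \<in> \<Gamma>P" and p: "p \<in> \<P> L"
  shows "cbr L \<sigma> (cbr L \<rho> \<tau>) p \<oplus>\<^bsub>\<E> L p\<^esub> cbr L \<rho> (cbr L \<tau> \<sigma>) p \<oplus>\<^bsub>\<E> L p\<^esub> cbr L \<tau> (cbr L \<sigma> \<rho>) p =
    \<zero>\<^bsub>\<E> L p\<^esub>"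
proof -
  let ?br = "vf_bracket (J1 L)"
  let ?s = "hv L \<sigma>" and ?r = "hv L \<rho>" and ?t = "hv L \<tau>"
  note v = hv_vfield[OF \<sigma>] hv_vfield[OF \<rho>] hv_vfield[OF \<tau>]
  note TT = J.tangent_vec_space[of p] and lin = lin_mapD[OF contact_form_lin[OF p]]
  have c: "?br ?s (?br ?r ?t) p \<in> \<T> (J1 L) p" "?br ?r (?br ?t ?s) p \<in> \<T> (J1 L) p"
    "?br ?t (?br ?s ?r) p \<in> \<T> (J1 L) p" by (intro J.vfield_tangent[OF _ p] J.vf_bracket_vfield v)+
  have "?br ?s (?br ?r ?t) p \<oplus>\<^bsub>tangent (J1 L) p\<^esub> ?br ?r (?br ?t ?s) p \<oplus>\<^bsub>tangent (J1 L) p\<^esub> ?br ?t (?br ?s ?r) p =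
      \<zero>\<^bsub>tangent (J1 L) p\<^esub>" unfolding tangent_simps by (rule restrict_ext) (simp add: J.vf_bracket_jacobi[OF v p])
  then have "contact_form L p (?br ?s (?br ?r ?t) p) \<oplus>\<^bsub>\<E> L p\<^esub> contact_form L p (?br ?r (?br ?t ?s) p)
      \<oplus>\<^bsub>\<E> L p\<^esub> contact_form L p (?br ?t (?br ?s ?r) p) = \<zero>\<^bsub>\<E> L p\<^esub>"
    by (simp only: lin(2)[OF c(1,2), symmetric] lin(2)[OF vs_add[OF TT c(1,2)] c(3), symmetric] contact_form_zero[OF p])
  then show ?thesis
    by (simp only: cbr_apply[OF p] hv_bracket[OF \<rho> \<tau>, symmetric] hv_bracket[OF \<tau> \<sigma>, symmetric] hv_bracket[OF \<sigma> \<rho>, symmetric])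
qed

lemma hv_lin: "lin_map (sections (pi_star L)) (vfields (J1 L)) (hv L)" unfolding lin_map_def
proof (intro conjI ballI allI)
  show "hv L \<in> \<Gamma>P \<rightarrow> \<X> (J1 L)" using hv_vfield by blast
  note c = J.Cs_const
  have *: "hv L (\<sigma> \<oplus>\<^bsub>sections (pi_star L)\<^esub> \<rho>) p = hv L \<sigma> p \<oplus>\<^bsub>tangent (J1 L) p\<^esub> hv L \<rho> p"
    "hv L (r \<odot>\<^bsub>sections (pi_star L)\<^esub> \<sigma>) p = r \<odot>\<^bsub>tangent (J1 L) p\<^esub> hv L \<sigma> p"
    if \<sigma>: "\<sigma> \<in> \<Gamma>P" and \<rho>: "\<rho> \<in> \<Gamma>P" and p: "p \<in> \<P> L" for \<sigma> \<rho> r p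
  proof -
    obtain U \<phi> V e where T: "jtriv L U \<phi> V e" "p \<in> jet_dom L U V" using jtriv_ex[OF p] .
    interpret jtriv L U \<phi> V e by (rule T)
    have s: "\<sigma> \<oplus>\<^bsub>sections (pi_star L)\<^esub> \<rho> \<in> \<Gamma>P" "r \<odot>\<^bsub>sections (pi_star L)\<^esub> \<sigma> \<in> \<Gamma>P"
      using P.sec_add[OF \<sigma> \<rho>] P.sec_scale[OF \<sigma>] by simp_all
    show "hv L (\<sigma> \<oplus>\<^bsub>sections (pi_star L)\<^esub> \<rho>) p = hv L \<sigma> p \<oplus>\<^bsub>tangent (J1 L) p\<^esub> hv L \<rho> p"
      unfolding hv_eq[OF s(1) T(2)] hv_eq[OF \<sigma> T(2)] hv_eq[OF \<rho> T(2)] jsr_lin(1)[OF T(2) \<sigma> \<rho> c]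
      by (rule J.tvec_add[OF \<Phi>_in_J1 T(2)])
    show "hv L (r \<odot>\<^bsub>sections (pi_star L)\<^esub> \<sigma>) p = r \<odot>\<^bsub>tangent (J1 L) p\<^esub> hv L \<sigma> p"
      unfolding hv_eq[OF s(2) T(2)] hv_eq[OF \<sigma> T(2)] jsr_lin(2)[OF T(2) \<sigma> \<rho> c]
      by (rule J.tvec_scale[OF \<Phi>_in_J1 T(2)])
  qed
  have x: "hv L \<sigma> \<in> extensional (\<P> L)" for \<sigma> by (simp add: hv_def)
  show "hv L (\<sigma> \<oplus>\<^bsub>sections (pi_star L)\<^esub> \<rho>) = hv L \<sigma> \<oplus>\<^bsub>vfields (J1 L)\<^esub> hv L \<rho>" if "\<sigma> \<in> \<Gamma>P" "\<rho> \<in> \<Gamma>P" for \<sigma> \<rho>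
    by (rule extensionalityI[of _ "\<P> L"])
      (simp_all only: *(1)[OF that] vfields_simps tangent_simps restrict_apply' restrict_extensional x)
  show "hv L (r \<odot>\<^bsub>sections (pi_star L)\<^esub> \<sigma>) = r \<odot>\<^bsub>vfields (J1 L)\<^esub> hv L \<sigma>" if "\<sigma> \<in> \<Gamma>P" for r \<sigma>
    by (rule extensionalityI[of _ "\<P> L"])
      (simp_all only: *(2)[OF that that] vfields_simps tangent_simps restrict_apply' restrict_extensional x)
qed

lemma hv_fmult:
  assumes \<sigma>: "\<sigma> \<in> \<Gamma>P" and f: "f \<in> Cs (J1 L)" and S: "S p = fibp p (\<sigma> p)" and p: "p \<in> \<P> L"
  shows "hv L (fmult (\<P> L) (fibre (pi_star L)) f \<sigma>) p =
    f p \<odot>\<^bsub>tangent (J1 L) p\<^esub> hv L \<sigma> p \<oplus>\<^bsub>tangent (J1 L) p\<^esub> omega_sharp (J1 L) (cartan L) f S p"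
proof -
  obtain U \<phi> V e where T: "jtriv L U \<phi> V e" "p \<in> jet_dom L U V" using jtriv_ex[OF p] .
  interpret jtriv L U \<phi> V e by (rule T)
  have fm: "fmult (\<P> L) (fibre (pi_star L)) f \<sigma> \<in> \<Gamma>P" using P.sec_fmult[OF \<sigma>, of f] f by simp
  show ?thesis
    unfolding hv_eq[OF fm T(2)] hv_eq[OF \<sigma> T(2)] jsr_lin(3)[OF T(2) \<sigma> \<sigma> f] omega_sharp_eq[where S = S, OF T(2) f \<sigma> S]
      J.tvec_add[OF \<Phi>_in_J1 T(2)] J.tvec_scale[OF \<Phi>_in_J1 T(2)] ..
qed

lemma cbr_jacobi_structure: "jacobi_structure (pi_star L) (cbr L)" unfolding jacobi_structure_def
proof (intro conjI ballI)
  show "is_line_bundle (pi_star L)" by (rule pi_star_line_bundle)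
  show "diff_op1 (pi_star L) (cbr L \<sigma>)" if \<sigma>: "\<sigma> \<in> \<Gamma>P" for \<sigma>
    by (rule P.diff_op1I_der) (use cbr_section[OF \<sigma>] cbr_der[OF \<sigma>] in simp_all)
  \<comment> \<open>The first argument is reduced to the second: at each point the two operators
    differ by the factor -1.\<close>
  show "diff_op1 (pi_star L) (\<lambda>\<sigma>. cbr L \<sigma> \<rho>)" if \<rho>: "\<rho> \<in> \<Gamma>P" for \<rho>
  proof (rule P.diff_op1I_der)
    show "cbr L \<sigma> \<rho> \<in> \<Gamma>P" if "\<sigma> \<in> \<Gamma>P" for \<sigma> by (rule cbr_section[OF that \<rho>])
    fix p assume "p \<in> pts (pi_star L)"
    then have p: "p \<in> \<P> L" by simp
    have "(\<lambda>\<sigma>\<in>\<Gamma>P. cbr L \<sigma> \<rho> p) = (-1) \<odot>\<^bsub>der_space (pi_star L) p\<^esub> (\<lambda>\<sigma>\<in>\<Gamma>P. cbr L \<rho> \<sigma> p)"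
      unfolding der_space_simps by (rule restrict_ext) (simp add: cbr_swap[OF p \<rho>])
    then show "(\<lambda>\<sigma>\<in>\<Gamma>P. cbr L \<sigma> \<rho> p) \<in> \<L> (pi_star L) p"
      using vs_smult[OF P.der_space_vec_space[OF \<open>p \<in> pts (pi_star L)\<close>] cbr_der[OF \<rho> p], of "-1"] by (simp only:)
  qed
  show "cbr L \<sigma> \<sigma> = \<zero>\<^bsub>sections (pi_star L)\<^esub>" if \<sigma>: "\<sigma> \<in> \<Gamma>P" for \<sigma>
    by (rule P.sec_eqI[OF cbr_section[OF \<sigma> \<sigma>]]) (use P.sec_zero cbr_self in simp_all)
  fix \<sigma> \<rho> \<tau> assume \<sigma>: "\<sigma> \<in> \<Gamma>P" and \<rho>: "\<rho> \<in> \<Gamma>P" and \<tau>: "\<tau> \<in> \<Gamma>P"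
  show "cbr L \<sigma> (cbr L \<rho> \<tau>) \<oplus>\<^bsub>sections (pi_star L)\<^esub> cbr L \<rho> (cbr L \<tau> \<sigma>) \<oplus>\<^bsub>sections (pi_star L)\<^esub> cbr L \<tau> (cbr L \<sigma> \<rho>) =
      \<zero>\<^bsub>sections (pi_star L)\<^esub>" unfolding sections_simps by (rule restrict_ext) (simp add: cbr_jacobi[OF \<sigma> \<rho> \<tau>])
qed

lemma
  assumes p: "p \<in> \<P> L" and \<rho>: "\<rho> \<in> \<Gamma>P" and \<sigma>: "\<sigma> \<in> \<Gamma>P"
  shows cbr_add: "\<tau> \<in> \<Gamma>P \<Longrightarrow> cbr L (\<sigma> \<oplus>\<^bsub>sections (pi_star L)\<^esub> \<tau>) \<rho> p = cbr L \<sigma> \<rho> p \<oplus>\<^bsub>\<E> L p\<^esub> cbr L \<tau> \<rho> p"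
    and cbr_scale: "cbr L (c \<odot>\<^bsub>sections (pi_star L)\<^esub> \<sigma>) \<rho> p = c \<odot>\<^bsub>\<E> L p\<^esub> cbr L \<sigma> \<rho> p"
proof -
  have "lin_map (sections (pi_star L)) (sections (pi_star L)) (\<lambda>\<sigma>. cbr L \<sigma> \<rho>)"
    using cbr_jacobi_structure \<rho> unfolding jacobi_structure_def diff_op1_def by blast
  note l = lin_mapD(2,3)[OF this]
  show "cbr L (\<sigma> \<oplus>\<^bsub>sections (pi_star L)\<^esub> \<tau>) \<rho> p = cbr L \<sigma> \<rho> p \<oplus>\<^bsub>\<E> L p\<^esub> cbr L \<tau> \<rho> p" if "\<tau> \<in> \<Gamma>P"
    unfolding l(1)[OF \<sigma> that] using p by simp
  show "cbr L (c \<odot>\<^bsub>sections (pi_star L)\<^esub> \<sigma>) \<rho> p = c \<odot>\<^bsub>\<E> L p\<^esub> cbr L \<sigma> \<rho> p" unfolding l(2)[OF \<sigma>] using p by simp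
qed

text \<open>In coordinates the map on jets sends value and differential \<open>(u, q)\<close> to the
  derivation with coefficients \<open>q (0, 1, 0)\<close> and \<open>hvec\<close>. Both are
  recovered: \<open>u\<close> by \<open>cform\<close>, and \<open>q\<close> by solving
  \<open>cpair_hvec\<close> for the differential.\<close>

lemma cbr_nondegenerate: "nondegenerate_jacobi (pi_star L) (cbr L)" unfolding nondegenerate_jacobi_def
proof (intro conjI ballI cbr_jacobi_structure)
  fix p assume pP: "p \<in> pts (pi_star L)"
  then have p: "p \<in> \<P> L" by simp
  let ?J = "jet_space (pi_star L) p" and ?D = "der_space (pi_star L) p"
  obtain U \<phi> V e where T: "jtriv L U \<phi> V e" "p \<in> jet_dom L U V" using jtriv_ex[OF p] .
  interpret jtriv L U \<phi> V e by (rule T)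
  note pd = jdom_Pt[OF T(2)] and z = \<Phi>_jimg[OF T(2)]
  let ?jco = "jco (pi_star L) jdom \<Phi> (\<lambda>p. e (fst p)) p"
  define F where "F \<alpha> = (let (u, q) = ?jco \<alpha> in Pt.dv p (ap q (0, 1, 0)) (hvec (\<Phi> p) u (ap q)))" for \<alpha>
  have Fj: "F (jet (pi_star L) \<sigma> p) = (\<lambda>\<rho>\<in>\<Gamma>P. cbr L \<sigma> \<rho> p)" if \<sigma>: "\<sigma> \<in> \<Gamma>P" for \<sigma>
    unfolding F_def Pt.jco_jet[OF pd \<sigma>] Let_def split
      bounded_linear_Blinfun_apply[OF Djsr_bounded_linear[OF \<sigma> z]] cbr_dvec[OF \<sigma> T(2)] ..
  have surj: "\<exists>\<sigma>\<in>\<Gamma>P. jet (pi_star L) \<sigma> p = \<alpha>" if "\<alpha> \<in> carrier ?J" for \<alpha> by (rule P.jet_surj[OF pP that])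
  have lin: "lin_map ?J ?D F" unfolding lin_map_def
  proof (intro conjI ballI allI funcsetI)
    show "F \<alpha> \<in> carrier ?D" if "\<alpha> \<in> carrier ?J" for \<alpha> using surj[OF that] Fj cbr_der[OF _ p] by fastforce
    fix \<alpha> \<beta> assume "\<alpha> \<in> carrier ?J" "\<beta> \<in> carrier ?J"
    then obtain \<sigma> \<tau> where s: "\<sigma> \<in> \<Gamma>P" "\<tau> \<in> \<Gamma>P" and e: "\<alpha> = jet (pi_star L) \<sigma> p" "\<beta> = jet (pi_star L) \<tau> p" using surj by blast
    have st: "\<sigma> \<oplus>\<^bsub>sections (pi_star L)\<^esub> \<tau> \<in> \<Gamma>P" using P.sec_add[OF s] by simp
    have "\<alpha> \<oplus>\<^bsub>?J\<^esub> \<beta> = jet (pi_star L) (\<sigma> \<oplus>\<^bsub>sections (pi_star L)\<^esub> \<tau>) p"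
      unfolding e sections_simps by (rule P.jet_add[OF s, symmetric])
    then have "F (\<alpha> \<oplus>\<^bsub>?J\<^esub> \<beta>) = (\<lambda>\<rho>\<in>\<Gamma>P. cbr L (\<sigma> \<oplus>\<^bsub>sections (pi_star L)\<^esub> \<tau>) \<rho> p)" using Fj[OF st] by simp
    also have "\<dots> = F \<alpha> \<oplus>\<^bsub>?D\<^esub> F \<beta>"
      unfolding e Fj[OF s(1)] Fj[OF s(2)] by (auto simp del: sections_simps simp: cbr_add[OF p _ s])
    finally show "F (\<alpha> \<oplus>\<^bsub>?J\<^esub> \<beta>) = F \<alpha> \<oplus>\<^bsub>?D\<^esub> F \<beta>" .
  next
    fix c \<alpha> assume "\<alpha> \<in> carrier ?J"
    then obtain \<sigma> where s: "\<sigma> \<in> \<Gamma>P" and e: "\<alpha> = jet (pi_star L) \<sigma> p" using surj by blast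
    have st: "c \<odot>\<^bsub>sections (pi_star L)\<^esub> \<sigma> \<in> \<Gamma>P" using P.sec_scale[OF s] by simp
    have "c \<odot>\<^bsub>?J\<^esub> \<alpha> = jet (pi_star L) (c \<odot>\<^bsub>sections (pi_star L)\<^esub> \<sigma>) p"
      unfolding e sections_simps by (rule P.jet_scale[OF s, symmetric])
    then have "F (c \<odot>\<^bsub>?J\<^esub> \<alpha>) = (\<lambda>\<rho>\<in>\<Gamma>P. cbr L (c \<odot>\<^bsub>sections (pi_star L)\<^esub> \<sigma>) \<rho> p)" using Fj[OF st] by simp
    also have "\<dots> = c \<odot>\<^bsub>?D\<^esub> F \<alpha>" unfolding e Fj[OF s] by (auto simp del: sections_simps simp: cbr_scale[OF p _ s])
    finally show "F (c \<odot>\<^bsub>?J\<^esub> \<alpha>) = c \<odot>\<^bsub>?D\<^esub> F \<alpha>" .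
  qed
  have inj: "\<alpha> = \<beta>" if \<alpha>: "\<alpha> \<in> carrier ?J" and \<beta>: "\<beta> \<in> carrier ?J" and eq: "F \<alpha> = F \<beta>" for \<alpha> \<beta>
  proof (rule Pt.jco_inject[OF pd \<alpha> \<beta>])
    obtain u q where uq: "?jco \<alpha> = (u, q)" by (cases "?jco \<alpha>")
    obtain u' q' where uq': "?jco \<beta> = (u', q')" by (cases "?jco \<beta>")
    have "Pt.dv p (ap q (0, 1, 0)) (hvec (\<Phi> p) u (ap q)) =
        Pt.dv p (ap q' (0, 1, 0)) (hvec (\<Phi> p) u' (ap q'))" using eq by (simp add: F_def uq uq')
    note i = Pt.dvec_inject[OF pd this]
    have u: "u = u'" using cform_hvec[of "\<Phi> p" u "ap q"] cform_hvec[of "\<Phi> p" u' "ap q'"] i(2) by simp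
    have "q = q'"
    proof (rule blinfun_eqI)
      fix \<eta>
      have "cpair (hvec (\<Phi> p) u (ap q)) \<eta> = cpair (hvec (\<Phi> p) u' (ap q')) \<eta>" using i(2) by simp
      then show "ap q \<eta> = ap q' \<eta>" unfolding cpair_hvec[OF fd blinfun.bounded_linear_right] using i(1) by simp
    qed
    then show "?jco \<alpha> = ?jco \<beta>" using u uq uq' by simp
  qed
  have onto: "\<exists>\<alpha>\<in>carrier ?J. F \<alpha> = a" if a: "a \<in> carrier ?D" for a
  proof -
    obtain c \<xi> where c: "a = Pt.dv p c \<xi>" using Pt.der_dvec[OF pd a] by blast
    \<comment> \<open>\<open>cpair_hvec\<close> solved for the differential, with \<open>c\<close>
      as derivative along \<open>u\<close>; consistency, \<open>d (0, 1, 0) = c\<close>, rests on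
      the value -1 of the form on that vector.\<close>
    define d where "d \<eta> = cpair \<xi> \<eta> - c * cform (\<Phi> p) \<eta>" for \<eta>
    have "linear d" unfolding d_def by (rule linearI)
        (simp_all add: cpair_def cform_def blinfun.add_left blinfun.add_right blinfun.scaleR_left blinfun.scaleR_right algebra_simps)
    then have d: "bounded_linear d" by (rule linear_imp_bounded_linear[OF J.fd])
    obtain \<sigma> where \<sigma>: "\<sigma> \<in> \<Gamma>P" "?jco (jet (pi_star L) \<sigma> p) = (cform (\<Phi> p) \<xi>, Blinfun d)"
      using Pt.jet_ex[OF pd, of "cform (\<Phi> p) \<xi>" "Blinfun d"] by blast
    have "d (0, 1, 0) = c" by (simp add: d_def cpair_def cform_def)
    moreover have "\<xi> = hvec (\<Phi> p) (cform (\<Phi> p) \<xi>) d" by (rule hvec_eqI[OF fd d refl]) (simp add: d_def)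
    ultimately have "F (jet (pi_star L) \<sigma> p) = a" by (simp add: F_def \<sigma>(2) bounded_linear_Blinfun_apply[OF d] c)
    then show ?thesis using P.jet_jet_space[OF \<sigma>(1) pP] by blast
  qed
  have "bij_betw F (carrier ?J) (carrier ?D)"
  proof (rule bij_betw_imageI)
    show "inj_on F (carrier ?J)" using inj by (rule inj_onI)
    show "F ` carrier ?J = carrier ?D" using lin_mapD(1)[OF lin] onto by (intro equalityI subsetI) (auto simp del: der_space_simps)
  qed
  then show "\<exists>F. lin_map ?J ?D F \<and> bij_betw F (carrier ?J) (carrier ?D) \<and>
      (\<forall>s\<in>\<Gamma>P. F (jet (pi_star L) s p) = (\<lambda>r\<in>\<Gamma>P. cbr L s r p))" using lin Fj by (intro exI[of _ F]) blast
qed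

end

section \<open>Fibre-wise linear and fibre-wise constant sections\<close>

lemma blinfun_separates:
  fixes v w :: "'e::real_normed_vector"
  assumes fd: "finite_dim TYPE('e)" and eq: "\<And>\<pi> :: 'e \<Rightarrow>\<^sub>L real. ap \<pi> v = ap \<pi> w"
  shows "v = w"
proof -
  obtain B :: "'e set" where B: "is_basis B" using finite_dim_basis[OF fd] .
  have "rep B v b = rep B w b" for b using eq[of "dual_basis B b"] by (simp only: dual_basis_apply[OF B])
  then have r: "rep B v = rep B w" by (rule ext)
  have "v = (\<Sum>b\<in>B. rep B v b *\<^sub>R b)" by (rule basis_sum[OF B, symmetric])
  also have "\<dots> = w" unfolding r by (rule basis_sum[OF B])
  finally show ?thesis .
qed

lemma (in jets) pi_star_sectionI:
  assumes c: "\<And>p. p \<in> \<P> L \<Longrightarrow> \<sigma> p \<in> \<F> L (fst p)" and e: "\<sigma> \<in> extensional (\<P> L)"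
    and loc: "\<And>p. p \<in> \<P> L \<Longrightarrow> \<exists>U \<phi> V e G. jtriv L U \<phi> V e \<and> fst p \<in> U \<inter> V \<and>
      smooth_on (\<phi> ` (U \<inter> V) \<times> UNIV) G \<and>
      (\<forall>q\<in>jet_dom L U V. \<sigma> q = G (jet_chart L U \<phi> e q) \<odot>\<^bsub>\<E> L q\<^esub> e (fst q))"
  shows "\<sigma> \<in> \<Gamma>P"
proof (rule P.sectionI_local)
  show "\<sigma> p \<in> \<F> (pi_star L) p" if "p \<in> pts (pi_star L)" for p using that c by simp
  show "\<sigma> \<in> extensional (pts (pi_star L))" using e by simp
  fix p assume "p \<in> pts (pi_star L)"
  then have p: "p \<in> \<P> L" by simp
  obtain U \<phi> V e G where T: "jtriv L U \<phi> V e" "fst p \<in> U \<inter> V" and G: "smooth_on (\<phi> ` (U \<inter> V) \<times> UNIV) G"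
    "\<forall>q\<in>jet_dom L U V. \<sigma> q = G (jet_chart L U \<phi> e q) \<odot>\<^bsub>\<E> L q\<^esub> e (fst q)" using loc[OF p] by blast
  interpret jtriv L U \<phi> V e by (rule T)
  have pj: "p \<in> jdom" using T(2) p by (auto simp: points_J1)
  have "smooth_fun (base (pi_star L)) jdom (\<lambda>q. crd L e (fst q) (\<sigma> q))"
  proof (rule Pt.smooth_funI_chart)
    show "mfd_open (base (pi_star L)) jdom" using J.mfd_open_chart[OF \<Phi>_in_J1] by simp
    show "smooth_on (\<Phi> ` jdom) ((\<lambda>q. crd L e (fst q) (\<sigma> q)) \<circ> \<I> jdom \<Phi>)" unfolding \<Phi>_image_jdom
    proof (rule smooth_on_transform[OF G(1) jimg_open])
      fix z assume "z \<in> jimg"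
      then obtain q where q: "q \<in> jdom" "z = \<Phi> q" using \<Phi>_image_jdom by blast
      then show "G z = ((\<lambda>q. crd L e (fst q) (\<sigma> q)) \<circ> \<I> jdom \<Phi>) z"
        using G(2)[rule_format, OF q(1)] crd_smult[OF fr jframe[OF q(1)]] inv_into_f_f[OF \<Phi>_inj q(1)] by simp
    qed
  qed simp
  then show "\<exists>V e W. (V, e) \<in> frames (pi_star L) \<and> mfd_open (base (pi_star L)) W \<and> p \<in> W \<and> W \<subseteq> V \<and>
      smooth_fun (base (pi_star L)) W (\<lambda>x. coord (fibre (pi_star L) x) (e x) (\<sigma> x))"
    using Pt.fr pj J.mfd_open_chart[OF \<Phi>_in_J1] jdom_frame
    by (intro exI[of _ "{p \<in> \<P> L. fst p \<in> V}"] exI[of _ "\<lambda>p. e (fst p)"] exI[of _ jdom]) auto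
qed

context jtriv
begin

definition coeffs where
  "coeffs a c \<xi> \<longleftrightarrow> smooth_on (\<phi> ` dom) c \<and> smooth_on (\<phi> ` dom) \<xi> \<and> (\<forall>x\<in>dom. a x = dv x (c (\<phi> x)) (\<xi> (\<phi> x)))"

text \<open>The frame coordinate of \<open>l_a\<close>: linear in the fibre coordinates
  \<open>(u, p)\<close>, with coefficients from the base.\<close>

definition lc :: "('e \<Rightarrow> real) \<Rightarrow> ('e \<Rightarrow> 'e) \<Rightarrow> 'e \<times> real \<times> ('e \<Rightarrow>\<^sub>L real) \<Rightarrow> real" where
  "lc c \<xi> z = c (fst z) * fst (snd z) + ap (snd (snd z)) (\<xi> (fst z))"

lemma coeffs_ex: "a \<in> derivations L \<Longrightarrow> \<exists>c \<xi>. coeffs a c \<xi>" unfolding coeffs_def by (rule derivation_coeffs)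

lemma fst_\<Phi>: "fst (\<Phi> p) = \<phi> (fst p)" by (simp add: \<Phi>_eq)

lemma fst_jdom: "p \<in> jdom \<Longrightarrow> fst p \<in> dom" by auto

lemma lin_section_eq:
  assumes a: "coeffs a c \<xi>" and p: "p \<in> jdom"
  shows "lin_section L a p = lc c \<xi> (\<Phi> p) \<odot>\<^bsub>\<E> L p\<^esub> e (fst p)"
proof -
  have x: "fst p \<in> dom" and \<alpha>: "snd p \<in> \<J> L (fst p)" using p by auto
  have "jco L U \<phi> e (fst p) (snd p) = (fst (snd (\<Phi> p)), snd (snd (\<Phi> p)))" by (simp add: \<Phi>_eq)
  from jco_apply[OF x \<alpha> this, of "c (\<phi> (fst p))" "\<xi> (\<phi> (fst p))"]
  show ?thesis using a x jdom_points[OF p] by (simp add: lin_section_def coeffs_def lc_def fst_\<Phi>)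
qed

lemma const_section_eq:
  assumes s: "s \<in> \<Gamma> L" and p: "p \<in> jdom"
  shows "const_section L s p = sr s (fst (\<Phi> p)) \<odot>\<^bsub>\<E> L p\<^esub> e (fst p)"
  using sec_eq[OF s fst_jdom[OF p]] jdom_points[OF p] by (simp add: const_section_def fst_\<Phi>)

lemma jimg_fst_comp: "smooth_on (\<phi> ` dom) g \<Longrightarrow> smooth_on jimg (\<lambda>z. g (fst z))"
  by (rule smooth_on_fst_comp[OF fd img_open])

lemma lc_smooth:
  assumes a: "coeffs a c \<xi>"
  shows "smooth_on jimg (lc c \<xi>)"
proof -
  have "smooth_on jimg (\<lambda>z. c (fst z))" "smooth_on jimg (\<lambda>z. \<xi> (fst z))"
    using jimg_fst_comp a by (auto simp: coeffs_def)
  then show ?thesis unfolding lc_def[abs_def]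
    by (intro smooth_on_add smooth_on_mult smooth_on_blinfun_apply smooth_on_fst smooth_on_snd smooth_on_ident jimg_open)
qed

lemma jsr_eqI:
  assumes eq: "\<And>q. q \<in> jdom \<Longrightarrow> \<sigma> q = G (\<Phi> q) \<odot>\<^bsub>\<E> L q\<^esub> e (fst q)" and p: "p \<in> jdom"
  shows "jsr \<sigma> (\<Phi> p) = G (\<Phi> p)" "Djsr \<sigma> (\<Phi> p) = \<D> G (\<Phi> p)"
proof -
  have *: "jsr \<sigma> (\<Phi> q) = G (\<Phi> q)" if "q \<in> jdom" for q
    using crd_smult[OF fr jframe[OF that]] by (simp only: Psr_eq[OF that] eq[OF that])
  show "jsr \<sigma> (\<Phi> p) = G (\<Phi> p)" by (rule *[OF p])
  show "Djsr \<sigma> (\<Phi> p) = \<D> G (\<Phi> p)"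
  proof (rule frechet_derivative_cong[OF jimg_open \<Phi>_jimg[OF p]])
    fix z assume "z \<in> jimg"
    then obtain q where "q \<in> jdom" "z = \<Phi> q" using \<Phi>_image_jdom by blast
    then show "jsr \<sigma> z = G z" using * by simp
  qed
qed

lemma jsr_lin_section:
  assumes a: "coeffs a c \<xi>" and p: "p \<in> jdom"
  shows "jsr (lin_section L a) (\<Phi> p) = lc c \<xi> (\<Phi> p)"
    "Djsr (lin_section L a) (\<Phi> p) = \<D> (lc c \<xi>) (\<Phi> p)"
  by (rule jsr_eqI[OF _ p], rule lin_section_eq[OF a], assumption)+

lemma jsr_const_section:
  assumes s: "s \<in> \<Gamma> L" and p: "p \<in> jdom"
  shows "jsr (const_section L s) (\<Phi> p) = sr s (fst (\<Phi> p))"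
    "Djsr (const_section L s) (\<Phi> p) = \<D> (\<lambda>z. sr s (fst z)) (\<Phi> p)"
  by (rule jsr_eqI[where G = "\<lambda>z. sr s (fst z)", OF _ p], rule const_section_eq[OF s], assumption)+

lemma D_lin_section:
  assumes a: "coeffs a c \<xi>" and p: "p \<in> jdom"
  shows "Djsr (lin_section L a) (\<Phi> p) w = \<D> c (\<phi> (fst p)) (fst w) * fst (snd (\<Phi> p)) +
    c (\<phi> (fst p)) * fst (snd w) + ap (snd (snd w)) (\<xi> (\<phi> (fst p))) +
    ap (snd (snd (\<Phi> p))) (\<D> \<xi> (\<phi> (fst p)) (fst w))"
proof -
  let ?y = "\<phi> (fst p)"
  have y: "?y \<in> \<phi> ` dom" using fst_jdom[OF p] by blast
  have hc: "(c has_derivative \<D> c ?y) (at (fst (\<Phi> p)))"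
    and hx: "(\<xi> has_derivative \<D> \<xi> ?y) (at (fst (\<Phi> p)))" using a y smooth_on_hd by (auto simp: coeffs_def fst_\<Phi>)
  note f1 = has_derivative_fst[OF has_derivative_ident, of "at (\<Phi> p)"]
    and f2 = has_derivative_fst[OF has_derivative_snd[OF has_derivative_ident], of "at (\<Phi> p)"]
    and f3 = has_derivative_snd[OF has_derivative_snd[OF has_derivative_ident], of "at (\<Phi> p)"]
  have "(lc c \<xi> has_derivative (\<lambda>w. c (fst (\<Phi> p)) * fst (snd w) + \<D> c ?y (fst w) * fst (snd (\<Phi> p)) +
      (ap (snd (snd (\<Phi> p))) (\<D> \<xi> ?y (fst w)) + ap (snd (snd w)) (\<xi> (fst (\<Phi> p)))))) (at (\<Phi> p))"
    unfolding lc_def[abs_def]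
    by (intro has_derivative_add has_derivative_mult bounded_bilinear.FDERIV[OF bounded_bilinear_blinfun_apply]
        has_derivative_compose[OF f1 hc] has_derivative_compose[OF f1 hx] f2 f3)
  from frechet_derivative_at[OF this, symmetric]
  show ?thesis unfolding jsr_lin_section(2)[OF a p] by (simp add: fst_\<Phi> algebra_simps)
qed

lemma D_const_section:
  assumes s: "s \<in> \<Gamma> L" and p: "p \<in> jdom"
  shows "Djsr (const_section L s) (\<Phi> p) w = \<D> (sr s) (\<phi> (fst p)) (fst w)"
proof -
  have h: "(sr s has_derivative \<D> (sr s) (\<phi> (fst p))) (at (fst (\<Phi> p)))"
    unfolding fst_\<Phi> by (rule sr_hd[OF s fst_jdom[OF p]])
  from frechet_derivative_at[OF has_derivative_compose[OF has_derivative_fst[OF has_derivative_ident] h], symmetric]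
  show ?thesis unfolding jsr_const_section(2)[OF s p] by simp
qed

end

context jets
begin

lemma const_section_section:
  assumes s: "s \<in> \<Gamma> L"
  shows "const_section L s \<in> \<Gamma>P"
proof (rule pi_star_sectionI)
  show "const_section L s p \<in> \<F> L (fst p)" if "p \<in> \<P> L" for p
    using that sec_carrier[OF s fst_pts[OF that]] by (simp add: const_section_def)
  show "const_section L s \<in> extensional (\<P> L)" by (simp add: const_section_def)
  fix p assume p: "p \<in> \<P> L"
  obtain U \<phi> V e where T: "jtriv L U \<phi> V e" "p \<in> jet_dom L U V" using jtriv_ex[OF p] .
  interpret jtriv L U \<phi> V e by (rule T)
  show "\<exists>U \<phi> V e G. jtriv L U \<phi> V e \<and> fst p \<in> U \<inter> V \<and> smooth_on (\<phi> ` (U \<inter> V) \<times> UNIV) G \<and>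
      (\<forall>q\<in>jet_dom L U V. const_section L s q = G (jet_chart L U \<phi> e q) \<odot>\<^bsub>\<E> L q\<^esub> e (fst q))"
    using T(1) fst_jdom[OF T(2)] jimg_fst_comp[OF sr_smooth[OF s]] const_section_eq[OF s]
    by (intro exI[of _ U] exI[of _ \<phi>] exI[of _ V] exI[of _ e] exI[of _ "\<lambda>z. sr s (fst z)"] conjI ballI)
qed

lemma lin_section_section:
  assumes a: "a \<in> derivations L"
  shows "lin_section L a \<in> \<Gamma>P"
proof (rule pi_star_sectionI)
  show "lin_section L a p \<in> \<F> L (fst p)" if p: "p \<in> \<P> L" for p
  proof -
    have "lin_map (der_space L (fst p)) (\<E> L p) (snd p)" using p by (auto simp: points_J1 jet_space_iff)
    from lin_mapD(1)[OF this derivation_der[OF a fst_pts[OF p]]] show ?thesis using p by (simp add: lin_section_def)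
  qed
  show "lin_section L a \<in> extensional (\<P> L)" by (simp add: lin_section_def)
  fix p assume p: "p \<in> \<P> L"
  obtain U \<phi> V e where T: "jtriv L U \<phi> V e" "p \<in> jet_dom L U V" using jtriv_ex[OF p] .
  interpret jtriv L U \<phi> V e by (rule T)
  obtain c \<xi> where c: "coeffs a c \<xi>" using coeffs_ex[OF a] by blast
  show "\<exists>U \<phi> V e G. jtriv L U \<phi> V e \<and> fst p \<in> U \<inter> V \<and> smooth_on (\<phi> ` (U \<inter> V) \<times> UNIV) G \<and>
      (\<forall>q\<in>jet_dom L U V. lin_section L a q = G (jet_chart L U \<phi> e q) \<odot>\<^bsub>\<E> L q\<^esub> e (fst q))"
    using T(1) fst_jdom[OF T(2)] lc_smooth[OF c] lin_section_eq[OF c]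
    by (intro exI[of _ U] exI[of _ \<phi>] exI[of _ V] exI[of _ e] exI[of _ "lc c \<xi>"] conjI ballI)
qed

lemma lin_section_jet:
  assumes a: "a \<in> derivations L" and s: "s \<in> \<Gamma> L" and x: "x \<in> pts L"
  shows "lin_section L a (x, jet L s x) = a x s"
  using jet_apply[OF derivation_der[OF a x]] jet_jet_space[OF s x] x by (simp add: lin_section_def points_J1)

text \<open>On the jet of \<open>s\<close> the section \<open>l_a\<close> has the value
  \<open>a[s]\<close>, so it determines \<open>a\<close> on all sections.\<close>

lemma lin_section_inj: "inj_on (lin_section L) (derivations L)"
proof (rule inj_onI)
  fix a b assume a: "a \<in> derivations L" and b: "b \<in> derivations L" and eq: "lin_section L a = lin_section L b"
  have "a x = b x" if x: "x \<in> pts L" for x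
  proof (rule extensionalityI[of _ "\<Gamma> L"])
    show "a x \<in> extensional (\<Gamma> L)" "b x \<in> extensional (\<Gamma> L)"
      using derivation_der[OF a x] derivation_der[OF b x] unfolding der_space_iff by blast+
    show "a x s = b x s" if s: "s \<in> \<Gamma> L" for s using lin_section_jet[OF a s x] lin_section_jet[OF b s x] eq by simp
  qed
  moreover have "a \<in> extensional (pts L)" "b \<in> extensional (pts L)"
    using a b by (auto simp: derivations_def PiE_def)
  ultimately show "a = b" by (intro extensionalityI[of a "pts L" b]) simp_all
qed

end

context triv
begin

text \<open>For a section that is affine near \<open>x\<close>, differentiating
  \<open>c s + ds(\<xi>)\<close> meets no second derivative of \<open>s\<close>. This is the
  computation for iterated derivations.\<close>

lemma derivation_affine:
  assumes x: "x \<in> dom" and c: "smooth_on (\<phi> ` dom) c" and \<xi>: "smooth_on (\<phi> ` dom) \<xi>"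
    and b: "\<forall>y\<in>dom. b y = dv y (c (\<phi> y)) (\<xi> (\<phi> y))" and s: "s \<in> \<Gamma> L"
    and T: "open T" "\<phi> x \<in> T" "T \<subseteq> \<phi> ` dom" "\<forall>z\<in>T. sr s z = u + ap q (z - \<phi> x)"
      "\<forall>z\<in>T. \<D> (sr s) z = ap q"
  shows "sr (act (pts L) b s) (\<phi> x) = c (\<phi> x) * u + ap q (\<xi> (\<phi> x))"
    "\<D> (sr (act (pts L) b s)) (\<phi> x) w =
      \<D> c (\<phi> x) w * u + c (\<phi> x) * ap q w +
      ap q (\<D> \<xi> (\<phi> x) w)"
proof -
  define G where "G z = c z * (u + ap q (z - \<phi> x)) + ap q (\<xi> z)" for z
  have *: "sr (act (pts L) b s) z = G z" if z: "z \<in> T" for z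
  proof -
    obtain y where y: "y \<in> dom" "z = \<phi> y" using z T(3) by blast
    have "act (pts L) b s y = G z \<odot>\<^bsub>fibre L y\<^esub> e y"
      using b[rule_format, OF y(1)] dvec_apply[OF s, of y] dom_pts[OF y(1)] T(4,5) z by (simp add: act_def G_def y(2))
    then show ?thesis using sr_eq[of y] y crd_smult[OF fr, of y] by simp
  qed
  show "sr (act (pts L) b s) (\<phi> x) = c (\<phi> x) * u + ap q (\<xi> (\<phi> x))" using *[OF T(2)] by (simp add: G_def)
  have X: "\<phi> x \<in> \<phi> ` dom" using x by blast
  have lin: "((\<lambda>z. ap q (z - \<phi> x)) has_derivative ap q) (at (\<phi> x))" by (auto intro!: derivative_eq_intros)
  have "(G has_derivative (\<lambda>w. c (\<phi> x) * (0 + ap q w) +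
      \<D> c (\<phi> x) w * (u + ap q (\<phi> x - \<phi> x)) +
      ap q (\<D> \<xi> (\<phi> x) w))) (at (\<phi> x))" unfolding G_def[abs_def]
    by (intro has_derivative_add has_derivative_mult has_derivative_const lin smooth_on_hd[OF c X]
        bounded_linear.has_derivative[OF blinfun.bounded_linear_right smooth_on_hd[OF \<xi> X]])
  from frechet_derivative_at[OF this, symmetric]
  show "\<D> (sr (act (pts L) b s)) (\<phi> x) w =
      \<D> c (\<phi> x) w * u + c (\<phi> x) * ap q w +
      ap q (\<D> \<xi> (\<phi> x) w)" using frechet_derivative_cong[OF T(1,2), of "sr (act (pts L) b s)" G] * by simp
qed

end

context jtriv
begin

text \<open>The contact field of \<open>l_a\<close> projects onto the vector part of
  \<open>a\<close>: the differential of \<open>c u + p(\<xi>)\<close> in \<open>p\<close> is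
  \<xi>.\<close>

lemma hgrad_lin_section:
  assumes a: "a \<in> derivations L" "coeffs a c \<xi>" and p: "p \<in> jdom"
  shows "hgrad (Djsr (lin_section L a) (\<Phi> p)) = \<xi> (\<phi> (fst p))"
proof (rule blinfun_separates[OF fd])
  fix \<pi> :: "'e \<Rightarrow>\<^sub>L real"
  have y: "\<phi> (fst p) \<in> \<phi> ` dom" using fst_jdom[OF p] by blast
  have "\<D> c (\<phi> (fst p)) 0 = 0" "\<D> \<xi> (\<phi> (fst p)) 0 = 0"
    using a(2) smooth_on_hd[OF _ y, THEN has_derivative_linear, THEN linear_0] by (auto simp: coeffs_def)
  then show "ap \<pi> (hgrad (Djsr (lin_section L a) (\<Phi> p))) = ap \<pi> (\<xi> (\<phi> (fst p)))"
    by (simp add: hgrad_apply[OF fd bounded_linear.linear[OF Djsr_bounded_linear[OF lin_section_section[OF a(1)] \<Phi>_jimg[OF p]]]]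
        D_lin_section[OF a(2) p])
qed

lemma hgrad_const_section:
  assumes s: "s \<in> \<Gamma> L" and p: "p \<in> jdom"
  shows "hgrad (Djsr (const_section L s) (\<Phi> p)) = 0"
  by (simp add: hgrad_def D_const_section[OF s p] linear_0[OF sr_linear[OF s fst_jdom[OF p]]])

text \<open>A constant section has no derivative along the fibre, so of the field of
  \<open>l_a\<close> only the projection \<xi> matters; the other contribution is \<open>c\<close>,
  the derivative of \<open>l_a\<close> along \<open>u\<close>.\<close>

lemma cbr_lin_const_at:
  assumes a: "a \<in> derivations L" and s: "s \<in> \<Gamma> L" and p: "p \<in> jdom"
  shows "cbr L (lin_section L a) (const_section L s) p = const_section L (act (pts L) a s) p"
proof -
  obtain c \<xi> where c: "coeffs a c \<xi>" using coeffs_ex[OF a] by blast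
  note x = fst_jdom[OF p]
  have y: "\<phi> (fst p) \<in> \<phi> ` dom" using x by blast
  note la = lin_section_section[OF a] and cs = const_section_section[OF s]
  have 0: "\<D> c (\<phi> (fst p)) 0 = 0" "\<D> \<xi> (\<phi> (fst p)) 0 = 0"
    using c smooth_on_hd[OF _ y, THEN has_derivative_linear, THEN linear_0] by (auto simp: coeffs_def)
  have "cbr L (lin_section L a) (const_section L s) p =
      (c (\<phi> (fst p)) * sr s (\<phi> (fst p)) + \<D> (sr s) (\<phi> (fst p)) (\<xi> (\<phi> (fst p)))) \<odot>\<^bsub>\<E> L p\<^esub> e (fst p)"
    unfolding Psec_eq[OF cbr_section[OF la cs] p] cbr_coord[OF la cs p] D_const_section[OF s p] hvec_simps
      hgrad_lin_section[OF a c p] by (simp add: D_lin_section[OF c p] 0 fst_\<Phi> jsr_const_section(1)[OF s p])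
  also have "\<dots> = a (fst p) s" using c x dvec_apply[OF s] by (simp add: coeffs_def)
  finally show ?thesis using jdom_points[OF p] dom_pts[OF x] by (simp add: const_section_def act_def)
qed

text \<open>The differential of a constant section lives on the base. So the field of the first
  section is vertical and does not move the second, and its derivative along \<open>u\<close> is
  zero: both terms of \<open>cbr_coord\<close> vanish.\<close>

lemma cbr_const_const_at:
  assumes s: "s \<in> \<Gamma> L" and r: "r \<in> \<Gamma> L" and p: "p \<in> jdom"
  shows "cbr L (const_section L s) (const_section L r) p = \<zero>\<^bsub>\<E> L p\<^esub>"
proof -
  note cs = const_section_section[OF s] and cr = const_section_section[OF r] and x = fst_jdom[OF p]
  show ?thesis
    unfolding Psec_eq[OF cbr_section[OF cs cr] p] cbr_coord[OF cs cr p] D_const_section[OF s p] D_const_section[OF r p]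
      hvec_simps hgrad_const_section[OF s p]
    by (simp add: linear_0[OF sr_linear[OF s x]] linear_0[OF sr_linear[OF r x]] frame_0[OF fr jframe[OF p]])
qed

text \<open>Both sides are evaluated at the jet of a section with vanishing second derivatives.\<close>

lemma cbr_lin_lin_at:
  assumes a: "a \<in> derivations L" and b: "b \<in> derivations L" and p: "p \<in> jdom"
  shows "cbr L (lin_section L a) (lin_section L b) p = lin_section L (der_bracket L a b) p"
proof -
  obtain c \<xi> where c: "coeffs a c \<xi>" using coeffs_ex[OF a] by blast
  obtain d \<eta> where d: "coeffs b d \<eta>" using coeffs_ex[OF b] by blast
  let ?x = "fst p" and ?y = "\<phi> (fst p)"
  note x = fst_jdom[OF p]
  note xP = dom_pts[OF x]
  have xV: "?x \<in> V" using x by blast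
  have y: "?y \<in> \<phi> ` dom" using x by blast
  note la = lin_section_section[OF a] and lb = lin_section_section[OF b]
  obtain u q where uq: "snd (\<Phi> p) = (u, q)" by (cases "snd (\<Phi> p)")
  define Dc where "Dc = \<D> c ?y"
  define Dd where "Dd = \<D> d ?y"
  define Dx where "Dx = \<D> \<xi> ?y"
  define De where "De = \<D> \<eta> ?y"
  have lin: "linear Dc" "linear Dd" "linear Dx" "linear De"
    using c d smooth_on_hd[OF _ y, THEN has_derivative_linear] by (auto simp: coeffs_def Dc_def Dd_def Dx_def De_def)
  note 0 = lin[THEN linear_0]
  let ?c = "c ?y" and ?d = "d ?y" and ?\<xi> = "\<xi> ?y" and ?\<eta> = "\<eta> ?y"
  have DA: "Djsr (lin_section L a) (\<Phi> p) w = Dc (fst w) * u + ?c * fst (snd w) + ap (snd (snd w)) ?\<xi> + ap q (Dx (fst w))" for w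
    using D_lin_section[OF c p, of w] by (simp add: uq Dc_def Dx_def)
  have DB: "Djsr (lin_section L b) (\<Phi> p) w = Dd (fst w) * u + ?d * fst (snd w) + ap (snd (snd w)) ?\<eta> + ap q (De (fst w))" for w
    using D_lin_section[OF d p, of w] by (simp add: uq Dd_def De_def)
  have JA: "jsr (lin_section L a) (\<Phi> p) = ?c * u + ap q ?\<xi>"
    and JB: "jsr (lin_section L b) (\<Phi> p) = ?d * u + ap q ?\<eta>"
    using jsr_lin_section(1)[OF c p] jsr_lin_section(1)[OF d p] by (simp_all add: lc_def uq fst_\<Phi>)
  have h1: "fst (hc (lin_section L a) (\<Phi> p)) = ?\<xi>" unfolding hvec_simps by (rule hgrad_lin_section[OF a c p])
  have h2: "fst (snd (hc (lin_section L a) (\<Phi> p))) = - ?c * u"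
    unfolding hvec_simps hgrad_lin_section[OF a c p] JA by (simp add: uq)
  have h3: "ap (snd (snd (hc (lin_section L a) (\<Phi> p)))) w = - (Dc w * u + ?c * ap q w + ap q (Dx w))" for w
    unfolding hvec_3[OF Djsr_bounded_linear[OF la \<Phi>_jimg[OF p]]] DA by (simp add: uq)
  have L: "jsr (cbr L (lin_section L a) (lin_section L b)) (\<Phi> p) =
      u * (Dd ?\<xi> - Dc ?\<eta>) + ap q (De ?\<xi>) - ap q (Dx ?\<eta>)"
    unfolding cbr_coord[OF la lb p] DB h1 h2 h3 JB by (simp add: DA 0 algebra_simps)
  obtain s T where s: "s \<in> \<Gamma> L" "open T" "?y \<in> T" "T \<subseteq> \<phi> ` dom" "\<forall>z\<in>T. sr s z = u + ap q (z - ?y)"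
    "\<forall>z\<in>T. \<D> (sr s) z = ap q" "sr s ?y = u"
    using affine_section[OF x blinfun.bounded_linear_right[of q], of u] by blast
  have "jco L U \<phi> e ?x (jet L s ?x) = jco L U \<phi> e ?x (snd p)"
    using jco_jet[OF x s(1)] s(3,6,7) uq by (simp add: \<Phi>_eq blinfun_apply_inverse)
  then have js: "jet L s ?x = snd p" by (rule jco_inject[OF x jet_jet_space[OF s(1) xP], rotated]) (use p in auto)
  have pe: "p = (?x, jet L s ?x)" by (simp add: js)
  have ca: "smooth_on (\<phi> ` dom) c" "smooth_on (\<phi> ` dom) \<xi>" "\<forall>y\<in>dom. a y = dv y (c (\<phi> y)) (\<xi> (\<phi> y))" using c by (auto simp: coeffs_def)
  have cb: "smooth_on (\<phi> ` dom) d" "smooth_on (\<phi> ` dom) \<eta>" "\<forall>y\<in>dom. b y = dv y (d (\<phi> y)) (\<eta> (\<phi> y))" using d by (auto simp: coeffs_def)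
  note A = derivation_affine[OF x ca s(1-6)] and B = derivation_affine[OF x cb s(1-6)]
  note as = derivation_act[OF a s(1)] and bs = derivation_act[OF b s(1)]
  have ab: "a ?x (act (pts L) b s) = (?c * (?d * u + ap q ?\<eta>) + (Dd ?\<xi> * u + ?d * ap q ?\<xi> + ap q (De ?\<xi>))) \<odot>\<^bsub>fibre L ?x\<^esub> e ?x"
    using ca(3) x dvec_apply[OF bs] by (simp add: B Dd_def De_def)
  have ba: "b ?x (act (pts L) a s) = (?d * (?c * u + ap q ?\<xi>) + (Dc ?\<eta> * u + ?c * ap q ?\<eta> + ap q (Dx ?\<eta>))) \<odot>\<^bsub>fibre L ?x\<^esub> e ?x"
    using cb(3) x dvec_apply[OF as] by (simp add: A Dc_def Dx_def)
  have R: "lin_section L (der_bracket L a b) p = a ?x (act (pts L) b s) \<ominus>\<^bsub>fibre L ?x\<^esub> b ?x (act (pts L) a s)"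
    by (subst pe) (simp only: lin_section_jet[OF der_bracket_derivation[OF a b] s(1) xP] der_bracket_apply[OF xP s(1)])
  note ac = der_carrier[OF derivation_der[OF a xP] bs] der_carrier[OF derivation_der[OF b xP] as]
  show ?thesis
  proof (rule crd_inject[OF fr xV])
    show "cbr L (lin_section L a) (lin_section L b) p \<in> \<F> L ?x"
      using P.sec_carrier[OF cbr_section[OF la lb], of p] jdom_points[OF p] by simp
    show "lin_section L (der_bracket L a b) p \<in> \<F> L ?x"
      using P.sec_carrier[OF lin_section_section[OF der_bracket_derivation[OF a b]], of p] jdom_points[OF p] by simp
    show "coord (fibre L ?x) (e ?x) (cbr L (lin_section L a) (lin_section L b) p) =
        coord (fibre L ?x) (e ?x) (lin_section L (der_bracket L a b) p)"
      unfolding Psr_eq[OF p, symmetric] L unfolding Psr_eq[OF p] R crd_minus[OF fr xV ac]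
      unfolding ab ba crd_smult[OF fr xV] by (simp add: algebra_simps)
  qed
qed

end

section \<open>The relations and the uniqueness of the bracket\<close>

context jets
begin

lemma cbr_derivation_relations: "derivation_relations L (cbr L)" unfolding derivation_relations_def
proof (intro conjI ballI)
  fix a b assume a: "a \<in> derivations L" and b: "b \<in> derivations L"
  show "cbr L (lin_section L a) (lin_section L b) = lin_section L (der_bracket L a b)"
  proof (rule P.sec_eqI[OF cbr_section[OF lin_section_section[OF a] lin_section_section[OF b]]
        lin_section_section[OF der_bracket_derivation[OF a b]]])
    fix p assume "p \<in> pts (pi_star L)"
    then have p: "p \<in> \<P> L" by simp
    show "cbr L (lin_section L a) (lin_section L b) p = lin_section L (der_bracket L a b) p"
      by (rule jtriv_ex[OF p], rule jtriv.cbr_lin_lin_at[OF _ a b])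
  qed
next
  fix a s assume a: "a \<in> derivations L" and s: "s \<in> \<Gamma> L"
  show "cbr L (lin_section L a) (const_section L s) = const_section L (act (pts L) a s)"
  proof (rule P.sec_eqI[OF cbr_section[OF lin_section_section[OF a] const_section_section[OF s]]
        const_section_section[OF derivation_act[OF a s]]])
    fix p assume "p \<in> pts (pi_star L)"
    then have p: "p \<in> \<P> L" by simp
    show "cbr L (lin_section L a) (const_section L s) p = const_section L (act (pts L) a s) p"
      by (rule jtriv_ex[OF p], rule jtriv.cbr_lin_const_at[OF _ a s])
  qed
next
  fix s r assume s: "s \<in> \<Gamma> L" and r: "r \<in> \<Gamma> L"
  show "cbr L (const_section L s) (const_section L r) = \<zero>\<^bsub>sections (pi_star L)\<^esub>"
  proof (rule P.sec_eqI[OF cbr_section[OF const_section_section[OF s] const_section_section[OF r]]])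
    show "\<zero>\<^bsub>sections (pi_star L)\<^esub> \<in> \<Gamma>P" using P.sec_zero by simp
    fix p assume "p \<in> pts (pi_star L)"
    then have p: "p \<in> \<P> L" by simp
    have "cbr L (const_section L s) (const_section L r) p = \<zero>\<^bsub>\<E> L p\<^esub>"
      by (rule jtriv_ex[OF p], rule jtriv.cbr_const_const_at[OF _ s r])
    then show "cbr L (const_section L s) (const_section L r) p = \<zero>\<^bsub>sections (pi_star L)\<^esub> p" using p by simp
  qed
qed

lemma cbr_fibrewise_linear: "fibrewise_linear L (cbr L)" unfolding fibrewise_linear_def
  using cbr_derivation_relations der_bracket_derivation derivation_act unfolding derivation_relations_def by simp

text \<open>The linear and the constant sections together have all 1-jets.\<close>

lemma lin_const_jet:
  assumes \<sigma>: "\<sigma> \<in> \<Gamma>P" and p: "p \<in> \<P> L"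
  shows "\<exists>a\<in>derivations L. \<exists>t\<in>\<Gamma> L. jet (pi_star L) \<sigma> p =
    jet (pi_star L) (\<lambda>p\<in>pts (pi_star L). lin_section L a p \<oplus>\<^bsub>fibre (pi_star L) p\<^esub> const_section L t p) p"
proof -
  obtain U \<phi> V e where T: "jtriv L U \<phi> V e" "p \<in> jet_dom L U V" using jtriv_ex[OF p] .
  interpret jtriv L U \<phi> V e by (rule T)
  note pj = T(2)
  note x = fst_jdom[OF pj] and pd = jdom_Pt[OF pj] and z = \<Phi>_jimg[OF pj]
  have pP: "p \<in> pts (pi_star L)" using p by simp
  let ?y = "\<phi> (fst p)"
  define D where "D = Djsr \<sigma> (\<Phi> p)"
  have bD: "bounded_linear D" unfolding D_def by (rule Djsr_bounded_linear[OF \<sigma> z])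
  \<comment> \<open>The derivation takes care of the fibre directions: \<open>D (0, 1, 0)\<close> is
    the derivative along \<open>u\<close>, and \<open>hgrad D\<close> encodes the one along
    \<open>p\<close>.\<close>
  obtain a where a: "a \<in> derivations L" "a (fst p) = dv (fst p) (D (0, 1, 0)) (hgrad D)"
    using derivation_cutoff[OF x] by blast
  obtain c \<xi> where c: "coeffs a c \<xi>" using coeffs_ex[OF a(1)] by blast
  have "dv (fst p) (c ?y) (\<xi> ?y) = dv (fst p) (D (0, 1, 0)) (hgrad D)" using c x a(2) by (simp add: coeffs_def)
  note ce = dvec_inject[OF x this]
  note la = lin_section_section[OF a(1)]
  define A where "A = Djsr (lin_section L a) (\<Phi> p)"
  have bA: "bounded_linear A" unfolding A_def by (rule Djsr_bounded_linear[OF la z])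
  have y: "?y \<in> \<phi> ` dom" using x by blast
  have 0: "\<D> c ?y 0 = 0" "\<D> \<xi> ?y 0 = 0"
    using c smooth_on_hd[OF _ y, THEN has_derivative_linear, THEN linear_0] by (auto simp: coeffs_def)
  have A2: "A (0, r, \<pi>) = D (0, r, \<pi>)" for r \<pi>
  proof -
    have "D (0, r, \<pi>) = D (r *\<^sub>R (0, 1, 0) + (0, 0, \<pi>))" by simp
    also have "\<dots> = r * D (0, 1, 0) + D (0, 0, \<pi>)"
      using linear_add[OF bounded_linear.linear[OF bD]] linear_scale[OF bounded_linear.linear[OF bD], of r "(0, 1, 0)"]
      by (simp del: scaleR_Pair add_Pair)
    finally show ?thesis
      using D_lin_section[OF c pj, of "(0, r, \<pi>)"] hgrad_apply[OF fd bounded_linear.linear[OF bD], of \<pi>]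
      by (simp add: A_def[symmetric] 0 ce)
  qed
  \<comment> \<open>What remains is a differential along the base. A constant section has no fibre
    derivatives, so \<open>t\<close> can supply it, and the value as well, without disturbing the
    rest.\<close>
  define k where "k w = D (w, 0, 0) - A (w, 0, 0)" for w
  have "bounded_linear (\<lambda>w::'e. (w, 0::real, 0::'e \<Rightarrow>\<^sub>L real))"
    by (intro bounded_linear_Pair bounded_linear_ident bounded_linear_zero)
  then have k: "bounded_linear k"
    unfolding k_def by (intro bounded_linear_sub bounded_linear_compose[OF bD] bounded_linear_compose[OF bA])
  obtain t T where t: "t \<in> \<Gamma> L" "?y \<in> T" "\<forall>z\<in>T. \<D> (sr t) z = k"
    "sr t ?y = jsr \<sigma> (\<Phi> p) - jsr (lin_section L a) (\<Phi> p)"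
    using affine_section[OF x k, of "jsr \<sigma> (\<Phi> p) - jsr (lin_section L a) (\<Phi> p)"] by blast
  note ct = const_section_section[OF t(1)]
  let ?\<rho> = "\<lambda>p\<in>pts (pi_star L). lin_section L a p \<oplus>\<^bsub>fibre (pi_star L) p\<^esub> const_section L t p"
  have \<rho>: "?\<rho> \<in> \<Gamma>P" by (rule P.sec_add[OF la ct])
  have "jsr ?\<rho> (\<Phi> p) = jsr \<sigma> (\<Phi> p)"
    unfolding Pt.sr_add[OF pd la ct] using t(4) jsr_const_section(1)[OF t(1) pj] by (simp add: fst_\<Phi>)
  moreover have "Djsr ?\<rho> (\<Phi> p) = Djsr \<sigma> (\<Phi> p)"
  proof (rule ext)
    fix w :: "'e \<times> real \<times> ('e \<Rightarrow>\<^sub>L real)"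
    obtain w1 w2 where w: "w = (w1, w2)" by (cases w)
    have "A w + k w1 = D w"
    proof -
      have s: "w = (w1, 0, 0) + (0, fst w2, snd w2)" by (simp add: w prod_eq_iff)
      show ?thesis
        unfolding s linear_add[OF bounded_linear.linear[OF bD]] linear_add[OF bounded_linear.linear[OF bA]] A2 by (simp add: k_def)
    qed
    then show "Djsr ?\<rho> (\<Phi> p) w = Djsr \<sigma> (\<Phi> p) w"
      unfolding Pt.D_sr_add[OF pd la ct] D_const_section[OF t(1) pj] using t(2,3) by (simp add: A_def D_def w)
  qed
  ultimately have "jet (pi_star L) \<sigma> p = jet (pi_star L) ?\<rho> p"
    by (intro Pt.jco_inject[OF pd P.jet_jet_space[OF \<sigma> pP] P.jet_jet_space[OF \<rho> pP]])
      (simp only: Pt.jco_jet[OF pd \<sigma>] Pt.jco_jet[OF pd \<rho>])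
  then show ?thesis using a(1) t(1) by blast
qed

text \<open>At a point a first-order operator is an element of \<open>DL\<close>, so its value
  depends only on the 1-jet, and \<open>lin_const_jet\<close> replaces \<sigma> by a linear plus a
  constant section with that jet.\<close>

lemma diff_op1_eqI:
  assumes D: "diff_op1 (pi_star L) D" "diff_op1 (pi_star L) D'"
    and l: "\<And>a. a \<in> derivations L \<Longrightarrow> D (lin_section L a) = D' (lin_section L a)"
    and c: "\<And>t. t \<in> \<Gamma> L \<Longrightarrow> D (const_section L t) = D' (const_section L t)" and \<sigma>: "\<sigma> \<in> \<Gamma>P"
  shows "D \<sigma> = D' \<sigma>"
proof (rule P.sec_eqI)
  have "lin_map (sections (pi_star L)) (sections (pi_star L)) D" "lin_map (sections (pi_star L)) (sections (pi_star L)) D'"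
    using D unfolding diff_op1_def by blast+
  from this[THEN lin_mapD(1), OF \<sigma>] show "D \<sigma> \<in> \<Gamma>P" "D' \<sigma> \<in> \<Gamma>P" .
  fix p assume pP: "p \<in> pts (pi_star L)"
  then have p: "p \<in> \<P> L" by simp
  obtain a t where a: "a \<in> derivations L" and t: "t \<in> \<Gamma> L" and j: "jet (pi_star L) \<sigma> p =
    jet (pi_star L) (\<lambda>p\<in>pts (pi_star L). lin_section L a p \<oplus>\<^bsub>fibre (pi_star L) p\<^esub> const_section L t p) p"
    using lin_const_jet[OF \<sigma> p] by blast
  note la = lin_section_section[OF a] and ct = const_section_section[OF t]
  let ?\<rho> = "\<lambda>p\<in>pts (pi_star L). lin_section L a p \<oplus>\<^bsub>fibre (pi_star L) p\<^esub> const_section L t p"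
  have \<rho>: "?\<rho> \<in> \<Gamma>P" by (rule P.sec_add[OF la ct])
  have e: "E \<sigma> p = E (lin_section L a) p \<oplus>\<^bsub>fibre (pi_star L) p\<^esub> E (const_section L t) p" if E: "diff_op1 (pi_star L) E" for E
  proof -
    note d = P.diff_op1_der[OF E pP]
    have "(\<lambda>s\<in>\<Gamma>P. E s p) \<sigma> = jet (pi_star L) \<sigma> p (\<lambda>s\<in>\<Gamma>P. E s p)" by (rule P.jet_apply[OF d, symmetric])
    also have "\<dots> = jet (pi_star L) ?\<rho> p (\<lambda>s\<in>\<Gamma>P. E s p)" by (rule fun_cong[OF j])
    also have "\<dots> = (\<lambda>s\<in>\<Gamma>P. E s p) ?\<rho>" by (rule P.jet_apply[OF d])
    also have "\<dots> = (\<lambda>s\<in>\<Gamma>P. E s p) (lin_section L a) \<oplus>\<^bsub>fibre (pi_star L) p\<^esub> (\<lambda>s\<in>\<Gamma>P. E s p) (const_section L t)"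
      using lin_mapD(2)[OF d[unfolded der_space_iff, THEN conjunct2, THEN conjunct1] la ct] by (simp only: sections_simps)
    finally show ?thesis by (simp only: restrict_apply'[OF \<sigma>] restrict_apply'[OF la] restrict_apply'[OF ct])
  qed
  show "D \<sigma> p = D' \<sigma> p" unfolding e[OF D(1)] e[OF D(2)] l[OF a] c[OF t] ..
qed

text \<open>Polarisation of the alternating law on \<sigma> + \<rho>.\<close>

lemma jacobi_antisym:
  assumes B: "jacobi_structure (pi_star L) B" and \<sigma>: "\<sigma> \<in> \<Gamma>P" and \<rho>: "\<rho> \<in> \<Gamma>P"
  shows "B \<sigma> \<rho> = (-1) \<odot>\<^bsub>sections (pi_star L)\<^esub> B \<rho> \<sigma>"
proof -
  let ?S = "sections (pi_star L)"
  note S = P.sections_vec_space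
  have l1: "lin_map ?S ?S (B s)" and l2: "lin_map ?S ?S (\<lambda>r. B r s)" and z: "B s s = \<zero>\<^bsub>?S\<^esub>" if "s \<in> \<Gamma>P" for s
    using B that unfolding jacobi_structure_def diff_op1_def by blast+
  have st: "\<sigma> \<oplus>\<^bsub>?S\<^esub> \<rho> \<in> \<Gamma>P" by (rule vs_add[OF S \<sigma> \<rho>])
  note c = lin_mapD(1)[OF l1[OF \<sigma>] \<rho>] lin_mapD(1)[OF l1[OF \<rho>] \<sigma>]
  have "\<zero>\<^bsub>?S\<^esub> = B (\<sigma> \<oplus>\<^bsub>?S\<^esub> \<rho>) (\<sigma> \<oplus>\<^bsub>?S\<^esub> \<rho>)" by (rule z[OF st, symmetric])
  also have "\<dots> = B (\<sigma> \<oplus>\<^bsub>?S\<^esub> \<rho>) \<sigma> \<oplus>\<^bsub>?S\<^esub> B (\<sigma> \<oplus>\<^bsub>?S\<^esub> \<rho>) \<rho>" by (rule lin_mapD(2)[OF l1[OF st] \<sigma> \<rho>])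
  also have "\<dots> = (B \<sigma> \<sigma> \<oplus>\<^bsub>?S\<^esub> B \<rho> \<sigma>) \<oplus>\<^bsub>?S\<^esub> (B \<sigma> \<rho> \<oplus>\<^bsub>?S\<^esub> B \<rho> \<rho>)"
    by (simp only: lin_mapD(2)[OF l2[OF \<sigma>] \<sigma> \<rho>] lin_mapD(2)[OF l2[OF \<rho>] \<sigma> \<rho>])
  also have "\<dots> = B \<rho> \<sigma> \<oplus>\<^bsub>?S\<^esub> B \<sigma> \<rho>" by (simp only: z[OF \<sigma>] z[OF \<rho>] vs_l_zero[OF S c(2)] vs_r_zero[OF S c(1)])
  finally have 0: "B \<rho> \<sigma> \<oplus>\<^bsub>?S\<^esub> B \<sigma> \<rho> = \<zero>\<^bsub>?S\<^esub>" by (rule sym)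
  have m: "(-1) \<odot>\<^bsub>?S\<^esub> B \<rho> \<sigma> \<oplus>\<^bsub>?S\<^esub> B \<rho> \<sigma> = \<zero>\<^bsub>?S\<^esub>"
    using vs_distr_l[OF S c(2), of "-1" 1] vs_one[OF S c(2)] vs_smult_0[OF S c(2)] by (simp del: sections_simps)
  have mc: "(-1) \<odot>\<^bsub>?S\<^esub> B \<rho> \<sigma> \<in> \<Gamma>P" by (rule vs_smult[OF S c(2)])
  have "(-1) \<odot>\<^bsub>?S\<^esub> B \<rho> \<sigma> = (-1) \<odot>\<^bsub>?S\<^esub> B \<rho> \<sigma> \<oplus>\<^bsub>?S\<^esub> (B \<rho> \<sigma> \<oplus>\<^bsub>?S\<^esub> B \<sigma> \<rho>)" unfolding 0 by (rule vs_r_zero[OF S mc, symmetric])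
  also have "\<dots> = B \<sigma> \<rho>" unfolding vs_assoc[OF S mc c(2) c(1), symmetric] m by (rule vs_l_zero[OF S c(1)])
  finally show ?thesis by (rule sym)
qed

text \<open>Two passes over the arguments: agreement for a linear or constant second argument
  extends to all first arguments, and then to all second arguments.\<close>

lemma derivation_relations_unique:
  assumes B: "jacobi_structure (pi_star L) B" "jacobi_structure (pi_star L) C"
    and R: "derivation_relations L B" "derivation_relations L C" and \<sigma>: "\<sigma> \<in> \<Gamma>P" and \<rho>: "\<rho> \<in> \<Gamma>P"
  shows "B \<sigma> \<rho> = C \<sigma> \<rho>"
proof -
  have D1: "diff_op1 (pi_star L) (E s)" and D2: "diff_op1 (pi_star L) (\<lambda>r. E r s)"
    if "jacobi_structure (pi_star L) E" "s \<in> \<Gamma>P" for E s using that unfolding jacobi_structure_def by blast+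
  note B1 = D1[OF B(1)] and B2 = D1[OF B(2)] and B3 = D2[OF B(1)] and B4 = D2[OF B(2)]
  have ll: "B (lin_section L a) (lin_section L b) = C (lin_section L a) (lin_section L b)"
    and lc: "B (lin_section L a) (const_section L s) = C (lin_section L a) (const_section L s)"
    if "a \<in> derivations L" "b \<in> derivations L" "s \<in> \<Gamma> L" for a b s
    using R that unfolding derivation_relations_def by simp_all
  have cc: "B (const_section L s) (const_section L r) = C (const_section L s) (const_section L r)"
    if "s \<in> \<Gamma> L" "r \<in> \<Gamma> L" for r s using R that unfolding derivation_relations_def by simp
  have l: "B \<tau> (lin_section L a) = C \<tau> (lin_section L a)" if a: "a \<in> derivations L" and \<tau>: "\<tau> \<in> \<Gamma>P" for \<tau> a
  proof (rule diff_op1_eqI[OF B3 B4 _ _ \<tau>])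
    show "lin_section L a \<in> \<Gamma>P" "lin_section L a \<in> \<Gamma>P" by (rule lin_section_section[OF a])+
    show "B (lin_section L b) (lin_section L a) = C (lin_section L b) (lin_section L a)" if "b \<in> derivations L" for b
      using that a R unfolding derivation_relations_def by simp
    \<comment> \<open>The mixed relation has the linear section in the first slot; antisymmetry
      supplies the other order.\<close>
    show "B (const_section L t) (lin_section L a) = C (const_section L t) (lin_section L a)" if t: "t \<in> \<Gamma> L" for t
      unfolding jacobi_antisym[OF B(1) const_section_section[OF t] lin_section_section[OF a]]
        jacobi_antisym[OF B(2) const_section_section[OF t] lin_section_section[OF a]] lc[OF a a t] ..
  qed
  have c: "B \<tau> (const_section L s) = C \<tau> (const_section L s)" if s: "s \<in> \<Gamma> L" and \<tau>: "\<tau> \<in> \<Gamma>P" for \<tau> s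
  proof (rule diff_op1_eqI[OF B3 B4 _ _ \<tau>])
    show "const_section L s \<in> \<Gamma>P" "const_section L s \<in> \<Gamma>P" by (rule const_section_section[OF s])+
    show "B (lin_section L b) (const_section L s) = C (lin_section L b) (const_section L s)" if b: "b \<in> derivations L" for b
      by (rule lc[OF b b s])
    show "B (const_section L t) (const_section L s) = C (const_section L t) (const_section L s)" if t: "t \<in> \<Gamma> L" for t
      by (rule cc[OF t s])
  qed
  show ?thesis by (rule diff_op1_eqI[OF B1[OF \<sigma>] B2[OF \<sigma>] l[OF _ \<sigma>] c[OF _ \<sigma>] \<rho>])
qed

end

section \<open>The bracket induced by the contact structure\<close>

context jets
begin

abbreviation to_pi where "to_pi \<equiv> on_sections (\<P> L) (theta_iso L)"

lemma LH_sec_carrier: "S \<in> \<Gamma> LH \<Longrightarrow> p \<in> \<P> L \<Longrightarrow> S p \<in> \<F> LH p"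
  using lbundle.sec_carrier[OF lbundle.intro[OF LH_line_bundle]] by (simp add: LH_base)

lemma to_pi_apply: "p \<in> \<P> L \<Longrightarrow> to_pi S p = theta_iso L p (S p)" by (simp add: on_sections_def)

lemma fibp_to_pi: "S \<in> \<Gamma> LH \<Longrightarrow> p \<in> \<P> L \<Longrightarrow> fibp p (to_pi S p) = S p"
  using fib_theta_iso LH_sec_carrier by (simp add: to_pi_apply)

lemma
  assumes S: "S \<in> \<Gamma> LH"
  shows to_pi_add: "R \<in> \<Gamma> LH \<Longrightarrow> to_pi (S \<oplus>\<^bsub>sections LH\<^esub> R) = to_pi S \<oplus>\<^bsub>sections (pi_star L)\<^esub> to_pi R"
    and to_pi_scale: "to_pi (c \<odot>\<^bsub>sections LH\<^esub> S) = c \<odot>\<^bsub>sections (pi_star L)\<^esub> to_pi S"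
    and to_pi_fmult: "to_pi (fmult (\<P> L) (fibre LH) f S) = fmult (\<P> L) (fibre (pi_star L)) f (to_pi S)"
  using lin_mapD(2,3)[OF theta_iso_lin] LH_sec_carrier S
  by (auto simp: on_sections_def fmult_def LH_base intro!: restrict_ext)

text \<open>The bracket on the pull-back carried over to classes modulo the Cartan distribution,
  \<open>fibp p\<close> being the inverse of the isomorphism at \<open>p\<close>.\<close>

definition LH_bracket where
  "LH_bracket S R = (\<lambda>p\<in>\<P> L. fibp p (cbr L (to_pi S) (to_pi R) p))"

lemma to_pi_bracket:
  assumes S: "S \<in> \<Gamma> LH" and R: "R \<in> \<Gamma> LH"
  shows "cbr L (to_pi S) (to_pi R) = to_pi (LH_bracket S R)"
proof (rule extensionalityI[of _ "\<P> L"])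
  note c = cbr_section[OF LH_section_to[OF S] LH_section_to[OF R]]
  show "cbr L (to_pi S) (to_pi R) \<in> extensional (\<P> L)" using P.sec_ext[OF c] by simp
  show "to_pi (LH_bracket S R) \<in> extensional (\<P> L)" by (simp add: on_sections_def)
  fix p assume p: "p \<in> \<P> L"
  then have "cbr L (to_pi S) (to_pi R) p \<in> \<F> L (fst p)" using P.sec_carrier[OF c, of p] by simp
  from theta_iso_fib[OF p this] show "cbr L (to_pi S) (to_pi R) p = to_pi (LH_bracket S R) p"
    using p by (simp add: to_pi_apply LH_bracket_def)
qed

lemma LH_symbol: "is_symbol LH LH_bracket (\<lambda>S. hv L (to_pi S))" unfolding is_symbol_def LH_base
proof (intro conjI ballI)
  show "lin_map (sections LH) (vfields (J1 L)) (\<lambda>S. hv L (to_pi S))" unfolding lin_map_def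
  proof (intro conjI ballI allI funcsetI)
    show "hv L (to_pi S) \<in> \<X> (J1 L)" if "S \<in> \<Gamma> LH" for S by (rule hv_vfield[OF LH_section_to[OF that]])
    show "hv L (to_pi (S \<oplus>\<^bsub>sections LH\<^esub> R)) = hv L (to_pi S) \<oplus>\<^bsub>vfields (J1 L)\<^esub> hv L (to_pi R)"
      if "S \<in> \<Gamma> LH" "R \<in> \<Gamma> LH" for S R
      unfolding to_pi_add[OF that] by (rule lin_mapD(2)[OF hv_lin LH_section_to[OF that(1)] LH_section_to[OF that(2)]])
    show "hv L (to_pi (c \<odot>\<^bsub>sections LH\<^esub> S)) = c \<odot>\<^bsub>vfields (J1 L)\<^esub> hv L (to_pi S)" if "S \<in> \<Gamma> LH" for c S
      unfolding to_pi_scale[OF that] by (rule lin_mapD(3)[OF hv_lin LH_section_to[OF that]])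
  qed
  fix S R f assume S: "S \<in> \<Gamma> LH" and R: "R \<in> \<Gamma> LH" and f: "f \<in> Cs (J1 L)"
  let ?s = "to_pi S" and ?r = "to_pi R"
  note s = LH_section_to[OF S] and r = LH_section_to[OF R]
  show "LH_bracket S (fmult (\<P> L) (fibre LH) f R) =
      fmult (\<P> L) (fibre LH) f (LH_bracket S R) \<oplus>\<^bsub>sections LH\<^esub>
      fmult (\<P> L) (fibre LH) (act (\<P> L) (hv L ?s) f) R"
  proof (rule extensionalityI[of _ "\<P> L"])
    fix p assume p: "p \<in> \<P> L"
    have c: "cbr L ?s ?r p \<in> \<F> L (fst p)" "?r p \<in> \<F> L (fst p)"
      using P.sec_carrier[OF cbr_section[OF s r], of p] P.sec_carrier[OF r, of p] p by simp_all
    note F = fibre_vs[OF fst_pts[OF p]]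
    have "LH_bracket S (fmult (\<P> L) (fibre LH) f R) p =
        f p \<odot>\<^bsub>fibre LH p\<^esub> fibp p (cbr L ?s ?r p) \<oplus>\<^bsub>fibre LH p\<^esub> hv L ?s p f \<odot>\<^bsub>fibre LH p\<^esub> fibp p (?r p)"
      unfolding LH_bracket_def restrict_apply'[OF p] to_pi_fmult[OF R] cbr_symbol[OF s r f p]
        LH_smult[OF p c(1)] LH_smult[OF p c(2)] LH_add[OF p vs_smult[OF F c(1)] vs_smult[OF F c(2)]] ..
    then show "LH_bracket S (fmult (\<P> L) (fibre LH) f R) p =
        (fmult (\<P> L) (fibre LH) f (LH_bracket S R) \<oplus>\<^bsub>sections LH\<^esub>
        fmult (\<P> L) (fibre LH) (act (\<P> L) (hv L ?s) f) R) p"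
      using p fibp_to_pi[OF R p] by (simp add: LH_base fmult_def act_def LH_bracket_def)
  qed (simp_all add: LH_bracket_def LH_base)
qed

text \<open>The conditions on the symbol, its contact value, the bracket and the squiggle are
  \<open>LH_symbol\<close>, \<open>contact_form_hv\<close>, \<open>cbr_apply\<close> and
  \<open>hv_fmult\<close>, transported through the isomorphism.\<close>

lemma LH_induced_bracket: "induced_bracket (J1 L) (cartan L) (\<lambda>S. hv L (to_pi S)) LH_bracket"
  unfolding induced_bracket_def Let_def
proof (intro conjI ballI LH_symbol)
  fix S assume S: "S \<in> \<Gamma> LH"
  note s = LH_section_to[OF S]
  show "theta (J1 L) (cartan L) p (hv L (to_pi S) p) = S p" if p: "p \<in> \<P> L" for p
    unfolding theta_eq[OF p hv_tangent[OF s p]] contact_form_hv[OF s p] by (rule fibp_to_pi[OF S p])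
  show "LH_bracket S R = (\<lambda>p\<in>\<P> L. theta (J1 L) (cartan L) p (vf_bracket (J1 L) (hv L (to_pi S)) (hv L (to_pi R)) p))"
    if R: "R \<in> \<Gamma> LH" for R unfolding LH_bracket_def
  proof (rule restrict_ext)
    fix p assume p: "p \<in> \<P> L"
    note t = J.vfield_tangent[OF J.vf_bracket_vfield[OF hv_vfield[OF s] hv_vfield[OF LH_section_to[OF R]]] p]
    show "fibp p (cbr L (to_pi S) (to_pi R) p) =
        theta (J1 L) (cartan L) p (vf_bracket (J1 L) (hv L (to_pi S)) (hv L (to_pi R)) p)"
      unfolding theta_eq[OF p t] cbr_apply[OF p] ..
  qed
  fix f assume f: "f \<in> Cs (J1 L)"
  show "hv L (to_pi (fmult (\<P> L) (fibre LH) f S)) =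
      fmult (\<P> L) (tangent (J1 L)) f (hv L (to_pi S)) \<oplus>\<^bsub>vfields (J1 L)\<^esub> omega_sharp (J1 L) (cartan L) f S"
  proof (rule extensionalityI[of _ "\<P> L"])
    fix p assume p: "p \<in> \<P> L"
    have "hv L (to_pi (fmult (\<P> L) (fibre LH) f S)) p =
        f p \<odot>\<^bsub>tangent (J1 L) p\<^esub> hv L (to_pi S) p \<oplus>\<^bsub>tangent (J1 L) p\<^esub> omega_sharp (J1 L) (cartan L) f S p"
      unfolding to_pi_fmult[OF S] by (rule hv_fmult[where S = S, OF s f fibp_to_pi[OF S p, symmetric] p])
    then show "hv L (to_pi (fmult (\<P> L) (fibre LH) f S)) p =
      (fmult (\<P> L) (tangent (J1 L)) f (hv L (to_pi S)) \<oplus>\<^bsub>vfields (J1 L)\<^esub> omega_sharp (J1 L) (cartan L) f S) p"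
      using p by (simp only: vfields_simps tangent_simps restrict_apply' fmult_def)
  qed (simp_all add: hv_def)
qed

end

theorem proposition4p3p1:
  fixes L :: "('q, 'e::real_normed_vector, 'v) line_bundle"
  assumes "is_line_bundle L"
  shows "contact_structure (J1 L) (cartan L) \<and>
    lin_section L \<in> derivations L \<rightarrow> \<Gamma> (pi_star L) \<and> inj_on (lin_section L) (derivations L) \<and>
    (\<exists>\<Theta> X B C.
       lb_isomorphism (contact_line_bundle (J1 L) (cartan L)) (pi_star L) \<Theta> \<and>
       induced_bracket (J1 L) (cartan L) X B \<and>
       (\<forall>s\<in>\<Gamma> (contact_line_bundle (J1 L) (cartan L)).
          \<forall>r\<in>\<Gamma> (contact_line_bundle (J1 L) (cartan L)).
          C (on_sections (points (J1 L)) \<Theta> s) (on_sections (points (J1 L)) \<Theta> r) =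
            on_sections (points (J1 L)) \<Theta> (B s r)) \<and>
       nondegenerate_jacobi (pi_star L) C \<and>
       fibrewise_linear L C \<and>
       derivation_relations L C \<and>
       (\<forall>C'. jacobi_structure (pi_star L) C' \<and> derivation_relations L C' \<longrightarrow>
          (\<forall>s\<in>\<Gamma> (pi_star L). \<forall>r\<in>\<Gamma> (pi_star L). C' s r = C s r)))"
proof -
  interpret jets L by (rule lbundle.jets[OF lbundle.intro[OF assms]])
  show ?thesis
  proof (intro conjI exI[of _ "theta_iso L"] exI[of _ "\<lambda>S. hv L (to_pi S)"] exI[of _ LH_bracket] exI[of _ "cbr L"]
      ballI allI impI contact_structure_cartan lin_section_inj LH_isomorphism LH_induced_bracket cbr_nondegenerate
      cbr_fibrewise_linear cbr_derivation_relations)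
    show "lin_section L \<in> derivations L \<rightarrow> \<Gamma>P" using lin_section_section by blast
    show "cbr L (to_pi s) (to_pi r) = to_pi (LH_bracket s r)" if "s \<in> \<Gamma> LH" "r \<in> \<Gamma> LH" for s r
      by (rule to_pi_bracket[OF that])
    show "C' s r = cbr L s r" if "jacobi_structure (pi_star L) C' \<and> derivation_relations L C'" "s \<in> \<Gamma>P" "r \<in> \<Gamma>P" for C' s r
      using derivation_relations_unique[of C' "cbr L"] that cbr_jacobi_structure cbr_derivation_relations by blast
  qed
qed

end
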